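(* Assume the setting described in the context, with $0<\beta<2\kappa$, where $\kappa\in(0,\tfrac12)$ is the ergodicity exponent. Then there is a continuous centered Gaussian process $\bar G=\{\bar G(t);t\ge0\}$ such that $\mathbf P$-almost surely (for almost every realization of $Z$), as $\varepsilon\to0$, $G^\varepsilon(\cdot)$ converges in distribution to $\bar G(\cdot)$ under the quenched probability $\mathbb P_Z$, in the Skorokhod topology of càdlàg processes on $[0,\infty)$.
   Context: Environment. $Z=\{Z_t;t\ge0\}$ is an $\mathbb R^d$-valued stochastic process with right-continuous paths with left limits on a probability space $(\Omega,\mathcal F,\mathbb P)$; it has a unique invariant probability measure $\pi$. $\mathbf P$ denotes the law of $Z$ (used also for probabilities of events depending only on $Z$). $\mathbb P_Z=\mathbb P(\cdot\mid Z)$ is the quenched probability. The functions $\lambda:[0,\infty)\to\mathbb R_+$ and $\psi:\mathbb R^d\to\mathbb R_+$ are positive, bounded and Lipschitz, and $\bar\psi=\int_{\mathbb R^d}\psi(z)\,\pi(dz)$. Ergodicity: for every $\kappa\in(0,\tfrac12)$ there is a finite random variable $C=C_{\kappa,\psi}(Z)>0$ such that $\mathbf P$-almost surely, for all $t>0$, $\left|\frac1t\int_0^t\psi(Z_u)\,du-\bar\psi\right|\le\frac{C}{(1+t)^{\kappa}}$. Service times. $\{\nu(s,dr);s\ge0\}$ is a family of probability laws on $[0,\infty)$ with densities, $\nu(s,dr)=\ell_s(r)\,dr$, and there are $\alpha>0$ and constants $c,C>0$ such that for all $r,s>0$: $c\,(r^{-1-\alpha}\wedge1)\le\ell_s(r)\le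 C\,(r^{-1-\alpha}\wedge1)$ and $\frac{\partial\ell_s(r)}{\partial s}\le C\,(r^{-1-\alpha}\wedge1)$. Set $\bar F_s(r)=\int_r^\infty\ell_s(\tau)\,d\tau$. Queue. For $\varepsilon>0$, conditionally on $Z$ the arrival times $\{\Gamma^\varepsilon_k;k\ge1\}$ form a Poisson process on $[0,\infty)$ with intensity $\mu^\varepsilon(ds)=\varepsilon^{-\beta}\lambda(s)\psi(Z_{s/\varepsilon})\,ds$; conditionally on $Z$ and the arrival times, the service times $L^\varepsilon_k$ are independent with $L^\varepsilon_k\sim\nu(\Gamma^\varepsilon_k,\cdot)$. The number of active jobs is $N^\varepsilon(t)=\sum_{k\ge1}\mathbf 1_{\{\Gamma^\varepsilon_k\le t<\Gamma^\varepsilon_k+L^\varepsilon_k\}}$. Set $\bar m_0(t)=\bar\psi\int_0^t\lambda(s)\bar F_s(t-s)\,ds$ and $$G^\varepsilon(t)=\varepsilon^{\beta/2}\left(N^\varepsilon(t)-\frac{\bar m_0(t)}{\varepsilon^\beta}\right).$$ *)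

theory Defs
  imports "HOL-Probability.Probability"
begin

section \<open>The Skorokhod space on the half-line\<close>

text \<open>Processes indexed by the half-line are functions of a real time argument; nothing is
  required of them at negative times. Elements of the path space are extensional on \<open>{0..}\<close>, and
  \<open>restrict x {0..}\<close> is the path of \<open>x\<close>.\<close>

definition cadlag :: "(real \<Rightarrow> 'b::topological_space) \<Rightarrow> bool" where
  "cadlag x \<longleftrightarrow>
     (\<forall>t\<ge>0. (x \<longlongrightarrow> x t) (at_right t)) \<and> (\<forall>t>0. \<exists>l. (x \<longlongrightarrow> l) (at_left t))"

definition skorokhod_space :: "(real \<Rightarrow> real) set" where
  "skorokhod_space = {x \<in> extensional {0..}. cadlag x}"

definition time_change :: "(real \<Rightarrow> real) \<Rightarrow> bool" where
  "time_change \<theta> \<longleftrightarrow> strict_mono_on {0..} \<theta> \<and> continuous_on {0..} \<theta> \<and> \<theta> ` {0..} = {0..}"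

definition skorokhod_nbhd :: "(real \<Rightarrow> real) \<Rightarrow> real \<Rightarrow> real \<Rightarrow> (real \<Rightarrow> real) set" where
  "skorokhod_nbhd x T \<delta> = {y \<in> skorokhod_space. \<exists>\<theta>. time_change \<theta> \<and>
     (\<forall>s\<ge>0. \<bar>\<theta> s - s\<bar> < \<delta>) \<and> (\<forall>s\<in>{0..T}. \<bar>y (\<theta> s) - x s\<bar> < \<delta>)}"

text \<open>The Skorokhod (\<open>J\<^sub>1\<close>) topology. The sets \<open>skorokhod_nbhd x T \<delta>\<close> are a neighbourhood base
  at \<open>x\<close>: a sequence is eventually in each of them iff there are time changes \<open>\<theta>\<^sub>n\<close> with
  \<open>\<theta>\<^sub>n\<close> tending to the identity uniformly on \<open>{0..}\<close> and \<open>x\<^sub>n \<circ> \<theta>\<^sub>n\<close> tending to \<open>x\<close> uniformly on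
  every \<open>{0..T}\<close>, which is the usual description of convergence in this (metrizable) topology
  (Jacod and Shiryaev, Limit Theorems for Stochastic Processes, Theorem VI.1.14).\<close>

definition skorokhod_topology :: "(real \<Rightarrow> real) topology" where
  "skorokhod_topology = topology (\<lambda>U. U \<subseteq> skorokhod_space \<and>
     (\<forall>x\<in>U. \<exists>T>0. \<exists>\<delta>>0. skorokhod_nbhd x T \<delta> \<subseteq> U))"

lemma skorokhod_nbhd_mono:
  assumes "T \<le> T'" "\<delta>' \<le> \<delta>"
  shows "skorokhod_nbhd x T' \<delta>' \<subseteq> skorokhod_nbhd x T \<delta>"
proof
  fix y assume "y \<in> skorokhod_nbhd x T' \<delta>'"
  then obtain \<theta> where y: "y \<in> skorokhod_space" and \<theta>: "time_change \<theta>"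
    and 1: "\<And>s. s \<ge> 0 \<Longrightarrow> \<bar>\<theta> s - s\<bar> < \<delta>'"
    and 2: "\<And>s. s \<in> {0..T'} \<Longrightarrow> \<bar>y (\<theta> s) - x s\<bar> < \<delta>'"
    by (auto simp: skorokhod_nbhd_def)
  have "\<forall>s\<ge>0. \<bar>\<theta> s - s\<bar> < \<delta>"
    using 1 assms(2) by (meson less_le_trans)
  moreover have "\<forall>s\<in>{0..T}. \<bar>y (\<theta> s) - x s\<bar> < \<delta>"
  proof
    fix s assume "s \<in> {0..T}"
    then have "s \<in> {0..T'}" using assms(1) by auto
    from 2[OF this] assms(2) show "\<bar>y (\<theta> s) - x s\<bar> < \<delta>" by linarith
  qed
  ultimately show "y \<in> skorokhod_nbhd x T \<delta>"
    using y \<theta> by (auto simp: skorokhod_nbhd_def)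
qed

lemma openin_skorokhod_topology:
  "openin skorokhod_topology U \<longleftrightarrow> U \<subseteq> skorokhod_space \<and>
     (\<forall>x\<in>U. \<exists>T>0. \<exists>\<delta>>0. skorokhod_nbhd x T \<delta> \<subseteq> U)"
proof -
  have "istopology (\<lambda>U. U \<subseteq> skorokhod_space \<and>
     (\<forall>x\<in>U. \<exists>T>0. \<exists>\<delta>>0. skorokhod_nbhd x T \<delta> \<subseteq> U))"
    unfolding istopology_def
  proof (intro conjI allI impI ballI)
    fix S S' x
    assume S: "S \<subseteq> skorokhod_space \<and> (\<forall>x\<in>S. \<exists>T>0. \<exists>\<delta>>0. skorokhod_nbhd x T \<delta> \<subseteq> S)"
      and S': "S' \<subseteq> skorokhod_space \<and> (\<forall>x\<in>S'. \<exists>T>0. \<exists>\<delta>>0. skorokhod_nbhd x T \<delta> \<subseteq> S')"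
      and x: "x \<in> S \<inter> S'"
    obtain T \<delta> where 1: "T > 0" "\<delta> > 0" "skorokhod_nbhd x T \<delta> \<subseteq> S" using S x by auto
    obtain T' \<delta>' where 2: "T' > 0" "\<delta>' > 0" "skorokhod_nbhd x T' \<delta>' \<subseteq> S'" using S' x by auto
    have "skorokhod_nbhd x (max T T') (min \<delta> \<delta>') \<subseteq> S \<inter> S'"
      using 1(3) 2(3) skorokhod_nbhd_mono[of T "max T T'" "min \<delta> \<delta>'" \<delta> x]
        skorokhod_nbhd_mono[of T' "max T T'" "min \<delta> \<delta>'" \<delta>' x] by auto
    then show "\<exists>T>0. \<exists>\<delta>>0. skorokhod_nbhd x T \<delta> \<subseteq> S \<inter> S'"
      using 1 2 by (intro exI[of _ "max T T'"] exI[of _ "min \<delta> \<delta>'"] conjI) auto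
  next
    fix \<K> :: "(real \<Rightarrow> real) set set" and x
    assume K: "\<forall>S\<in>\<K>. S \<subseteq> skorokhod_space \<and>
      (\<forall>x\<in>S. \<exists>T>0. \<exists>\<delta>>0. skorokhod_nbhd x T \<delta> \<subseteq> S)" and "x \<in> \<Union>\<K>"
    then obtain S where S: "S \<in> \<K>" "x \<in> S" by auto
    with K obtain T \<delta> where "T > 0" "\<delta> > 0" "skorokhod_nbhd x T \<delta> \<subseteq> S" by meson
    with S show "\<exists>T>0. \<exists>\<delta>>0. skorokhod_nbhd x T \<delta> \<subseteq> \<Union>\<K>"
      by (intro exI[of _ T] exI[of _ \<delta>] conjI) auto
  qed auto
  then show ?thesis
    unfolding skorokhod_topology_def by (simp add: topology_inverse')
qed

lemma topspace_skorokhod_topology [simp]: "topspace skorokhod_topology = skorokhod_space"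
proof -
  have "openin skorokhod_topology skorokhod_space"
    unfolding openin_skorokhod_topology
    by (auto intro!: exI[of _ 1] simp: skorokhod_nbhd_def)
  then show ?thesis
    by (meson openin_skorokhod_topology openin_subset openin_topspace subset_antisym)
qed

text \<open>Convergence in distribution of random elements \<open>X i\<close>, each on its own probability space
  \<open>M i\<close>. The integrability clauses say that the expectations are meaningful (the Bochner integral
  of a non-measurable function is \<open>0\<close>).\<close>

definition converges_in_distribution ::
  "'i filter \<Rightarrow> 'b topology \<Rightarrow> ('i \<Rightarrow> 'w measure) \<Rightarrow> ('i \<Rightarrow> 'w \<Rightarrow> 'b) \<Rightarrow> 'v measure \<Rightarrow> ('v \<Rightarrow> 'b) \<Rightarrow> bool"
where
  "converges_in_distribution F S M X M' X' \<longleftrightarrow>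
     (\<forall>\<^sub>F i in F. X i \<in> space (M i) \<rightarrow> topspace S) \<and> X' \<in> space M' \<rightarrow> topspace S \<and>
     (\<forall>f. continuous_map S euclideanreal f \<and> bounded (f ` topspace S) \<longrightarrow>
        (\<forall>\<^sub>F i in F. integrable (M i) (\<lambda>w. f (X i w))) \<and> integrable M' (\<lambda>w. f (X' w)) \<and>
        ((\<lambda>i. \<integral>w. f (X i w) \<partial>M i) \<longlongrightarrow> (\<integral>w. f (X' w) \<partial>M')) F)"


section \<open>Gaussian processes\<close>

text \<open>The Dirac mass at \<open>0\<close> counts as a Gaussian law.\<close>

definition centered_gaussian :: "'w measure \<Rightarrow> ('w \<Rightarrow> real) \<Rightarrow> bool" where
  "centered_gaussian M Y \<longleftrightarrow> Y \<in> borel_measurable M \<and>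
     (distr M borel Y = return borel 0 \<or>
      (\<exists>\<sigma>>0. distributed M lborel Y (\<lambda>x. ennreal (normal_density 0 \<sigma> x))))"

definition centered_gaussian_process :: "'w measure \<Rightarrow> (real \<Rightarrow> 'w \<Rightarrow> real) \<Rightarrow> bool" where
  "centered_gaussian_process M X \<longleftrightarrow>
     (\<forall>I a. finite I \<and> I \<subseteq> {0..} \<longrightarrow> centered_gaussian M (\<lambda>w. \<Sum>t\<in>I. a t * X t w))"


section \<open>The environment\<close>

definition generated_sigma ::
  "'w measure \<Rightarrow> 'i set \<Rightarrow> ('i \<Rightarrow> 'w \<Rightarrow> 'b::topological_space) \<Rightarrow> 'w measure" where
  "generated_sigma M I X =
     sigma (space M) {X i -` B \<inter> space M | i B. i \<in> I \<and> B \<in> sets borel}"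

text \<open>\<open>K t z\<close> is the law at time \<open>t\<close> of the dynamics of \<open>Z\<close> started from \<open>z\<close>. For a Markov process
  \<open>K\<close> is its transition semigroup; neither the Markov nor the semigroup property is required.\<close>

definition transition_laws ::
  "'w measure \<Rightarrow> (real \<Rightarrow> 'w \<Rightarrow> 'b::topological_space) \<Rightarrow> (real \<Rightarrow> 'b \<Rightarrow> 'b measure) \<Rightarrow> bool" where
  "transition_laws M Z K \<longleftrightarrow>
     (\<forall>t\<ge>0. K t \<in> borel \<rightarrow>\<^sub>M prob_algebra borel) \<and>
     (\<forall>z. K 0 z = return borel z) \<and>
     (\<forall>t\<ge>0. distr M borel (Z t) = distr M borel (Z 0) \<bind> K t)"

definition invariant_law :: "(real \<Rightarrow> 'b::topological_space \<Rightarrow> 'b measure) \<Rightarrow> 'b measure \<Rightarrow> bool" where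
  "invariant_law K \<pi> \<longleftrightarrow> \<pi> \<in> space (prob_algebra borel) \<and> (\<forall>t\<ge>0. \<pi> \<bind> K t = \<pi>)"

text \<open>\<open>Q\<close> is a regular version of the conditional probability of \<open>M\<close> given the sub-\<open>\<sigma>\<close>-algebra \<open>F\<close>.\<close>

definition regular_cond_prob :: "'w measure \<Rightarrow> 'w measure \<Rightarrow> ('w \<Rightarrow> 'w measure) \<Rightarrow> bool" where
  "regular_cond_prob M F Q \<longleftrightarrow> Q \<in> F \<rightarrow>\<^sub>M prob_algebra M \<and>
     (\<forall>A\<in>sets M. AE w in M. measure (Q w) A = real_cond_exp M F (indicator A) w)"


section \<open>The queue\<close>

text \<open>Arrival times are indexed from \<open>0\<close> and listed in nondecreasing order; \<open>\<infinity>\<close> stands for an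
  arrival that never happens (the total intensity may be finite).\<close>

definition arrival_times :: "'w measure \<Rightarrow> (nat \<Rightarrow> 'w \<Rightarrow> ereal) \<Rightarrow> bool" where
  "arrival_times M \<Gamma> \<longleftrightarrow> (\<forall>k. \<Gamma> k \<in> borel_measurable M) \<and>
     (\<forall>w\<in>space M. (\<forall>k. 0 \<le> \<Gamma> k w \<and> \<Gamma> k w \<le> \<Gamma> (Suc k) w) \<and>
        (\<forall>T::real. finite {k. \<Gamma> k w \<le> ereal T}))"

definition num_points :: "(nat \<Rightarrow> 'w \<Rightarrow> ereal) \<Rightarrow> real set \<Rightarrow> 'w \<Rightarrow> nat" where
  "num_points \<Gamma> B w = card {k. \<Gamma> k w \<in> ereal ` B}"

definition poisson_process :: "'w measure \<Rightarrow> (nat \<Rightarrow> 'w \<Rightarrow> ereal) \<Rightarrow> real measure \<Rightarrow> bool" where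
  "poisson_process Q \<Gamma> \<mu> \<longleftrightarrow>
     (\<forall>B\<in>sets borel. bounded B \<and> B \<subseteq> {0..} \<longrightarrow>
        (\<forall>n. measure Q {w \<in> space Q. num_points \<Gamma> B w = n}
              = exp (- measure \<mu> B) * measure \<mu> B ^ n / fact n)) \<and>
     (\<forall>B::nat \<Rightarrow> real set. (\<forall>i. B i \<in> sets borel \<and> bounded (B i) \<and> B i \<subseteq> {0..}) \<and>
        disjoint_family B \<longrightarrow>
        prob_space.indep_vars Q (\<lambda>_. count_space UNIV) (\<lambda>i. num_points \<Gamma> (B i)) UNIV)"

definition service_law :: "(real \<Rightarrow> real \<Rightarrow> real) \<Rightarrow> real \<Rightarrow> real measure" where
  "service_law \<rho> s = density lborel (\<lambda>r. ennreal (indicator {0..} r * \<rho> s r))"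

definition service_tail :: "(real \<Rightarrow> real \<Rightarrow> real) \<Rightarrow> real \<Rightarrow> real \<Rightarrow> real" where
  "service_tail \<rho> s r = (LBINT \<tau>:{r..}. \<rho> s \<tau>)"

text \<open>Given the arrival times, the service times of the jobs that do arrive are independent, the
  job arriving at time \<open>s\<close> having law \<open>\<nu> s\<close>.\<close>

definition conditional_services ::
  "'w measure \<Rightarrow> (nat \<Rightarrow> 'w \<Rightarrow> ereal) \<Rightarrow> (nat \<Rightarrow> 'w \<Rightarrow> real) \<Rightarrow> (real \<Rightarrow> real measure) \<Rightarrow> bool" where
  "conditional_services Q \<Gamma> L \<nu> \<longleftrightarrow>
     (\<forall>n. \<forall>B::nat \<Rightarrow> real set. (\<forall>k<n. B k \<in> sets borel) \<longrightarrow>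
        (AE w in Q. (\<forall>k<n. \<Gamma> k w < \<infinity>) \<longrightarrow>
           real_cond_exp Q (generated_sigma Q UNIV \<Gamma>)
             (indicator {w \<in> space Q. \<forall>k<n. L k w \<in> B k}) w
           = (\<Prod>k<n. measure (\<nu> (real_of_ereal (\<Gamma> k w))) (B k))))"

definition arrival_intensity ::
  "real \<Rightarrow> (real \<Rightarrow> real) \<Rightarrow> ('b \<Rightarrow> real) \<Rightarrow> real \<Rightarrow> (real \<Rightarrow> 'b) \<Rightarrow> real measure" where
  "arrival_intensity \<beta> \<Lambda> \<psi> \<epsilon> z = density lborel
     (\<lambda>s. ennreal (indicator {0..} s * (\<epsilon> powr (- \<beta>) * \<Lambda> s * \<psi> (z (s / \<epsilon>)))))"

definition active_jobs ::
  "(nat \<Rightarrow> 'w \<Rightarrow> ereal) \<Rightarrow> (nat \<Rightarrow> 'w \<Rightarrow> real) \<Rightarrow> real \<Rightarrow> 'w \<Rightarrow> real" where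
  "active_jobs \<Gamma> L t w =
     (\<Sum>k. of_bool (\<Gamma> k w \<le> ereal t \<and> ereal t < \<Gamma> k w + ereal (L k w)))"

definition limit_mean ::
  "real \<Rightarrow> (real \<Rightarrow> real) \<Rightarrow> (real \<Rightarrow> real \<Rightarrow> real) \<Rightarrow> real \<Rightarrow> real" where
  "limit_mean \<psi>bar \<Lambda> \<rho> t = \<psi>bar * (LBINT s:{0..t}. \<Lambda> s * service_tail \<rho> s (t - s))"

definition fluctuation ::
  "real \<Rightarrow> (real \<Rightarrow> real) \<Rightarrow> real \<Rightarrow> (nat \<Rightarrow> 'w \<Rightarrow> ereal) \<Rightarrow> (nat \<Rightarrow> 'w \<Rightarrow> real) \<Rightarrow> real \<Rightarrow> 'w \<Rightarrow> real" where
  "fluctuation \<beta> m0 \<epsilon> \<Gamma> L t w =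
     \<epsilon> powr (\<beta> / 2) * (active_jobs \<Gamma> L t w - m0 t / \<epsilon> powr \<beta>)"

end

theory Submission
  imports Defs
begin

text \<open>Given the environment, the numbers of active jobs are additive functionals of a marked Poisson
  process, so their joint characteristic function is the exponential of an explicit integral, and a
  Taylor expansion with a remainder of order \<open>\<epsilon> powr (\<beta> / 2)\<close> leaves a quadratic form. The ergodic
  rate lets one replace \<open>\<psi> (Z (s / \<epsilon>))\<close> by \<open>\<psi>bar\<close> in integrals against Lipschitz weights, up to an
  error of order \<open>\<epsilon> powr \<kappa>\<close>. Hence the error in the centering is of order \<open>\<epsilon> powr (\<kappa> - \<beta> / 2)\<close>,
  which is where \<open>\<beta> < 2 * \<kappa>\<close> enters, and the limiting covariance of \<open>s \<le> t\<close> is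
  \<open>\<psi>bar\<close> times the integral of \<open>\<Lambda> u * service_tail \<rho> u (t - u)\<close> over \<open>u \<in> {0..s}\<close>.
  For tightness, exponential moments bound the fourth moments of increments over dyadic
  intervals longer than \<open>\<epsilon> powr \<beta>\<close>, and these are chained; inside an interval of length about
  \<open>\<epsilon> powr \<beta>\<close> the queue moves by at most the number of arrivals and departures, which is \<open>O(1)\<close>.
  The limit is built from white noise by elimination at the dyadic times and has continuous paths by
  the same chaining. Approximating paths by dyadic step functions then upgrades convergence of the
  characteristic functions to convergence in distribution in the Skorokhod topology.\<close>

section \<open>Step approximation in the Skorokhod space\<close>

text \<open>Two obstacles shape the argument. A functional that is continuous on the Skorokhod space
  need not be uniformly continuous, so closeness of a path to its step version says nothing yet
  about the values of the functional. The remedy is a truncated distance to the set of paths around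
  which the functional is stable: its mean is small under the limit, and it is regular enough for
  this smallness to pass to the step paths. Secondly, Levy's theorem is applied to real random
  variables only. Vectors are treated one coordinate at a time, the other coordinates entering
  through bounded weights such as \<open>1 + V * (1 + cos S)\<close>, which are at least 1 and
  therefore normalise to probability laws. One product formula for marked Poisson processes serves
  twice: with imaginary exponents for the limit law, with real exponents for the moments. The
  chaining threshold \<open>(9 / 10) ^ l\<close> is slow enough for a union bound over about
  \<open>2 ^ l\<close> increments with fourth moments of order \<open>1 / 4 ^ l\<close>, because
  \<open>2 * (9 / 10) ^ 4 > 1\<close>.\<close>

definition dyadic_floor :: "nat \<Rightarrow> real \<Rightarrow> real" where
  "dyadic_floor l t = real_of_int \<lfloor>2 ^ l * t\<rfloor> / 2 ^ l"

lemma dyadic_floor_le: "dyadic_floor l t \<le> t"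
  unfolding dyadic_floor_def by (simp add: divide_le_eq mult.commute)

lemma dyadic_floor_gt: "t - 1 / 2 ^ l < dyadic_floor l t"
proof -
  have "2 ^ l * t - 1 < real_of_int \<lfloor>2 ^ l * t\<rfloor>" by linarith
  then have "(2 ^ l * t - 1) / 2 ^ l < real_of_int \<lfloor>2 ^ l * t\<rfloor> / 2 ^ l"
    by (rule divide_strict_right_mono) simp
  then show ?thesis unfolding dyadic_floor_def by (simp add: diff_divide_distrib)
qed

lemma dyadic_floor_nonneg: "t \<ge> 0 \<Longrightarrow> dyadic_floor l t \<ge> 0"
  unfolding dyadic_floor_def by simp

lemma dyadic_floor_eq_nat:
  "t \<ge> 0 \<Longrightarrow> dyadic_floor l t = real (nat \<lfloor>2 ^ l * t\<rfloor>) / 2 ^ l"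
  unfolding dyadic_floor_def by simp

text \<open>A continuous function that stays within \<open>\<delta>\<close> of the identity is at
  least \<open>y\<close> at \<open>y + \<delta>\<close>, so surjectivity follows from the
  intermediate value theorem.\<close>

lemma time_changeI:
  assumes sm: "strict_mono_on {0..} \<theta>" and cont: "continuous_on {0..} \<theta>" and "\<theta> 0 = 0"
    and close: "\<And>s. s \<ge> 0 \<Longrightarrow> \<bar>\<theta> s - s\<bar> \<le> \<delta>"
  shows "time_change \<theta>"
  unfolding time_change_def
proof (intro conjI sm cont equalityI subsetI)
  fix y assume "y \<in> \<theta> ` {0..}"
  then obtain s where s: "s \<ge> 0" "y = \<theta> s" by auto
  have "\<theta> 0 \<le> \<theta> s" using sm s by (meson atLeast_iff order_refl strict_mono_on_leD)
  then show "y \<in> {0..}" using s \<open>\<theta> 0 = 0\<close> by simp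
next
  fix y :: real assume y: "y \<in> {0..}"
  have "\<delta> \<ge> 0" using close[of 0] by simp
  have "\<exists>s\<ge>0. s \<le> y + \<delta> \<and> \<theta> s = y"
  proof (rule IVT')
    show "\<theta> 0 \<le> y" using \<open>\<theta> 0 = 0\<close> y by simp
    show "y \<le> \<theta> (y + \<delta>)" using close[of "y + \<delta>"] y \<open>\<delta> \<ge> 0\<close> by (simp add: abs_le_iff)
    show "0 \<le> y + \<delta>" using y \<open>\<delta> \<ge> 0\<close> by simp
    show "continuous_on {0..y + \<delta>} \<theta>" using cont by (rule continuous_on_subset) auto
  qed
  then show "y \<in> \<theta> ` {0..}" by auto
qed

text \<open>Piecewise linear interpolation through the points \<open>(t i, u i)\<close>, continued
  with slope 1. On a segment the displacement \<open>\<theta> s - s\<close> interpolates between its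
  values at the two ends, so the bound at the nodes holds everywhere. The clause on
  \<open>s \<ge> t n\<close> tells the induction what the last segment looks like.\<close>

lemma time_change_nodes:
  fixes t u :: "nat \<Rightarrow> real"
  assumes "t 0 = 0" "u 0 = 0" "\<And>i. i < n \<Longrightarrow> t i < t (Suc i)" "\<And>i. i < n \<Longrightarrow> u i < u (Suc i)"
    and "\<And>i. i \<le> n \<Longrightarrow> \<bar>u i - t i\<bar> \<le> \<delta>"
  shows "\<exists>\<theta>. strict_mono_on {0..} \<theta> \<and> continuous_on {0..} \<theta> \<and> (\<forall>i\<le>n. \<theta> (t i) = u i) \<and>
    (\<forall>s\<ge>0. \<bar>\<theta> s - s\<bar> \<le> \<delta>) \<and> (\<forall>s\<ge>t n. \<theta> s = s + (u n - t n))"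
  using assms(3-5)
proof (induction n)
  case 0
  show ?case
    using assms(1,2) "0.prems"(3)[of 0]
    by (intro exI[of _ "\<lambda>s. s"]) (auto simp: strict_mono_on_def intro: continuous_on_id)
next
  case (Suc n)
  have "\<exists>\<theta>. strict_mono_on {0..} \<theta> \<and> continuous_on {0..} \<theta> \<and> (\<forall>i\<le>n. \<theta> (t i) = u i) \<and>
    (\<forall>s\<ge>0. \<bar>\<theta> s - s\<bar> \<le> \<delta>) \<and> (\<forall>s\<ge>t n. \<theta> s = s + (u n - t n))"
    by (rule Suc.IH) (use Suc.prems in auto)
  then obtain \<theta> where sm: "strict_mono_on {0..} \<theta>" and cont: "continuous_on {0..} \<theta>"
    and nodes: "\<And>i. i \<le> n \<Longrightarrow> \<theta> (t i) = u i" and close: "\<And>s. s \<ge> 0 \<Longrightarrow> \<bar>\<theta> s - s\<bar> \<le> \<delta>"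
    and tail: "\<And>s. s \<ge> t n \<Longrightarrow> \<theta> s = s + (u n - t n)"
    by blast
  have tn: "i \<le> n \<Longrightarrow> t i \<le> t n" for i
  proof (induction rule: inc_induct)
    case (step j)
    then show ?case using Suc.prems(1)[of j] by auto
  qed simp
  then have tn0: "t n \<ge> 0" using assms(1) by (metis le0)
  define h where "h = t (Suc n) - t n"
  \<comment> \<open>The slope to be added to the tail of slope 1 on the new segment;
    \<open>c > -1\<close> expresses that \<open>u\<close> grows strictly.\<close>
  define c where "c = ((u (Suc n) - t (Suc n)) - (u n - t n)) / h"
  have h: "h > 0" using Suc.prems(1)[of n] by (simp add: h_def)
  have un: "u n < u (Suc n)" using Suc.prems(2) by simp
  have ch: "c * h = (u (Suc n) - t (Suc n)) - (u n - t n)" using h by (simp add: c_def)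
  have c: "c > -1"
  proof -
    have "c * h > - 1 * h" unfolding ch using un by (simp add: h_def)
    then show ?thesis using h by (simp only: mult_less_cancel_right_pos)
  qed
  \<comment> \<open>A ramp that is 0 up to \<open>t n\<close> and constant after
    \<open>t (Suc n)\<close>, so earlier nodes are untouched and slope 1 returns afterwards.\<close>
  define q where "q s = max 0 (min (s - t n) h)" for s
  define \<theta>' where "\<theta>' s = \<theta> s + c * q s" for s
  have q0: "q s = 0" if "s \<le> t n" for s using that by (simp add: q_def)
  have qinc: "0 \<le> q s' - q s" "q s' - q s \<le> s' - s" if "s < s'" for s s'
    using that by (auto simp: q_def)
  have step: "\<theta>' s < \<theta>' s'" if "t n \<le> s" "s < s'" for s s'
  proof -
    have "c * (q s' - q s) > - (s' - s)"
    proof (cases "q s' - q s = 0")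
      case True then show ?thesis using that by simp
    next
      case False
      then have "q s' - q s > 0" using qinc(1)[OF that(2)] by simp
      then have "c * (q s' - q s) > - 1 * (q s' - q s)" using c mult_strict_right_mono by blast
      then show ?thesis using qinc(2)[OF that(2)] by simp
    qed
    then show ?thesis using that by (simp add: \<theta>'_def tail algebra_simps)
  qed
  show ?case
  proof (intro exI[of _ \<theta>'] conjI allI impI)
    show "strict_mono_on {0..} \<theta>'"
    proof (rule strict_mono_onI)
      fix r s :: real assume rs: "r \<in> {0..}" "s \<in> {0..}" "r < s"
      consider "s \<le> t n" | "t n \<le> r" | "r < t n" "t n < s" by linarith
      then show "\<theta>' r < \<theta>' s"
      proof cases
        case 1
        then show ?thesis using rs sm by (auto simp: \<theta>'_def q0 strict_mono_on_def)
      next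
        case 2
        then show ?thesis using step rs by simp
      next
        case 3
        have "\<theta>' r = \<theta> r" using 3 by (simp add: \<theta>'_def q0)
        also have "\<dots> < \<theta> (t n)" using sm 3 rs tn0 by (auto simp: strict_mono_on_def)
        also have "\<theta> (t n) = \<theta>' (t n)" by (simp add: \<theta>'_def q0)
        also have "\<dots> < \<theta>' s" using step 3 by simp
        finally show ?thesis .
      qed
    qed
    show "continuous_on {0..} \<theta>'"
      unfolding \<theta>'_def q_def by (intro continuous_intros cont)
    fix i assume "i \<le> Suc n"
    then consider "i \<le> n" | "i = Suc n" by linarith
    then show "\<theta>' (t i) = u i"
    proof cases
      case 1
      then show ?thesis using tn nodes by (simp add: \<theta>'_def q0)
    next
      case 2
      have "q (t (Suc n)) = h" using h by (simp add: q_def h_def)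
      then show ?thesis using 2 h ch by (simp add: \<theta>'_def tail h_def)
    qed
  next
    fix s :: real assume s: "s \<ge> 0"
    show "\<bar>\<theta>' s - s\<bar> \<le> \<delta>"
    proof (cases "s \<le> t n")
      case True then show ?thesis using close[OF s] by (simp add: \<theta>'_def q0)
    next
      case False
      \<comment> \<open>The relative position in the last segment, equal to 1 beyond it; the
        displacement is the convex combination of the two end displacements with weight
        \<open>p\<close>.\<close>
      define p where "p = q s / h"
      have p: "0 \<le> p" "p \<le> 1" using h by (auto simp: p_def q_def)
      have 1: "\<theta>' s - s = (u n - t n) + c * h * p" using False h by (simp add: \<theta>'_def tail p_def)
      have "\<theta>' s - s = (1 - p) * (u n - t n) + p * (u (Suc n) - t (Suc n))"
        unfolding 1 ch by (simp add: algebra_simps)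
      also have "\<bar>\<dots>\<bar> \<le> (1 - p) * \<bar>u n - t n\<bar> + p * \<bar>u (Suc n) - t (Suc n)\<bar>"
        using p by (intro order_trans[OF abs_triangle_ineq]) (simp add: abs_mult)
      also have "\<dots> \<le> (1 - p) * \<delta> + p * \<delta>"
        using p Suc.prems(3)[of n] Suc.prems(3)[of "Suc n"] by (intro add_mono mult_left_mono) auto
      finally show ?thesis by (simp add: algebra_simps)
    qed
  next
    fix s assume s: "t (Suc n) \<le> s"
    then have "q s = h" using h by (simp add: q_def h_def)
    then show "\<theta>' s = s + (u (Suc n) - t (Suc n))"
      using s h ch by (simp add: \<theta>'_def tail h_def)
  qed
qed

text \<open>The inductive form suits a supremum argument over reachable endpoints, where one
  half-open piece of small oscillation is appended at a time.\<close>

inductive osc_partition :: "(real \<Rightarrow> real) \<Rightarrow> real \<Rightarrow> real \<Rightarrow> bool" for x \<eta> where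
  start: "osc_partition x \<eta> 0"
| step: "osc_partition x \<eta> b \<Longrightarrow> b < b' \<Longrightarrow>
    (\<And>s s'. b \<le> s \<Longrightarrow> s < b' \<Longrightarrow> b \<le> s' \<Longrightarrow> s' < b' \<Longrightarrow> \<bar>x s - x s'\<bar> < \<eta>) \<Longrightarrow> osc_partition x \<eta> b'"

lemma osc_partition_nodes:
  assumes "osc_partition x \<eta> b"
  shows "\<exists>n t. t 0 = 0 \<and> t n = b \<and> (\<forall>i<n. t i < t (Suc i)) \<and>
    (\<forall>i<n. \<forall>s\<in>{t i..<t (Suc i)}. \<forall>s'\<in>{t i..<t (Suc i)}. \<bar>x s - x s'\<bar> < \<eta>)"
  using assms
proof induction
  case start
  show ?case by (intro exI[of _ 0] exI[of _ "\<lambda>_. 0"]) auto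
next
  case (step b b')
  then obtain n t where t: "t 0 = 0" "t n = b" "\<forall>i<n. t i < t (Suc i)"
    "\<forall>i<n. \<forall>s\<in>{t i..<t (Suc i)}. \<forall>s'\<in>{t i..<t (Suc i)}. \<bar>x s - x s'\<bar> < \<eta>" by blast
  have "\<forall>i<Suc n. (t(Suc n := b')) i < (t(Suc n := b')) (Suc i)"
    using t step(2) by (auto simp: less_Suc_eq)
  moreover have "\<forall>i<Suc n. \<forall>s\<in>{(t(Suc n := b')) i..<(t(Suc n := b')) (Suc i)}.
     \<forall>s'\<in>{(t(Suc n := b')) i..<(t(Suc n := b')) (Suc i)}. \<bar>x s - x s'\<bar> < \<eta>"
    using t step(3) by (auto simp: less_Suc_eq)
  ultimately show ?case using t
    by (intro exI[of _ "Suc n"] exI[of _ "t(Suc n := b')"]) auto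
qed

text \<open>If the reachable endpoints were bounded, the left limit at their supremum
  \<open>c\<close> would make \<open>c\<close> itself reachable, and right-continuity at
  \<open>c\<close> would add one more piece beyond it.\<close>

lemma cadlag_osc_partition:
  fixes x :: "real \<Rightarrow> real"
  assumes "cadlag x" "\<eta> > 0"
  shows "\<exists>b>T. osc_partition x \<eta> b"
proof (rule ccontr)
  assume neg: "\<not> (\<exists>b>T. osc_partition x \<eta> b)"
  define S where "S = {b. osc_partition x \<eta> b}"
  have S0: "0 \<in> S" by (simp add: S_def osc_partition.start)
  have bdd: "bdd_above S" using neg by (intro bdd_aboveI[of _ T]) (auto simp: S_def not_less)
  define c where "c = Sup S"
  have c0: "c \<ge> 0" using S0 bdd by (auto simp: c_def intro: cSup_upper)
  have osc: "\<exists>d>0. \<forall>s s'. s \<in> A d \<and> s' \<in> A d \<longrightarrow> \<bar>x s - x s'\<bar> < \<eta>"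
    if "\<exists>d>0. \<forall>s\<in>A d. \<bar>x s - l\<bar> < \<eta> / 2" for A :: "real \<Rightarrow> real set" and l
  proof -
    obtain d where d: "d > 0" "\<And>s. s \<in> A d \<Longrightarrow> \<bar>x s - l\<bar> < \<eta> / 2" using \<open>\<exists>d>0. _\<close> by blast
    have "\<bar>x s - x s'\<bar> < \<eta>" if "s \<in> A d" "s' \<in> A d" for s s'
      using d(2)[OF that(1)] d(2)[OF that(2)] by linarith
    then show ?thesis using d(1) by blast
  qed
  have cS: "c \<in> S"
  proof (cases "c = 0")
    case True then show ?thesis using S0 by simp
  next
    case False
    then have "c > 0" using c0 by simp
    then obtain l where l: "(x \<longlongrightarrow> l) (at_left c)" using assms(1) by (auto simp: cadlag_def)
    have "\<forall>\<^sub>F s in at_left c. \<bar>x s - l\<bar> < \<eta> / 2"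
      using tendstoD[OF l, of "\<eta> / 2"] assms(2) by (simp add: dist_real_def)
    then obtain a where a: "a < c" "\<And>s. a < s \<Longrightarrow> s < c \<Longrightarrow> \<bar>x s - l\<bar> < \<eta> / 2"
      by (auto simp: eventually_at_left[of 0 c, OF \<open>c > 0\<close>] eventually_at_left_field)
    obtain b where b: "b \<in> S" "a < b"
      using less_cSupD[of S a] a(1) S0 unfolding c_def by blast
    have "b \<le> c" using b bdd by (auto simp: c_def intro: cSup_upper)
    show ?thesis
    proof (cases "b = c")
      case True then show ?thesis using b by simp
    next
      case False
      then have "b < c" using \<open>b \<le> c\<close> by simp
      have "osc_partition x \<eta> c"
      proof (rule osc_partition.step)
        show "osc_partition x \<eta> b" using b by (simp add: S_def)
        fix s s' assume "b \<le> s" "s < c" "b \<le> s'" "s' < c"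
        then show "\<bar>x s - x s'\<bar> < \<eta>" using a(2)[of s] a(2)[of s'] b(2) by linarith
      qed fact
      then show ?thesis by (simp add: S_def)
    qed
  qed
  have "(x \<longlongrightarrow> x c) (at_right c)" using assms(1) c0 by (auto simp: cadlag_def)
  then have "\<forall>\<^sub>F s in at_right c. \<bar>x s - x c\<bar> < \<eta> / 2"
    using tendstoD[of x "x c" _ "\<eta> / 2"] assms(2) by (simp add: dist_real_def)
  then obtain e where e: "e > c" "\<And>s. c < s \<Longrightarrow> s < e \<Longrightarrow> \<bar>x s - x c\<bar> < \<eta> / 2"
    by (auto simp: eventually_at_right_field)
  have e': "\<bar>x s - x c\<bar> < \<eta> / 2" if "c \<le> s" "s < e" for s
    using e(2)[of s] that assms(2) by (cases "s = c") auto
  have "osc_partition x \<eta> e"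
  proof (rule osc_partition.step)
    show "osc_partition x \<eta> c" using cS by (simp add: S_def)
    fix s s' assume "c \<le> s" "s < e" "c \<le> s'" "s' < e"
    then show "\<bar>x s - x s'\<bar> < \<eta>" using e'[of s] e'[of s'] by linarith
  qed fact
  then have "e \<le> c" using bdd by (auto simp: S_def c_def intro: cSup_upper)
  then show False using e(1) by simp
qed

text \<open>The index is frozen at \<open>l * 2 ^ l\<close>, that is from time \<open>l\<close> on,
  so only finitely many values of \<open>v\<close> enter and finite-dimensional convergence can be
  applied.\<close>

definition step_path :: "nat \<Rightarrow> (nat \<Rightarrow> real) \<Rightarrow> real \<Rightarrow> real" where
  "step_path l v = restrict (\<lambda>t. v (min (nat \<lfloor>2 ^ l * t\<rfloor>) (l * 2 ^ l))) {0..}"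

definition grid_values :: "nat \<Rightarrow> (real \<Rightarrow> real) \<Rightarrow> nat \<Rightarrow> real" where
  "grid_values l x i = x (real i / 2 ^ l)"

lemma step_path_grid_values:
  assumes "0 \<le> t" "t \<le> real l"
  shows "step_path l (grid_values l x) t = x (dyadic_floor l t)"
proof -
  have "2 ^ l * t \<le> real (l * 2 ^ l)" using assms by (simp add: mult.commute)
  then have "nat \<lfloor>2 ^ l * t\<rfloor> \<le> l * 2 ^ l" by linarith
  then show ?thesis using assms
    by (simp add: step_path_def grid_values_def dyadic_floor_eq_nat)
qed

lemma floor_locally_constant_right:
  fixes t :: real
  shows "\<forall>\<^sub>F s in at_right t. \<lfloor>s\<rfloor> = \<lfloor>t\<rfloor>"
proof -
  have "t < real_of_int \<lfloor>t\<rfloor> + 1" by linarith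
  moreover have "\<lfloor>s\<rfloor> = \<lfloor>t\<rfloor>" if "t < s" "s < real_of_int \<lfloor>t\<rfloor> + 1" for s
    using that by linarith
  ultimately show ?thesis unfolding eventually_at_right_field by blast
qed

lemma floor_locally_constant_left:
  fixes t :: real
  shows "\<forall>\<^sub>F s in at_left t. \<lfloor>s\<rfloor> = \<lceil>t\<rceil> - 1"
proof -
  have "real_of_int \<lceil>t\<rceil> - 1 < t" by linarith
  moreover have "\<lfloor>s\<rfloor> = \<lceil>t\<rceil> - 1" if "real_of_int \<lceil>t\<rceil> - 1 < s" "s < t" for s
    using that by linarith
  ultimately show ?thesis unfolding eventually_at_left_field by blast
qed

lemma cadlag_restrict:
  assumes "cadlag x"
  shows "cadlag (restrict x {0..})"
  unfolding cadlag_def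
proof (intro conjI allI impI)
  fix t :: real assume t: "t \<ge> 0"
  have "\<forall>\<^sub>F s in at_right t. restrict x {0..} s = x s"
    unfolding eventually_at_right_field using t by (intro exI[of _ "t + 1"]) auto
  then show "(restrict x {0..} \<longlongrightarrow> restrict x {0..} t) (at_right t)"
    using assms t by (subst tendsto_cong[where g=x]) (auto simp: cadlag_def)
next
  fix t :: real assume t: "t > 0"
  then obtain l where l: "(x \<longlongrightarrow> l) (at_left t)" using assms by (auto simp: cadlag_def)
  have "\<forall>\<^sub>F s in at_left t. restrict x {0..} s = x s"
    unfolding eventually_at_left_field using t by (intro exI[of _ 0]) auto
  then show "\<exists>l. (restrict x {0..} \<longlongrightarrow> l) (at_left t)"
    using l by (intro exI[of _ l]) (subst tendsto_cong[where g=x])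
qed

lemma filterlim_mult_at_right: "filterlim (\<lambda>s. 2 ^ l * s) (at_right (2 ^ l * t)) (at_right (t::real))"
  unfolding filterlim_at
proof (intro conjI)
  show "((\<lambda>s. 2 ^ l * s) \<longlongrightarrow> 2 ^ l * t) (at_right t)" by (intro tendsto_intros)
  show "\<forall>\<^sub>F s in at_right t. 2 ^ l * s \<in> {2 ^ l * t<..} \<and> 2 ^ l * s \<noteq> 2 ^ l * t"
    by (rule eventually_mono[OF eventually_at_right_less]) simp
qed

lemma filterlim_mult_at_left: "filterlim (\<lambda>s. 2 ^ l * s) (at_left (2 ^ l * t)) (at_left (t::real))"
  unfolding filterlim_at
proof (intro conjI)
  show "((\<lambda>s. 2 ^ l * s) \<longlongrightarrow> 2 ^ l * t) (at_left t)" by (intro tendsto_intros)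
  have "\<forall>\<^sub>F s in at_left t. s < t" unfolding eventually_at_left_field by (intro exI[of _ "t - 1"]) auto
  then show "\<forall>\<^sub>F s in at_left t. 2 ^ l * s \<in> {..<2 ^ l * t} \<and> 2 ^ l * s \<noteq> 2 ^ l * t"
    by (rule eventually_mono) simp
qed

lemma step_path_skorokhod: "step_path l v \<in> skorokhod_space"
proof -
  have "cadlag (\<lambda>t. v (min (nat \<lfloor>2 ^ l * t\<rfloor>) (l * 2 ^ l)))" (is "cadlag ?x")
    unfolding cadlag_def
  proof (intro conjI allI impI)
    fix t :: real
    have "\<forall>\<^sub>F s in at_right t. \<lfloor>2 ^ l * s\<rfloor> = \<lfloor>2 ^ l * t\<rfloor>"
      using filterlim_mult_at_right floor_locally_constant_right
      by (rule eventually_compose_filterlim[rotated])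
    then have "\<forall>\<^sub>F s in at_right t. ?x s = ?x t" by eventually_elim simp
    then show "(?x \<longlongrightarrow> ?x t) (at_right t)" by (rule tendsto_eventually)
  next
    fix t :: real
    have "\<forall>\<^sub>F s in at_left t. \<lfloor>2 ^ l * s\<rfloor> = \<lceil>2 ^ l * t\<rceil> - 1"
      using filterlim_mult_at_left floor_locally_constant_left
      by (rule eventually_compose_filterlim[rotated])
    then have "\<forall>\<^sub>F s in at_left t. ?x s = v (min (nat (\<lceil>2 ^ l * t\<rceil> - 1)) (l * 2 ^ l))"
      by eventually_elim simp
    then show "\<exists>m. (?x \<longlongrightarrow> m) (at_left t)" by (intro exI tendsto_eventually)
  qed
  from cadlag_restrict[OF this] show ?thesis unfolding step_path_def skorokhod_space_def
    by simp
qed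

text \<open>Near a jump a path and its dyadic step version are not uniformly close. A time change
  sending each node of a partition of small oscillation to the first dyadic point at or above it
  aligns the jumps; afterwards both values come from the same piece.\<close>

lemma step_path_in_skorokhod_nbhd:
  assumes x: "cadlag x" and "\<delta> > 0"
  shows "\<forall>\<^sub>F l in sequentially. step_path l (grid_values l x) \<in> skorokhod_nbhd x T \<delta>"
proof -
  obtain b where b: "b > max T 0" "osc_partition x \<delta> b"
    using cadlag_osc_partition[OF x \<open>\<delta> > 0\<close>] by blast
  obtain n t where t: "t 0 = 0" "t n = b" "\<And>i. i < n \<Longrightarrow> t i < t (Suc i)"
    and osc: "\<And>i s s'. i < n \<Longrightarrow> s \<in> {t i..<t (Suc i)} \<Longrightarrow> s' \<in> {t i..<t (Suc i)} \<Longrightarrow> \<bar>x s - x s'\<bar> < \<delta>"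
    using osc_partition_nodes[OF b(2)] by blast
  have lim: "(\<lambda>l. 1 / 2 ^ l :: real) \<longlonglongrightarrow> 0" by (rule LIMSEQ_divide_realpow_zero) simp
  \<comment> \<open>A mesh below every piece length keeps the rounded nodes strictly
    increasing.\<close>
  have "\<forall>\<^sub>F l in sequentially. \<forall>i\<in>{..<n}. 1 / 2 ^ l < t (Suc i) - t i"
    using t by (intro eventually_ball_finite ballI order_tendstoD(2)[OF lim]) auto
  moreover have "\<forall>\<^sub>F l in sequentially. 1 / 2 ^ l < \<delta>"
    using \<open>\<delta> > 0\<close> by (intro order_tendstoD(2)[OF lim]) auto
  moreover have "\<forall>\<^sub>F l in sequentially. real l \<ge> T + \<delta>"
    by (rule eventually_sequentiallyI[of "nat \<lceil>T + \<delta>\<rceil>"]) linarith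
  ultimately show ?thesis
  proof eventually_elim
    case (elim l)
    \<comment> \<open>Rounded up, because a step path sees a change at \<open>t i\<close> only from
      the first grid point at or after \<open>t i\<close>.\<close>
    define u where "u i = real_of_int \<lceil>2 ^ l * t i\<rceil> / 2 ^ l" for i
    have u1: "t i \<le> u i" for i unfolding u_def by (simp add: pos_le_divide_eq mult.commute)
    have u2: "u i < t i + 1 / 2 ^ l" for i
    proof -
      have "real_of_int \<lceil>2 ^ l * t i\<rceil> < 2 ^ l * t i + 1" by linarith
      then have "real_of_int \<lceil>2 ^ l * t i\<rceil> / 2 ^ l < (2 ^ l * t i + 1) / 2 ^ l"
        by (rule divide_strict_right_mono) simp
      then show ?thesis unfolding u_def by (simp add: add_divide_distrib)
    qed
    have uinc: "u i < u (Suc i)" if "i < n" for i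
      using u2[of i] u1[of "Suc i"] elim(1) that by (smt (verit) lessThan_iff)
    have ucl: "\<bar>u i - t i\<bar> \<le> 1 / 2 ^ l" for i using u1[of i] u2[of i] by simp
    have u0: "u 0 = 0" by (simp add: u_def t)
    obtain \<theta> where sm: "strict_mono_on {0..} \<theta>" and cont: "continuous_on {0..} \<theta>"
      and nodes: "\<And>i. i \<le> n \<Longrightarrow> \<theta> (t i) = u i" and cl: "\<And>s. s \<ge> 0 \<Longrightarrow> \<bar>\<theta> s - s\<bar> \<le> 1 / 2 ^ l"
      using time_change_nodes[of t u n "1 / 2 ^ l", OF t(1) u0 t(3) uinc ucl] by blast
    have \<theta>0: "\<theta> 0 = 0" using nodes[of 0] t(1) u0 by simp
    have tc: "time_change \<theta>" by (rule time_changeI[OF sm cont \<theta>0 cl])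
    have "\<bar>step_path l (grid_values l x) (\<theta> s) - x s\<bar> < \<delta>" if s: "s \<in> {0..T}" for s
    proof -
      have "\<exists>i<n. t i \<le> s \<and> s < t (Suc i)"
      proof -
        have "s < t n" using s t(2) b(1) by simp
        then show ?thesis
        proof (induction n)
          case 0 then show ?case using t(1) s by simp
        next
          case (Suc n)
          then show ?case by (cases "s < t n") (auto simp: not_less intro: less_SucI)
        qed
      qed
      then obtain i where i: "i < n" "t i \<le> s" "s < t (Suc i)" by blast
      have ti: "t i \<ge> 0"
      proof -
        have "j \<le> n \<Longrightarrow> t j \<ge> 0" for j
        proof (induction j)
          case (Suc j) then show ?case using t(3)[of j] by simp
        qed (simp add: t)
        then show ?thesis using i by simp
      qed
      have "\<theta> (t i) \<le> \<theta> s" using sm i ti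
        by (meson atLeast_iff order_trans strict_mono_on_leD)
      then have 1: "u i \<le> \<theta> s" using nodes i by simp
      have "\<theta> s < \<theta> (t (Suc i))" using sm i ti
        by (meson atLeast_iff less_imp_le order_trans strict_mono_on_def)
      then have 2: "\<theta> s < u (Suc i)" using nodes[of "Suc i"] i by simp
      have \<theta>s: "0 \<le> \<theta> s" "\<theta> s \<le> real l"
        using 1 u1[of i] ti cl[of s] s elim(2,3) by auto
      \<comment> \<open>Floor and ceiling turn \<open>u i \<le> \<theta> s < u (Suc i)\<close> into
        \<open>t i \<le> dyadic_floor l (\<theta> s) < t (Suc i)\<close>: the grid point read by the
        step path lies in the piece of \<open>s\<close>.\<close>
      have "\<lceil>2 ^ l * t i\<rceil> \<le> \<lfloor>2 ^ l * \<theta> s\<rfloor>"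
        using 1 by (simp add: u_def pos_divide_le_eq le_floor_iff mult.commute)
      then have 3: "t i \<le> dyadic_floor l (\<theta> s)"
        unfolding dyadic_floor_def by (simp add: pos_le_divide_eq ceiling_le_iff mult.commute)
      have "\<lfloor>2 ^ l * \<theta> s\<rfloor> < \<lceil>2 ^ l * t (Suc i)\<rceil>"
        using 2 by (simp add: u_def pos_less_divide_eq floor_less_iff mult.commute)
      then have 4: "dyadic_floor l (\<theta> s) < t (Suc i)"
        unfolding dyadic_floor_def by (simp add: pos_divide_less_eq less_ceiling_iff mult.commute)
      show ?thesis
        unfolding step_path_grid_values[OF \<theta>s] using osc[OF i(1)] 3 4 i by simp
    qed
    moreover have "\<forall>s\<ge>0. \<bar>\<theta> s - s\<bar> < \<delta>" using cl elim(2) by (meson le_less_trans)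
    ultimately show ?case
      using tc step_path_skorokhod unfolding skorokhod_nbhd_def by blast
  qed
qed

lemma skorokhod_continuous_at:
  assumes "continuous_map skorokhod_topology euclideanreal f" "x \<in> skorokhod_space" "\<eta> > 0"
  shows "\<exists>T>0. \<exists>\<delta>>0. \<forall>y\<in>skorokhod_nbhd x T \<delta>. \<bar>f y - f x\<bar> < \<eta>"
proof -
  have "openin skorokhod_topology {y \<in> topspace skorokhod_topology. f y \<in> ball (f x) \<eta>}"
    by (rule openin_continuous_map_preimage[OF assms(1)]) simp
  moreover have "x \<in> {y \<in> topspace skorokhod_topology. f y \<in> ball (f x) \<eta>}"
    using assms by simp
  ultimately obtain T \<delta> where "T > 0" "\<delta> > 0"
    "skorokhod_nbhd x T \<delta> \<subseteq> {y \<in> topspace skorokhod_topology. f y \<in> ball (f x) \<eta>}"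
    unfolding openin_skorokhod_topology by blast
  then show ?thesis
    by (intro exI[of _ T] exI[of _ \<delta>] conjI) (auto simp: dist_real_def abs_minus_commute)
qed

lemma step_path_tendsto:
  assumes f: "continuous_map skorokhod_topology euclideanreal f" and x: "x \<in> skorokhod_space"
  shows "(\<lambda>l. f (step_path l (grid_values l x))) \<longlonglongrightarrow> f x"
proof (rule tendstoI)
  fix e :: real assume "e > 0"
  then obtain T \<delta> where "\<delta> > 0" and *: "\<And>y. y \<in> skorokhod_nbhd x T \<delta> \<Longrightarrow> \<bar>f y - f x\<bar> < e"
    using skorokhod_continuous_at[OF f x] by blast
  have "\<forall>\<^sub>F l in sequentially. step_path l (grid_values l x) \<in> skorokhod_nbhd x T \<delta>"
    using x \<open>\<delta> > 0\<close> by (intro step_path_in_skorokhod_nbhd) (auto simp: skorokhod_space_def)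
  then show "\<forall>\<^sub>F l in sequentially. dist (f (step_path l (grid_values l x))) (f x) < e"
    by eventually_elim (use * in \<open>simp add: dist_real_def\<close>)
qed

text \<open>Continuity with respect to locally uniform convergence, implied by Skorokhod continuity.
  \<open>T\<close> and \<open>\<delta>\<close> may depend on \<open>x\<close>. This is the
  regularity that the cut-off \<open>set_gap\<close> is shown to have, and it suffices at step paths
  and at continuous paths.\<close>

definition locally_uniformly_continuous :: "((real \<Rightarrow> real) \<Rightarrow> real) \<Rightarrow> bool" where
  "locally_uniformly_continuous f \<longleftrightarrow> (\<forall>x\<in>skorokhod_space. \<forall>\<eta>>0. \<exists>T. \<exists>\<delta>>0. \<forall>y\<in>skorokhod_space.
     (\<forall>t\<in>{0..T}. \<bar>y t - x t\<bar> < \<delta>) \<longrightarrow> \<bar>f y - f x\<bar> < \<eta>)"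

lemma skorokhod_continuous_imp_locally_uniformly_continuous:
  assumes "continuous_map skorokhod_topology euclideanreal f"
  shows "locally_uniformly_continuous f"
  unfolding locally_uniformly_continuous_def
proof (intro ballI allI impI)
  fix x and \<eta> :: real assume x: "x \<in> skorokhod_space" and "\<eta> > 0"
  then obtain T \<delta> where \<delta>: "\<delta> > 0" and *: "\<And>y. y \<in> skorokhod_nbhd x T \<delta> \<Longrightarrow> \<bar>f y - f x\<bar> < \<eta>"
    using skorokhod_continuous_at[OF assms] by blast
  \<comment> \<open>With the identity as time change, uniformly close paths are
    Skorokhod-close.\<close>
  have "time_change (\<lambda>s. s)"
    by (rule time_changeI[where \<delta>=0]) (auto simp: strict_mono_on_def intro: continuous_on_id)
  then have "y \<in> skorokhod_nbhd x T \<delta>"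
    if "y \<in> skorokhod_space" "\<forall>t\<in>{0..T}. \<bar>y t - x t\<bar> < \<delta>" for y
    using that \<delta> unfolding skorokhod_nbhd_def by (intro CollectI conjI exI[of _ "\<lambda>s. s"]) auto
  then show "\<exists>T. \<exists>\<delta>>0. \<forall>y\<in>skorokhod_space. (\<forall>t\<in>{0..T}. \<bar>y t - x t\<bar> < \<delta>) \<longrightarrow> \<bar>f y - f x\<bar> < \<eta>"
    using * \<delta> by blast
qed

text \<open>In the product topology on \<open>nat \<Rightarrow> real\<close>, closeness in the
  finitely many coordinates up to \<open>l * 2 ^ l\<close> makes the step paths uniformly
  close.\<close>

lemma continuous_step_path:
  assumes f: "locally_uniformly_continuous f"
  shows "continuous_on UNIV (\<lambda>v. f (step_path l v))"
  unfolding continuous_on_eq_continuous_at[OF open_UNIV]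
proof
  fix v :: "nat \<Rightarrow> real"
  show "isCont (\<lambda>v. f (step_path l v)) v"
    unfolding isCont_def
  proof (rule tendstoI)
    fix e :: real assume "e > 0"
    then obtain T \<delta> where \<delta>: "\<delta> > 0" and *: "\<And>y. y \<in> skorokhod_space \<Longrightarrow>
        (\<forall>t\<in>{0..T}. \<bar>y t - step_path l v t\<bar> < \<delta>) \<Longrightarrow> \<bar>f y - f (step_path l v)\<bar> < e"
      using f step_path_skorokhod[of l v] unfolding locally_uniformly_continuous_def by blast
    have "\<forall>\<^sub>F w in at v. \<forall>i\<in>{..l * 2 ^ l}. \<bar>w i - v i\<bar> < \<delta>"
    proof (intro eventually_ball_finite ballI)
      fix i
      have "isCont (\<lambda>w::nat \<Rightarrow> real. w i) v"
        by (metis UNIV_I continuous_on_eq_continuous_at continuous_on_product_coordinates open_UNIV)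
      then have "((\<lambda>w. w i) \<longlongrightarrow> v i) (at v)" by (simp add: isCont_def)
      from tendstoD[OF this \<delta>] show "\<forall>\<^sub>F w in at v. \<bar>w i - v i\<bar> < \<delta>"
        by (simp add: dist_real_def)
    qed simp
    then show "\<forall>\<^sub>F w in at v. dist (f (step_path l w)) (f (step_path l v)) < e"
    proof eventually_elim
      case (elim w)
      have "\<bar>step_path l w t - step_path l v t\<bar> < \<delta>" if "t \<in> {0..T}" for t
        using elim that by (auto simp: step_path_def)
      then show ?case using *[OF step_path_skorokhod] by (simp add: dist_real_def)
    qed
  qed
qed

lemma step_path_cong:
  "(\<And>i. i \<le> l * 2 ^ l \<Longrightarrow> v i = w i) \<Longrightarrow> step_path l v = step_path l w"
  by (auto simp: step_path_def fun_eq_iff restrict_def)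

text \<open>No sigma-algebra on the path space is involved: \<open>f\<close> of the path is a
  pointwise limit of \<open>f\<close> of its step paths, each of which is a continuous function of
  the grid values.\<close>

lemma borel_measurable_continuous_skorokhod:
  assumes f: "continuous_map skorokhod_topology euclideanreal f"
    and X: "\<And>t. t \<ge> 0 \<Longrightarrow> X t \<in> borel_measurable M"
    and path: "\<And>w. w \<in> space M \<Longrightarrow> cadlag (\<lambda>t. X t w)"
  shows "(\<lambda>w. f (restrict (\<lambda>t. X t w) {0..})) \<in> borel_measurable M"
proof (rule borel_measurable_LIMSEQ_real)
  fix w assume w: "w \<in> space M"
  have "restrict (\<lambda>t. X t w) {0..} \<in> skorokhod_space"
    using cadlag_restrict[OF path[OF w]] by (simp add: skorokhod_space_def)
  from step_path_tendsto[OF f this]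
  have "(\<lambda>l. f (step_path l (grid_values l (restrict (\<lambda>t. X t w) {0..})))) \<longlonglongrightarrow> f (restrict (\<lambda>t. X t w) {0..})" .
  moreover have "grid_values l (restrict (\<lambda>t. X t w) {0..}) = grid_values l (\<lambda>t. X t w)" for l
    by (simp add: grid_values_def fun_eq_iff)
  ultimately show "(\<lambda>l. f (step_path l (grid_values l (\<lambda>t. X t w)))) \<longlonglongrightarrow> f (restrict (\<lambda>t. X t w) {0..})"
    by simp
next
  fix l
  have 1: "(\<lambda>v. f (step_path l v)) \<in> borel_measurable borel"
    by (intro borel_measurable_continuous_onI continuous_step_path
        skorokhod_continuous_imp_locally_uniformly_continuous f)
  have 2: "(\<lambda>w. grid_values l (\<lambda>t. X t w)) \<in> borel_measurable M"
    unfolding grid_values_def by (intro measurable_coordinatewise_then_product X) simp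
  show "(\<lambda>w. f (step_path l (grid_values l (\<lambda>t. X t w)))) \<in> borel_measurable M"
    using measurable_compose[OF 2 1] .
qed

section \<open>Characteristic functions and convergence of random vectors\<close>

text \<open>Tilting by a weight and normalising. The lower bound 1 keeps the constant
  \<open>E\<close> away from 0, the upper bound makes the weight integrable.\<close>

lemma weighted_distr:
  fixes M :: "'w measure" and X W :: "'w \<Rightarrow> real"
  assumes "prob_space M" and X[measurable]: "X \<in> borel_measurable M"
    and W[measurable]: "W \<in> borel_measurable M" and W1: "\<And>w. w \<in> space M \<Longrightarrow> 1 \<le> W w"
    and WB: "\<And>w. w \<in> space M \<Longrightarrow> W w \<le> B"
  defines "E \<equiv> \<integral>w. W w \<partial>M"
  defines "\<mu> \<equiv> distr (density M (\<lambda>w. ennreal (W w / E))) borel X"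
  shows "E \<ge> 1" "real_distribution \<mu>"
    and "\<And>h :: real \<Rightarrow> 'b :: {banach, second_countable_topology}. h \<in> borel_measurable borel \<Longrightarrow>
      integral\<^sup>L \<mu> h = (1 / E) *\<^sub>R (\<integral>w. W w *\<^sub>R h (X w) \<partial>M)"
proof -
  interpret prob_space M by fact
  have Wint: "integrable M W"
    proof (rule integrable_const_bound[of _ B])
    show "AE w in M. norm (W w) \<le> B" using W1 WB by (intro AE_I2) (force simp: abs_le_iff)
  qed simp
  have "(\<integral>w. 1 \<partial>M) \<le> E" unfolding E_def
    by (rule integral_mono_AE) (use W1 Wint in \<open>auto intro!: AE_I2\<close>)
  then show E: "E \<ge> 1" by (simp add: prob_space)
  have "(\<integral>\<^sup>+ w. ennreal (W w / E) \<partial>M) = ennreal (\<integral>w. W w / E \<partial>M)"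
    by (rule nn_integral_eq_integral)
      (use Wint W1 E in \<open>auto intro!: AE_I2 divide_nonneg_nonneg intro: order_trans[OF zero_le_one]\<close>)
  also have "(\<integral>w. W w / E \<partial>M) = 1" using E by (simp add: E_def)
  finally have 1: "(\<integral>\<^sup>+ w. ennreal (W w / E) \<partial>M) = 1" by simp
  have "prob_space (density M (\<lambda>w. ennreal (W w / E)))"
    by (rule prob_spaceI) (simp add: emeasure_density 1 cong: nn_integral_cong)
  then have "prob_space \<mu>" unfolding \<mu>_def by (rule prob_space.prob_space_distr) simp
  then show "real_distribution \<mu>"
    by (simp add: real_distribution_def real_distribution_axioms_def \<mu>_def)
  fix h :: "real \<Rightarrow> 'b" assume h[measurable]: "h \<in> borel_measurable borel"
  have "integral\<^sup>L \<mu> h = (\<integral>w. h (X w) \<partial>density M (\<lambda>w. ennreal (W w / E)))"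
    unfolding \<mu>_def by (rule integral_distr) auto
  also have "\<dots> = (\<integral>w. (W w / E) *\<^sub>R h (X w) \<partial>M)"
    by (rule integral_density)
      (use W1 E in \<open>auto intro!: AE_I2 divide_nonneg_nonneg intro: order_trans[OF zero_le_one]\<close>)
  also have "\<dots> = (\<integral>w. (1 / E) *\<^sub>R (W w *\<^sub>R h (X w)) \<partial>M)" by simp
  also have "\<dots> = (1 / E) *\<^sub>R (\<integral>w. W w *\<^sub>R h (X w) \<partial>M)"
    by (rule integral_scaleR_right)
  finally show "integral\<^sup>L \<mu> h = (1 / E) *\<^sub>R (\<integral>w. W w *\<^sub>R h (X w) \<partial>M)" .
qed

text \<open>Levy's continuity theorem for the normalised tilted laws. The normalising constants
  converge as well, since they are the weighted characteristic functions at 0.\<close>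

lemma weighted_levy_continuity:
  fixes M :: "nat \<Rightarrow> 'w measure" and M' :: "'v measure"
  assumes P: "\<And>n. prob_space (M n)" "prob_space M'"
    and X: "\<And>n. X n \<in> borel_measurable (M n)" "X' \<in> borel_measurable M'"
    and W: "\<And>n. W n \<in> borel_measurable (M n)" "W' \<in> borel_measurable M'"
    and W1: "\<And>n w. w \<in> space (M n) \<Longrightarrow> 1 \<le> W n w" "\<And>w. w \<in> space M' \<Longrightarrow> 1 \<le> W' w"
    and WB: "\<And>n w. w \<in> space (M n) \<Longrightarrow> W n w \<le> (B::real)" "\<And>w. w \<in> space M' \<Longrightarrow> W' w \<le> B"
    and char: "\<And>\<theta>. (\<lambda>n. \<integral>w. W n w *\<^sub>R iexp (\<theta> * X n w) \<partial>M n)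
      \<longlonglongrightarrow> (\<integral>w. W' w *\<^sub>R iexp (\<theta> * X' w) \<partial>M')"
    and g: "\<And>x. isCont g x" "\<And>x. \<bar>g x\<bar> \<le> (B' :: real)"
  shows "(\<lambda>n. \<integral>w. W n w * g (X n w) \<partial>M n) \<longlonglongrightarrow> (\<integral>w. W' w * g (X' w) \<partial>M')"
proof -
  define E where "E n = (\<integral>w. W n w \<partial>M n)" for n
  define E' where "E' = (\<integral>w. W' w \<partial>M')"
  define \<mu> where "\<mu> n = distr (density (M n) (\<lambda>w. ennreal (W n w / E n))) borel (X n)" for n
  define \<mu>' where "\<mu>' = distr (density M' (\<lambda>w. ennreal (W' w / E'))) borel X'"
  have D1: "E n \<ge> 1" and D2: "real_distribution (\<mu> n)" for n
    unfolding E_def \<mu>_def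
    by (rule weighted_distr(1,2)[OF P(1) X(1) W(1) W1(1) WB(1)]; assumption)+
  have D3: "integral\<^sup>L (\<mu> n) h = (1 / E n) *\<^sub>R (\<integral>w. W n w *\<^sub>R h (X n w) \<partial>M n)"
    if "h \<in> borel_measurable borel" for h :: "real \<Rightarrow> 'b :: {banach, second_countable_topology}" and n
    unfolding E_def \<mu>_def
    by (rule weighted_distr(3)[OF P(1) X(1) W(1) W1(1) WB(1)]) (assumption | fact)+
  have D1': "E' \<ge> 1" and D2': "real_distribution \<mu>'"
    unfolding E'_def \<mu>'_def
    by (rule weighted_distr(1,2)[OF P(2) X(2) W(2) W1(2) WB(2)]; assumption)+
  have D3': "integral\<^sup>L \<mu>' h = (1 / E') *\<^sub>R (\<integral>w. W' w *\<^sub>R h (X' w) \<partial>M')"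
    if "h \<in> borel_measurable borel" for h :: "real \<Rightarrow> 'b :: {banach, second_countable_topology}"
    unfolding E'_def \<mu>'_def
    by (rule weighted_distr(3)[OF P(2) X(2) W(2) W1(2) WB(2)]) (assumption | fact)+
  have g_meas: "g \<in> borel_measurable borel"
    by (intro borel_measurable_continuous_onI continuous_at_imp_continuous_on) (use g in auto)
  have E: "E \<longlonglongrightarrow> E'"
    using char[of 0] by (simp add: E_def[abs_def] E'_def scaleR_conv_of_real tendsto_of_real_iff)
  have "weak_conv_m \<mu> \<mu>'"
  proof (rule levy_continuity)
    fix \<theta>
    have "(\<lambda>n. (1 / E n) *\<^sub>R (\<integral>w. W n w *\<^sub>R iexp (\<theta> * X n w) \<partial>M n))
      \<longlonglongrightarrow> (1 / E') *\<^sub>R (\<integral>w. W' w *\<^sub>R iexp (\<theta> * X' w) \<partial>M')"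
      using D1' by (intro tendsto_intros E char) auto
    then show "(\<lambda>n. char (\<mu> n) \<theta>) \<longlonglongrightarrow> char \<mu>' \<theta>"
      unfolding char_def using D3[of "\<lambda>x. iexp (\<theta> * x)"] D3'[of "\<lambda>x. iexp (\<theta> * x)"] by simp
  qed (use D2 D2' in auto)
  then have "(\<lambda>n. integral\<^sup>L (\<mu> n) g) \<longlonglongrightarrow> integral\<^sup>L \<mu>' g"
    using D2 D2' g by (intro weak_conv_imp_integral_bdd_continuous_conv) auto
  then have "(\<lambda>n. E n * integral\<^sup>L (\<mu> n) g) \<longlonglongrightarrow> E' * integral\<^sup>L \<mu>' g"
    by (intro tendsto_intros E)
  moreover have "E n * integral\<^sup>L (\<mu> n) g = (\<integral>w. W n w * g (X n w) \<partial>M n)" for n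
    using D1[of n] D3[OF g_meas, of n] by simp
  moreover have "E' * integral\<^sup>L \<mu>' g = (\<integral>w. W' w * g (X' w) \<partial>M')"
    using D1' D3'[OF g_meas] by simp
  ultimately show ?thesis by simp
qed

lemma (in prob_space) integrable_bounded_scaleR_iexp:
  fixes V Y :: "'a \<Rightarrow> real"
  assumes [measurable]: "V \<in> borel_measurable M" "Y \<in> borel_measurable M"
    and V: "\<And>w. w \<in> space M \<Longrightarrow> \<bar>V w\<bar> \<le> 1"
  shows "integrable M (\<lambda>w. V w *\<^sub>R iexp (Y w))"
proof (rule integrable_const_bound[of _ 1])
  show "AE w in M. norm (V w *\<^sub>R iexp (Y w)) \<le> 1" using V by (intro AE_I2) simp
qed measurable

text \<open>By Euler's formulas a factor \<open>cos (S w)\<close> or \<open>sin (S w)\<close> in the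
  weight only shifts the phase \<open>Y\<close> by \<open>S\<close> or \<open>- S\<close>, so these
  weighted characteristic functions reduce to ones with weight 1 or \<open>V\<close>.\<close>

lemma (in prob_space) trig_weight_identities:
  fixes V S Y :: "'a \<Rightarrow> real"
  assumes [measurable]: "V \<in> borel_measurable M" "S \<in> borel_measurable M" "Y \<in> borel_measurable M"
    and V: "\<And>w. w \<in> space M \<Longrightarrow> \<bar>V w\<bar> \<le> 1"
  shows "(\<integral>w. (1 + V w * (1 + cos (S w))) *\<^sub>R iexp (Y w) \<partial>M) =
      (\<integral>w. iexp (Y w) \<partial>M) + (\<integral>w. V w *\<^sub>R iexp (Y w) \<partial>M)
      + (1/2) * (\<integral>w. V w *\<^sub>R iexp (Y w + S w) \<partial>M) + (1/2) * (\<integral>w. V w *\<^sub>R iexp (Y w - S w) \<partial>M)"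
    and "(\<integral>w. (1 + V w * (1 + sin (S w))) *\<^sub>R iexp (Y w) \<partial>M) =
      (\<integral>w. iexp (Y w) \<partial>M) + (\<integral>w. V w *\<^sub>R iexp (Y w) \<partial>M)
      + (1/(2*\<i>)) * (\<integral>w. V w *\<^sub>R iexp (Y w + S w) \<partial>M) - (1/(2*\<i>)) * (\<integral>w. V w *\<^sub>R iexp (Y w - S w) \<partial>M)"
    and "(\<integral>w. (1 + V w) *\<^sub>R iexp (Y w) \<partial>M) = (\<integral>w. iexp (Y w) \<partial>M) + (\<integral>w. V w *\<^sub>R iexp (Y w) \<partial>M)"
proof -
  have i0: "integrable M (\<lambda>w. iexp (Y w))"
    using integrable_bounded_scaleR_iexp[of "\<lambda>_. 1" Y] by simp
  have i1: "integrable M (\<lambda>w. V w *\<^sub>R iexp (Y w))"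
    "integrable M (\<lambda>w. V w *\<^sub>R iexp (Y w + S w))" "integrable M (\<lambda>w. V w *\<^sub>R iexp (Y w - S w))"
    by (intro integrable_bounded_scaleR_iexp V; simp)+
  have c: "complex_of_real (cos s) = (iexp s + iexp (- s)) / 2" for s
    by (simp add: complex_eq_iff Re_exp Im_exp)
  have s: "complex_of_real (sin s) = (iexp s - iexp (- s)) / (2 * \<i>)" for s
    by (simp add: complex_eq_iff Re_exp Im_exp)
  have e: "iexp (y + s) = iexp y * iexp s" "iexp (y - s) = iexp y * iexp (- s)" for y s
    by (simp_all only: exp_add[symmetric] of_real_add of_real_diff of_real_minus distrib_left
        diff_conv_add_uminus)
  have "(1 + V w * (1 + cos (S w))) *\<^sub>R iexp (Y w) = iexp (Y w) + V w *\<^sub>R iexp (Y w)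
      + (1/2) * (V w *\<^sub>R iexp (Y w + S w)) + (1/2) * (V w *\<^sub>R iexp (Y w - S w))" for w
    unfolding e unfolding scaleR_conv_of_real of_real_add of_real_mult of_real_1 c by (simp add: algebra_simps)
  then show "(\<integral>w. (1 + V w * (1 + cos (S w))) *\<^sub>R iexp (Y w) \<partial>M) =
      (\<integral>w. iexp (Y w) \<partial>M) + (\<integral>w. V w *\<^sub>R iexp (Y w) \<partial>M)
      + (1/2) * (\<integral>w. V w *\<^sub>R iexp (Y w + S w) \<partial>M) + (1/2) * (\<integral>w. V w *\<^sub>R iexp (Y w - S w) \<partial>M)"
    using i0 i1 by (simp only: Bochner_Integration.integral_add Bochner_Integration.integrable_add
      integral_mult_right_zero integrable_mult_right)
  have "(1 + V w * (1 + sin (S w))) *\<^sub>R iexp (Y w) = iexp (Y w) + V w *\<^sub>R iexp (Y w)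
      + (1/(2*\<i>)) * (V w *\<^sub>R iexp (Y w + S w)) - (1/(2*\<i>)) * (V w *\<^sub>R iexp (Y w - S w))" for w
    unfolding e unfolding scaleR_conv_of_real of_real_add of_real_mult of_real_1 s by (simp add: algebra_simps diff_divide_distrib)
  then show "(\<integral>w. (1 + V w * (1 + sin (S w))) *\<^sub>R iexp (Y w) \<partial>M) =
      (\<integral>w. iexp (Y w) \<partial>M) + (\<integral>w. V w *\<^sub>R iexp (Y w) \<partial>M)
      + (1/(2*\<i>)) * (\<integral>w. V w *\<^sub>R iexp (Y w + S w) \<partial>M) - (1/(2*\<i>)) * (\<integral>w. V w *\<^sub>R iexp (Y w - S w) \<partial>M)"
    using i0 i1 by (simp only: Bochner_Integration.integral_add Bochner_Integration.integrable_add
      Bochner_Integration.integral_diff integral_mult_right_zero integrable_mult_right)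
  have "(1 + V w) *\<^sub>R iexp (Y w) = iexp (Y w) + V w *\<^sub>R iexp (Y w)" for w
    by (simp add: scaleR_add_left)
  then show "(\<integral>w. (1 + V w) *\<^sub>R iexp (Y w) \<partial>M) = (\<integral>w. iexp (Y w) \<partial>M) + (\<integral>w. V w *\<^sub>R iexp (Y w) \<partial>M)"
    using i0 i1 by (simp only: Bochner_Integration.integral_add)
qed

text \<open>The way back: real and imaginary part of a complex expectation are differences of
  expectations against weights that are at least 1 as soon as \<open>V\<close> is
  nonnegative.\<close>

lemma (in prob_space) weight_recombine:
  fixes V S h :: "'a \<Rightarrow> real"
  assumes [measurable]: "V \<in> borel_measurable M" "S \<in> borel_measurable M" "h \<in> borel_measurable M"
    and V: "\<And>w. w \<in> space M \<Longrightarrow> \<bar>V w\<bar> \<le> 1" and h: "\<And>w. w \<in> space M \<Longrightarrow> \<bar>h w\<bar> \<le> 1"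
  shows "(\<integral>w. (V w * h w) *\<^sub>R iexp (S w) \<partial>M) =
    of_real ((\<integral>w. (1 + V w * (1 + cos (S w))) * h w \<partial>M) - (\<integral>w. (1 + V w) * h w \<partial>M)) +
    \<i> * of_real ((\<integral>w. (1 + V w * (1 + sin (S w))) * h w \<partial>M) - (\<integral>w. (1 + V w) * h w \<partial>M))"
proof -
  have Vh: "\<bar>V w * h w\<bar> \<le> 1" if "w \<in> space M" for w
    using V[OF that] h[OF that] by (simp add: abs_mult mult_le_one)
  have Vhb: "\<bar>V w * h w * c\<bar> \<le> 1" if "w \<in> space M" "\<bar>c\<bar> \<le> 1" for w c
    using mult_le_one[OF Vh[OF that(1)] _ that(2)] by (simp only: abs_mult abs_ge_zero)
  have i: "integrable M h" "integrable M (\<lambda>w. V w * h w)"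
    "integrable M (\<lambda>w. V w * h w * cos (S w))" "integrable M (\<lambda>w. V w * h w * sin (S w))"
    by (rule integrable_const_bound[of _ 1], intro AE_I2, simp only: real_norm_def,
        (rule Vhb Vh h; simp)?, measurable)+
  have c: "(\<integral>w. (1 + V w * (1 + cos (S w))) * h w \<partial>M) - (\<integral>w. (1 + V w) * h w \<partial>M)
     = (\<integral>w. V w * h w * cos (S w) \<partial>M)"
    using i by (subst Bochner_Integration.integral_diff[symmetric]) (auto simp: algebra_simps)
  have s: "(\<integral>w. (1 + V w * (1 + sin (S w))) * h w \<partial>M) - (\<integral>w. (1 + V w) * h w \<partial>M)
     = (\<integral>w. V w * h w * sin (S w) \<partial>M)"
    using i by (subst Bochner_Integration.integral_diff[symmetric]) (auto simp: algebra_simps)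
  have "(V w * h w) *\<^sub>R iexp (S w) = of_real (V w * h w * cos (S w)) + \<i> * of_real (V w * h w * sin (S w))" for w
    by (simp add: complex_eq_iff Re_exp Im_exp)
  then have "(\<integral>w. (V w * h w) *\<^sub>R iexp (S w) \<partial>M) =
      (\<integral>w. of_real (V w * h w * cos (S w)) \<partial>M) + (\<integral>w. \<i> * of_real (V w * h w * sin (S w)) \<partial>M)"
    using i by (simp only:) (intro Bochner_Integration.integral_add integrable_mult_right integrable_of_real)
  then show ?thesis unfolding c s by (simp only: integral_mult_right_zero integral_complex_of_real)
qed

text \<open>Induction on the number \<open>m\<close> of coordinates in which an exponential has been
  traded for a test function. To trade one more, the earlier factors form \<open>V\<close>, the
  phase of the later coordinates forms \<open>S\<close>, and Levy's theorem is applied to coordinate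
  \<open>m\<close> alone under the weights \<open>1 + V * (1 + cos S)\<close>,
  \<open>1 + V * (1 + sin S)\<close> and \<open>1 + V\<close>.\<close>

lemma char_convergence_prod:
  fixes M :: "nat \<Rightarrow> 'w measure" and M' :: "'v measure"
    and X :: "nat \<Rightarrow> nat \<Rightarrow> 'w \<Rightarrow> real" and X' :: "nat \<Rightarrow> 'v \<Rightarrow> real"
  assumes P: "\<And>n. prob_space (M n)" "prob_space M'"
    and X[measurable]: "\<And>n j. X n j \<in> borel_measurable (M n)" "\<And>j. X' j \<in> borel_measurable M'"
    and char: "\<And>\<theta>. (\<lambda>n. \<integral>w. iexp (\<Sum>j<k. \<theta> j * X n j w) \<partial>M n)
      \<longlonglongrightarrow> (\<integral>w. iexp (\<Sum>j<k. \<theta> j * X' j w) \<partial>M')"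
    and "m \<le> k" and g: "\<And>j x. isCont (g j) x" "\<And>j x. 0 \<le> g j x" "\<And>j x. g j x \<le> (1::real)"
  shows "(\<lambda>n. \<integral>w. (\<Prod>j<m. g j (X n j w)) *\<^sub>R iexp (\<Sum>j\<in>{m..<k}. \<theta> j * X n j w) \<partial>M n)
      \<longlonglongrightarrow> (\<integral>w. (\<Prod>j<m. g j (X' j w)) *\<^sub>R iexp (\<Sum>j\<in>{m..<k}. \<theta> j * X' j w) \<partial>M')"
  using \<open>m \<le> k\<close> g
proof (induction m arbitrary: \<theta> g)
  case 0
  then show ?case using char[where \<theta>=\<theta>] by (simp add: lessThan_atLeast0)
next
  case (Suc m)
  note gc = Suc.prems(2) and g0 = Suc.prems(3) and g1 = Suc.prems(4)
  have [measurable]: "g j \<in> borel_measurable borel" for j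
    by (intro borel_measurable_continuous_onI continuous_at_imp_continuous_on) (use gc in auto)
  define V where "V n w = (\<Prod>j<m. g j (X n j w))" for n w
  define V' where "V' w = (\<Prod>j<m. g j (X' j w))" for w
  define S where "S n w = (\<Sum>j\<in>{Suc m..<k}. \<theta> j * X n j w)" for n w
  define S' where "S' w = (\<Sum>j\<in>{Suc m..<k}. \<theta> j * X' j w)" for w
  have [measurable]: "V n \<in> borel_measurable (M n)" "S n \<in> borel_measurable (M n)" for n
    unfolding V_def[abs_def] S_def[abs_def] by measurable
  have [measurable]: "V' \<in> borel_measurable M'" "S' \<in> borel_measurable M'"
    unfolding V'_def[abs_def] S'_def[abs_def] by measurable
  have V: "0 \<le> V n w" "V n w \<le> 1" "0 \<le> V' w'" "V' w' \<le> 1" for n w w'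
    unfolding V_def V'_def by (auto intro!: prod_nonneg prod_le_1 g0 g1)
  have Vabs: "\<bar>V n w\<bar> \<le> 1" "\<bar>V' w'\<bar> \<le> 1"  for n w w' using V by (simp_all add: abs_of_nonneg)
  have split: "{m..<k} = insert m {Suc m..<k}" using Suc.prems(1) by auto
  \<comment> \<open>Frequency \<open>x\<close> for coordinate \<open>m\<close> and a common multiple
    \<open>y\<close> of the remaining frequencies. Below, \<open>y\<close> is 0, 1 or -1, which
    matches the phases produced by the trigonometric weights.\<close>
  have IH: "(\<lambda>n. \<integral>w. (\<Prod>j<m. f j (X n j w)) *\<^sub>R iexp (x * X n m w + y * S n w) \<partial>M n)
      \<longlonglongrightarrow> (\<integral>w. (\<Prod>j<m. f j (X' j w)) *\<^sub>R iexp (x * X' m w + y * S' w) \<partial>M')"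
    if f: "\<And>j x. isCont (f j) x" "\<And>j x. 0 \<le> f j x" "\<And>j x. f j x \<le> (1::real)" for x y f
  proof -
    have 1: "(\<Sum>j\<in>{m..<k}. (if j = m then x else y * \<theta> j) * z j)
      = x * z m + y * (\<Sum>j\<in>{Suc m..<k}. \<theta> j * z j)" for z :: "nat \<Rightarrow> real"
    proof -
      have "(\<Sum>j\<in>{Suc m..<k}. (if j = m then x else y * \<theta> j) * z j) = (\<Sum>j\<in>{Suc m..<k}. y * (\<theta> j * z j))"
        by (intro sum.cong) auto
      then show ?thesis unfolding split by (simp add: sum_distrib_left)
    qed
    from Suc.IH[where g=f and \<theta>="\<lambda>j. if j = m then x else y * \<theta> j"] Suc.prems(1) f
    show ?thesis unfolding 1 S_def S'_def by simp
  qed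
  have IHV: "(\<lambda>n. \<integral>w. V n w *\<^sub>R iexp (x * X n m w + y * S n w) \<partial>M n)
      \<longlonglongrightarrow> (\<integral>w. V' w *\<^sub>R iexp (x * X' m w + y * S' w) \<partial>M')" for x y
    unfolding V_def V'_def by (rule IH) (use gc g0 g1 in auto)
  have C0: "(\<lambda>n. \<integral>w. V n w *\<^sub>R iexp (x * X n m w) \<partial>M n) \<longlonglongrightarrow> (\<integral>w. V' w *\<^sub>R iexp (x * X' m w) \<partial>M')"
    and C1: "(\<lambda>n. \<integral>w. V n w *\<^sub>R iexp (x * X n m w + S n w) \<partial>M n)
        \<longlonglongrightarrow> (\<integral>w. V' w *\<^sub>R iexp (x * X' m w + S' w) \<partial>M')"
    and C2: "(\<lambda>n. \<integral>w. V n w *\<^sub>R iexp (x * X n m w - S n w) \<partial>M n)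
        \<longlonglongrightarrow> (\<integral>w. V' w *\<^sub>R iexp (x * X' m w - S' w) \<partial>M')"
    and C3: "(\<lambda>n. \<integral>w. iexp (x * X n m w) \<partial>M n) \<longlonglongrightarrow> (\<integral>w. iexp (x * X' m w) \<partial>M')" for x
    using IHV[where x=x and y=0] IHV[where x=x and y=1] IHV[where x=x and y="-1"]
    IH[where f="\<lambda>_ _. 1" and x=x and y=0] by simp_all
  have bd: "\<bar>g m x\<bar> \<le> 1" for x using g0[of m x] g1[of m x] by simp
  have cs: "1 \<le> 1 + v * (1 + cos s)" "1 + v * (1 + cos s) \<le> 3" "1 \<le> 1 + v * (1 + sin s)"
    "1 + v * (1 + sin s) \<le> 3" "1 \<le> 1 + v" "1 + v \<le> 3" if "0 \<le> v" "v \<le> 1" for v s :: real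
  proof -
    have 1: "0 \<le> 1 + cos s" "1 + cos s \<le> 2" "0 \<le> 1 + sin s" "1 + sin s \<le> 2"
      using cos_ge_minus_one[of s] cos_le_one[of s] sin_ge_minus_one[of s] sin_le_one[of s] by linarith+
    then show "1 \<le> 1 + v * (1 + cos s)" "1 + v * (1 + cos s) \<le> 3" "1 \<le> 1 + v * (1 + sin s)"
      "1 + v * (1 + sin s) \<le> 3" "1 \<le> 1 + v" "1 + v \<le> 3"
      using that mult_mono[OF that(2) 1(2)] mult_mono[OF that(2) 1(4)] by auto
  qed
  have W1: "(\<lambda>n. \<integral>w. (1 + V n w * (1 + cos (S n w))) * g m (X n m w) \<partial>M n)
    \<longlonglongrightarrow> (\<integral>w. (1 + V' w * (1 + cos (S' w))) * g m (X' m w) \<partial>M')"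
  proof (rule weighted_levy_continuity[where B=3 and B'=1 and g="g m" and X="\<lambda>n. X n m" and X'="X' m"
      and W="\<lambda>n w. 1 + V n w * (1 + cos (S n w))" and W'="\<lambda>w. 1 + V' w * (1 + cos (S' w))"])
    fix x
    show "(\<lambda>n. \<integral>w. (1 + V n w * (1 + cos (S n w))) *\<^sub>R iexp (x * X n m w) \<partial>M n)
       \<longlonglongrightarrow> (\<integral>w. (1 + V' w * (1 + cos (S' w))) *\<^sub>R iexp (x * X' m w) \<partial>M')"
      by (subst prob_space.trig_weight_identities(1)[OF P(1)], measurable, rule Vabs,
          subst prob_space.trig_weight_identities(1)[OF P(2)], measurable, rule Vabs,
          intro tendsto_intros C0 C1 C2 C3)
  qed (use P gc bd cs V in \<open>auto\<close>)
  have W2: "(\<lambda>n. \<integral>w. (1 + V n w * (1 + sin (S n w))) * g m (X n m w) \<partial>M n)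
    \<longlonglongrightarrow> (\<integral>w. (1 + V' w * (1 + sin (S' w))) * g m (X' m w) \<partial>M')"
  proof (rule weighted_levy_continuity[where B=3 and B'=1 and g="g m" and X="\<lambda>n. X n m" and X'="X' m"
      and W="\<lambda>n w. 1 + V n w * (1 + sin (S n w))" and W'="\<lambda>w. 1 + V' w * (1 + sin (S' w))"])
    fix x
    show "(\<lambda>n. \<integral>w. (1 + V n w * (1 + sin (S n w))) *\<^sub>R iexp (x * X n m w) \<partial>M n)
       \<longlonglongrightarrow> (\<integral>w. (1 + V' w * (1 + sin (S' w))) *\<^sub>R iexp (x * X' m w) \<partial>M')"
      by (subst prob_space.trig_weight_identities(2)[OF P(1)], measurable, rule Vabs,
          subst prob_space.trig_weight_identities(2)[OF P(2)], measurable, rule Vabs,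
          intro tendsto_intros C0 C1 C2 C3)
  qed (use P gc bd cs V in \<open>auto\<close>)
  have W3: "(\<lambda>n. \<integral>w. (1 + V n w) * g m (X n m w) \<partial>M n) \<longlonglongrightarrow> (\<integral>w. (1 + V' w) * g m (X' m w) \<partial>M')"
  proof (rule weighted_levy_continuity[where B=3 and B'=1 and g="g m" and X="\<lambda>n. X n m" and X'="X' m"
      and W="\<lambda>n w. 1 + V n w" and W'="\<lambda>w. 1 + V' w"])
    fix x
    show "(\<lambda>n. \<integral>w. (1 + V n w) *\<^sub>R iexp (x * X n m w) \<partial>M n)
       \<longlonglongrightarrow> (\<integral>w. (1 + V' w) *\<^sub>R iexp (x * X' m w) \<partial>M')"
      by (subst prob_space.trig_weight_identities(3)[OF P(1), where S="\<lambda>_. 0"], measurable, rule Vabs,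
          subst prob_space.trig_weight_identities(3)[OF P(2), where S="\<lambda>_. 0"], measurable, rule Vabs,
          intro tendsto_intros C0 C3)
  qed (use P gc bd V in \<open>auto intro: order_trans[OF V(2)] order_trans[OF V(4)]\<close>)
  have prod: "(\<Prod>j<Suc m. g j (X n j w)) = V n w * g m (X n m w)" 
    "(\<Prod>j<Suc m. g j (X' j w')) = V' w' * g m (X' m w')" for n w w'
    by (simp_all add: V_def V'_def)
  show ?case
    unfolding prod S_def[symmetric] S'_def[symmetric]
    by (subst prob_space.weight_recombine[OF P(1)], measurable, rule Vabs, rule bd,
        subst prob_space.weight_recombine[OF P(2)], measurable, rule Vabs, rule bd,
        intro tendsto_intros W1 W2 W3)
qed

section \<open>Partition of unity by tents and Levy's theorem for vectors\<close>

definition tent :: "real \<Rightarrow> real" where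
  "tent x = max 0 (1 - \<bar>x\<bar>)"

lemma tent_nonneg: "0 \<le> tent x" and tent_le_1: "tent x \<le> 1"
  by (auto simp: tent_def)

lemma isCont_tent: "isCont (\<lambda>x. tent (a * x - b)) x"
  unfolding tent_def by (intro continuous_intros)

lemma tent_eq_0: "\<bar>x\<bar> \<ge> 1 \<Longrightarrow> tent x = 0"
  by (simp add: tent_def)

lemma sum_tent_pair: "tent (x - real_of_int \<lfloor>x\<rfloor>) + tent (x - real_of_int (\<lfloor>x\<rfloor> + 1)) = 1"
proof -
  have "0 \<le> x - real_of_int \<lfloor>x\<rfloor>" "x - real_of_int \<lfloor>x\<rfloor> < 1" by linarith+
  then show ?thesis by (simp add: tent_def)
qed

lemma sum_tent_eq: 
  assumes "finite F"
  shows "(\<Sum>v\<in>F. tent (x - real_of_int v)) = (\<Sum>v\<in>F \<inter> {\<lfloor>x\<rfloor>, \<lfloor>x\<rfloor> + 1}. tent (x - real_of_int v))"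
proof (rule sum.mono_neutral_right)
  show "\<forall>v\<in>F - F \<inter> {\<lfloor>x\<rfloor>, \<lfloor>x\<rfloor> + 1}. tent (x - real_of_int v) = 0"
  proof
    fix v assume "v \<in> F - F \<inter> {\<lfloor>x\<rfloor>, \<lfloor>x\<rfloor> + 1}"
    then have "v < \<lfloor>x\<rfloor> \<or> v > \<lfloor>x\<rfloor> + 1" by auto
    then have "\<bar>x - real_of_int v\<bar> \<ge> 1" by linarith
    then show "tent (x - real_of_int v) = 0" by (rule tent_eq_0)
  qed
qed (use assms in auto)

lemma sum_tent_le_1:
  assumes "finite F"
  shows "(\<Sum>v\<in>F. tent (x - real_of_int v)) \<le> 1"
proof -
  have "(\<Sum>v\<in>F. tent (x - real_of_int v)) \<le> (\<Sum>v\<in>{\<lfloor>x\<rfloor>, \<lfloor>x\<rfloor> + 1}. tent (x - real_of_int v))"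
    unfolding sum_tent_eq[OF assms] by (intro sum_mono2) (auto simp: tent_nonneg)
  also have "\<dots> = 1" using sum_tent_pair[of x] by simp
  finally show ?thesis .
qed

lemma sum_tent_eq_1:
  assumes "\<bar>x\<bar> < real N"
  shows "(\<Sum>v\<in>{- int N..int N}. tent (x - real_of_int v)) = 1"
proof -
  have "- int N \<le> \<lfloor>x\<rfloor>" "\<lfloor>x\<rfloor> + 1 \<le> int N" using assms by linarith+
  then have "{- int N..int N} \<inter> {\<lfloor>x\<rfloor>, \<lfloor>x\<rfloor> + 1} = {\<lfloor>x\<rfloor>, \<lfloor>x\<rfloor> + 1}" by auto
  then show ?thesis using sum_tent_pair[of x] by (subst sum_tent_eq) auto
qed

lemma LIMSEQ_coordinatewise:
  fixes f :: "nat \<Rightarrow> nat \<Rightarrow> real"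
  assumes "\<And>i. (\<lambda>n. f n i) \<longlonglongrightarrow> l i"
  shows "f \<longlonglongrightarrow> l"
proof -
  have "limitin (product_topology (\<lambda>_. euclidean) UNIV) f l sequentially"
    unfolding limitin_componentwise using assms by simp
  then show ?thesis by (simp add: euclidean_product_topology)
qed

text \<open>The sequential proof of the Heine-Cantor theorem. Since \<open>g\<close> sees only the
  first \<open>k\<close> coordinates, the others may be set to 0, which puts the sequence into a
  compact product.\<close>

lemma uniformly_continuous_on_box:
  fixes g :: "(nat \<Rightarrow> real) \<Rightarrow> real"
  assumes g: "continuous_on UNIV g" and dep: "\<And>v w. (\<And>j. j < k \<Longrightarrow> v j = w j) \<Longrightarrow> g v = g w" and "\<eta> > 0"
  shows "\<exists>q::nat. q > 0 \<and> (\<forall>x y. (\<forall>j<k. \<bar>x j\<bar> \<le> R \<and> \<bar>x j - y j\<bar> < 1 / real q) \<longrightarrow> \<bar>g x - g y\<bar> \<le> \<eta>)"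
proof (rule ccontr)
  assume neg: "\<not> ?thesis"
  have "\<exists>x y. (\<forall>j<k. \<bar>x j\<bar> \<le> R \<and> \<bar>x j - y j\<bar> < 1 / real (Suc q)) \<and> \<not> \<bar>g x - g y\<bar> \<le> \<eta>" for q
    using neg by (metis zero_less_Suc)
  then obtain x y where xy: "\<And>q j. j < k \<Longrightarrow> \<bar>x q j\<bar> \<le> R"
    "\<And>q j. j < k \<Longrightarrow> \<bar>x q j - y q j\<bar> < 1 / real (Suc q)" "\<And>q. \<not> \<bar>g (x q) - g (y q)\<bar> \<le> \<eta>"
    by metis
  \<comment> \<open>Compact as a product of compact sets: intervals in the first \<open>k\<close>
    coordinates, the singleton 0 in all others.\<close>
  define K where "K = PiE UNIV (\<lambda>j::nat. if j < k then {-R..R} else {0::real})"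
  have "compactin (product_topology (\<lambda>_. euclidean) UNIV) K"
    unfolding K_def compactin_PiE by auto
  then have "compact K" by (simp add: euclidean_product_topology)
  then have sc: "seq_compact K" by (simp add: compact_eq_seq_compact_metric)
  define x' where "x' q = (\<lambda>j. if j < k then x q j else 0)" for q
  define y' where "y' q = (\<lambda>j. if j < k then y q j else 0)" for q
  have "\<forall>q. x' q \<in> K" using xy(1) by (auto simp: K_def x'_def abs_le_iff minus_le_iff)
  then obtain l r where l: "l \<in> K" "strict_mono r" "(x' \<circ> r) \<longlonglongrightarrow> l"
    using sc unfolding seq_compact_def by blast
  have y'_l: "(y' \<circ> r) \<longlonglongrightarrow> l"
  proof (rule LIMSEQ_coordinatewise)
    fix j
    have cx: "(\<lambda>n. (x' \<circ> r) n j) \<longlonglongrightarrow> l j"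
      by (rule isCont_tendsto_compose[OF _ l(3)])
        (metis UNIV_I continuous_on_eq_continuous_at continuous_on_product_coordinates open_UNIV)
    have "(\<lambda>n. (y' \<circ> r) n j - (x' \<circ> r) n j) \<longlonglongrightarrow> 0"
    proof (rule Lim_null_comparison)
      show "\<forall>\<^sub>F n in sequentially. norm ((y' \<circ> r) n j - (x' \<circ> r) n j) \<le> inverse (real (Suc (r n)))"
        using xy(2)[of j "r _"] by (intro always_eventually allI)
          (auto simp: x'_def y'_def abs_minus_commute inverse_eq_divide intro: less_imp_le)
      show "(\<lambda>n. inverse (real (Suc (r n)))) \<longlonglongrightarrow> 0"
        using LIMSEQ_subseq_LIMSEQ[OF LIMSEQ_inverse_real_of_nat l(2)] by (simp add: o_def)
    qed
    from tendsto_add[OF this cx] show "(\<lambda>n. (y' \<circ> r) n j) \<longlonglongrightarrow> l j" by simp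
  qed
  have gl: "isCont g l" using g by (simp add: continuous_on_eq_continuous_at)
  have "(\<lambda>n. g ((x' \<circ> r) n) - g ((y' \<circ> r) n)) \<longlonglongrightarrow> g l - g l"
    by (rule tendsto_diff[OF isCont_tendsto_compose[OF gl l(3)] isCont_tendsto_compose[OF gl y'_l]])
  then have lim0: "(\<lambda>n. g ((x' \<circ> r) n) - g ((y' \<circ> r) n)) \<longlonglongrightarrow> 0" by simp
  have "\<forall>\<^sub>F n in sequentially. \<bar>g ((x' \<circ> r) n) - g ((y' \<circ> r) n)\<bar> < \<eta>"
    using tendstoD[OF lim0 \<open>\<eta> > 0\<close>] by (simp add: dist_real_def)
  then obtain n where n: "\<bar>g (x' (r n)) - g (y' (r n))\<bar> < \<eta>"
    by (auto simp: eventually_sequentially)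
  have "g (x' (r n)) = g (x (r n))" "g (y' (r n)) = g (y (r n))"
    by (auto intro!: dep simp: x'_def y'_def)
  then show False using n xy(3)[of "r n"] by simp
qed

lemma integrable_bounded_prob:
  fixes f :: "'c \<Rightarrow> real"
  assumes "prob_space N" "f \<in> borel_measurable N" "\<And>w. w \<in> space N \<Longrightarrow> \<bar>f w\<bar> \<le> c"
  shows "integrable N f"
proof -
  interpret prob_space N by fact
  show ?thesis by (rule integrable_const_bound[of _ c]) (use assms in auto)
qed

text \<open>On a large box \<open>g\<close> is uniformly close to a finite combination of products
  of tents, to which \<open>char_convergence_prod\<close> applies. Tightness of the sequence is
  derived rather than assumed: the plateau function \<open>plat\<close> is itself such a product,
  and its means carry the concentration of the limit over to the sequence.\<close>

lemma levy_continuity_finite_dim: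
  fixes M :: "nat \<Rightarrow> 'w measure" and M' :: "'v measure"
    and X :: "nat \<Rightarrow> nat \<Rightarrow> 'w \<Rightarrow> real" and X' :: "nat \<Rightarrow> 'v \<Rightarrow> real"
  assumes P: "\<And>n. prob_space (M n)" "prob_space M'"
    and X[measurable]: "\<And>n j. X n j \<in> borel_measurable (M n)" "\<And>j. X' j \<in> borel_measurable M'"
    and char: "\<And>\<theta>. (\<lambda>n. \<integral>w. iexp (\<Sum>j<k. \<theta> j * X n j w) \<partial>M n)
      \<longlonglongrightarrow> (\<integral>w. iexp (\<Sum>j<k. \<theta> j * X' j w) \<partial>M')"
    and g: "continuous_on UNIV g" and dep: "\<And>v w. (\<And>j. j < k \<Longrightarrow> v j = w j) \<Longrightarrow> g v = g w"
    and bd: "\<And>v. \<bar>g v\<bar> \<le> (B::real)"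
  shows "(\<lambda>n. \<integral>w. g (\<lambda>j. X n j w) \<partial>M n) \<longlonglongrightarrow> (\<integral>w. g (\<lambda>j. X' j w) \<partial>M')"
proof -
  have B: "B \<ge> 0" using bd[of "\<lambda>_. 0"] by simp
  have g_meas[measurable]: "g \<in> borel_measurable borel" using g by (rule borel_measurable_continuous_onI)
  have gX[measurable]: "(\<lambda>w. g (\<lambda>j. Y j w)) \<in> borel_measurable N"
    if "\<And>j. Y j \<in> borel_measurable N" for Y :: "nat \<Rightarrow> 'c \<Rightarrow> real" and N
    by (rule measurable_compose[OF measurable_coordinatewise_then_product g_meas]) (use that in auto)
  \<comment> \<open>All \<open>k\<close> coordinates are traded, so the remaining exponential is
    taken over an empty range.\<close>
  have P1: "(\<lambda>n. \<integral>w. (\<Prod>j<k. f j (X n j w)) \<partial>M n) \<longlonglongrightarrow> (\<integral>w. (\<Prod>j<k. f j (X' j w)) \<partial>M')"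
    if "\<And>j x. isCont (f j) x" "\<And>j x. 0 \<le> f j x" "\<And>j x. f j x \<le> (1::real)" for f
  proof -
    have "(\<lambda>n. \<integral>w. (\<Prod>j<k. f j (X n j w)) *\<^sub>R iexp (\<Sum>j\<in>{k..<k}. 0 * X n j w) \<partial>M n)
      \<longlonglongrightarrow> (\<integral>w. (\<Prod>j<k. f j (X' j w)) *\<^sub>R iexp (\<Sum>j\<in>{k..<k}. 0 * X' j w) \<partial>M')"
      by (rule char_convergence_prod[OF P X char order_refl that])
    then show ?thesis by (simp add: scaleR_conv_of_real tendsto_of_real_iff del: of_real_prod)
  qed
  show ?thesis
  proof (rule LIMSEQ_I)
    fix e :: real assume "e > 0"
    \<comment> \<open>The errors collected at the end add up to
      \<open>(3 * B + 3) * \<eta>\<close>.\<close>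
    define \<eta> where "\<eta> = e / (3 * B + 3)"
    have \<eta>: "\<eta> > 0" using \<open>e > 0\<close> B by (simp add: \<eta>_def)
    interpret M': prob_space M' by (rule P)
    \<comment> \<open>These events decrease to the empty set, so some box captures the limit vector
      up to probability \<open>\<eta>\<close>.\<close>
    define bad where "bad R = (\<Union>j<k. {w \<in> space M'. \<bar>X' j w\<bar> \<ge> real R})" for R :: nat
    have bad_sets[measurable]: "bad R \<in> sets M'" for R unfolding bad_def by measurable
    have "(\<lambda>R. measure M' (bad R)) \<longlonglongrightarrow> measure M' (\<Inter>R. bad R)"
    proof (rule M'.finite_Lim_measure_decseq)
      show "decseq bad" unfolding bad_def decseq_def by (auto intro: order_trans[rotated])
    qed auto
    moreover have "(\<Inter>R. bad R) = {}"
    proof (rule equals0I)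
      fix w assume w: "w \<in> (\<Inter>R. bad R)"
      define R where "R = nat \<lceil>\<Sum>j<k. \<bar>X' j w\<bar>\<rceil> + 1"
      from w have "w \<in> bad R" by auto
      then obtain j where j: "j < k" "\<bar>X' j w\<bar> \<ge> real R" by (auto simp: bad_def)
      have "\<bar>X' j w\<bar> \<le> (\<Sum>j<k. \<bar>X' j w\<bar>)" using j by (intro member_le_sum) auto
      also have "\<dots> < real R" unfolding R_def by linarith
      finally show False using j by simp
    qed
    ultimately have "(\<lambda>R. measure M' (bad R)) \<longlonglongrightarrow> 0" by simp
    then obtain R where R: "measure M' (bad R) < \<eta>"
      using order_tendstoD(2)[of _ 0 sequentially \<eta>] \<eta> by (auto simp: eventually_sequentially)
    obtain q :: nat where q: "q > 0" and uc: "\<And>x y. (\<And>j. j < k \<Longrightarrow> \<bar>x j\<bar> \<le> real R + 1 \<and> \<bar>x j - y j\<bar> < 1 / real q) \<Longrightarrow> \<bar>g x - g y\<bar> \<le> \<eta>"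
      using uniformly_continuous_on_box[OF g dep \<eta>, of k "real R + 1"] by blast
    define N where "N = R * q"
    define I where "I = {- int N..int N}"
    define tt where "tt v x = tent (real q * x - real_of_int v)" for v x
    define cc where "cc x = (\<Sum>v\<in>I. tt v x)" for x
    define plat where "plat x = (\<Prod>j<k. cc (x j))" for x :: "nat \<Rightarrow> real"
    define V where "V = PiE {..<k} (\<lambda>_. I)"
    define pt where "pt v = (\<lambda>j. real_of_int (v j) / real q)" for v :: "nat \<Rightarrow> int"
    define A where "A x = (\<Sum>v\<in>V. g (pt v) * (\<Prod>j<k. tt (v j) (x j)))" for x
    have fin: "finite I" "finite V" unfolding I_def V_def by (auto intro: finite_PiE)
    have tt: "0 \<le> tt v x" "tt v x \<le> 1" "isCont (tt v) x" for v x
      unfolding tt_def using tent_nonneg tent_le_1 isCont_tent by auto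
    have [measurable]: "tt v \<in> borel_measurable borel" for v
      by (intro borel_measurable_continuous_onI continuous_at_imp_continuous_on) (use tt in auto)
    have cc: "0 \<le> cc x" "cc x \<le> 1" "isCont cc x" for x
      unfolding cc_def using sum_tent_le_1[OF fin(1), of "real q * x"] tt
      by (auto intro!: sum_nonneg simp: tt_def[symmetric] continuous_sum)
    have [measurable]: "cc \<in> borel_measurable borel" unfolding cc_def by measurable
    have plat01: "0 \<le> plat x" "plat x \<le> 1" for x unfolding plat_def using cc by (auto intro!: prod_nonneg prod_le_1)
    have platV: "plat x = (\<Sum>v\<in>V. \<Prod>j<k. tt (v j) (x j))" for x
      unfolding plat_def cc_def V_def by (rule prod_sum_PiE) (auto simp: fin)
    \<comment> \<open>A product of tents at \<open>x\<close> vanishes unless the node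
      \<open>pt v\<close> is within \<open>1 / real q\<close> of \<open>x\<close> in each of the
      first \<open>k\<close> coordinates, and over that distance \<open>g\<close> varies by at most
      \<open>\<eta>\<close>.\<close>
    have A_approx: "\<bar>g x * plat x - A x\<bar> \<le> \<eta>" for x
    proof -
      have "\<bar>g x * plat x - A x\<bar> = \<bar>\<Sum>v\<in>V. (g x - g (pt v)) * (\<Prod>j<k. tt (v j) (x j))\<bar>"
        unfolding platV A_def by (simp add: sum_distrib_left sum_subtractf left_diff_distrib)
      also have "\<dots> \<le> (\<Sum>v\<in>V. \<bar>(g x - g (pt v)) * (\<Prod>j<k. tt (v j) (x j))\<bar>)" by (rule sum_abs)
      also have "\<dots> \<le> (\<Sum>v\<in>V. \<eta> * (\<Prod>j<k. tt (v j) (x j)))"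
      proof (rule sum_mono)
        fix v assume v: "v \<in> V"
        have nn: "0 \<le> (\<Prod>j<k. tt (v j) (x j))" by (intro prod_nonneg) (use tt in auto)
        show "\<bar>(g x - g (pt v)) * (\<Prod>j<k. tt (v j) (x j))\<bar> \<le> \<eta> * (\<Prod>j<k. tt (v j) (x j))"
        proof (cases "\<exists>j<k. tt (v j) (x j) = 0")
          case True
          then have p0: "(\<Prod>j<k. tt (v j) (x j)) = 0" by auto
          show ?thesis unfolding p0 by simp
        next
          case False
          have "\<bar>g (pt v) - g x\<bar> \<le> \<eta>"
          proof (rule uc)
            fix j assume j: "j < k"
            then have "\<bar>real q * x j - real_of_int (v j)\<bar> < 1"
              using False tent_eq_0 unfolding tt_def by (meson not_less)
            then have "\<bar>real q * (x j - pt v j)\<bar> < 1" using q by (simp add: pt_def right_diff_distrib)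
            then have m: "real q * \<bar>x j - pt v j\<bar> < 1" by (simp only: abs_mult abs_of_nat)
            have q': "real q > 0" using q by simp
            have 1: "\<bar>x j - pt v j\<bar> < 1 / real q"
              unfolding pos_less_divide_eq[OF q'] using m by (simp only: mult.commute)
            have "v j \<in> I" using v j unfolding V_def using PiE_mem[of v "{..<k}" "\<lambda>_. I" j] by simp
            then have "\<bar>v j\<bar> \<le> int N" unfolding I_def atLeastAtMost_iff by linarith
            then have "\<bar>real_of_int (v j)\<bar> \<le> real N" by linarith
            then have "\<bar>real_of_int (v j)\<bar> \<le> real R * real q" by (simp add: N_def)
            then have "\<bar>pt v j\<bar> \<le> real R"
              unfolding pt_def abs_divide abs_of_nat pos_divide_le_eq[OF q'] .
            then show "\<bar>pt v j\<bar> \<le> real R + 1 \<and> \<bar>pt v j - x j\<bar> < 1 / real q"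
              using 1 by (simp add: abs_minus_commute)
          qed
          then show ?thesis using nn by (simp add: abs_mult abs_minus_commute mult_right_mono)
        qed
      qed
      also have "\<dots> = \<eta> * plat x" unfolding platV by (simp add: sum_distrib_left)
      also have "\<dots> \<le> \<eta> * 1" using \<eta> plat01 by (intro mult_left_mono) auto
      finally show ?thesis by simp
    qed
    have plat_lim: "(\<lambda>n. \<integral>w. plat (\<lambda>j. X n j w) \<partial>M n) \<longlonglongrightarrow> (\<integral>w. plat (\<lambda>j. X' j w) \<partial>M')"
      unfolding plat_def by (rule P1) (use cc in auto)
    have intprod: "integrable N (\<lambda>w. c * (\<Prod>j<k. tt (v j) (Y j w)))"
      if "prob_space N" "\<And>j. Y j \<in> borel_measurable N" for N :: "'c measure" and Y c and v :: "nat \<Rightarrow> int"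
    proof -
      have [measurable]: "Y j \<in> borel_measurable N" for j by fact
      show ?thesis
        by (intro integrable_mult_right integrable_bounded_prob[where c=1] that)
          (use tt in \<open>auto simp: abs_of_nonneg prod_nonneg intro!: prod_le_1\<close>)
    qed
    have A_lim: "(\<lambda>n. \<integral>w. A (\<lambda>j. X n j w) \<partial>M n) \<longlonglongrightarrow> (\<integral>w. A (\<lambda>j. X' j w) \<partial>M')"
    proof -
      have 1: "(\<integral>w. A (\<lambda>j. Y j w) \<partial>N) = (\<Sum>v\<in>V. g (pt v) * (\<integral>w. (\<Prod>j<k. tt (v j) (Y j w)) \<partial>N))"
        if "prob_space N" "\<And>j. Y j \<in> borel_measurable N" for N :: "'c measure" and Y
        unfolding A_def using intprod[OF that]
        by (subst Bochner_Integration.integral_sum) auto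
      show ?thesis unfolding 1[OF P(1) X(1)] 1[OF P(2) X(2)]
        by (intro tendsto_intros P1) (use tt in auto)
    qed
    have near: "\<bar>(\<integral>w. g (\<lambda>j. Y j w) \<partial>N) - (\<integral>w. A (\<lambda>j. Y j w) \<partial>N)\<bar>
        \<le> B * (1 - (\<integral>w. plat (\<lambda>j. Y j w) \<partial>N)) + \<eta>"
      if N: "prob_space N" "\<And>j. Y j \<in> borel_measurable N" for N :: "'c measure" and Y
    proof -
      interpret N: prob_space N by fact
      have [measurable]: "Y j \<in> borel_measurable N" for j by fact
      have i1: "integrable N (\<lambda>w. g (\<lambda>j. Y j w))"
        by (rule integrable_bounded_prob[where c=B]) (use N bd gX in auto)
      have i2: "integrable N (\<lambda>w. A (\<lambda>j. Y j w))"
        unfolding A_def by (intro Bochner_Integration.integrable_sum intprod N)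
      have i3: "integrable N (\<lambda>w. plat (\<lambda>j. Y j w))"
        by (rule integrable_bounded_prob[where c=1]) (use N plat01 in \<open>auto simp: plat_def\<close>)
      have pw: "\<bar>g x - A x\<bar> \<le> B * (1 - plat x) + \<eta>" for x
      proof -
        have "\<bar>g x * (1 - plat x)\<bar> \<le> B * (1 - plat x)"
          using bd[of x] plat01[of x] by (simp add: abs_mult mult_right_mono)
        moreover have "g x - A x = g x * (1 - plat x) + (g x * plat x - A x)" by (simp add: algebra_simps)
        ultimately show ?thesis using A_approx[of x] by linarith
      qed
      have "\<bar>(\<integral>w. g (\<lambda>j. Y j w) \<partial>N) - (\<integral>w. A (\<lambda>j. Y j w) \<partial>N)\<bar> = \<bar>\<integral>w. g (\<lambda>j. Y j w) - A (\<lambda>j. Y j w) \<partial>N\<bar>"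
        using i1 i2 by simp
      also have "\<dots> \<le> (\<integral>w. \<bar>g (\<lambda>j. Y j w) - A (\<lambda>j. Y j w)\<bar> \<partial>N)" by (rule integral_abs_bound)
      also have "\<dots> \<le> (\<integral>w. B * (1 - plat (\<lambda>j. Y j w)) + \<eta> \<partial>N)"
        using i1 i2 i3 pw by (intro integral_mono) auto
      also have "\<dots> = B * (1 - (\<integral>w. plat (\<lambda>j. Y j w) \<partial>N)) + \<eta>" using i3 by (simp add: N.prob_space)
      finally show ?thesis .
    qed
    \<comment> \<open>\<open>plat\<close> equals 1 where all coordinates are below
      \<open>real R\<close> in absolute value, since the tents centred at \<open>v / q\<close> with
      \<open>\<bar>v\<bar> \<le> R * q\<close> sum to 1 there.\<close>
    have plat_ge: "(\<integral>w. plat (\<lambda>j. X' j w) \<partial>M') \<ge> 1 - \<eta>"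
    proof -
      have "1 - indicator (bad R) w \<le> plat (\<lambda>j. X' j w)" if "w \<in> space M'" for w
      proof (cases "w \<in> bad R")
        case False
        have "cc (X' j w) = 1" if j: "j < k" for j
        proof -
          have "\<bar>X' j w\<bar> < real R" using False j \<open>w \<in> space M'\<close> by (auto simp: bad_def not_le)
          then have "real q * \<bar>X' j w\<bar> < real q * real R" using q by simp
          then have "\<bar>real q * X' j w\<bar> < real N" by (simp add: N_def abs_mult mult.commute)
          then show ?thesis unfolding cc_def tt_def I_def by (rule sum_tent_eq_1)
        qed
        then show ?thesis by (simp add: plat_def)
      qed (use plat01 in simp)
      moreover have "integrable M' (\<lambda>w. plat (\<lambda>j. X' j w))"
        by (rule integrable_bounded_prob[where c=1]) (use P plat01 in \<open>auto simp: plat_def\<close>)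
      moreover have "integrable M' (\<lambda>w. 1 - indicat_real (bad R) w)"
        by (rule integrable_bounded_prob[where c=1]) (use P in \<open>auto simp: indicator_def\<close>)
      ultimately have "(\<integral>w. 1 - indicator (bad R) w \<partial>M') \<le> (\<integral>w. plat (\<lambda>j. X' j w) \<partial>M')"
        by (intro integral_mono) auto
      moreover have "integrable M' (indicat_real (bad R))"
        by (rule integrable_bounded_prob[where c=1]) (use P in \<open>auto simp: indicator_def\<close>)
      ultimately show ?thesis using R by (simp add: M'.prob_space)
    qed
    have "\<forall>\<^sub>F n in sequentially. (\<integral>w. plat (\<lambda>j. X n j w) \<partial>M n) > 1 - 2 * \<eta>"
      by (rule order_tendstoD(1)[OF plat_lim]) (use plat_ge \<eta> in simp)
    moreover have "\<forall>\<^sub>F n in sequentially. \<bar>(\<integral>w. A (\<lambda>j. X n j w) \<partial>M n) - (\<integral>w. A (\<lambda>j. X' j w) \<partial>M')\<bar> < \<eta>"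
      using tendstoD[OF A_lim \<eta>] by (simp add: dist_real_def)
    ultimately have "\<forall>\<^sub>F n in sequentially. norm ((\<integral>w. g (\<lambda>j. X n j w) \<partial>M n) - (\<integral>w. g (\<lambda>j. X' j w) \<partial>M')) < e"
    proof eventually_elim
      case (elim n)
      have 1: "B * (1 - (\<integral>w. plat (\<lambda>j. X n j w) \<partial>M n)) \<le> B * (2 * \<eta>)" using elim(1) B by (intro mult_left_mono) auto
      have 2: "B * (1 - (\<integral>w. plat (\<lambda>j. X' j w) \<partial>M')) \<le> B * \<eta>" using plat_ge B by (intro mult_left_mono) auto
      have "\<bar>(\<integral>w. g (\<lambda>j. X n j w) \<partial>M n) - (\<integral>w. g (\<lambda>j. X' j w) \<partial>M')\<bar> < B * (2 * \<eta>) + \<eta> + \<eta> + (B * \<eta> + \<eta>)"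
        using order_trans[OF near[OF P(1) X(1), of n] add_right_mono[OF 1]]
          order_trans[OF near[OF P(2) X(2)] add_right_mono[OF 2]] elim(2) by linarith
      also have "\<dots> = (3 * B + 3) * \<eta>" by (simp add: algebra_simps)
      also have "\<dots> = e" using B by (simp add: \<eta>_def)
      finally show ?case by simp
    qed
    then show "\<exists>no. \<forall>n\<ge>no. norm ((\<integral>w. g (\<lambda>j. X n j w) \<partial>M n) - (\<integral>w. g (\<lambda>j. X' j w) \<partial>M')) < e"
      by (simp add: eventually_sequentially)
  qed
qed

section \<open>Convergence in distribution from finite-dimensional convergence and tightness\<close>

text \<open>A substitute for uniform continuity: the radius \<open>1 / k\<close> on
  \<open>{0..k}\<close> is prescribed, and by \<open>eventually_stable_set\<close> every path
  belongs to the set from some \<open>k\<close> on.\<close>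

definition stable_set :: "((real \<Rightarrow> real) \<Rightarrow> real) \<Rightarrow> real \<Rightarrow> nat \<Rightarrow> (real \<Rightarrow> real) set" where
  "stable_set f \<eta> k = {x \<in> skorokhod_space. \<forall>y\<in>skorokhod_space.
     (\<forall>t\<in>{0..real k}. real k * \<bar>y t - x t\<bar> < 1) \<longrightarrow> \<bar>f y - f x\<bar> \<le> \<eta>}"

text \<open>A uniform distance to \<open>A\<close> on \<open>{0..k}\<close>, measured in units of
  \<open>1 / (2 * k)\<close> and truncated at 1; inserting 1 both truncates and keeps the infimum
  over a nonempty set. A value below 1 gives a member of \<open>A\<close> at distance less than
  \<open>1 / (2 * k)\<close>, which leaves room for a further approximation inside the radius
  \<open>1 / k\<close> of \<open>stable_set\<close>.\<close>

definition set_gap :: "(real \<Rightarrow> real) set \<Rightarrow> nat \<Rightarrow> (real \<Rightarrow> real) \<Rightarrow> real" where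
  "set_gap A k x = Inf (insert 1 {r. 0 \<le> r \<and> (\<exists>a\<in>A. \<forall>t\<in>{0..real k}. 2 * real k * \<bar>x t - a t\<bar> \<le> r)})"

lemma set_gap_bdd: "bdd_below (insert 1 {r. 0 \<le> (r::real) \<and> P r})"
  by (intro bdd_belowI[of _ 0]) auto

lemma set_gap_nonneg: "0 \<le> set_gap A k x" and set_gap_le_1: "set_gap A k x \<le> 1"
  unfolding set_gap_def using set_gap_bdd by (auto intro!: cInf_greatest cInf_lower)

lemma set_gap_eq_0: "x \<in> A \<Longrightarrow> set_gap A k x = 0"
proof (rule antisym[OF _ set_gap_nonneg])
  assume "x \<in> A"
  then show "set_gap A k x \<le> 0"
    unfolding set_gap_def using set_gap_bdd by (intro cInf_lower) (auto intro!: bexI[of _ x])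
qed

lemma set_gap_less_1:
  assumes "set_gap A k x < 1"
  shows "\<exists>a\<in>A. \<forall>t\<in>{0..real k}. 2 * real k * \<bar>x t - a t\<bar> < 1"
proof -
  obtain r where r: "r \<in> insert 1 {r. 0 \<le> r \<and> (\<exists>a\<in>A. \<forall>t\<in>{0..real k}. 2 * real k * \<bar>x t - a t\<bar> \<le> r)}" "r < 1"
    using cInf_lessD[OF _ assms[unfolded set_gap_def]] by blast
  then show ?thesis by (auto intro: le_less_trans)
qed

text \<open>A distance function is Lipschitz whatever the set is, so neither closedness nor
  measurability of \<open>stable_set\<close> has to be established.\<close>

lemma set_gap_lipschitz:
  assumes "\<And>t. t \<in> {0..real k} \<Longrightarrow> \<bar>x t - y t\<bar> \<le> \<delta>" "0 \<le> \<delta>"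
  shows "set_gap A k x \<le> set_gap A k y + 2 * real k * \<delta>"
proof -
  have "set_gap A k x - 2 * real k * \<delta> \<le> set_gap A k y"
    unfolding set_gap_def[of A k y]
  proof (rule cInf_greatest)
    fix r assume "r \<in> insert 1 {r. 0 \<le> r \<and> (\<exists>a\<in>A. \<forall>t\<in>{0..real k}. 2 * real k * \<bar>y t - a t\<bar> \<le> r)}"
    then consider "r = 1" | a where "0 \<le> r" "a \<in> A" "\<And>t. t \<in> {0..real k} \<Longrightarrow> 2 * real k * \<bar>y t - a t\<bar> \<le> r" by auto
    then show "set_gap A k x - 2 * real k * \<delta> \<le> r"
    proof cases
      case 1
      have "0 \<le> 2 * real k * \<delta>" using assms(2) by simp
      then show ?thesis using set_gap_le_1[of A k x] 1 by linarith
    next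
      case 2
      have "2 * real k * \<bar>x t - a t\<bar> \<le> r + 2 * real k * \<delta>" if t: "t \<in> {0..real k}" for t
      proof -
        have "\<bar>x t - a t\<bar> \<le> \<bar>y t - a t\<bar> + \<delta>" using assms(1)[OF t] by linarith
        then have "2 * real k * \<bar>x t - a t\<bar> \<le> 2 * real k * (\<bar>y t - a t\<bar> + \<delta>)" by (intro mult_left_mono) auto
        then show ?thesis using 2(3)[OF t] by (simp add: distrib_left)
      qed
      then have "set_gap A k x \<le> r + 2 * real k * \<delta>"
        unfolding set_gap_def[of A k x] using 2 assms(2)
        by (intro cInf_lower set_gap_bdd) (auto intro!: bexI[of _ a])
      then show ?thesis by simp
    qed
  qed simp
  then show ?thesis by simp
qed

lemma locally_uniformly_continuous_set_gap: "locally_uniformly_continuous (set_gap A k)"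
  unfolding locally_uniformly_continuous_def
proof (intro ballI allI impI)
  fix x and \<eta> :: real assume "\<eta> > 0"
  define \<delta> where "\<delta> = \<eta> / (2 * real k + 1)"
  have \<delta>: "\<delta> > 0" using \<open>\<eta> > 0\<close> by (simp add: \<delta>_def)
  have "(2 * real k + 1) * \<delta> = \<eta>" unfolding \<delta>_def by simp
  then have "2 * real k * \<delta> + \<delta> = \<eta>" by (simp add: distrib_right)
  then have k\<delta>: "2 * real k * \<delta> < \<eta>" using \<delta> by linarith
  have "\<bar>set_gap A k y - set_gap A k x\<bar> < \<eta>" if y: "\<forall>t\<in>{0..real k}. \<bar>y t - x t\<bar> < \<delta>" for y
  proof -
    have 1: "set_gap A k y \<le> set_gap A k x + 2 * real k * \<delta>"
      by (rule set_gap_lipschitz) (use y \<delta> in \<open>auto intro: less_imp_le\<close>)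
    have 2: "set_gap A k x \<le> set_gap A k y + 2 * real k * \<delta>"
      by (rule set_gap_lipschitz) (use y \<delta> in \<open>auto intro: less_imp_le simp: abs_minus_commute\<close>)
    show ?thesis using 1 2 k\<delta> by linarith
  qed
  then show "\<exists>T. \<exists>\<delta>>0. \<forall>y\<in>skorokhod_space. (\<forall>t\<in>{0..T}. \<bar>y t - x t\<bar> < \<delta>) \<longrightarrow>
      \<bar>set_gap A k y - set_gap A k x\<bar> < \<eta>"
    using \<delta> by blast
qed

lemma eventually_stable_set:
  assumes f: "locally_uniformly_continuous f" and x: "x \<in> skorokhod_space" and "\<eta> > 0"
  shows "\<forall>\<^sub>F k in sequentially. x \<in> stable_set f \<eta> k"
proof -
  obtain T \<delta> where \<delta>: "\<delta> > 0" and *: "\<And>y. y \<in> skorokhod_space \<Longrightarrow>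
      (\<forall>t\<in>{0..T}. \<bar>y t - x t\<bar> < \<delta>) \<Longrightarrow> \<bar>f y - f x\<bar> < \<eta>"
    using f x \<open>\<eta> > 0\<close> unfolding locally_uniformly_continuous_def by blast
  have "x \<in> stable_set f \<eta> k" if k: "k \<ge> nat \<lceil>max T (1 / \<delta>)\<rceil> + 1" for k
  proof -
    have kT: "real k \<ge> T" "real k \<ge> 1 / \<delta>" "k > 0" using k by linarith+
    then have k\<delta>: "real k * \<delta> \<ge> 1" using \<delta> by (simp add: field_simps)
    have "\<bar>f y - f x\<bar> \<le> \<eta>" if y: "y \<in> skorokhod_space" "\<forall>t\<in>{0..real k}. real k * \<bar>y t - x t\<bar> < 1" for y
    proof -
      have "\<bar>y t - x t\<bar> < \<delta>" if "t \<in> {0..T}" for t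
      proof -
        have "real k * \<bar>y t - x t\<bar> < real k * \<delta>" using y(2) that kT(1) k\<delta> by force
        then show ?thesis using kT(3) by simp
      qed
      then show ?thesis using *[OF y(1)] by (simp add: less_imp_le)
    qed
    then show ?thesis using x by (simp add: stable_set_def)
  qed
  then show ?thesis by (rule eventually_sequentiallyI)
qed

lemma continuous_imp_cadlag:
  fixes y :: "real \<Rightarrow> real"
  assumes "continuous_on {0..} y"
  shows "cadlag y"
  unfolding cadlag_def
proof (intro conjI allI impI)
  fix t :: real assume "t \<ge> 0"
  then have "(y \<longlongrightarrow> y t) (at t within {0..})" using assms by (simp add: continuous_on_def)
  then show "(y \<longlongrightarrow> y t) (at_right t)"
    by (rule tendsto_within_subset) (use \<open>t \<ge> 0\<close> in auto)
next
  fix t :: real assume "t > 0"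
  then have "isCont y t" using assms continuous_on_interior[of "{0..}" y t] by simp
  then show "\<exists>l. (y \<longlongrightarrow> l) (at_left t)"
    by (intro exI[of _ "y t"]) (auto simp: isCont_def filterlim_at_split)
qed

lemma continuous_imp_skorokhod:
  assumes "continuous_on {0..} y"
  shows "restrict y {0..} \<in> skorokhod_space"
  using cadlag_restrict[OF continuous_imp_cadlag[OF assms]] by (simp add: skorokhod_space_def)

text \<open>Uniform continuity on \<open>{0..T}\<close> makes the step versions of a continuous path
  converge locally uniformly, without any time change; hence the weaker regularity of
  \<open>h\<close> is enough.\<close>

lemma step_path_tendsto_continuous:
  assumes h: "locally_uniformly_continuous h" and y: "continuous_on {0..} y"
  shows "(\<lambda>l. h (step_path l (grid_values l y))) \<longlonglongrightarrow> h (restrict y {0..})"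
proof (rule tendstoI)
  fix e :: real assume "e > 0"
  then obtain T \<delta> where \<delta>: "\<delta> > 0" and *: "\<And>x. x \<in> skorokhod_space \<Longrightarrow>
      (\<forall>t\<in>{0..T}. \<bar>x t - restrict y {0..} t\<bar> < \<delta>) \<Longrightarrow> \<bar>h x - h (restrict y {0..})\<bar> < e"
    using h continuous_imp_skorokhod[OF y] unfolding locally_uniformly_continuous_def by blast
  have "uniformly_continuous_on {0..T} y"
    by (intro compact_uniformly_continuous continuous_on_subset[OF y]) auto
  then obtain d where d: "d > 0" "\<And>s t. s \<in> {0..T} \<Longrightarrow> t \<in> {0..T} \<Longrightarrow> dist s t < d \<Longrightarrow> dist (y s) (y t) < \<delta>"
    using \<delta> unfolding uniformly_continuous_on_def by blast
  have lim: "(\<lambda>l. 1 / 2 ^ l :: real) \<longlonglongrightarrow> 0" by (rule LIMSEQ_divide_realpow_zero) simp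
  have "\<forall>\<^sub>F l in sequentially. 1 / 2 ^ l < d" by (rule order_tendstoD(2)[OF lim d(1)])
  moreover have "\<forall>\<^sub>F l in sequentially. real l \<ge> T"
    by (rule eventually_sequentiallyI[of "nat \<lceil>T\<rceil>"]) linarith
  ultimately show "\<forall>\<^sub>F l in sequentially. dist (h (step_path l (grid_values l y))) (h (restrict y {0..})) < e"
  proof eventually_elim
    case (elim l)
    have "\<bar>step_path l (grid_values l y) t - restrict y {0..} t\<bar> < \<delta>" if t: "t \<in> {0..T}" for t
    proof -
      have 1: "dyadic_floor l t \<in> {0..T}" using t dyadic_floor_le[of l t] dyadic_floor_nonneg[of t l] by auto
      have "dist (dyadic_floor l t) t < d"
        using dyadic_floor_le[of l t] dyadic_floor_gt[of t l] elim(1) by (simp add: dist_real_def)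
      from d(2)[OF 1 t this] show ?thesis
        using t elim(2) by (simp add: step_path_grid_values dist_real_def)
    qed
    then show ?case using *[OF step_path_skorokhod] by (simp add: dist_real_def)
  qed
qed

text \<open>Step versions converge by the finite-dimensional theorem, and \<open>tight\<close> keeps
  the paths close to their step versions. Passing this through \<open>f\<close> requires a stable
  path nearby: where \<open>gap k\<close> is below 1, the step path is near some \<open>a\<close> in
  the stable set, and so is the path itself, hence both values are within \<open>\<eta>\<close> of
  \<open>f a\<close>. The mean of \<open>gap k\<close> is small under the limit, and therefore under
  the step paths.\<close>

lemma weak_convergence_skorokhod:
  fixes M :: "nat \<Rightarrow> 'w measure" and M' :: "'v measure"
    and X :: "nat \<Rightarrow> real \<Rightarrow> 'w \<Rightarrow> real" and Y :: "real \<Rightarrow> 'v \<Rightarrow> real"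
  assumes P: "\<And>n. prob_space (M n)" "prob_space M'"
    and X: "\<And>n t. t \<ge> 0 \<Longrightarrow> X n t \<in> borel_measurable (M n)"
    and Xpath: "\<And>n w. w \<in> space (M n) \<Longrightarrow> cadlag (\<lambda>t. X n t w)"
    and Y: "\<And>t. t \<ge> 0 \<Longrightarrow> Y t \<in> borel_measurable M'"
    and Ypath: "\<And>w. w \<in> space M' \<Longrightarrow> continuous_on {0..} (\<lambda>t. Y t w)"
    and char: "\<And>(k::nat) t \<theta>. (\<And>j. j < k \<Longrightarrow> t j \<ge> 0) \<Longrightarrow>
      (\<lambda>n. \<integral>w. iexp (\<Sum>j<k. \<theta> j * X n (t j) w) \<partial>M n) \<longlonglongrightarrow> (\<integral>w. iexp (\<Sum>j<k. \<theta> j * Y (t j) w) \<partial>M')"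
    and tight: "\<And>T \<delta> \<eta>. T > 0 \<Longrightarrow> \<delta> > 0 \<Longrightarrow> \<eta> > 0 \<Longrightarrow> \<exists>l0. \<forall>l\<ge>l0. \<forall>\<^sub>F n in sequentially.
      \<exists>B\<in>sets (M n). measure (M n) B \<le> \<eta> \<and>
        (\<forall>w\<in>space (M n) - B. \<forall>t\<in>{0..T}. \<bar>X n t w - X n (dyadic_floor l t) w\<bar> \<le> \<delta>)"
    and f: "continuous_map skorokhod_topology euclideanreal f"
    and bd: "\<And>x. x \<in> skorokhod_space \<Longrightarrow> \<bar>f x\<bar> \<le> B"
  shows "(\<lambda>n. \<integral>w. f (restrict (\<lambda>t. X n t w) {0..}) \<partial>M n) \<longlonglongrightarrow> (\<integral>w. f (restrict (\<lambda>t. Y t w) {0..}) \<partial>M')"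
proof (rule LIMSEQ_I)
  fix e :: real assume "e > 0"
  have luc: "locally_uniformly_continuous f" by (rule skorokhod_continuous_imp_locally_uniformly_continuous[OF f])
  interpret M': prob_space M' by fact
  have B: "B \<ge> 0" using bd[OF step_path_skorokhod[of 0 "\<lambda>_. 0"]] by simp
  define sX where "sX l n w = step_path l (grid_values l (\<lambda>t. X n t w))" for l n w
  define sY where "sY l w = step_path l (grid_values l (\<lambda>t. Y t w))" for l w
  have step_conv: "(\<lambda>n. \<integral>w. h (sX l n w) \<partial>M n) \<longlonglongrightarrow> (\<integral>w. h (sY l w) \<partial>M')"
    and step_meas: "\<And>n. (\<lambda>w. h (sX l n w)) \<in> borel_measurable (M n)" "(\<lambda>w. h (sY l w)) \<in> borel_measurable M'"
    if h: "locally_uniformly_continuous h" and hb: "\<And>x. x \<in> skorokhod_space \<Longrightarrow> \<bar>h x\<bar> \<le> b" for h b l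
  proof -
    have c: "continuous_on UNIV (\<lambda>v. h (step_path l v))" by (rule continuous_step_path[OF h])
    show "(\<lambda>n. \<integral>w. h (sX l n w) \<partial>M n) \<longlonglongrightarrow> (\<integral>w. h (sY l w) \<partial>M')"
      unfolding sX_def sY_def grid_values_def
    proof (rule levy_continuity_finite_dim[OF P, where k="Suc (l * 2 ^ l)" and B=b
        and g="\<lambda>v. h (step_path l v)" and X="\<lambda>n j w. X n (real j / 2 ^ l) w" and X'="\<lambda>j w. Y (real j / 2 ^ l) w"])
      show "continuous_on UNIV (\<lambda>v. h (step_path l v))" by fact
      show "h (step_path l v) = h (step_path l w)" if "\<And>j. j < Suc (l * 2 ^ l) \<Longrightarrow> v j = w j" for v w
        using step_path_cong[of l v w] that by (simp add: less_Suc_eq_le)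
      show "\<bar>h (step_path l v)\<bar> \<le> b" for v by (rule hb[OF step_path_skorokhod])
      show "(\<lambda>n. \<integral>w. iexp (\<Sum>j<Suc (l * 2 ^ l). \<theta> j * X n (real j / 2 ^ l) w) \<partial>M n)
        \<longlonglongrightarrow> (\<integral>w. iexp (\<Sum>j<Suc (l * 2 ^ l). \<theta> j * Y (real j / 2 ^ l) w) \<partial>M')" for \<theta>
        by (rule char[where k="Suc (l * 2 ^ l)" and t="\<lambda>j. real j / 2 ^ l" and \<theta>=\<theta>]) simp
    qed (use X Y in auto)
    have [measurable]: "(\<lambda>v. h (step_path l v)) \<in> borel_measurable borel" using c by (rule borel_measurable_continuous_onI)
    show "(\<lambda>w. h (sX l n w)) \<in> borel_measurable (M n)" for n
      unfolding sX_def grid_values_def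
      by (rule measurable_compose[of _ _ borel _ borel, OF measurable_coordinatewise_then_product]) (use X in auto)
    show "(\<lambda>w. h (sY l w)) \<in> borel_measurable M'"
      unfolding sY_def grid_values_def
      by (rule measurable_compose[of _ _ borel _ borel, OF measurable_coordinatewise_then_product]) (use Y in auto)
  qed
  have Ysk: "restrict (\<lambda>t. Y t w) {0..} \<in> skorokhod_space" if "w \<in> space M'" for w
    by (rule continuous_imp_skorokhod[OF Ypath[OF that]])
  have Xsk: "restrict (\<lambda>t. X n t w) {0..} \<in> skorokhod_space" if "w \<in> space (M n)" for n w
    using cadlag_restrict[OF Xpath[OF that]] by (simp add: skorokhod_space_def)
  have Ylim: "(\<lambda>l. h (sY l w)) \<longlonglongrightarrow> h (restrict (\<lambda>t. Y t w) {0..})"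
    if "locally_uniformly_continuous h" "w \<in> space M'" for h w
    unfolding sY_def by (rule step_path_tendsto_continuous[OF that(1) Ypath[OF that(2)]])
  have Ymeas: "(\<lambda>w. h (restrict (\<lambda>t. Y t w) {0..})) \<in> borel_measurable M'"
    if h: "locally_uniformly_continuous h" and hb: "\<And>x. x \<in> skorokhod_space \<Longrightarrow> \<bar>h x\<bar> \<le> b" for h b
    by (rule borel_measurable_LIMSEQ_real[where u="\<lambda>l w. h (sY l w)"]) (auto intro: Ylim h step_meas(2)[OF h hb])
  have Yint: "(\<lambda>l. \<integral>w. h (sY l w) \<partial>M') \<longlonglongrightarrow> (\<integral>w. h (restrict (\<lambda>t. Y t w) {0..}) \<partial>M')"
    if h: "locally_uniformly_continuous h" and hb: "\<And>x. x \<in> skorokhod_space \<Longrightarrow> \<bar>h x\<bar> \<le> b" for h b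
  proof (rule integral_dominated_convergence[where w="\<lambda>_. b"])
    show "AE w in M'. (\<lambda>l. h (sY l w)) \<longlonglongrightarrow> h (restrict (\<lambda>t. Y t w) {0..})"
      by (intro AE_I2 Ylim h)
    show "AE w in M'. norm (h (sY l w)) \<le> b" for l
      using hb[OF step_path_skorokhod] by (simp add: sY_def)
  qed (use step_meas[OF h hb] Ymeas[OF h hb] in auto)
  \<comment> \<open>The errors below sum to less than \<open>(4 + 4 * B) * \<eta>\<close>.\<close>
  define \<eta> where "\<eta> = e / (5 + 4 * B)"
  have \<eta>: "\<eta> > 0" using \<open>e > 0\<close> B by (simp add: \<eta>_def)
  define gap where "gap k = set_gap (stable_set f \<eta> k) k" for k
  have gluc: "locally_uniformly_continuous (gap k)" for k
    unfolding gap_def by (rule locally_uniformly_continuous_set_gap)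
  have gb: "0 \<le> gap k x" "gap k x \<le> 1" "\<bar>gap k x\<bar> \<le> 1" for k x
    using set_gap_nonneg[of "stable_set f \<eta> k" k x] set_gap_le_1[of "stable_set f \<eta> k" k x] unfolding gap_def by auto
  have "(\<lambda>k. \<integral>w. gap k (restrict (\<lambda>t. Y t w) {0..}) \<partial>M') \<longlonglongrightarrow> (\<integral>w. 0 \<partial>M')"
  proof (rule integral_dominated_convergence[where w="\<lambda>_. 1"])
    show "AE w in M'. (\<lambda>k. gap k (restrict (\<lambda>t. Y t w) {0..})) \<longlonglongrightarrow> 0"
    proof (rule AE_I2)
      fix w assume "w \<in> space M'"
      from eventually_stable_set[OF luc Ysk[OF this] \<eta>]
      show "(\<lambda>k. gap k (restrict (\<lambda>t. Y t w) {0..})) \<longlonglongrightarrow> 0"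
        by (intro tendsto_eventually) (auto elim!: eventually_mono simp: gap_def set_gap_eq_0)
    qed
  qed (use Ymeas[OF gluc gb(3)] gb in auto)
  then have "\<forall>\<^sub>F k in sequentially. (\<integral>w. gap k (restrict (\<lambda>t. Y t w) {0..}) \<partial>M') < \<eta> \<and> k > 0"
    using \<eta> order_tendstoD(2)[of _ 0 sequentially \<eta>] by (intro eventually_conj eventually_gt_at_top) auto
  then obtain k where k: "(\<integral>w. gap k (restrict (\<lambda>t. Y t w) {0..}) \<partial>M') < \<eta>" "k > 0"
    by (auto simp: eventually_sequentially)
  \<comment> \<open>In units of \<open>1 / (2 * k)\<close> the tightness error is at most 1/2 and
    the distance to the stable path is below 1, so the path stays within \<open>1 / k\<close> of the
    stable path. The order of choice is \<open>k\<close>, then the level \<open>l\<close>, then the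
    index \<open>n\<close>.\<close>
  have "real k > 0" "1 / (4 * real k) > 0" using k by auto
  then obtain l0 where l0: "\<And>l. l \<ge> l0 \<Longrightarrow> \<forall>\<^sub>F n in sequentially.
      \<exists>B\<in>sets (M n). measure (M n) B \<le> \<eta> \<and>
        (\<forall>w\<in>space (M n) - B. \<forall>t\<in>{0..real k}. \<bar>X n t w - X n (dyadic_floor l t) w\<bar> \<le> 1 / (4 * real k))"
    using tight[of "real k" "1 / (4 * real k)" \<eta>] \<eta> by blast
  have "\<forall>\<^sub>F l in sequentially. (\<integral>w. gap k (sY l w) \<partial>M') < \<eta> \<and>
      \<bar>(\<integral>w. f (sY l w) \<partial>M') - (\<integral>w. f (restrict (\<lambda>t. Y t w) {0..}) \<partial>M')\<bar> < \<eta> \<and> l \<ge> max l0 k"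
    using order_tendstoD(2)[OF Yint[OF gluc gb(3)] k(1)] tendstoD[OF Yint[OF luc bd] \<eta>]
    by (intro eventually_conj eventually_ge_at_top) (auto simp: dist_real_def)
  then obtain l where l: "(\<integral>w. gap k (sY l w) \<partial>M') < \<eta>"
      "\<bar>(\<integral>w. f (sY l w) \<partial>M') - (\<integral>w. f (restrict (\<lambda>t. Y t w) {0..}) \<partial>M')\<bar> < \<eta>" "l \<ge> l0" "l \<ge> k"
    by (auto simp: eventually_sequentially)
  have "\<forall>\<^sub>F n in sequentially. (\<integral>w. gap k (sX l n w) \<partial>M n) < \<eta>"
    by (rule order_tendstoD(2)[OF step_conv[OF gluc gb(3)] l(1)])
  moreover have "\<forall>\<^sub>F n in sequentially. \<bar>(\<integral>w. f (sX l n w) \<partial>M n) - (\<integral>w. f (sY l w) \<partial>M')\<bar> < \<eta>"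
    using tendstoD[OF step_conv[OF luc bd] \<eta>] by (simp add: dist_real_def)
  ultimately have "\<forall>\<^sub>F n in sequentially. norm ((\<integral>w. f (restrict (\<lambda>t. X n t w) {0..}) \<partial>M n) -
      (\<integral>w. f (restrict (\<lambda>t. Y t w) {0..}) \<partial>M')) < e"
    using l0[OF l(3)]
  proof eventually_elim
    case (elim n)
    interpret prob_space "M n" by fact
    obtain Bad where Bad[measurable]: "Bad \<in> sets (M n)" and "measure (M n) Bad \<le> \<eta>"
      and close: "\<And>w t. w \<in> space (M n) - Bad \<Longrightarrow> t \<in> {0..real k} \<Longrightarrow>
        \<bar>X n t w - X n (dyadic_floor l t) w\<bar> \<le> 1 / (4 * real k)"
      using elim(3) by blast
    note [measurable] = step_meas(1)[OF luc bd, of l n] step_meas(1)[OF gluc gb(3), of k l n]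
    have [measurable]: "(\<lambda>w. f (restrict (\<lambda>t. X n t w) {0..})) \<in> borel_measurable (M n)"
      by (rule borel_measurable_continuous_skorokhod[OF f X Xpath])
    have fs: "\<bar>f (sX l n w)\<bar> \<le> B" for w unfolding sX_def by (rule bd[OF step_path_skorokhod])
    have i1: "integrable (M n) (\<lambda>w. f (restrict (\<lambda>t. X n t w) {0..}))"
      by (rule integrable_const_bound[of _ B]) (use bd Xsk in auto)
    have i2: "integrable (M n) (\<lambda>w. f (sX l n w))"
      by (rule integrable_const_bound[of _ B]) (use fs in auto)
    have i3: "integrable (M n) (\<lambda>w. gap k (sX l n w))"
      by (rule integrable_const_bound[of _ 1]) (use gb in auto)
    have i4: "integrable (M n) (indicat_real Bad)"
      by (rule integrable_const_bound[of _ 1]) (auto simp: indicator_def)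
    have i5: "integrable (M n) (\<lambda>w. 2 * \<eta> + 2 * B * (gap k (sX l n w) + indicator Bad w))"
      by (intro Bochner_Integration.integrable_add integrable_mult_right i3 i4 integrable_const)
    have pw: "\<bar>f (restrict (\<lambda>t. X n t w) {0..}) - f (sX l n w)\<bar> \<le> 2 * \<eta> + 2 * B * (gap k (sX l n w) + indicator Bad w)"
      if w: "w \<in> space (M n)" for w
    proof (cases "gap k (sX l n w) < 1 \<and> w \<notin> Bad")
      case True
      then obtain a where a: "a \<in> stable_set f \<eta> k" "\<And>t. t \<in> {0..real k} \<Longrightarrow> 2 * real k * \<bar>sX l n w t - a t\<bar> < 1"
        using set_gap_less_1 unfolding gap_def by blast
      have c: "2 * real k * \<bar>X n t w - sX l n w t\<bar> \<le> 1 / 2" if t: "t \<in> {0..real k}" for t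
      proof -
        have "t \<le> real l" using t l(4) by auto
        then have s: "sX l n w t = X n (dyadic_floor l t) w"
          using t unfolding sX_def by (subst step_path_grid_values) auto
        have "2 * real k * \<bar>X n t w - sX l n w t\<bar> \<le> 2 * real k * (1 / (4 * real k))"
          unfolding s using close[of w t] True w t by (intro mult_left_mono) auto
        also have "2 * real k * (1 / (4 * real k)) = 1 / 2" using k(2) by simp
        finally show ?thesis .
      qed
      have "\<bar>f (sX l n w) - f a\<bar> \<le> \<eta>"
      proof -
        have "real k * \<bar>sX l n w t - a t\<bar> < 1" if t: "t \<in> {0..real k}" for t
        proof -
          have "0 \<le> real k * \<bar>sX l n w t - a t\<bar>" by simp
          then show ?thesis using a(2)[OF t] unfolding mult.assoc by linarith
        qed
        moreover have "sX l n w \<in> skorokhod_space" unfolding sX_def by (rule step_path_skorokhod)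
        ultimately show ?thesis using a(1) unfolding stable_set_def by blast
      qed
      moreover have "\<bar>f (restrict (\<lambda>t. X n t w) {0..}) - f a\<bar> \<le> \<eta>"
      proof -
        have "real k * \<bar>restrict (\<lambda>t. X n t w) {0..} t - a t\<bar> < 1" if t: "t \<in> {0..real k}" for t
        proof -
          have "\<bar>X n t w - a t\<bar> \<le> \<bar>X n t w - sX l n w t\<bar> + \<bar>sX l n w t - a t\<bar>" by linarith
          then have "2 * real k * \<bar>X n t w - a t\<bar> \<le> 2 * real k * (\<bar>X n t w - sX l n w t\<bar> + \<bar>sX l n w t - a t\<bar>)"
            by (intro mult_left_mono) auto
          then have "2 * real k * \<bar>X n t w - a t\<bar> < 2" using c[OF t] a(2)[OF t] by (simp add: distrib_left)
          then show ?thesis using t by simp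
        qed
        then show ?thesis using a(1) Xsk[OF w] unfolding stable_set_def by blast
      qed
      moreover have "0 \<le> 2 * B * (gap k (sX l n w) + indicator Bad w)" using B gb by (intro mult_nonneg_nonneg add_nonneg_nonneg) auto
      ultimately show ?thesis by linarith
    next
      case False
      \<comment> \<open>On the exceptional event the trivial bound \<open>2 * B\<close> is paid for
        by a summand that is at least 1 there and small in the mean.\<close>
      then have "1 \<le> gap k (sX l n w) + indicator Bad w" using gb[of k "sX l n w"] by (auto simp: not_less)
      then have "2 * B * 1 \<le> 2 * B * (gap k (sX l n w) + indicator Bad w)" using B by (intro mult_left_mono) auto
      then show ?thesis using bd[OF Xsk[OF w]] fs[of w] \<eta> by linarith
    qed
    have "\<bar>(\<integral>w. f (restrict (\<lambda>t. X n t w) {0..}) \<partial>M n) - (\<integral>w. f (sX l n w) \<partial>M n)\<bar>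
        = \<bar>\<integral>w. f (restrict (\<lambda>t. X n t w) {0..}) - f (sX l n w) \<partial>M n\<bar>" using i1 i2 by simp
    also have "\<dots> \<le> (\<integral>w. \<bar>f (restrict (\<lambda>t. X n t w) {0..}) - f (sX l n w)\<bar> \<partial>M n)" by (rule integral_abs_bound)
    also have "\<dots> \<le> (\<integral>w. 2 * \<eta> + 2 * B * (gap k (sX l n w) + indicator Bad w) \<partial>M n)"
      using i1 i2 i5 pw by (intro integral_mono) auto
    also have "\<dots> = 2 * \<eta> + 2 * B * ((\<integral>w. gap k (sX l n w) \<partial>M n) + measure (M n) Bad)"
      using i3 i4 by (simp add: prob_space)
    also have "\<dots> \<le> 2 * \<eta> + 2 * B * (\<eta> + \<eta>)"
      using elim(1) \<open>measure (M n) Bad \<le> \<eta>\<close> B by (intro add_mono mult_left_mono) auto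
    finally have "\<bar>(\<integral>w. f (restrict (\<lambda>t. X n t w) {0..}) \<partial>M n) - (\<integral>w. f (restrict (\<lambda>t. Y t w) {0..}) \<partial>M')\<bar>
        < 2 * \<eta> + 2 * B * (\<eta> + \<eta>) + \<eta> + \<eta>"
      using elim(2) l(2) by linarith
    also have "\<dots> \<le> (5 + 4 * B) * \<eta>" using \<eta> by (simp add: algebra_simps)
    also have "\<dots> = e" using B by (simp add: \<eta>_def)
    finally show ?case by simp
  qed
  then show "\<exists>no. \<forall>n\<ge>no. norm ((\<integral>w. f (restrict (\<lambda>t. X n t w) {0..}) \<partial>M n) -
      (\<integral>w. f (restrict (\<lambda>t. Y t w) {0..}) \<partial>M')) < e"
    by (simp add: eventually_sequentially)
qed

section \<open>Continuous Gaussian processes\<close>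

definition pos_semidef :: "(nat \<Rightarrow> nat \<Rightarrow> real) \<Rightarrow> bool" where
  "pos_semidef S \<longleftrightarrow> (\<forall>i j. S i j = S j i) \<and> (\<forall>N a. 0 \<le> (\<Sum>i<N. \<Sum>j<N. a i * a j * S i j))"

text \<open>Padding the coefficients with zeros enlarges the range beyond \<open>n\<close>, so
  ranges that miss the pivot index need no separate treatment.\<close>

lemma pos_semidef_support:
  fixes S :: "nat \<Rightarrow> nat \<Rightarrow> real"
  assumes "\<And>N a. n < N \<Longrightarrow> 0 \<le> (\<Sum>i<N. \<Sum>j<N. a i * a j * S i j)"
  shows "0 \<le> (\<Sum>i<N. \<Sum>j<N. a i * a j * S i j)"
proof -
  define a' where "a' i = (if i < N then a i else 0)" for i
  have inner: "(\<Sum>j<N + n + 1. a' i * a' j * S i j) = (\<Sum>j<N. a' i * a j * S i j)" for i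
    by (rule sum.mono_neutral_cong_right) (auto simp: a'_def)
  have "(\<Sum>i<N + n + 1. \<Sum>j<N + n + 1. a' i * a' j * S i j) = (\<Sum>i<N. \<Sum>j<N. a i * a j * S i j)"
    unfolding inner by (rule sum.mono_neutral_cong_right) (auto simp: a'_def)
  then show ?thesis using assms[of "N + n + 1" a'] by simp
qed

lemma quadratic_form_perturb:
  fixes S :: "nat \<Rightarrow> nat \<Rightarrow> real"
  assumes sym: "\<And>i j. S i j = S j i" and "n < N"
  shows "(\<Sum>i<N. \<Sum>j<N. (a i + (if i = n then x else 0)) * (a j + (if j = n then x else 0)) * S i j)
    = (\<Sum>i<N. \<Sum>j<N. a i * a j * S i j) + 2 * x * (\<Sum>i<N. a i * S i n) + x\<^sup>2 * S n n"
proof -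
  let ?d = "\<lambda>i. if i = n then x else 0"
  have d: "(\<Sum>i<N. ?d i * f i) = x * f n" for f :: "nat \<Rightarrow> real"
    using \<open>n < N\<close> by (simp add: if_distrib[of "\<lambda>y. y * _"] cong: if_cong)
  have 1: "(\<Sum>i<N. \<Sum>j<N. a i * ?d j * S i j) = x * (\<Sum>i<N. a i * S i n)"
  proof -
    have "(\<Sum>j<N. a i * ?d j * S i j) = x * (a i * S i n)" for i
      using d[of "\<lambda>j. a i * S i j"] by (simp add: mult_ac)
    then show ?thesis by (simp add: sum_distrib_left)
  qed
  have 2: "(\<Sum>i<N. \<Sum>j<N. ?d i * a j * S i j) = x * (\<Sum>i<N. a i * S i n)"
  proof -
    have "(\<Sum>i<N. \<Sum>j<N. ?d i * a j * S i j) = (\<Sum>i<N. ?d i * (\<Sum>j<N. a j * S i j))"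
      by (simp add: sum_distrib_left mult.assoc)
    also have "\<dots> = x * (\<Sum>j<N. a j * S n j)" by (rule d)
    finally show ?thesis using sym by simp
  qed
  have 3: "(\<Sum>i<N. \<Sum>j<N. ?d i * ?d j * S i j) = x\<^sup>2 * S n n"
  proof -
    have "(\<Sum>i<N. \<Sum>j<N. ?d i * ?d j * S i j) = (\<Sum>i<N. ?d i * (\<Sum>j<N. ?d j * S i j))"
      by (simp only: sum_distrib_left mult.assoc)
    then show ?thesis unfolding d by (simp add: power2_eq_square)
  qed
  have "(\<Sum>i<N. \<Sum>j<N. (a i + ?d i) * (a j + ?d j) * S i j) =
    (\<Sum>i<N. \<Sum>j<N. a i * a j * S i j) + (\<Sum>i<N. \<Sum>j<N. a i * ?d j * S i j)
    + ((\<Sum>i<N. \<Sum>j<N. ?d i * a j * S i j) + (\<Sum>i<N. \<Sum>j<N. ?d i * ?d j * S i j))"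
    by (simp only: distrib_left distrib_right sum.distrib add_ac)
  then show ?thesis unfolding 1 2 3 by simp
qed

lemma pos_semidef_diag:
  assumes "pos_semidef S"
  shows "0 \<le> S n n"
proof -
  have "0 \<le> (\<Sum>i<Suc n. \<Sum>j<Suc n. (0 + (if i = n then 1 else 0)) * (0 + (if j = n then 1 else 0)) * S i j)"
    using assms[unfolded pos_semidef_def, THEN conjunct2, rule_format,
      of "\<lambda>i. 0 + (if i = n then 1 else 0)" "Suc n"] .
  then show ?thesis using quadratic_form_perturb[of S n "Suc n" "\<lambda>_. 0" 1] assms
    unfolding pos_semidef_def by simp
qed

text \<open>With \<open>S n n = 0\<close>, moving the \<open>i\<close>-th unit vector along
  direction \<open>n\<close> changes the form by an affine function of \<open>x\<close>; being
  nonnegative for all \<open>x\<close>, it must have slope 0.\<close>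

lemma pos_semidef_row_zero:
  assumes S: "pos_semidef S" and "S n n = 0"
  shows "S i n = 0"
proof (rule ccontr)
  assume ne: "S i n \<noteq> 0"
  have sym: "\<And>i j. S i j = S j i" using S by (simp add: pos_semidef_def)
  obtain N where N: "i < N" "n < N" by (metis gt_ex max_less_iff_conj)
  define a where "a = (\<lambda>k. if k = i then 1 else 0 :: real)"
  have b: "(\<Sum>k<N. a k * S k n) = S i n"
    using N by (simp add: a_def if_distrib[of "\<lambda>y. y * _"] cong: if_cong)
  define Q where "Q = (\<Sum>k<N. \<Sum>j<N. a k * a j * S k j)"
  have "0 \<le> Q + 2 * x * S i n" for x
  proof -
    have "0 \<le> (\<Sum>k<N. \<Sum>j<N. (a k + (if k = n then x else 0)) * (a j + (if j = n then x else 0)) * S k j)"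
      using S[unfolded pos_semidef_def, THEN conjunct2, rule_format, of "\<lambda>k. a k + (if k = n then x else 0)" N] .
    then show ?thesis
      using quadratic_form_perturb[of S n N a x, OF sym] assms(2) unfolding b Q_def[symmetric]
      using N by simp
  qed
  \<comment> \<open>This value of \<open>x\<close> would make the affine function negative.\<close>
  moreover have "2 * (- (\<bar>Q\<bar> + 1) / (2 * S i n)) * S i n = - (\<bar>Q\<bar> + 1)" using ne by simp
  ultimately have "0 \<le> Q + - (\<bar>Q\<bar> + 1)" by metis
  then show False by linarith
qed

definition schur :: "(nat \<Rightarrow> nat \<Rightarrow> real) \<Rightarrow> nat \<Rightarrow> nat \<Rightarrow> nat \<Rightarrow> real" where
  "schur S n = (\<lambda>i j. S i j - S i n * S n j / S n n)"

text \<open>Division by zero gives zero: a vanishing pivot \<open>S n n\<close> forces the whole row to vanish, and the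
  complement is then \<open>S\<close> itself.\<close>

lemma pos_semidef_schur:
  assumes S: "pos_semidef S"
  shows "pos_semidef (schur S n)"
proof -
  have sym: "\<And>i j. S i j = S j i" using S by (simp add: pos_semidef_def)
  have "0 \<le> (\<Sum>i<N. \<Sum>j<N. a i * a j * schur S n i j)" if "n < N" for N a
  proof -
    define b where "b = (\<Sum>i<N. a i * S i n)"
    \<comment> \<open>The minimiser of the quadratic polynomial in \<open>x\<close>; for a zero
      pivot, division by zero makes it 0.\<close>
    define x where "x = - b / S n n"
    have "(\<Sum>i<N. \<Sum>j<N. a i * a j * (S i n * S n j / S n n)) = b * b / S n n"
    proof -
      have "a i * a j * (S i n * S n j / S n n) = (a i * S i n) * (a j * S j n) / S n n" for i j
        using sym[of n j] by simp
      then have "(\<Sum>i<N. \<Sum>j<N. a i * a j * (S i n * S n j / S n n))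
          = (\<Sum>i<N. \<Sum>j<N. (a i * S i n) * (a j * S j n)) / S n n"
        by (simp only: sum_divide_distrib)
      then show ?thesis by (simp add: b_def sum_product)
    qed
    then have 1: "(\<Sum>i<N. \<Sum>j<N. a i * a j * schur S n i j) = (\<Sum>i<N. \<Sum>j<N. a i * a j * S i j) - b * b / S n n"
      by (simp add: schur_def right_diff_distrib sum_subtractf)
    have "0 \<le> (\<Sum>i<N. \<Sum>j<N. (a i + (if i = n then x else 0)) * (a j + (if j = n then x else 0)) * S i j)"
      using S[unfolded pos_semidef_def, THEN conjunct2, rule_format, of "\<lambda>k. a k + (if k = n then x else 0)" N] .
    also have "\<dots> = (\<Sum>i<N. \<Sum>j<N. a i * a j * S i j) + 2 * x * b + x\<^sup>2 * S n n"
      unfolding b_def by (rule quadratic_form_perturb[OF sym that])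
    finally have 2: "0 \<le> (\<Sum>i<N. \<Sum>j<N. a i * a j * S i j) + 2 * x * b + x\<^sup>2 * S n n" .
    have "2 * x * b + x\<^sup>2 * S n n = - (b * b / S n n)"
      by (cases "S n n = 0") (simp_all add: x_def power2_eq_square field_simps)
    then show ?thesis unfolding 1 using 2 by linarith
  qed
  then have "\<And>N a. 0 \<le> (\<Sum>i<N. \<Sum>j<N. a i * a j * schur S n i j)" by (rule pos_semidef_support)
  moreover have "schur S n i j = schur S n j i" for i j
    unfolding schur_def by (simp add: sym[of i j] sym[of i n] sym[of n j] mult.commute)
  ultimately show ?thesis by (simp add: pos_semidef_def)
qed

primrec schur_iter :: "(nat \<Rightarrow> nat \<Rightarrow> real) \<Rightarrow> nat \<Rightarrow> nat \<Rightarrow> nat \<Rightarrow> real" where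
  "schur_iter R 0 = R"
| "schur_iter R (Suc n) = schur (schur_iter R n) n"

lemma pos_semidef_schur_iter: "pos_semidef R \<Longrightarrow> pos_semidef (schur_iter R n)"
  by (induction n) (auto intro: pos_semidef_schur)

text \<open>An eliminated row stays zero, because later steps subtract multiples of entries of that
  row which already vanish. For a zero pivot the row was zero before the step.\<close>

lemma schur_iter_zero:
  assumes "pos_semidef R"
  shows "i < n \<Longrightarrow> schur_iter R n i j = 0"
proof (induction n arbitrary: i j)
  case (Suc n)
  let ?S = "schur_iter R n"
  have S: "pos_semidef ?S" by (rule pos_semidef_schur_iter[OF assms])
  show ?case
  proof (cases "i < n")
    case True
    then show ?thesis using Suc.IH by (simp add: schur_def)
  next
    case False
    then have "i = n" using Suc.prems by simp
    then show ?thesis using pos_semidef_row_zero[OF S, of n j] S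
      by (cases "?S n n = 0") (simp_all add: schur_def pos_semidef_def)
  qed
qed simp

text \<open>The Cholesky factorisation: \<open>v k\<close> is the pivot column of step
  \<open>k\<close> divided by the root of the pivot, and after \<open>n > i\<close> steps the
  residual row \<open>i\<close> is zero. That every \<open>n > i\<close> is allowed later shows
  \<open>v\<close> to be triangular.\<close>

lemma pos_semidef_factorization:
  assumes "pos_semidef R"
  shows "\<exists>v :: nat \<Rightarrow> nat \<Rightarrow> real. \<forall>i j n. i < n \<longrightarrow> R i j = (\<Sum>k<n. v k i * v k j)"
proof -
  define v where "v k i = schur_iter R k i k / sqrt (schur_iter R k k k)" for k i
  have "R i j = (\<Sum>k<n. v k i * v k j) + schur_iter R n i j" for i j n
  proof (induction n)
    case (Suc n)
    let ?S = "schur_iter R n"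
    have S: "pos_semidef ?S" by (rule pos_semidef_schur_iter[OF assms])
    have "v n i * v n j = ?S i n * ?S n j / ?S n n"
      using pos_semidef_diag[OF S, of n] S by (simp add: v_def pos_semidef_def)
    then show ?case using Suc by (simp add: schur_def)
  qed simp
  then have "\<forall>i j n. i < n \<longrightarrow> R i j = (\<Sum>k<n. v k i * v k j)"
    using schur_iter_zero[OF assms] by (metis add_0_right)
  then show ?thesis by blast
qed

section \<open>Gaussian laws recognised by their characteristic functions\<close>

lemma char_gaussian_imp_distr:
  assumes "prob_space M" and X[measurable]: "X \<in> borel_measurable M"
    and char: "\<And>\<theta>. (\<integral>w. iexp (\<theta> * X w) \<partial>M) = exp (- (\<theta>\<^sup>2 * v / 2))" and "v \<ge> 0"
  shows "distr M borel X = distr std_normal_distribution borel (\<lambda>x. sqrt v * x)"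
proof (rule Levy_uniqueness)
  interpret prob_space M by fact
  interpret N: real_distribution std_normal_distribution by (rule real_dist_normal_dist)
  show "real_distribution (distr M borel X)" by simp
  show "real_distribution (distr std_normal_distribution borel (\<lambda>x. sqrt v * x))"
    by (rule N.real_distribution_distr) simp
  show "Characteristic_Functions.char (distr M borel X) =
    Characteristic_Functions.char (distr std_normal_distribution borel (\<lambda>x. sqrt v * x))"
  proof
    fix \<theta>
    have "Characteristic_Functions.char (distr M borel X) \<theta> = exp (- (\<theta>\<^sup>2 * v / 2))"
      unfolding char_def using char[of \<theta>] by (subst integral_distr) auto
    also have "\<dots> = Characteristic_Functions.char std_normal_distribution (\<theta> * sqrt v)"
      unfolding char_std_normal_distribution using \<open>v \<ge> 0\<close>
      by (simp add: power_mult_distrib exp_of_real[symmetric])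
    also have "\<dots> = Characteristic_Functions.char (distr std_normal_distribution borel (\<lambda>x. sqrt v * x)) \<theta>"
      unfolding char_def by (subst integral_distr) (auto simp: mult_ac)
    finally show "Characteristic_Functions.char (distr M borel X) \<theta> =
      Characteristic_Functions.char (distr std_normal_distribution borel (\<lambda>x. sqrt v * x)) \<theta>" .
  qed
qed

lemma char_gaussian_imp_centered_gaussian:
  assumes "prob_space M" and X[measurable]: "X \<in> borel_measurable M"
    and char: "\<And>\<theta>. (\<integral>w. iexp (\<theta> * X w) \<partial>M) = exp (- (\<theta>\<^sup>2 * v / 2))" and v: "v \<ge> 0"
  shows "centered_gaussian M X"
proof -
  interpret prob_space M by fact
  interpret N: real_distribution std_normal_distribution by (rule real_dist_normal_dist)
  note D = char_gaussian_imp_distr[OF assms]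
  show ?thesis
  proof (cases "v = 0")
    case True
    have "distr std_normal_distribution borel (\<lambda>x. sqrt v * x) = return borel 0"
      using True N.distr_const[of 0 borel] by simp
    then show ?thesis using D X by (simp add: centered_gaussian_def)
  next
    case False
    then have "sqrt v > 0" using v by simp
    have "distributed std_normal_distribution lborel (\<lambda>x. x) (\<lambda>x. ennreal (std_normal_density x))"
      by (simp add: distributed_def distr_id2)
    from N.normal_density_affine[OF this, of "sqrt v" 0] \<open>sqrt v > 0\<close>
    have "distributed std_normal_distribution lborel (\<lambda>x. sqrt v * x) (\<lambda>x. ennreal (normal_density 0 (sqrt v) x))"
      by simp
    then have "distr std_normal_distribution lborel (\<lambda>x. sqrt v * x) = density lborel (\<lambda>x. ennreal (normal_density 0 (sqrt v) x))"
      by (simp add: distributed_def)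
    moreover have "distr std_normal_distribution lborel (\<lambda>x. sqrt v * x) = distr std_normal_distribution borel (\<lambda>x. sqrt v * x)"
      "distr M lborel X = distr M borel X"
      by (auto intro!: distr_cong)
    ultimately have "distributed M lborel X (\<lambda>x. ennreal (normal_density 0 (sqrt v) x))"
      using D by (simp add: distributed_def)
    then show ?thesis using \<open>sqrt v > 0\<close> X unfolding centered_gaussian_def by blast
  qed
qed

text \<open>\<open>X\<close> has the law of \<open>sqrt v\<close> times a standard normal variable,
  whose fourth moment is 3.\<close>

lemma char_gaussian_fourth_moment:
  assumes "prob_space M" and X[measurable]: "X \<in> borel_measurable M"
    and char: "\<And>\<theta>. (\<integral>w. iexp (\<theta> * X w) \<partial>M) = exp (- (\<theta>\<^sup>2 * v / 2))" and v: "v \<ge> 0"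
  shows "integrable M (\<lambda>w. X w ^ 4)" "(\<integral>w. X w ^ 4 \<partial>M) = 3 * v\<^sup>2"
proof -
  note D = char_gaussian_imp_distr[OF assms]
  have N4: "(\<integral>x. x ^ 4 \<partial>std_normal_distribution) = 3" "integrable std_normal_distribution (\<lambda>x. x ^ 4)"
    using std_normal_distribution_even_moments[of 2] by (simp_all add: fact_numeral)
  have "sqrt v ^ 4 = v\<^sup>2" using v by (metis mult_2 numeral_Bit0 power2_eq_square power_add real_sqrt_pow2)
  then have e: "(sqrt v * x) ^ 4 = v\<^sup>2 * x ^ 4" for x by (simp add: power_mult_distrib)
  have "integrable (distr std_normal_distribution borel (\<lambda>x. sqrt v * x)) (\<lambda>x. x ^ 4)"
    by (subst integrable_distr_eq) (auto simp: e N4)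
  then show "integrable M (\<lambda>w. X w ^ 4)" unfolding D[symmetric] by (subst (asm) integrable_distr_eq) auto
  have "(\<integral>w. X w ^ 4 \<partial>M) = (\<integral>x. x ^ 4 \<partial>distr M borel X)" by (subst integral_distr) auto
  also have "\<dots> = (\<integral>x. (sqrt v * x) ^ 4 \<partial>std_normal_distribution)" unfolding D by (subst integral_distr) auto
  also have "\<dots> = 3 * v\<^sup>2" unfolding e using N4 by simp
  finally show "(\<integral>w. X w ^ 4 \<partial>M) = 3 * v\<^sup>2" .
qed

lemma fourth_moment_tail:
  assumes "prob_space M" "X \<in> borel_measurable M" "integrable M (\<lambda>w. X w ^ 4)"
    and "(\<integral>w. X w ^ 4 \<partial>M) \<le> K" "c > 0"
  shows "measure M {w\<in>space M. c < \<bar>X w\<bar>} \<le> K / c ^ 4"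
proof -
  interpret prob_space M by fact
  have [measurable]: "X \<in> borel_measurable M" by fact
  have "measure M {w\<in>space M. c < \<bar>X w\<bar>} \<le> measure M {w\<in>space M. c ^ 4 \<le> X w ^ 4}"
  proof (rule finite_measure_mono)
    show "{w\<in>space M. c < \<bar>X w\<bar>} \<subseteq> {w\<in>space M. c ^ 4 \<le> X w ^ 4}"
    proof safe
      fix w assume "c < \<bar>X w\<bar>"
      then have "c ^ 4 \<le> \<bar>X w\<bar> ^ 4" using \<open>c > 0\<close> by (intro power_mono) auto
      then show "c ^ 4 \<le> X w ^ 4" by (simp add: power_even_abs)
    qed
  qed measurable
  also have "\<dots> \<le> (\<integral>w. X w ^ 4 \<partial>M) / c ^ 4"
    by (rule integral_Markov_inequality_measure[where A="space M"])
      (use assms in \<open>auto simp: zero_le_even_power'\<close>)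
  also have "\<dots> \<le> K / c ^ 4" using assms by (simp add: divide_right_mono)
  finally show ?thesis .
qed

text \<open>Coordinates are indexed by \<open>real\<close> to obtain the sample space
  \<open>real \<Rightarrow> real\<close> of the final statement; the construction reads the
  coordinates at natural numbers.\<close>

definition white_noise :: "(real \<Rightarrow> real) measure" where
  "white_noise = PiM UNIV (\<lambda>_. std_normal_distribution)"

lemma prob_space_white_noise: "prob_space white_noise"
  unfolding white_noise_def using real_dist_normal_dist
  by (intro prob_space_PiM) (simp add: real_distribution_def)

lemma measurable_white_noise: "(\<lambda>w. w x) \<in> borel_measurable white_noise"
proof -
  have "(\<lambda>w. w x) \<in> measurable white_noise std_normal_distribution"
    unfolding white_noise_def by (rule measurable_component_singleton) simp
  then show ?thesis by simp
qed

lemma char_white_noise: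
  "(\<integral>w. iexp (\<Sum>k<n. c k * w (real k)) \<partial>white_noise) = exp (- ((\<Sum>k<n. (c k)\<^sup>2) / 2))"
proof -
  interpret W: prob_space white_noise by (rule prob_space_white_noise)
  note [measurable] = measurable_white_noise
  interpret N: real_distribution std_normal_distribution by (rule real_dist_normal_dist)
  have distr1: "distr white_noise borel (\<lambda>w. w x) = std_normal_distribution" for x
  proof -
    have "distr white_noise borel (\<lambda>w. w x) = distr white_noise std_normal_distribution (\<lambda>w. w x)"
      by (rule distr_cong) auto
    also have "\<dots> = std_normal_distribution" unfolding white_noise_def
      by (rule distr_PiM_component) (auto intro: N.prob_space_axioms)
    finally show ?thesis .
  qed
  \<comment> \<open>Restricting the product measure to the coordinates \<open>real k\<close> and
    reindexing them by \<open>k\<close> gives again a product measure, which is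
    independence.\<close>
  have ind: "W.indep_vars (\<lambda>_. borel) (\<lambda>k w. w (real k)) {..<n}" if "n > 0"
  proof (subst W.indep_vars_iff_distr_eq_PiM')
    have "distr white_noise (Pi\<^sub>M {..<n} (\<lambda>i. borel)) (\<lambda>w. \<lambda>k\<in>{..<n}. w (real k))
      = distr white_noise (Pi\<^sub>M {..<n} (\<lambda>i. std_normal_distribution)) (\<lambda>w. \<lambda>k\<in>{..<n}. w (real k))"
      by (rule distr_cong) (auto intro!: sets_PiM_cong)
    also have "\<dots> = Pi\<^sub>M {..<n} (\<lambda>i. std_normal_distribution)"
      unfolding white_noise_def by (rule distr_PiM_reindex) (auto intro: N.prob_space_axioms simp: inj_on_def)
    finally show "distr white_noise (Pi\<^sub>M {..<n} (\<lambda>i. borel)) (\<lambda>w. \<lambda>k\<in>{..<n}. w (real k)) =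
      Pi\<^sub>M {..<n} (\<lambda>k. distr white_noise borel (\<lambda>w. w (real k)))" unfolding distr1 .
  qed (use that in auto)
  have one: "(\<integral>w. iexp (a * w x) \<partial>white_noise) = exp (- (a\<^sup>2 / 2))" for a x
  proof -
    have "(\<integral>w. iexp (a * w x) \<partial>white_noise) = char (distr white_noise borel (\<lambda>w. w x)) a"
      unfolding char_def by (subst integral_distr) auto
    then show ?thesis unfolding distr1 char_std_normal_distribution by (simp add: exp_of_real)
  qed
  show ?thesis
  proof (cases "n = 0")
    case True then show ?thesis by (simp add: W.prob_space)
  next
    case False
    have "(\<integral>w. iexp (\<Sum>k<n. c k * w (real k)) \<partial>white_noise) = (\<integral>w. (\<Prod>k<n. iexp (c k * w (real k))) \<partial>white_noise)"
      by (simp add: sum_distrib_left exp_sum)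
    also have "\<dots> = (\<Prod>k<n. \<integral>w. iexp (c k * w (real k)) \<partial>white_noise)"
    proof (rule W.indep_vars_lebesgue_integral)
      show "W.indep_vars (\<lambda>_. borel) (\<lambda>k w. iexp (c k * w (real k))) {..<n}"
        using W.indep_vars_compose2[OF ind, of "\<lambda>k y. iexp (c k * y)" "\<lambda>_. borel"] False by simp
      show "integrable white_noise (\<lambda>w. iexp (c k * w (real k)))" for k
        using W.integrable_bounded_scaleR_iexp[of "\<lambda>_. 1" "\<lambda>w. c k * w (real k)"] by simp
    qed simp
    also have "\<dots> = exp (- ((\<Sum>k<n. (c k)\<^sup>2) / 2))"
      unfolding one by (simp add: exp_sum[symmetric] sum_negf sum_divide_distrib of_real_prod[symmetric] del: of_real_prod)
    finally show ?thesis .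
  qed
qed

section \<open>Chaining over dyadic levels\<close>

lemma dyadic_floor_Suc:
  assumes "t \<ge> 0"
  obtains j where "dyadic_floor L t = real j / 2 ^ L" "real j \<le> 2 ^ L * t"
    "dyadic_floor (Suc L) t = real (2 * j) / 2 ^ Suc L \<or> dyadic_floor (Suc L) t = real (Suc (2 * j)) / 2 ^ Suc L"
proof
  let ?z = "2 ^ L * t"
  have z: "?z \<ge> 0" using assms by simp
  have f0: "0 \<le> \<lfloor>?z\<rfloor>" using z by simp
  then have f: "real (nat \<lfloor>?z\<rfloor>) = real_of_int \<lfloor>?z\<rfloor>" by simp
  show "dyadic_floor L t = real (nat \<lfloor>?z\<rfloor>) / 2 ^ L" by (simp only: dyadic_floor_def f)
  show "real (nat \<lfloor>?z\<rfloor>) \<le> ?z" unfolding f by simp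
  have e: "2 ^ Suc L * t = 2 * ?z" by simp
  have "\<lfloor>2 * ?z\<rfloor> = 2 * \<lfloor>?z\<rfloor> \<or> \<lfloor>2 * ?z\<rfloor> = 2 * \<lfloor>?z\<rfloor> + 1" by linarith
  then show "dyadic_floor (Suc L) t = real (2 * nat \<lfloor>?z\<rfloor>) / 2 ^ Suc L \<or>
    dyadic_floor (Suc L) t = real (Suc (2 * nat \<lfloor>?z\<rfloor>)) / 2 ^ Suc L"
    unfolding dyadic_floor_def e using f by auto
qed

text \<open>A telescoping sum over levels: from one level to the next the dyadic floor either stays
  or moves to the next point of the finer grid.\<close>

lemma dyadic_chain:
  fixes x :: "real \<Rightarrow> real" and e :: "nat \<Rightarrow> real"
  assumes t: "0 \<le> t" "t < real T" and "l0 \<le> L" and e: "\<And>l. e l \<ge> 0"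
    and incr: "\<And>l j. l0 < l \<Longrightarrow> l \<le> L \<Longrightarrow> j < T * 2 ^ l \<Longrightarrow> \<bar>x (real (Suc j) / 2 ^ l) - x (real j / 2 ^ l)\<bar> \<le> e l"
  shows "\<bar>x (dyadic_floor L t) - x (dyadic_floor l0 t)\<bar> \<le> (\<Sum>l\<in>{l0<..L}. e l)"
  using \<open>l0 \<le> L\<close> incr
proof (induction rule: dec_induct)
  case base
  then show ?case by simp
next
  case (step n)
  have IH: "\<bar>x (dyadic_floor n t) - x (dyadic_floor l0 t)\<bar> \<le> (\<Sum>l\<in>{l0<..n}. e l)"
    by (rule step.IH) (use step.prems in auto)
  obtain j where j: "dyadic_floor n t = real j / 2 ^ n" "real j \<le> 2 ^ n * t"
    "dyadic_floor (Suc n) t = real (2 * j) / 2 ^ Suc n \<or> dyadic_floor (Suc n) t = real (Suc (2 * j)) / 2 ^ Suc n"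
    using dyadic_floor_Suc[OF t(1)] by blast
  have "real j < 2 ^ n * real T" using j(2) t(2) by (meson le_less_trans mult_strict_left_mono zero_less_numeral zero_less_power)
  then have "real j < real (2 ^ n * T)" by simp
  then have "2 * j < T * 2 ^ Suc n" by (simp only: of_nat_less_iff) (simp add: mult.commute)
  then have inc: "\<bar>x (real (Suc (2 * j)) / 2 ^ Suc n) - x (real (2 * j) / 2 ^ Suc n)\<bar> \<le> e (Suc n)"
    using step.hyps by (intro step.prems) auto
  have same: "real (2 * j) / 2 ^ Suc n = dyadic_floor n t" unfolding j(1) by simp
  have "\<bar>x (dyadic_floor (Suc n) t) - x (dyadic_floor n t)\<bar> \<le> e (Suc n)"
    using j(3) inc e[of "Suc n"] unfolding same by auto
  moreover have "{l0<..Suc n} = insert (Suc n) {l0<..n}" using step.hyps by auto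
  ultimately show ?case using IH by simp
qed

text \<open>Any \<open>r < 1\<close> with \<open>2 * r ^ 4 > 1\<close> would serve. The thresholds
  \<open>r ^ l\<close> are summable, and so is the union bound over about \<open>2 ^ l\<close>
  increments with fourth moments of order \<open>(1 / 2 ^ l)\<^sup>2\<close>, whose ratio is
  \<open>1 / (2 * r ^ 4) = 5000 / 6561\<close>.\<close>

definition chain_rate :: real where "chain_rate = 9 / 10"

text \<open>The factor 9 is \<open>r / (1 - r)\<close> for \<open>r = 9 / 10\<close>.\<close>

lemma sum_chain_rate: "l0 \<le> L \<Longrightarrow> (\<Sum>l\<in>{l0<..L}. chain_rate ^ l) \<le> 9 * chain_rate ^ l0"
proof -
  assume "l0 \<le> L"
  then have "(\<Sum>l\<in>{l0<..L}. chain_rate ^ l) = 9 * (chain_rate ^ l0 - chain_rate ^ L)"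
  proof (induction rule: dec_induct)
    case (step n)
    have "{l0<..Suc n} = insert (Suc n) {l0<..n}" using step.hyps by auto
    then show ?case using step.IH by (simp add: chain_rate_def)
  qed simp
  also have "\<dots> \<le> 9 * chain_rate ^ l0" by (simp add: chain_rate_def)
  finally show ?thesis .
qed

text \<open>The exact factor of the geometric tail is \<open>5000 / 1561\<close>, rounded up to
  4.\<close>

lemma sum_tail_rate: "l0 \<le> n \<Longrightarrow> (\<Sum>l\<in>{l0<..n}. (5000 / 6561 :: real) ^ l) \<le> 4 * (5000 / 6561) ^ l0"
proof -
  assume "l0 \<le> n"
  then have "(\<Sum>l\<in>{l0<..n}. (5000 / 6561 :: real) ^ l) = 5000 / 1561 * ((5000 / 6561) ^ l0 - (5000 / 6561) ^ n)"
  proof (induction rule: dec_induct)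
    case (step n)
    have "{l0<..Suc n} = insert (Suc n) {l0<..n}" using step.hyps by auto
    then show ?case using step.IH by simp
  qed simp
  also have "\<dots> \<le> 4 * (5000 / 6561) ^ l0"
  proof -
    have *: "5000 / 1561 * (x - y) \<le> 4 * x" if "0 \<le> x" "0 \<le> y" for x y :: real using that by simp
    show ?thesis by (rule *) simp_all
  qed
  finally show ?thesis .
qed

text \<open>The union bound at level \<open>l\<close>: number of cells per unit time, times the
  order of the fourth moments, divided by the fourth power of the threshold.\<close>

lemma chain_rate_tail: "2 ^ l * ((1 / 2 ^ l)\<^sup>2 / (chain_rate ^ l) ^ 4) = (5000 / 6561) ^ l"
proof -
  have e: "(5000 / 6561 :: real) = 1 / (2 * chain_rate ^ 4)" by (simp add: chain_rate_def power_divide)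
  have "(5000 / 6561 :: real) ^ l = (1 / (2 * chain_rate ^ 4)) ^ l" by (simp only: e)
  also have "\<dots> = 1 / (2 ^ l * (chain_rate ^ l) ^ 4)"
    by (simp add: power_one_over power_mult_distrib power_mult[symmetric] mult.commute)
  finally have "(5000 / 6561 :: real) ^ l = 1 / (2 ^ l * (chain_rate ^ l) ^ 4)" .
  then show ?thesis by (simp add: power2_eq_square)
qed

text \<open>The second alternative is stated with unordered pairs, so that it is symmetric in
  \<open>s\<close> and \<open>t\<close>.\<close>

lemma dyadic_adjacent:
  assumes "0 \<le> s" "0 \<le> t" "\<bar>s - t\<bar> < 1 / 2 ^ l"
  shows "dyadic_floor l s = dyadic_floor l t \<or>
    (\<exists>j. real j \<le> 2 ^ l * max s t \<and> {dyadic_floor l s, dyadic_floor l t} = {real j / 2 ^ l, real (Suc j) / 2 ^ l})"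
proof -
  have "\<bar>2 ^ l * s - 2 ^ l * t\<bar> < 1"
  proof -
    have "\<bar>2 ^ l * s - 2 ^ l * t\<bar> = 2 ^ l * \<bar>s - t\<bar>" by (simp add: right_diff_distrib[symmetric] abs_mult)
    also have "\<dots> < 2 ^ l * (1 / 2 ^ l)" by (rule mult_strict_left_mono[OF assms(3)]) simp
    finally show ?thesis by simp
  qed
  then have "\<lfloor>2 ^ l * s\<rfloor> = \<lfloor>2 ^ l * t\<rfloor> \<or> \<lfloor>2 ^ l * s\<rfloor> = \<lfloor>2 ^ l * t\<rfloor> + 1 \<or> \<lfloor>2 ^ l * t\<rfloor> = \<lfloor>2 ^ l * s\<rfloor> + 1"
    by linarith
  moreover have st: "0 \<le> \<lfloor>2 ^ l * s\<rfloor>" "0 \<le> \<lfloor>2 ^ l * t\<rfloor>" using assms by simp_all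
  moreover have fl: "real_of_int \<lfloor>2 ^ l * s\<rfloor> \<le> 2 ^ l * max s t" "real_of_int \<lfloor>2 ^ l * t\<rfloor> \<le> 2 ^ l * max s t"
  proof -
    have "2 ^ l * s \<le> 2 ^ l * max s t" "2 ^ l * t \<le> 2 ^ l * max s t" by (intro mult_left_mono; simp)+
    then show "real_of_int \<lfloor>2 ^ l * s\<rfloor> \<le> 2 ^ l * max s t" "real_of_int \<lfloor>2 ^ l * t\<rfloor> \<le> 2 ^ l * max s t"
      using of_int_floor_le order_trans by blast+
  qed
  ultimately consider "\<lfloor>2 ^ l * s\<rfloor> = \<lfloor>2 ^ l * t\<rfloor>" | "\<lfloor>2 ^ l * s\<rfloor> = \<lfloor>2 ^ l * t\<rfloor> + 1" | "\<lfloor>2 ^ l * t\<rfloor> = \<lfloor>2 ^ l * s\<rfloor> + 1"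
    by blast
  then show ?thesis
  proof cases
    case 1 then show ?thesis by (simp add: dyadic_floor_def)
  next
    case 2
    then have "{dyadic_floor l s, dyadic_floor l t} = {real (nat \<lfloor>2 ^ l * t\<rfloor>) / 2 ^ l, real (Suc (nat \<lfloor>2 ^ l * t\<rfloor>)) / 2 ^ l}"
      using st by (auto simp: dyadic_floor_def)
    moreover have "real (nat \<lfloor>2 ^ l * t\<rfloor>) \<le> 2 ^ l * max s t" using fl(2) st(2) by simp
    ultimately show ?thesis by blast
  next
    case 3
    then have "{dyadic_floor l s, dyadic_floor l t} = {real (nat \<lfloor>2 ^ l * s\<rfloor>) / 2 ^ l, real (Suc (nat \<lfloor>2 ^ l * s\<rfloor>)) / 2 ^ l}"
      using st by (auto simp: dyadic_floor_def)
    moreover have "real (nat \<lfloor>2 ^ l * s\<rfloor>) \<le> 2 ^ l * max s t" using fl(1) st(1) by simp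
    ultimately show ?thesis by blast
  qed
qed

text \<open>The event delivered by Borel-Cantelli. It involves countably many times only, which
  makes it measurable.\<close>

definition chained :: "(real \<Rightarrow> real) \<Rightarrow> bool" where
  "chained x \<longleftrightarrow> (\<forall>T::nat. \<exists>l0. \<forall>l\<ge>l0. \<forall>j<T * 2 ^ l. \<bar>x (real (Suc j) / 2 ^ l) - x (real j / 2 ^ l)\<bar> \<le> chain_rate ^ l)"

lemma chain_rate_tendsto: "(\<lambda>l. C * chain_rate ^ l) \<longlonglongrightarrow> 0"
  using tendsto_mult_right_zero[OF LIMSEQ_realpow_zero[of chain_rate], of C] by (simp add: chain_rate_def)

text \<open>Chaining makes the values along \<open>dyadic_floor l t\<close> Cauchy, uniformly on
  bounded intervals. Two times closer than the mesh lie in equal or adjacent cells, so one more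
  increment compares them and gives continuity of the limit.\<close>

lemma chained_limit:
  assumes x: "chained x"
  defines "g \<equiv> \<lambda>t. lim (\<lambda>l. x (dyadic_floor l t))"
  shows "\<And>t. t \<ge> 0 \<Longrightarrow> (\<lambda>l. x (dyadic_floor l t)) \<longlonglongrightarrow> g t" "continuous_on {0..} g"
proof -
  have r: "0 \<le> chain_rate" by (simp add: chain_rate_def)
  have est: "\<exists>l0. \<forall>l\<ge>l0. \<forall>L\<ge>l. \<forall>t. 0 \<le> t \<longrightarrow> t < real T \<longrightarrow>
      \<bar>x (dyadic_floor L t) - x (dyadic_floor l t)\<bar> \<le> 9 * chain_rate ^ l" for T :: nat
  proof -
    obtain l0 where l0: "\<And>l j. l \<ge> l0 \<Longrightarrow> j < T * 2 ^ l \<Longrightarrow> \<bar>x (real (Suc j) / 2 ^ l) - x (real j / 2 ^ l)\<bar> \<le> chain_rate ^ l"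
      using x unfolding chained_def by blast
    have "\<bar>x (dyadic_floor L t) - x (dyadic_floor l t)\<bar> \<le> 9 * chain_rate ^ l"
      if "l \<ge> l0" "L \<ge> l" "0 \<le> t" "t < real T" for l L t
    proof -
      have "\<bar>x (dyadic_floor L t) - x (dyadic_floor l t)\<bar> \<le> (\<Sum>i\<in>{l<..L}. chain_rate ^ i)"
        by (rule dyadic_chain[where T=T]) (use that r l0 in auto)
      also have "\<dots> \<le> 9 * chain_rate ^ l" by (rule sum_chain_rate[OF that(2)])
      finally show ?thesis .
    qed
    then show ?thesis by blast
  qed
  show lim: "(\<lambda>l. x (dyadic_floor l t)) \<longlonglongrightarrow> g t" if t: "t \<ge> 0" for t
  proof -
    have tT: "t < real (nat \<lceil>t\<rceil> + 1)" by linarith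
    obtain l0 where l0: "\<And>l L. l \<ge> l0 \<Longrightarrow> L \<ge> l \<Longrightarrow> \<bar>x (dyadic_floor L t) - x (dyadic_floor l t)\<bar> \<le> 9 * chain_rate ^ l"
      using est[of "nat \<lceil>t\<rceil> + 1"] t tT by blast
    have "Cauchy (\<lambda>l. x (dyadic_floor l t))"
    proof (rule CauchyI')
      fix e :: real assume "e > 0"
      \<comment> \<open>Both indices are compared with \<open>m\<close>, at a cost of 9
        each.\<close>
      then have "\<forall>\<^sub>F l in sequentially. 18 * chain_rate ^ l < e \<and> l \<ge> l0"
        by (intro eventually_conj order_tendstoD(2)[OF chain_rate_tendsto] eventually_ge_at_top)
      then obtain m where m: "18 * chain_rate ^ m < e" "m \<ge> l0" by (auto simp: eventually_sequentially)
      have "dist (x (dyadic_floor m' t)) (x (dyadic_floor n t)) < e" if "m' \<ge> m" "n > m'" for m' n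
      proof -
        have "n \<ge> m" using that by simp
        then show ?thesis using l0[OF m(2) that(1)] l0[OF m(2), of n] m(1) by (simp add: dist_real_def)
      qed
      then show "\<exists>M. \<forall>m\<ge>M. \<forall>n>m. dist (x (dyadic_floor m t)) (x (dyadic_floor n t)) < e" by blast
    qed
    then show ?thesis unfolding g_def by (simp add: Cauchy_convergent_iff convergent_LIMSEQ_iff)
  qed
  show "continuous_on {0..} g"
    unfolding continuous_on_iff
  proof (intro ballI allI impI)
    fix t e :: real assume t: "t \<in> {0..}" and "e > 0"
    define T where "T = nat \<lceil>t\<rceil> + 2"
    have tT: "t + 1 < real T" unfolding T_def by linarith
    obtain l1 where l1: "\<And>l L t. l \<ge> l1 \<Longrightarrow> L \<ge> l \<Longrightarrow> 0 \<le> t \<Longrightarrow> t < real T \<Longrightarrow>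
        \<bar>x (dyadic_floor L t) - x (dyadic_floor l t)\<bar> \<le> 9 * chain_rate ^ l"
      using est[of T] by blast
    obtain l0 where l0: "\<And>l j. l \<ge> l0 \<Longrightarrow> j < T * 2 ^ l \<Longrightarrow> \<bar>x (real (Suc j) / 2 ^ l) - x (real j / 2 ^ l)\<bar> \<le> chain_rate ^ l"
      using x unfolding chained_def by blast
    \<comment> \<open>19 collects the chaining constant 9 for each of the two times and one
      increment between adjacent cells.\<close>
    have "\<forall>\<^sub>F l in sequentially. 19 * chain_rate ^ l < e \<and> l \<ge> max l0 l1"
      using \<open>e > 0\<close> by (intro eventually_conj order_tendstoD(2)[OF chain_rate_tendsto] eventually_ge_at_top)
    then obtain l where l: "19 * chain_rate ^ l < e" "l \<ge> l0" "l \<ge> l1" by (auto simp: eventually_sequentially)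
    have glim: "\<bar>g s - x (dyadic_floor l s)\<bar> \<le> 9 * chain_rate ^ l" if s: "0 \<le> s" "s < real T" for s
    proof (rule tendsto_upperbound)
      show "(\<lambda>L. \<bar>x (dyadic_floor L s) - x (dyadic_floor l s)\<bar>) \<longlonglongrightarrow> \<bar>g s - x (dyadic_floor l s)\<bar>"
        by (intro tendsto_intros lim s)
      show "\<forall>\<^sub>F L in sequentially. \<bar>x (dyadic_floor L s) - x (dyadic_floor l s)\<bar> \<le> 9 * chain_rate ^ l"
        using eventually_ge_at_top[of l] by eventually_elim (rule l1[OF l(3) _ s])
    qed simp
    have "dist (g s) (g t) < e" if s: "s \<in> {0..}" "dist s t < 1 / 2 ^ l" for s
    proof -
      have "dist s t < 1" using s(2) by (rule less_le_trans) simp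
      then have sT: "s < real T" "t < real T" using tT by (auto simp: dist_real_def)
      have "\<bar>x (dyadic_floor l s) - x (dyadic_floor l t)\<bar> \<le> chain_rate ^ l"
      proof -
        have "dyadic_floor l s = dyadic_floor l t \<or> (\<exists>j. real j \<le> 2 ^ l * max s t \<and>
            {dyadic_floor l s, dyadic_floor l t} = {real j / 2 ^ l, real (Suc j) / 2 ^ l})"
          by (rule dyadic_adjacent) (use s t in \<open>auto simp: dist_real_def\<close>)
        then show ?thesis
        proof (elim disjE exE conjE)
        assume "dyadic_floor l s = dyadic_floor l t" then show ?thesis using r by simp
      next
        fix j assume j: "real j \<le> 2 ^ l * max s t"
          "{dyadic_floor l s, dyadic_floor l t} = {real j / 2 ^ l, real (Suc j) / 2 ^ l}"
        have "2 ^ l * max s t < 2 ^ l * real T" using sT by simp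
        then have "real j < 2 ^ l * real T" using j(1) by (rule le_less_trans[rotated])
        then have "real j < real (T * 2 ^ l)" by (simp add: mult.commute)
        then have "j < T * 2 ^ l" by (simp only: of_nat_less_iff)
        from l0[OF l(2) this] show ?thesis using j(2) by (auto simp: doubleton_eq_iff abs_minus_commute)
        qed
      qed
      then have "\<bar>g s - g t\<bar> \<le> 9 * chain_rate ^ l + 9 * chain_rate ^ l + chain_rate ^ l"
        using glim[of s] glim[of t] s t sT by simp
      then show ?thesis using l(1) by (simp add: dist_real_def)
    qed
    then show "\<exists>d>0. \<forall>s\<in>{0..}. dist s t < d \<longrightarrow> dist (g s) (g t) < e"
      by (intro exI[of _ "1 / 2 ^ l"]) auto
  qed
qed

lemma borel_measurable_dyadic_limit:
  fixes Y :: "real \<Rightarrow> 'w \<Rightarrow> real"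
  assumes "\<And>d. Y d \<in> borel_measurable M" and "{w \<in> space M. chained (\<lambda>d. Y d w)} \<in> sets M" and "t \<ge> 0"
  shows "(\<lambda>w. if chained (\<lambda>d. Y d w) then lim (\<lambda>l. Y (dyadic_floor l t) w) else 0) \<in> borel_measurable M"
proof (rule borel_measurable_LIMSEQ_real)
  fix w assume "w \<in> space M"
  show "(\<lambda>l. if chained (\<lambda>d. Y d w) then Y (dyadic_floor l t) w else 0)
      \<longlonglongrightarrow> (if chained (\<lambda>d. Y d w) then lim (\<lambda>l. Y (dyadic_floor l t) w) else 0)"
    using chained_limit(1)[of "\<lambda>d. Y d w" t] \<open>t \<ge> 0\<close> by simp
next
  fix l
  note [measurable] = assms(1,2)
  show "(\<lambda>w. if chained (\<lambda>d. Y d w) then Y (dyadic_floor l t) w else 0) \<in> borel_measurable M"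
    by measurable
qed

lemma measurable_chained:
  fixes Y :: "real \<Rightarrow> 'w \<Rightarrow> real"
  assumes [measurable]: "\<And>d. Y d \<in> borel_measurable M"
  shows "{w \<in> space M. chained (\<lambda>d. Y d w)} \<in> sets M"
  unfolding chained_def by measurable

text \<open>Markov's inequality for fourth powers, a union bound over the \<open>T * 2 ^ l\<close>
  cells, and Borel-Cantelli; the assumed moment bound is the Kolmogorov criterion with exponents 4
  and 2.\<close>

lemma AE_chained:
  fixes Y :: "real \<Rightarrow> 'w \<Rightarrow> real"
  assumes "prob_space M" and [measurable]: "\<And>d. Y d \<in> borel_measurable M"
    and mom: "\<And>T::nat. \<exists>K. \<forall>l. \<forall>j<T * 2 ^ l.
      integrable M (\<lambda>w. (Y (real (Suc j) / 2 ^ l) w - Y (real j / 2 ^ l) w) ^ 4) \<and>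
      (\<integral>w. (Y (real (Suc j) / 2 ^ l) w - Y (real j / 2 ^ l) w) ^ 4 \<partial>M) \<le> K * (1 / 2 ^ l)\<^sup>2"
  shows "AE w in M. chained (\<lambda>d. Y d w)"
proof -
  interpret prob_space M by fact
  have "AE w in M. \<exists>l0. \<forall>l\<ge>l0. \<forall>j<T * 2 ^ l. \<bar>Y (real (Suc j) / 2 ^ l) w - Y (real j / 2 ^ l) w\<bar> \<le> chain_rate ^ l" for T :: nat
  proof -
    obtain K where K: "\<And>l j. j < T * 2 ^ l \<Longrightarrow> integrable M (\<lambda>w. (Y (real (Suc j) / 2 ^ l) w - Y (real j / 2 ^ l) w) ^ 4)"
      "\<And>l j. j < T * 2 ^ l \<Longrightarrow> (\<integral>w. (Y (real (Suc j) / 2 ^ l) w - Y (real j / 2 ^ l) w) ^ 4 \<partial>M) \<le> K * (1 / 2 ^ l)\<^sup>2"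
      using mom[of T] by blast
    define E where "E l = (\<Union>j<T * 2 ^ l. {w\<in>space M. chain_rate ^ l < \<bar>Y (real (Suc j) / 2 ^ l) w - Y (real j / 2 ^ l) w\<bar>})" for l
    have [measurable]: "E l \<in> sets M" for l unfolding E_def by measurable
    have "measure M (E l) \<le> (real T * K) * (5000 / 6561) ^ l" for l
    proof -
      have "measure M (E l) \<le> (\<Sum>j<T * 2 ^ l. measure M {w\<in>space M. chain_rate ^ l < \<bar>Y (real (Suc j) / 2 ^ l) w - Y (real j / 2 ^ l) w\<bar>})"
        unfolding E_def by (rule finite_measure_subadditive_finite) auto
      also have "\<dots> \<le> (\<Sum>j<T * 2 ^ l. K * (1 / 2 ^ l)\<^sup>2 / (chain_rate ^ l) ^ 4)"
        by (intro sum_mono fourth_moment_tail prob_space_axioms K) (auto simp: chain_rate_def)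
      also have "\<dots> = real T * K * (2 ^ l * ((1 / 2 ^ l)\<^sup>2 / (chain_rate ^ l) ^ 4))" by simp
      finally show ?thesis unfolding chain_rate_tail .
    qed
    note bound = this
    have "summable (\<lambda>l. measure M (E l))"
    proof (rule summable_comparison_test'[where N=0])
      show "summable (\<lambda>l. (real T * K) * (5000 / 6561) ^ l)"
        by (intro summable_mult summable_geometric) simp
      show "norm (measure M (E l)) \<le> (real T * K) * (5000 / 6561) ^ l" for l
        using bound[of l] by (simp only: real_norm_def abs_of_nonneg measure_nonneg)
    qed
    then have "AE w in M. \<forall>\<^sub>F l in sequentially. w \<in> space M - E l"
      by (intro borel_cantelli_AE1) (auto simp: emeasure_eq_measure)
    then show ?thesis
    proof eventually_elim
      case (elim w)
      then show ?case unfolding eventually_sequentially E_def by (force simp: not_less)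
    qed
  qed
  then show ?thesis unfolding chained_def by (simp add: AE_all_countable)
qed

text \<open>An enumeration with repetitions; \<open>dyadic_index\<close> then selects one index for
  each dyadic point.\<close>

definition dyadic_point :: "nat \<Rightarrow> real" where
  "dyadic_point i = (case prod_decode i of (j, l) \<Rightarrow> real j / 2 ^ l)"

definition dyadic_index :: "real \<Rightarrow> nat" where
  "dyadic_index d = (SOME i. dyadic_point i = d)"

lemma dyadic_point_index: "dyadic_point (dyadic_index (real j / 2 ^ l)) = real j / 2 ^ l"
  unfolding dyadic_index_def by (rule someI[of _ "prod_encode (j, l)"]) (simp add: dyadic_point_def)

lemma dyadic_point_index_floor: "t \<ge> 0 \<Longrightarrow> dyadic_point (dyadic_index (dyadic_floor l t)) = dyadic_floor l t"
  by (metis dyadic_floor_eq_nat dyadic_point_index)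

lemma dyadic_point_nonneg: "dyadic_point i \<ge> 0"
  by (simp add: dyadic_point_def split: prod.split)

text \<open>The covariance at the enumerated dyadic points is factorised and the factor applied to
  white noise. Increments are Gaussian, so \<open>incr\<close> bounds their fourth moments by
  \<open>3 * K\<^sup>2 * (t - s)\<^sup>2\<close> and chaining yields continuous paths;
  \<open>cont\<close> carries the characteristic functions from dyadic floors to all times.\<close>

lemma gaussian_process_exists:
  fixes R :: "real \<Rightarrow> real \<Rightarrow> real"
  assumes sym: "\<And>s t. R s t = R t s"
    and psd: "\<And>(N::nat) t a. (\<And>i. i < N \<Longrightarrow> t i \<ge> 0) \<Longrightarrow> 0 \<le> (\<Sum>i<N. \<Sum>j<N. a i * a j * R (t i) (t j))"
    and incr: "\<And>T. \<exists>K. \<forall>s\<in>{0..T}. \<forall>t\<in>{0..T}. R t t - 2 * R s t + R s s \<le> K * \<bar>t - s\<bar>"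
    and cont: "\<And>s t. s \<ge> 0 \<Longrightarrow> t \<ge> 0 \<Longrightarrow> (\<lambda>l. R (dyadic_floor l s) (dyadic_floor l t)) \<longlonglongrightarrow> R s t"
  shows "\<exists>G. centered_gaussian_process white_noise G \<and>
    (\<forall>w. continuous_on {0..} (\<lambda>t. G t w)) \<and> (\<forall>t\<ge>0. G t \<in> borel_measurable white_noise) \<and>
    (\<forall>(k::nat) t \<theta>. (\<forall>j<k. t j \<ge> 0) \<longrightarrow> (\<integral>w. iexp (\<Sum>j<k. \<theta> j * G (t j) w) \<partial>white_noise)
      = exp (- ((\<Sum>i<k. \<Sum>j<k. \<theta> i * \<theta> j * R (t i) (t j)) / 2)))"
proof -
  interpret W: prob_space white_noise by (rule prob_space_white_noise)
  note [measurable] = measurable_white_noise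
  have "pos_semidef (\<lambda>i j. R (dyadic_point i) (dyadic_point j))"
    unfolding pos_semidef_def using psd[of _ dyadic_point] sym dyadic_point_nonneg by blast
  then obtain v :: "nat \<Rightarrow> nat \<Rightarrow> real" where
    v: "\<And>i j n. i < n \<Longrightarrow> R (dyadic_point i) (dyadic_point j) = (\<Sum>k<n. v k i * v k j)"
    using pos_semidef_factorization by blast
  \<comment> \<open>The factorisations with \<open>k\<close> and with \<open>Suc k\<close> terms
    agree at \<open>i < k\<close>, so the additional square is 0. Hence the finite sum defining
    \<open>Y\<close> may be extended to any larger range.\<close>
  have v0: "v k i = 0" if "i < k" for i k
  proof -
    have "(\<Sum>k<k. v k i * v k i) = (\<Sum>k<Suc k. v k i * v k i)"
      using v[of i k i] v[of i "Suc k" i] that by simp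
    then show ?thesis by simp
  qed
  define Y where "Y d w = (\<Sum>k\<le>dyadic_index d. v k (dyadic_index d) * w (real k))" for d and w :: "real \<Rightarrow> real"
  have Ym[measurable]: "Y d \<in> borel_measurable white_noise" for d
    unfolding Y_def[abs_def] by measurable
  have Yn: "Y d w = (\<Sum>k<n. v k (dyadic_index d) * w (real k))" if "dyadic_index d < n" for d n w
    unfolding Y_def by (rule sum.mono_neutral_left) (use that v0 in auto)
  have charY: "(\<integral>w. iexp (\<Sum>j<m. \<theta> j * Y (d j) w) \<partial>white_noise)
      = exp (- ((\<Sum>i<m. \<Sum>j<m. \<theta> i * \<theta> j * R (d i) (d j)) / 2))"
    if d: "\<And>j. j < m \<Longrightarrow> dyadic_point (dyadic_index (d j)) = d j" for m :: nat and \<theta> d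
  proof -
    define n where "n = Suc (\<Sum>j<m. dyadic_index (d j))"
    have n: "dyadic_index (d j) < n" if "j < m" for j
      unfolding n_def less_Suc_eq_le by (rule member_le_sum) (use that in auto)
    define c where "c k = (\<Sum>j<m. \<theta> j * v k (dyadic_index (d j)))" for k
    have "(\<Sum>j<m. \<theta> j * Y (d j) w) = (\<Sum>k<n. c k * w (real k))" for w
    proof -
      have "(\<Sum>j<m. \<theta> j * Y (d j) w) = (\<Sum>j<m. \<Sum>k<n. \<theta> j * (v k (dyadic_index (d j)) * w (real k)))"
        by (rule sum.cong) (auto simp: Yn[OF n] sum_distrib_left)
      also have "\<dots> = (\<Sum>k<n. \<Sum>j<m. \<theta> j * (v k (dyadic_index (d j)) * w (real k)))" by (rule sum.swap)
      finally show ?thesis by (simp add: c_def sum_distrib_right mult.assoc)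
    qed
    moreover have "(\<Sum>k<n. (c k)\<^sup>2) = (\<Sum>i<m. \<Sum>j<m. \<theta> i * \<theta> j * R (d i) (d j))"
    proof -
      have "(\<Sum>k<n. (c k)\<^sup>2) = (\<Sum>k<n. \<Sum>i<m. \<Sum>j<m. (\<theta> i * v k (dyadic_index (d i))) * (\<theta> j * v k (dyadic_index (d j))))"
        by (simp add: c_def power2_eq_square sum_product)
      also have "\<dots> = (\<Sum>i<m. \<Sum>k<n. \<Sum>j<m. (\<theta> i * v k (dyadic_index (d i))) * (\<theta> j * v k (dyadic_index (d j))))"
        by (rule sum.swap)
      also have "\<dots> = (\<Sum>i<m. \<Sum>j<m. \<Sum>k<n. (\<theta> i * v k (dyadic_index (d i))) * (\<theta> j * v k (dyadic_index (d j))))"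
        by (intro sum.cong refl sum.swap)
      also have "\<dots> = (\<Sum>i<m. \<Sum>j<m. \<theta> i * \<theta> j * R (d i) (d j))"
      proof (intro sum.cong refl)
        fix i j assume ij: "i \<in> {..<m}" "j \<in> {..<m}"
        have "R (d i) (d j) = (\<Sum>k<n. v k (dyadic_index (d i)) * v k (dyadic_index (d j)))"
          using v[of "dyadic_index (d i)" n "dyadic_index (d j)"] n d ij by auto
        then show "(\<Sum>k<n. (\<theta> i * v k (dyadic_index (d i))) * (\<theta> j * v k (dyadic_index (d j)))) = \<theta> i * \<theta> j * R (d i) (d j)"
          by (simp add: sum_distrib_left mult_ac)
      qed
      finally show ?thesis .
    qed
    ultimately show ?thesis using char_white_noise[where c=c and n=n] by simp
  qed
  \<comment> \<open>The quadratic form with coefficients 1 at \<open>t\<close> and -1 at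
    \<open>s\<close>.\<close>
  have nonneg_incr: "0 \<le> R t t - 2 * R s t + R s s" if "s \<ge> 0" "t \<ge> 0" for s t
  proof -
    have "0 \<le> (\<Sum>i<2::nat. \<Sum>j<2::nat. (if i = 0 then 1 else -1) * (if j = 0 then 1 else -1)
        * R (if i = 0 then t else s) (if j = 0 then t else s))"
      by (rule psd[where t="\<lambda>i. if i = 0 then t else s" and a="\<lambda>i. if i = 0 then 1 else -1"]) (use that in auto)
    then show ?thesis using sym[of s t] by (simp add: numeral_2_eq_2)
  qed
  have charincr: "(\<integral>w. iexp (\<theta> * (Y d w - Y d' w)) \<partial>white_noise) = exp (- (\<theta>\<^sup>2 * (R d d - 2 * R d' d + R d' d') / 2))"
    if "dyadic_point (dyadic_index d) = d" "dyadic_point (dyadic_index d') = d'" for d d' \<theta>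
  proof -
    have "(\<integral>w. iexp (\<Sum>j<2::nat. (if j = 0 then \<theta> else - \<theta>) * Y (if j = 0 then d else d') w) \<partial>white_noise)
      = exp (- ((\<Sum>i<2::nat. \<Sum>j<2::nat. (if i = 0 then \<theta> else - \<theta>) * (if j = 0 then \<theta> else - \<theta>)
        * R (if i = 0 then d else d') (if j = 0 then d else d')) / 2))"
      by (rule charY) (use that in auto)
    moreover have "(\<Sum>j<2::nat. (if j = 0 then \<theta> else - \<theta>) * Y (if j = 0 then d else d') w) = \<theta> * (Y d w - Y d' w)" for w
      by (simp add: numeral_2_eq_2 algebra_simps)
    moreover have "(\<Sum>i<2::nat. \<Sum>j<2::nat. (if i = 0 then \<theta> else - \<theta>) * (if j = 0 then \<theta> else - \<theta>)
        * R (if i = 0 then d else d') (if j = 0 then d else d')) = \<theta>\<^sup>2 * (R d d - 2 * R d' d + R d' d')"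
      using sym[of d d'] by (simp add: numeral_2_eq_2 algebra_simps)
    ultimately show ?thesis by simp
  qed
  have chained: "AE w in white_noise. chained (\<lambda>d. Y d w)"
  proof (rule AE_chained[OF prob_space_white_noise])
    show "Y d \<in> borel_measurable white_noise" for d by (rule Ym)
    fix T :: nat
    obtain K where K: "\<And>s t. s \<in> {0..real T} \<Longrightarrow> t \<in> {0..real T} \<Longrightarrow> R t t - 2 * R s t + R s s \<le> K * \<bar>t - s\<bar>"
      using incr[of "real T"] by blast
    have "integrable white_noise (\<lambda>w. (Y (real (Suc j) / 2 ^ l) w - Y (real j / 2 ^ l) w) ^ 4) \<and>
      (\<integral>w. (Y (real (Suc j) / 2 ^ l) w - Y (real j / 2 ^ l) w) ^ 4 \<partial>white_noise) \<le> (3 * K\<^sup>2) * (1 / 2 ^ l)\<^sup>2"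
      if j: "j < T * 2 ^ l" for l j
    proof -
      let ?d = "real (Suc j) / 2 ^ l" and ?d' = "real j / 2 ^ l"
      define s where "s = R ?d ?d - 2 * R ?d' ?d + R ?d' ?d'"
      have s0: "0 \<le> s" unfolding s_def by (intro nonneg_incr; simp)
      have "real (Suc j) \<le> real (T * 2 ^ l)" using j by (simp only: of_nat_le_iff Suc_le_eq)
      then have jT: "?d \<le> real T" by (simp add: pos_divide_le_eq)
      have "?d' \<le> ?d" by (rule divide_right_mono) auto
      then have "s \<le> K * \<bar>?d - ?d'\<bar>" unfolding s_def using jT by (intro K) auto
      also have "?d - ?d' = 1 / 2 ^ l" by (simp add: diff_divide_distrib[symmetric])
      finally have s1: "s \<le> K * (1 / 2 ^ l)" by simp
      have mm: "(\<lambda>w. Y ?d w - Y ?d' w) \<in> borel_measurable white_noise" by measurable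
      note mom = char_gaussian_fourth_moment[OF prob_space_white_noise mm charincr[OF dyadic_point_index dyadic_point_index] s0[unfolded s_def]]
      have "s\<^sup>2 \<le> (K * (1 / 2 ^ l))\<^sup>2" using s0 s1 by (intro power_mono) auto
      then have "3 * s\<^sup>2 \<le> (3 * K\<^sup>2) * (1 / 2 ^ l)\<^sup>2" by (simp add: power_mult_distrib power_divide)
      then show ?thesis using mom unfolding s_def by simp
    qed
    then show "\<exists>K. \<forall>l. \<forall>j<T * 2 ^ l.
      integrable white_noise (\<lambda>w. (Y (real (Suc j) / 2 ^ l) w - Y (real j / 2 ^ l) w) ^ 4) \<and>
      (\<integral>w. (Y (real (Suc j) / 2 ^ l) w - Y (real j / 2 ^ l) w) ^ 4 \<partial>white_noise) \<le> K * (1 / 2 ^ l)\<^sup>2"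
      by blast
  qed
  \<comment> \<open>The value 0 off the good event makes every path continuous, not just almost
    every one.\<close>
  define G where "G t w = (if chained (\<lambda>d. Y d w) then lim (\<lambda>l. Y (dyadic_floor l t) w) else 0)" for t w
  have Gm: "G t \<in> borel_measurable white_noise" if "t \<ge> 0" for t
    unfolding G_def[abs_def] by (rule borel_measurable_dyadic_limit[OF Ym measurable_chained[OF Ym] that])
  have Gc: "continuous_on {0..} (\<lambda>t. G t w)" for w
    using chained_limit(2)[of "\<lambda>d. Y d w"] by (cases "chained (\<lambda>d. Y d w)") (auto simp: G_def)
  have Glim: "AE w in white_noise. \<forall>j<k. (\<lambda>l. Y (dyadic_floor l (t j)) w) \<longlonglongrightarrow> G (t j) w"
    if "\<And>j. j < k \<Longrightarrow> t j \<ge> 0" for k :: nat and t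
    using chained by eventually_elim (use that chained_limit(1) in \<open>auto simp: G_def\<close>)
  have charG: "(\<integral>w. iexp (\<Sum>j<k. \<theta> j * G (t j) w) \<partial>white_noise)
      = exp (- ((\<Sum>i<k. \<Sum>j<k. \<theta> i * \<theta> j * R (t i) (t j)) / 2))"
    if t: "\<And>j. j < k \<Longrightarrow> t j \<ge> 0" for k :: nat and t \<theta>
  proof (rule LIMSEQ_unique)
    have [measurable]: "(\<lambda>w. \<Sum>j<k. \<theta> j * G (t j) w) \<in> borel_measurable white_noise"
      by (intro borel_measurable_sum borel_measurable_times Gm t) auto
    show "(\<lambda>l. \<integral>w. iexp (\<Sum>j<k. \<theta> j * Y (dyadic_floor l (t j)) w) \<partial>white_noise)
        \<longlonglongrightarrow> (\<integral>w. iexp (\<Sum>j<k. \<theta> j * G (t j) w) \<partial>white_noise)"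
    proof (rule integral_dominated_convergence[where w="\<lambda>_. 1"])
      show "AE w in white_noise. (\<lambda>l. iexp (\<Sum>j<k. \<theta> j * Y (dyadic_floor l (t j)) w))
          \<longlonglongrightarrow> iexp (\<Sum>j<k. \<theta> j * G (t j) w)"
      proof -
        have "AE w in white_noise. \<forall>j<k. (\<lambda>l. Y (dyadic_floor l (t j)) w) \<longlonglongrightarrow> G (t j) w"
          by (rule Glim) (rule t)
        then show ?thesis
      proof eventually_elim
        case (elim w)
        then show ?case by (intro tendsto_intros) auto
      qed
      qed
    qed (auto simp: norm_exp_i_times simp del: of_real_sum)
    have "(\<integral>w. iexp (\<Sum>j<k. \<theta> j * Y (dyadic_floor l (t j)) w) \<partial>white_noise)
      = exp (- ((\<Sum>i<k. \<Sum>j<k. \<theta> i * \<theta> j * R (dyadic_floor l (t i)) (dyadic_floor l (t j))) / 2))" for l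
      by (rule charY) (use t in \<open>simp add: dyadic_point_index_floor\<close>)
    moreover have "(\<lambda>l. complex_of_real (exp (- ((\<Sum>i<k. \<Sum>j<k. \<theta> i * \<theta> j * R (dyadic_floor l (t i)) (dyadic_floor l (t j))) / 2))))
      \<longlonglongrightarrow> complex_of_real (exp (- ((\<Sum>i<k. \<Sum>j<k. \<theta> i * \<theta> j * R (t i) (t j)) / 2)))"
      by (intro tendsto_intros cont t) auto
    ultimately show "(\<lambda>l. \<integral>w. iexp (\<Sum>j<k. \<theta> j * Y (dyadic_floor l (t j)) w) \<partial>white_noise)
        \<longlonglongrightarrow> exp (- ((\<Sum>i<k. \<Sum>j<k. \<theta> i * \<theta> j * R (t i) (t j)) / 2))" by simp
  qed
  have "centered_gaussian_process white_noise G"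
    unfolding centered_gaussian_process_def
  proof (intro allI impI)
    fix I :: "real set" and a :: "real \<Rightarrow> real" assume I: "finite I \<and> I \<subseteq> {0..}"
    then obtain h where h: "bij_betw h {..<card I} I"
      using ex_bij_betw_nat_finite[of I] by (auto simp: lessThan_atLeast0)
    have hI: "h j \<in> I" if "j < card I" for j using h that by (auto simp: bij_betw_def)
    have h0: "h j \<ge> 0" if "j < card I" for j using hI[OF that] I by auto
    let ?v = "\<Sum>i<card I. \<Sum>j<card I. a (h i) * a (h j) * R (h i) (h j)"
    have S: "(\<Sum>t\<in>I. a t * G t w) = (\<Sum>j<card I. a (h j) * G (h j) w)" for w
      using sum.reindex_bij_betw[OF h, of "\<lambda>t. a t * G t w"] by simp
    show "centered_gaussian white_noise (\<lambda>w. \<Sum>t\<in>I. a t * G t w)"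
    proof (rule char_gaussian_imp_centered_gaussian[OF prob_space_white_noise])
      show "(\<lambda>w. \<Sum>t\<in>I. a t * G t w) \<in> borel_measurable white_noise"
        using I by (intro borel_measurable_sum borel_measurable_times Gm) auto
      show "0 \<le> ?v" by (rule psd[where t=h and a="\<lambda>i. a (h i)"]) (use h0 in auto)
      fix \<theta>
      have "(\<integral>w. iexp (\<Sum>j<card I. (\<theta> * a (h j)) * G (h j) w) \<partial>white_noise)
        = exp (- ((\<Sum>i<card I. \<Sum>j<card I. (\<theta> * a (h i)) * (\<theta> * a (h j)) * R (h i) (h j)) / 2))"
        by (rule charG) (use h0 in auto)
      moreover have "(\<Sum>j<card I. (\<theta> * a (h j)) * G (h j) w) = \<theta> * (\<Sum>t\<in>I. a t * G t w)" for w
        unfolding S by (simp add: sum_distrib_left mult_ac)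
      moreover have "(\<Sum>i<card I. \<Sum>j<card I. (\<theta> * a (h i)) * (\<theta> * a (h j)) * R (h i) (h j)) = \<theta>\<^sup>2 * ?v"
        by (simp add: sum_distrib_left power2_eq_square mult_ac)
      ultimately show "(\<integral>w. iexp (\<theta> * (\<Sum>t\<in>I. a t * G t w)) \<partial>white_noise) = exp (- (\<theta>\<^sup>2 * ?v / 2))" by simp
    qed
  qed
  then show ?thesis using Gc Gm charG by blast
qed

section \<open>Service laws and ergodic averages\<close>

locale service_density =
  fixes \<rho> :: "real \<Rightarrow> real \<Rightarrow> real" and \<alpha> c C :: real
  assumes c_pos: "c > 0" and C_pos: "C > 0"
    and \<rho>_measurable: "\<And>s. s \<ge> 0 \<Longrightarrow> set_borel_measurable borel {0..} (\<rho> s)"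
    and \<rho>_nonneg: "\<And>s r. s \<ge> 0 \<Longrightarrow> r \<ge> 0 \<Longrightarrow> \<rho> s r \<ge> 0"
    and \<rho>_prob: "\<And>s. s \<ge> 0 \<Longrightarrow> prob_space (service_law \<rho> s)"
    and \<rho>_bounds: "\<And>r s. r > 0 \<Longrightarrow> s > 0 \<Longrightarrow>
      c * min (r powr (- 1 - \<alpha>)) 1 \<le> \<rho> s r \<and> \<rho> s r \<le> C * min (r powr (- 1 - \<alpha>)) 1"
    and \<rho>_deriv: "\<And>r s. r > 0 \<Longrightarrow> s > 0 \<Longrightarrow>
      \<exists>D. ((\<lambda>u. \<rho> u r) has_real_derivative D) (at s) \<and> D \<le> C * min (r powr (- 1 - \<alpha>)) 1"
begin

abbreviation "hmin r \<equiv> min (r powr (- 1 - \<alpha>)) (1::real)"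

text \<open>\<open>\<rho> s\<close> is constrained only on \<open>{0..}\<close>; this version is a
  density on the whole line.\<close>

definition dens :: "real \<Rightarrow> real \<Rightarrow> real" where
  "dens s r = indicator {0..} r * \<rho> s r"

lemma dens_measurable: "s \<ge> 0 \<Longrightarrow> dens s \<in> borel_measurable borel"
  using \<rho>_measurable[of s] by (simp add: set_borel_measurable_def dens_def[abs_def])

lemma dens_nonneg: "s \<ge> 0 \<Longrightarrow> dens s r \<ge> 0"
  using \<rho>_nonneg[of s r] by (simp add: dens_def indicator_def)

lemma service_law_dens: "service_law \<rho> s = density lborel (\<lambda>r. ennreal (dens s r))"
  by (simp add: service_law_def dens_def)

lemma nn_integral_dens:
  assumes "s \<ge> 0"
  shows "(\<integral>\<^sup>+r. ennreal (dens s r) \<partial>lborel) = 1"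
proof -
  note [measurable] = dens_measurable[OF assms]
  have "emeasure (service_law \<rho> s) (space (service_law \<rho> s)) = 1"
    using \<rho>_prob[OF assms] by (rule prob_space.emeasure_space_1)
  then show ?thesis unfolding service_law_dens by (simp add: emeasure_density)
qed

lemma integrable_dens: "s \<ge> 0 \<Longrightarrow> integrable lborel (dens s)"
  using dens_measurable[of s] nn_integral_dens[of s] dens_nonneg[of s]
  by (intro integrableI_nonneg) auto

lemma integral_dens: "s \<ge> 0 \<Longrightarrow> (\<integral>r. dens s r \<partial>lborel) = 1"
  using nn_integral_dens[of s] dens_nonneg[of s] dens_measurable[of s]
  by (subst integral_eq_nn_integral) auto

lemma measure_service_law:
  assumes s: "s \<ge> 0" and B[measurable]: "B \<in> sets borel"
  shows "measure (service_law \<rho> s) B = (\<integral>r. indicator B r * dens s r \<partial>lborel)"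
    and "integrable lborel (\<lambda>r. indicator B r * dens s r)"
proof -
  note [measurable] = dens_measurable[OF s]
  show i: "integrable lborel (\<lambda>r. indicator B r * dens s r)"
    by (rule Bochner_Integration.integrable_bound[OF integrable_dens[OF s]])
      (use dens_nonneg[OF s] in \<open>auto simp: indicator_def\<close>)
  have "emeasure (service_law \<rho> s) B = (\<integral>\<^sup>+r. ennreal (indicator B r * dens s r) \<partial>lborel)"
    unfolding service_law_dens by (subst emeasure_density) (auto intro!: nn_integral_cong split: split_indicator)
  also have "\<dots> = ennreal (\<integral>r. indicator B r * dens s r \<partial>lborel)"
    by (rule nn_integral_eq_integral[OF i]) (use dens_nonneg[OF s] in auto)
  finally show "measure (service_law \<rho> s) B = (\<integral>r. indicator B r * dens s r \<partial>lborel)"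
    unfolding measure_def using dens_nonneg[OF s] by (simp add: enn2real_ennreal integral_nonneg_AE)
qed

text \<open>The lower bound on the density makes its upper envelope integrable.\<close>

lemma hmin_integrable: "integrable lborel (\<lambda>r. indicator {0<..} r * hmin r)"
  and hmin_integral: "(\<integral>r. indicator {0<..} r * hmin r \<partial>lborel) \<le> 1 / c"
proof -
  have 1: "\<bar>indicator {0<..} r * hmin r\<bar> \<le> dens 1 r / c" for r
    using \<rho>_bounds[of r 1] c_pos dens_nonneg[of 1 r] by (auto simp: indicator_def dens_def field_simps)
  have i: "integrable lborel (\<lambda>r. dens 1 r / c)" using integrable_dens[of 1] by simp
  show i2: "integrable lborel (\<lambda>r. indicator {0<..} r * hmin r)"
    by (rule Bochner_Integration.integrable_bound[OF i], measurable, intro AE_I2,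
        simp only: real_norm_def, rule order_trans[OF 1 abs_ge_self])
  have "(\<integral>r. indicator {0<..} r * hmin r \<partial>lborel) \<le> (\<integral>r. dens 1 r / c \<partial>lborel)"
    by (rule integral_mono[OF i2 i]) (use 1 in \<open>auto intro: order_trans[OF abs_ge_self]\<close>)
  then show "(\<integral>r. indicator {0<..} r * hmin r \<partial>lborel) \<le> 1 / c"
    using integral_dens[of 1] by simp
qed

text \<open>The mean value theorem with an upper bound for the derivative, hence a one-sided
  estimate.\<close>

lemma \<rho>_increment:
  assumes "0 < s" "s \<le> s'" "r > 0"
  shows "\<rho> s' r - \<rho> s r \<le> C * hmin r * (s' - s)"
proof (cases "s = s'")
  case False
  obtain D where D: "\<And>x. x > 0 \<Longrightarrow> ((\<lambda>u. \<rho> u r) has_real_derivative D x) (at x)" "\<And>x. x > 0 \<Longrightarrow> D x \<le> C * hmin r"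
    using \<rho>_deriv[OF \<open>r > 0\<close>] by metis
  have "\<exists>z>s. z < s' \<and> \<rho> s' r - \<rho> s r = (s' - s) * D z"
    by (rule MVT2) (use False assms D in auto)
  then obtain z where z: "z > s" "\<rho> s' r - \<rho> s r = (s' - s) * D z" by blast
  have "(s' - s) * D z \<le> (s' - s) * (C * hmin r)" using assms D(2)[of z] z by (intro mult_left_mono) auto
  then show ?thesis using z by (simp add: mult_ac)
qed simp

text \<open>The pointwise increments are integrated; \<open>1 / c\<close> is the bound for the
  integral of the envelope.\<close>

lemma service_law_increment:
  assumes s: "0 < s" "s \<le> s'" and B[measurable]: "B \<in> sets borel"
  shows "measure (service_law \<rho> s') B - measure (service_law \<rho> s) B \<le> C / c * (s' - s)"
proof -
  have s0: "s \<ge> 0" "s' \<ge> 0" using s by auto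
  note m = measure_service_law[OF s0(1) B] measure_service_law[OF s0(2) B]
  have "measure (service_law \<rho> s') B - measure (service_law \<rho> s) B
    = (\<integral>r. indicator B r * dens s' r - indicator B r * dens s r \<partial>lborel)"
    using m by simp
  also have "\<dots> \<le> (\<integral>r. (C * (s' - s)) * (indicator {0<..} r * hmin r) \<partial>lborel)"
  proof (rule integral_mono_AE)
    show "AE r in lborel. indicator B r * dens s' r - indicator B r * dens s r \<le> (C * (s' - s)) * (indicator {0<..} r * hmin r)"
      using AE_lborel_singleton[of "0::real"]
    proof eventually_elim
      case (elim r)
      show ?case
      proof (cases "r > 0")
        case True
        have "0 \<le> C * hmin r * (s' - s)" using C_pos s by simp
        then show ?thesis using \<rho>_increment[OF s True] True by (auto simp: indicator_def dens_def mult_ac)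
      next
        case False
        then show ?thesis using elim by (auto simp: indicator_def dens_def)
      qed
    qed
  qed (use m hmin_integrable in auto)
  also have "\<dots> = C * (s' - s) * (\<integral>r. indicator {0<..} r * hmin r \<partial>lborel)" by (rule integral_mult_right_zero)
  also have "\<dots> \<le> C * (s' - s) * (1 / c)" by (rule mult_left_mono[OF hmin_integral]) (use C_pos s in auto)
  finally show ?thesis by (simp add: mult_ac)
qed

text \<open>The derivative is bounded from above only; passing to complements gives the other side.\<close>

lemma service_law_lipschitz:
  assumes s: "0 < s" "0 < s'" and B[measurable]: "B \<in> sets borel"
  shows "\<bar>measure (service_law \<rho> s') B - measure (service_law \<rho> s) B\<bar> \<le> C / c * \<bar>s' - s\<bar>"
proof -
  have main: "\<bar>measure (service_law \<rho> s') B - measure (service_law \<rho> s) B\<bar> \<le> C / c * (s' - s)"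
    if s: "0 < s" "s \<le> s'" for s s'
  proof -
    have compl: "measure (service_law \<rho> x) (- B) = 1 - measure (service_law \<rho> x) B" if "x > 0" for x
    proof -
      interpret prob_space "service_law \<rho> x" by (rule \<rho>_prob) (use that in simp)
      have "space (service_law \<rho> x) = UNIV" "B \<in> events" by (auto simp: service_law_def)
      then show ?thesis using prob_compl[of B] by (simp add: Compl_eq_Diff_UNIV)
    qed
    have "measure (service_law \<rho> s') (- B) - measure (service_law \<rho> s) (- B) \<le> C / c * (s' - s)"
      by (rule service_law_increment[OF that]) simp
    then show ?thesis using service_law_increment[OF that B] compl[of s] compl[of s'] s by simp
  qed
  show ?thesis
  proof (cases "s \<le> s'")
    case True then show ?thesis using main[OF s(1)] by simp
  next
    case False then show ?thesis using main[OF s(2), of s] by (simp add: abs_minus_commute)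
  qed
qed

text \<open>The map is Lipschitz for \<open>s > 0\<close>; the bounds do not connect the law at
  \<open>s = 0\<close> with the others, so that single point is added by hand.\<close>

lemma service_law_measurable:
  assumes B: "B \<in> sets borel"
  shows "(\<lambda>s. indicator {0..} s * measure (service_law \<rho> s) B) \<in> borel_measurable borel"
proof -
  have "continuous_on {0<..} (\<lambda>s. measure (service_law \<rho> s) B)"
    unfolding continuous_on_iff
  proof (intro ballI allI impI)
    fix s e :: real assume s: "s \<in> {0<..}" and "e > 0"
    have K: "C / c > 0" using C_pos c_pos by simp
    have "dist (measure (service_law \<rho> s') B) (measure (service_law \<rho> s) B) < e"
      if "s' \<in> {0<..}" "dist s' s < e / (C / c)" for s'
    proof -
      have "C / c * \<bar>s' - s\<bar> < C / c * (e / (C / c))" using that K by (intro mult_strict_left_mono) (auto simp: dist_real_def)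
      also have "C / c * (e / (C / c)) = e" using K by (metis nonzero_mult_div_cancel_left order_less_irrefl times_divide_eq_right)
      finally have "C / c * \<bar>s' - s\<bar> < e" .
      moreover have "\<bar>measure (service_law \<rho> s') B - measure (service_law \<rho> s) B\<bar> \<le> C / c * \<bar>s' - s\<bar>"
        by (rule service_law_lipschitz) (use s that B in auto)
      ultimately show ?thesis unfolding dist_real_def by (rule le_less_trans[rotated])
    qed
    then show "\<exists>d>0. \<forall>s'\<in>{0<..}. dist s' s < d \<longrightarrow> dist (measure (service_law \<rho> s') B) (measure (service_law \<rho> s) B) < e"
      using divide_pos_pos[OF \<open>e > 0\<close> K] by blast
  qed
  from borel_measurable_continuous_on_indicator[OF _ this]
  have [measurable]: "(\<lambda>s. indicator {0<..} s *\<^sub>R measure (service_law \<rho> s) B) \<in> borel_measurable borel" by simp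
  have "(\<lambda>s. indicator {0<..} s *\<^sub>R measure (service_law \<rho> s) B + indicator {0} s * measure (service_law \<rho> 0) B) \<in> borel_measurable borel"
    by measurable
  also have "(\<lambda>s. indicator {0<..} s *\<^sub>R measure (service_law \<rho> s) B + indicator {0} s * measure (service_law \<rho> 0) B)
    = (\<lambda>s. indicator {0..} s * measure (service_law \<rho> s) B)" by (auto simp: indicator_def fun_eq_iff)
  finally show ?thesis .
qed

lemma dens_le: "s > 0 \<Longrightarrow> r \<noteq> 0 \<Longrightarrow> dens s r \<le> C"
proof -
  assume s: "s > 0" and r: "r \<noteq> 0"
  show "dens s r \<le> C"
  proof (cases "r > 0")
    case True
    have "C * hmin r \<le> C * 1" using C_pos by (intro mult_left_mono) auto
    then show ?thesis using \<rho>_bounds[OF True s] True by (simp add: dens_def)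
  next
    case False
    then show ?thesis using r C_pos by (simp add: dens_def)
  qed
qed

lemma service_law_interval:
  assumes s: "s > 0" and ab: "a \<le> b"
  shows "measure (service_law \<rho> s) {a<..b} \<le> C * (b - a)"
proof -
  have "measure (service_law \<rho> s) {a<..b} = (\<integral>r. indicator {a<..b} r * dens s r \<partial>lborel)"
    using s by (intro measure_service_law) auto
  also have "\<dots> \<le> (\<integral>r. indicator {a<..b} r * C \<partial>lborel)"
  proof (rule integral_mono_AE)
    show "AE r in lborel. indicator {a<..b} r * dens s r \<le> indicator {a<..b} r * C"
      using AE_lborel_singleton[of "0::real"] by eventually_elim (use dens_le[OF s] in \<open>auto simp: indicator_def\<close>)
    show "integrable lborel (\<lambda>r. indicator {a<..b} r * C)"
      by (intro integrable_mult_left integrable_real_indicator) (auto simp: emeasure_lborel_Ioc ab)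
    show "integrable lborel (\<lambda>r. indicator {a<..b} r * dens s r)"
      using s by (intro measure_service_law) auto
  qed
  also have "\<dots> = C * (b - a)" using ab by simp
  finally show ?thesis .
qed

text \<open>A law with a density gives no mass to points, so the closed half-line of
  \<open>service_tail\<close> may be opened; the open form matches the strict inequality in
  \<open>active_jobs\<close>.\<close>

lemma service_tail_eq:
  assumes s: "s \<ge> 0" and r: "r \<ge> 0"
  shows "service_tail \<rho> s r = measure (service_law \<rho> s) {r<..}"
proof -
  have "service_tail \<rho> s r = (\<integral>\<tau>. indicator {r..} \<tau> * dens s \<tau> \<partial>lborel)"
    unfolding service_tail_def set_lebesgue_integral_def
    by (rule Bochner_Integration.integral_cong) (use r in \<open>auto simp: dens_def indicator_def\<close>)
  also have "\<dots> = (\<integral>\<tau>. indicator {r<..} \<tau> * dens s \<tau> \<partial>lborel)"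
  proof (rule integral_cong_AE)
    note [measurable] = dens_measurable[OF s]
    show "(\<lambda>\<tau>. indicator {r..} \<tau> * dens s \<tau>) \<in> borel_measurable lborel" by measurable
    show "(\<lambda>\<tau>. indicator {r<..} \<tau> * dens s \<tau>) \<in> borel_measurable lborel" by measurable
    show "AE \<tau> in lborel. indicator {r..} \<tau> * dens s \<tau> = indicator {r<..} \<tau> * dens s \<tau>"
      using AE_lborel_singleton[of r] by eventually_elim (auto simp: indicator_def)
  qed
  also have "\<dots> = measure (service_law \<rho> s) {r<..}" by (rule measure_service_law(1)[OF s, symmetric]) simp
  finally show ?thesis .
qed

lemma service_tail_bounds: "s \<ge> 0 \<Longrightarrow> r \<ge> 0 \<Longrightarrow> 0 \<le> service_tail \<rho> s r \<and> service_tail \<rho> s r \<le> 1"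
  using prob_space.prob_le_1[OF \<rho>_prob, of s] by (simp add: service_tail_eq)

text \<open>The first term comes from the dependence of the law on the arrival time, the second from
  the bound \<open>C\<close> on the density.\<close>

lemma service_tail_lipschitz:
  assumes s: "0 < s" "0 < s'" and r: "0 \<le> r" "0 \<le> r'"
  shows "\<bar>service_tail \<rho> s r - service_tail \<rho> s' r'\<bar> \<le> C / c * \<bar>s - s'\<bar> + C * \<bar>r - r'\<bar>"
proof -
  have 1: "\<bar>service_tail \<rho> s r - service_tail \<rho> s' r\<bar> \<le> C / c * \<bar>s - s'\<bar>"
    using service_law_lipschitz[of s' s "{r<..}"] s r by (simp add: service_tail_eq)
  have mono: "\<bar>service_tail \<rho> s' a - service_tail \<rho> s' b\<bar> \<le> C * (b - a)" if "0 \<le> a" "a \<le> b" for a b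
  proof -
    interpret prob_space "service_law \<rho> s'" by (rule \<rho>_prob) (use s in simp)
    have "{a<..b} \<in> events" "{b<..} \<in> events" by (auto simp: service_law_def)
    then have "prob ({a<..b} \<union> {b<..}) = prob {a<..b} + prob {b<..}" by (intro finite_measure_Union) auto
    moreover have "{a<..b} \<union> {b<..} = {a<..}" using that by auto
    ultimately show ?thesis
      using service_law_interval[OF s(2) that(2)] that s by (simp add: service_tail_eq)
  qed
  have 2: "\<bar>service_tail \<rho> s' r - service_tail \<rho> s' r'\<bar> \<le> C * \<bar>r - r'\<bar>"
    using mono[of r r'] mono[of r' r] r by (cases "r \<le> r'") (auto simp: abs_minus_commute)
  show ?thesis using 1 2 by linarith
qed

end

section \<open>Averaging of integrands that oscillate with the environment\<close>

lemma abel_sum: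
  fixes H Q :: "nat \<Rightarrow> real"
  assumes "Q 0 = 0"
  shows "(\<Sum>j<Suc n. H j * (Q (Suc j) - Q j)) = H n * Q (Suc n) - (\<Sum>j<n. (H (Suc j) - H j) * Q (Suc j))"
  using assms by (induction n) (auto simp: algebra_simps)

text \<open>Integration by parts without derivatives: \<open>h\<close> is replaced by a step
  function, Abel summation moves the differences onto \<open>h\<close>, and the primitive of
  \<open>p\<close> is bounded by \<open>S\<close>. The end value of \<open>h\<close> contributes
  \<open>H * S\<close>, its variation \<open>K * s * S\<close>.\<close>

lemma oscillating_integral_bound:
  fixes h p :: "real \<Rightarrow> real"
  assumes s: "s > 0" and h[measurable]: "h \<in> borel_measurable borel" and p[measurable]: "p \<in> borel_measurable borel"
    and hH: "\<And>u. 0 < u \<Longrightarrow> u \<le> s \<Longrightarrow> \<bar>h u\<bar> \<le> H"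
    and hK: "\<And>u u'. 0 < u \<Longrightarrow> u \<le> s \<Longrightarrow> 0 < u' \<Longrightarrow> u' \<le> s \<Longrightarrow> \<bar>h u - h u'\<bar> \<le> K * \<bar>u - u'\<bar>"
    and pB: "\<And>u. \<bar>p u\<bar> \<le> B" and "K \<ge> 0"
    and S: "\<And>v. 0 < v \<Longrightarrow> v \<le> s \<Longrightarrow> \<bar>\<integral>u. indicator {0<..v} u * p u \<partial>lborel\<bar> \<le> S"
  shows "\<bar>\<integral>u. indicator {0<..s} u * (h u * p u) \<partial>lborel\<bar> \<le> (H + K * s) * S"
proof -
  have B0: "B \<ge> 0" using pB[of 0] by linarith
  have H0: "H \<ge> 0" using hH[of s] s by linarith
  have S0: "S \<ge> 0" using S[of s] s by linarith
  have ip: "integrable lborel (\<lambda>u. indicator {a<..b} u * p u)" for a b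
  proof (rule Bochner_Integration.integrable_bound)
    show "integrable lborel (\<lambda>u. indicator {a<..max a b} u * B)"
      by (intro integrable_mult_left integrable_real_indicator) (auto simp: emeasure_lborel_Ioc)
    show "AE u in lborel. norm (indicator {a<..b} u * p u) \<le> norm (indicator {a<..max a b} u * B)"
      using pB B0 by (intro AE_I2) (auto simp: indicator_def)
  qed measurable
  define \<Psi> where "\<Psi> v = (\<integral>u. indicator {0<..v} u * p u \<partial>lborel)" for v
  \<comment> \<open>The last term is the error of the step approximation on \<open>Suc n\<close>
    cells; it disappears in the limit.\<close>
  have est: "\<bar>\<integral>u. indicator {0<..s} u * (h u * p u) \<partial>lborel\<bar> \<le> (H + K * s) * S + K * s * B * s / real (Suc n)" for n
  proof -
    define N where "N = real (Suc n)"
    have N: "N > 0" by (simp add: N_def)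
    define x where "x j = real j * s / N" for j
    have x0: "x 0 = 0" and xs: "x (Suc n) = s" using N by (simp_all add: x_def N_def)
    have xpos: "x (Suc j) > 0" for j using N s by (simp add: x_def)
    have xinc: "x j < x (Suc j)" for j using N s by (simp add: x_def divide_strict_right_mono)
    have xle: "x (Suc j) \<le> s" if "j < Suc n" for j
    proof -
      have "real (Suc j) * s \<le> N * s" using that s unfolding N_def by (intro mult_right_mono) auto
      then show ?thesis using N by (simp add: x_def pos_divide_le_eq mult.commute)
    qed
    have xdiff: "x (Suc j) - x j = s / N" for j by (simp add: x_def diff_divide_distrib[symmetric] algebra_simps)
    \<comment> \<open>The cell of \<open>u\<close> is read off from a ceiling, so exactly one
      summand of \<open>hn\<close> is active at a given point of \<open>{0<..s}\<close>.\<close>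
    have idx: "u \<in> {x j<..x (Suc j)} \<longleftrightarrow> \<lceil>N * u / s\<rceil> = int j + 1" if "0 < u" for u j
    proof -
      have "x j < u \<longleftrightarrow> real j < N * u / s" using N s by (simp add: x_def field_simps)
      moreover have "u \<le> x (Suc j) \<longleftrightarrow> N * u / s \<le> real j + 1" using N s by (simp add: x_def field_simps)
      ultimately show ?thesis by (auto simp: ceiling_eq_iff)
    qed
    define hn where "hn u = (\<Sum>j<Suc n. h (x (Suc j)) * indicator {x j<..x (Suc j)} u)" for u
    have hn: "\<bar>h u - hn u\<bar> \<le> K * (s / N)" if u: "0 < u" "u \<le> s" for u
    proof -
      define j0 where "j0 = nat (\<lceil>N * u / s\<rceil> - 1)"
      have pos: "0 < N * u / s" using N s u by simp
      have le: "N * u / s \<le> N" using N s u by (simp add: pos_divide_le_eq)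
      have j0: "\<lceil>N * u / s\<rceil> = int j0 + 1" using pos unfolding j0_def by linarith
      have "\<lceil>N * u / s\<rceil> \<le> int (Suc n)" using le by (simp add: ceiling_le_iff N_def)
      then have j0n: "j0 < Suc n" using j0 by linarith
      have "hn u = (\<Sum>j<Suc n. if j = j0 then h (x (Suc j)) else 0)"
        unfolding hn_def
      proof (rule sum.cong[OF refl])
        fix j assume "j \<in> {..<Suc n}"
        have "u \<in> {x j<..x (Suc j)} \<longleftrightarrow> j = j0" using idx[OF u(1), of j] j0 by auto
        then show "h (x (Suc j)) * indicator {x j<..x (Suc j)} u = (if j = j0 then h (x (Suc j)) else 0)"
          by (auto simp: indicator_def)
      qed
      also have "\<dots> = h (x (Suc j0))" using j0n by (simp del: sum.lessThan_Suc)
      finally have e: "hn u = h (x (Suc j0))" .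
      have "u \<in> {x j0<..x (Suc j0)}" using idx[OF u(1)] j0 by blast
      then have "\<bar>u - x (Suc j0)\<bar> \<le> s / N" using xdiff[of j0] by auto
      then have "K * \<bar>u - x (Suc j0)\<bar> \<le> K * (s / N)" using \<open>K \<ge> 0\<close> by (rule mult_left_mono)
      then show ?thesis unfolding e using hK[OF u xpos xle[OF j0n]] by linarith
    qed
    have hn_int: "(\<integral>u. hn u * p u \<partial>lborel) = (\<Sum>j<Suc n. h (x (Suc j)) * (\<Psi> (x (Suc j)) - \<Psi> (x j)))"
    proof -
      have "(\<integral>u. hn u * p u \<partial>lborel) = (\<integral>u. (\<Sum>j<Suc n. h (x (Suc j)) * (indicator {x j<..x (Suc j)} u * p u)) \<partial>lborel)"
        unfolding hn_def by (simp only: sum_distrib_right mult.assoc)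
      also have "\<dots> = (\<Sum>j<Suc n. h (x (Suc j)) * (\<integral>u. indicator {x j<..x (Suc j)} u * p u \<partial>lborel))"
        by (subst Bochner_Integration.integral_sum) (auto simp del: sum.lessThan_Suc intro!: ip)
      also have "\<dots> = (\<Sum>j<Suc n. h (x (Suc j)) * (\<Psi> (x (Suc j)) - \<Psi> (x j)))"
      proof (rule sum.cong[OF refl])
        fix j
        have "0 \<le> x j" using N s by (simp add: x_def)
        then have "indicator {0<..x (Suc j)} u * p u = indicator {0<..x j} u * p u + indicator {x j<..x (Suc j)} u * p u" for u
          using xinc[of j] by (auto simp: indicator_def)
        then have "\<Psi> (x (Suc j)) = \<Psi> (x j) + (\<integral>u. indicator {x j<..x (Suc j)} u * p u \<partial>lborel)"
          unfolding \<Psi>_def using Bochner_Integration.integral_add[OF ip ip] by simp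
        then show "h (x (Suc j)) * (\<integral>u. indicator {x j<..x (Suc j)} u * p u \<partial>lborel) = h (x (Suc j)) * (\<Psi> (x (Suc j)) - \<Psi> (x j))" by simp
      qed
      finally show ?thesis .
    qed
    have "\<bar>\<integral>u. hn u * p u \<partial>lborel\<bar> \<le> (H + K * s) * S"
    proof -
      have "(\<integral>u. hn u * p u \<partial>lborel) = h s * \<Psi> s - (\<Sum>j<n. (h (x (Suc (Suc j))) - h (x (Suc j))) * \<Psi> (x (Suc j)))"
        unfolding hn_int by (subst abel_sum[of "\<lambda>j. \<Psi> (x j)"]) (simp_all add: x0 xs \<Psi>_def del: sum.lessThan_Suc)
      also have "\<bar>\<dots>\<bar> \<le> H * S + (\<Sum>j<n. (K * (s / N)) * S)"
      proof -
        have 1: "\<bar>h s * \<Psi> s\<bar> \<le> H * S" unfolding abs_mult \<Psi>_def by (rule mult_mono) (use hH S s H0 in auto)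
        have "\<bar>\<Sum>j<n. (h (x (Suc (Suc j))) - h (x (Suc j))) * \<Psi> (x (Suc j))\<bar> \<le> (\<Sum>j<n. \<bar>(h (x (Suc (Suc j))) - h (x (Suc j))) * \<Psi> (x (Suc j))\<bar>)"
          by (rule sum_abs)
        also have "\<dots> \<le> (\<Sum>j<n. (K * (s / N)) * S)"
        proof (rule sum_mono)
          fix j assume j: "j \<in> {..<n}"
          have a: "\<bar>h (x (Suc (Suc j))) - h (x (Suc j))\<bar> \<le> K * (s / N)"
            using hK[OF xpos xle xpos xle, of "Suc j" j] j xdiff[of "Suc j"] s N by simp
          have b: "\<bar>\<Psi> (x (Suc j))\<bar> \<le> S" unfolding \<Psi>_def by (rule S[OF xpos xle]) (use j in auto)
          show "\<bar>(h (x (Suc (Suc j))) - h (x (Suc j))) * \<Psi> (x (Suc j))\<bar> \<le> (K * (s / N)) * S"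
            unfolding abs_mult by (rule mult_mono[OF a b]) (use \<open>K \<ge> 0\<close> s N in auto)
        qed
        finally show ?thesis using 1 by linarith
      qed
      also have "(\<Sum>j<n. (K * (s / N)) * S) = (K * s * S) * (real n / N)" by simp
      also have "\<dots> \<le> (K * s * S) * 1" using \<open>K \<ge> 0\<close> s S0 N by (intro mult_left_mono) (auto simp: N_def)
      finally show ?thesis by (simp add: algebra_simps)
    qed
    moreover have "\<bar>(\<integral>u. indicator {0<..s} u * (h u * p u) \<partial>lborel) - (\<integral>u. hn u * p u \<partial>lborel)\<bar> \<le> K * s * B * s / N"
    proof -
      have ihp: "integrable lborel (\<lambda>u. indicator {0<..s} u * (h u * p u))"
      proof (rule Bochner_Integration.integrable_bound)
        show "integrable lborel (\<lambda>u. indicator {0<..s} u * (H * B))"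
          using s by (intro integrable_mult_left integrable_real_indicator) (auto simp: emeasure_lborel_Ioc)
        show "AE u in lborel. norm (indicator {0<..s} u * (h u * p u)) \<le> norm (indicator {0<..s} u * (H * B))"
          using hH pB H0 B0 by (intro AE_I2) (auto simp: indicator_def abs_mult intro!: mult_mono)
      qed measurable
      have ihn: "integrable lborel (\<lambda>u. hn u * p u)"
        unfolding hn_def sum_distrib_right mult.assoc by (intro Bochner_Integration.integrable_sum integrable_mult_right ip)
      have supp: "hn u = 0" if "u \<notin> {0<..s}" for u
        unfolding hn_def
      proof (rule sum.neutral, rule ballI)
        fix j assume "j \<in> {..<Suc n}"
        then have "0 \<le> x j" "x (Suc j) \<le> s" using N s xle[of j] by (auto simp: x_def)
        then show "h (x (Suc j)) * indicator {x j<..x (Suc j)} u = 0" using that by (auto simp: indicator_def)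
      qed
      have "\<bar>(\<integral>u. indicator {0<..s} u * (h u * p u) \<partial>lborel) - (\<integral>u. hn u * p u \<partial>lborel)\<bar>
        = \<bar>\<integral>u. indicator {0<..s} u * (h u * p u) - hn u * p u \<partial>lborel\<bar>" using ihp ihn by simp
      also have "\<dots> \<le> (\<integral>u. \<bar>indicator {0<..s} u * (h u * p u) - hn u * p u\<bar> \<partial>lborel)" by (rule integral_abs_bound)
      also have "\<dots> \<le> (\<integral>u. indicator {0<..s} u * (K * (s / N) * B) \<partial>lborel)"
      proof (rule integral_mono)
        show "integrable lborel (\<lambda>u. indicator {0<..s} u * (K * (s / N) * B))"
          using s by (intro integrable_mult_left integrable_real_indicator) (auto simp: emeasure_lborel_Ioc)
        show "integrable lborel (\<lambda>u. \<bar>indicator {0<..s} u * (h u * p u) - hn u * p u\<bar>)" using ihp ihn by simp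
        fix u
        show "\<bar>indicator {0<..s} u * (h u * p u) - hn u * p u\<bar> \<le> indicator {0<..s} u * (K * (s / N) * B)"
        proof (cases "u \<in> {0<..s}")
          case True
          then have "\<bar>indicator {0<..s} u * (h u * p u) - hn u * p u\<bar> = \<bar>h u - hn u\<bar> * \<bar>p u\<bar>"
            by (simp add: abs_mult[symmetric] left_diff_distrib)
          also have "\<dots> \<le> (K * (s / N)) * B" by (rule mult_mono) (use hn pB True \<open>K \<ge> 0\<close> s N in auto)
          finally show ?thesis using True by simp
        qed (simp add: supp)
      qed
      also have "\<dots> = K * s * B * s / N" using s by (simp add: mult_ac)
      finally show ?thesis .
    qed
    ultimately show ?thesis unfolding N_def[symmetric] by linarith
  qed
  have "(\<lambda>n. (H + K * s) * S + (K * s * B * s) * inverse (real (Suc n))) \<longlonglongrightarrow> (H + K * s) * S + (K * s * B * s) * 0"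
    by (intro tendsto_intros LIMSEQ_inverse_real_of_nat)
  then show ?thesis
    by (intro LIMSEQ_le_const[where X="\<lambda>n. (H + K * s) * S + (K * s * B * s) * inverse (real (Suc n))"])
      (use est in \<open>auto simp: divide_inverse\<close>)
qed

text \<open>Rescaling time turns the integral into \<open>v\<close> times an ergodic average at time
  \<open>v / \<epsilon>\<close>, whose error is at most
  \<open>D * (\<epsilon> / v) powr \<kappa>\<close>. Because \<open>\<kappa> < 1\<close>, the
  product \<open>v powr (1 - \<kappa>)\<close> stays below \<open>T\<close>, also for small
  \<open>v\<close>; this makes the bound uniform.\<close>

lemma ergodic_average_bound:
  fixes q :: "real \<Rightarrow> real"
  assumes q[measurable]: "q \<in> borel_measurable borel" and qb: "\<And>u. \<bar>q u\<bar> \<le> b"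
    and erg: "\<And>t. t > 0 \<Longrightarrow> \<bar>1 / t * (\<integral>u. indicator {0..t} u * q u \<partial>lborel) - a\<bar> \<le> D / (1 + t) powr \<kappa>"
    and "D > 0" and \<kappa>: "0 < \<kappa>" "\<kappa> < 1" and \<epsilon>: "\<epsilon> > 0" and T: "T \<ge> 1" and v: "0 < v" "v \<le> T"
  shows "\<bar>\<integral>u. indicator {0<..v} u * (q (u / \<epsilon>) - a) \<partial>lborel\<bar> \<le> D * T * \<epsilon> powr \<kappa>"
proof -
  define t where "t = v / \<epsilon>"
  have t: "t > 0" using v \<epsilon> by (simp add: t_def)
  have b0: "b \<ge> 0" using qb[of 0] by linarith
  have iq: "integrable lborel (\<lambda>u. indicator {0<..v} u * q (u / \<epsilon>))"
  proof (rule Bochner_Integration.integrable_bound)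
    show "integrable lborel (\<lambda>u. indicator {0<..v} u * b)"
      using v by (intro integrable_mult_left integrable_real_indicator) (auto simp: emeasure_lborel_Ioc)
    show "AE u in lborel. norm (indicator {0<..v} u * q (u / \<epsilon>)) \<le> norm (indicator {0<..v} u * b)"
      using qb b0 by (intro AE_I2) (auto simp: indicator_def)
  qed measurable
  have ia: "integrable lborel (\<lambda>u. indicator {0<..v} u * a)"
    using v by (intro integrable_mult_left integrable_real_indicator) (auto simp: emeasure_lborel_Ioc)
  have "(\<integral>u. indicator {0<..v} u * q (u / \<epsilon>) \<partial>lborel) = \<epsilon> * (\<integral>u. indicator {0<..v} (\<epsilon> * u) * q (\<epsilon> * u / \<epsilon>) \<partial>lborel)"
    using lborel_integral_real_affine[of \<epsilon> "\<lambda>u. indicator {0<..v} u * q (u / \<epsilon>)" 0] \<epsilon> by simp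
  also have "(\<integral>u. indicator {0<..v} (\<epsilon> * u) * q (\<epsilon> * u / \<epsilon>) \<partial>lborel) = (\<integral>u. indicator {0..t} u * q u \<partial>lborel)"
  proof (rule integral_cong_AE)
    show "AE u in lborel. indicator {0<..v} (\<epsilon> * u) * q (\<epsilon> * u / \<epsilon>) = indicator {0..t} u * q u"
      using AE_lborel_singleton[of "0::real"]
    proof eventually_elim
      case (elim u)
      have "\<epsilon> * u \<in> {0<..v} \<longleftrightarrow> u \<in> {0..t}"
        using elim \<epsilon> by (auto simp: t_def zero_less_mult_iff pos_le_divide_eq mult.commute)
      then show ?case using \<epsilon> by (simp add: indicator_def)
    qed
  qed measurable
  also have "\<epsilon> * (\<integral>u. indicator {0..t} u * q u \<partial>lborel) = v * (1 / t * (\<integral>u. indicator {0..t} u * q u \<partial>lborel))"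
    using v \<epsilon> by (simp add: t_def)
  finally have e: "(\<integral>u. indicator {0<..v} u * q (u / \<epsilon>) \<partial>lborel) = v * (1 / t * (\<integral>u. indicator {0..t} u * q u \<partial>lborel))" .
  have "(\<integral>u. indicator {0<..v} u * (q (u / \<epsilon>) - a) \<partial>lborel)
      = (\<integral>u. indicator {0<..v} u * q (u / \<epsilon>) \<partial>lborel) - (\<integral>u. indicator {0<..v} u * a \<partial>lborel)"
    using iq ia by (simp add: right_diff_distrib)
  also have "(\<integral>u. indicator {0<..v} u * a \<partial>lborel) = v * a" using v by simp
  finally have "(\<integral>u. indicator {0<..v} u * (q (u / \<epsilon>) - a) \<partial>lborel) = v * (1 / t * (\<integral>u. indicator {0..t} u * q u \<partial>lborel) - a)"
    unfolding e by (simp only: right_diff_distrib)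
  then have "\<bar>\<integral>u. indicator {0<..v} u * (q (u / \<epsilon>) - a) \<partial>lborel\<bar> = v * \<bar>1 / t * (\<integral>u. indicator {0..t} u * q u \<partial>lborel) - a\<bar>"
    using v by (simp add: abs_mult)
  also have "\<dots> \<le> v * (D / (1 + t) powr \<kappa>)" by (rule mult_left_mono[OF erg[OF t]]) (use v in simp)
  also have "\<dots> \<le> v * (D / t powr \<kappa>)"
    using v t \<kappa> \<open>D > 0\<close> by (intro mult_left_mono divide_left_mono powr_mono2) auto
  also have "\<dots> = D * (v powr (1 - \<kappa>) * \<epsilon> powr \<kappa>)"
    using v \<epsilon> by (simp add: t_def powr_divide powr_diff)
  also have "\<dots> \<le> D * (T * \<epsilon> powr \<kappa>)"
  proof -
    have "v powr (1 - \<kappa>) \<le> T powr (1 - \<kappa>)" using v \<kappa> by (intro powr_mono2) auto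
    also have "\<dots> \<le> T powr 1" using T \<kappa> by (intro powr_mono) auto
    finally have "v powr (1 - \<kappa>) \<le> T" using T by simp
    then show ?thesis using \<open>D > 0\<close> by (intro mult_left_mono mult_right_mono) auto
  qed
  finally show ?thesis by (simp add: mult.assoc)
qed

section \<open>Marked Poisson processes\<close>

text \<open>The Poisson generating function, at complex arguments so that it covers characteristic
  functions and exponential moments alike.\<close>

lemma (in prob_space) poisson_power_expectation:
  fixes c :: complex and X :: "'a \<Rightarrow> nat"
  assumes X[measurable]: "X \<in> measurable M (count_space UNIV)"
    and pois: "\<And>n. prob {w\<in>space M. X w = n} = exp (- a) * a ^ n / fact n" and "a \<ge> 0"
  shows "integrable M (\<lambda>w. c ^ X w)" "(\<integral>w. c ^ X w \<partial>M) = exp (a * (c - 1))"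
proof -
  define p where "p n = exp (- a) * a ^ n / fact n" for n
  have p0: "p n \<ge> 0" for n using \<open>a \<ge> 0\<close> by (simp add: p_def)
  \<comment> \<open>On a countable space the probabilities of single values determine the
    law.\<close>
  have D: "distr M (count_space UNIV) X = density (count_space UNIV) (\<lambda>n. ennreal (p n))"
  proof (rule measure_eqI_countable[where A=UNIV])
    fix n :: nat
    have "emeasure (distr M (count_space UNIV) X) {n} = emeasure M {w\<in>space M. X w = n}"
      by (subst emeasure_distr) (auto intro!: arg_cong[where f="emeasure M"])
    also have "\<dots> = ennreal (p n)" using pois[of n] by (simp add: emeasure_eq_measure p_def)
    finally show "emeasure (distr M (count_space UNIV) X) {n} = emeasure (density (count_space UNIV) (\<lambda>n. ennreal (p n))) {n}"
      by (simp add: emeasure_density)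
  qed auto
  have s: "(\<lambda>n. (a * c) ^ n /\<^sub>R fact n) sums exp (a * c)" by (rule exp_converges)
  have e: "p n *\<^sub>R c ^ n = exp (- a) *\<^sub>R ((a * c) ^ n /\<^sub>R fact n)" for n
    by (simp add: p_def power_mult_distrib scaleR_conv_of_real divide_inverse mult_ac)
  have sm: "(\<lambda>n. p n *\<^sub>R c ^ n) sums (exp (- a) *\<^sub>R exp (a * c))"
    unfolding e by (rule sums_scaleR_right[OF s])
  have "summable (\<lambda>n. norm (p n *\<^sub>R c ^ n))"
  proof -
    have "summable (\<lambda>n. exp (- a) * norm ((a * c) ^ n /\<^sub>R fact n))"
      by (intro summable_mult summable_norm_exp)
    moreover have "norm (exp (- a) *\<^sub>R y) = exp (- a) * norm y" for y :: complex by simp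
    ultimately show ?thesis unfolding e by (simp only:)
  qed
  then have i: "integrable (count_space UNIV) (\<lambda>n. p n *\<^sub>R c ^ n)" by (simp add: integrable_count_space_nat_iff)
  have "integrable (distr M (count_space UNIV) X) (\<lambda>n. c ^ n)"
    unfolding D by (subst integrable_density) (use p0 i in auto)
  then show "integrable M (\<lambda>w. c ^ X w)" by (subst (asm) integrable_distr_eq) auto
  have "(\<integral>w. c ^ X w \<partial>M) = (\<integral>n. c ^ n \<partial>distr M (count_space UNIV) X)" by (subst integral_distr) auto
  also have "\<dots> = (\<integral>n. p n *\<^sub>R c ^ n \<partial>count_space UNIV)"
    unfolding D by (subst integral_density) (use p0 in auto)
  also have "\<dots> = (\<Sum>n. p n *\<^sub>R c ^ n)" by (rule integral_count_space_nat[OF i])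
  also have "\<dots> = exp (- a) *\<^sub>R exp (a * c)" using sm by (simp add: sums_iff)
  also have "\<dots> = exp (a * (c - 1))"
    by (simp add: scaleR_conv_of_real exp_of_real[symmetric] exp_add[symmetric] algebra_simps)
  finally show "(\<integral>w. c ^ X w \<partial>M) = exp (a * (c - 1))" .
qed

text \<open>Linear combinations of indicators of rectangles: the functions of arrival time and
  service time on which the product form of \<open>conditional_services\<close> can be used
  directly.\<close>

inductive rect_simple :: "(real \<Rightarrow> real \<Rightarrow> complex) \<Rightarrow> bool" where
  rect: "A \<in> sets borel \<Longrightarrow> B \<in> sets borel \<Longrightarrow> rect_simple (\<lambda>u r. c * indicator A u * indicator B r)"
| add: "rect_simple f \<Longrightarrow> rect_simple g \<Longrightarrow> rect_simple (\<lambda>u r. f u r + g u r)"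

lemma rect_simple_const: "rect_simple (\<lambda>u r. c)"
  using rect_simple.rect[of UNIV UNIV c] by simp

lemma rect_simple_mult_rect:
  assumes "rect_simple f" "A \<in> sets borel" "B \<in> sets borel"
  shows "rect_simple (\<lambda>u r. (c * indicator A u * indicator B r) * f u r)"
  using assms(1)
proof induction
  case (rect A' B' c')
  have "rect_simple (\<lambda>u r. (c * c') * indicator (A \<inter> A') u * indicator (B \<inter> B') r)"
    using rect assms by (intro rect_simple.rect) auto
  then show ?case by (simp add: indicator_inter_arith mult_ac)
next
  case (add f g)
  then show ?case using rect_simple.add[OF add.IH] by (simp add: distrib_left)
qed

lemma rect_simple_mult:
  assumes "rect_simple f" "rect_simple g"
  shows "rect_simple (\<lambda>u r. f u r * g u r)"
  using assms(1)
proof induction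
  case (rect A B c)
  then show ?case by (intro rect_simple_mult_rect assms)
next
  case (add f1 f2)
  then show ?case using rect_simple.add[OF add.IH] by (simp add: distrib_right)
qed

lemma rect_simple_sum:
  assumes "finite J" "\<And>j. j \<in> J \<Longrightarrow> rect_simple (f j)"
  shows "rect_simple (\<lambda>u r. \<Sum>j\<in>J. f j u r)"
  using assms
proof (induction J rule: finite_induct)
  case empty
  then show ?case using rect_simple_const[of 0] by simp
next
  case (insert x F)
  then show ?case using rect_simple.add[of "f x" "\<lambda>u r. \<Sum>j\<in>F. f j u r"] by simp
qed

lemma rect_simple_representation:
  assumes "rect_simple f"
  shows "\<exists>(q::nat) c A B. (\<forall>i. A i \<in> sets borel \<and> B i \<in> sets borel) \<and>
    f = (\<lambda>u r. \<Sum>i<q. c i * indicator (A i) u * indicator (B i) r)"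
  using assms
proof induction
  case (rect A B c)
  then show ?case
    by (intro exI[of _ "1::nat"] exI[of _ "\<lambda>_. c"] exI[of _ "\<lambda>_. A"] exI[of _ "\<lambda>_. B"]) auto
next
  case (add f g)
  then obtain q c A B q' c' A' B' where
    *: "\<forall>i::nat. A i \<in> sets borel \<and> B i \<in> sets borel" "f = (\<lambda>u r. \<Sum>i<q. c i * indicator (A i) u * indicator (B i) r)"
    "\<forall>i::nat. A' i \<in> sets borel \<and> B' i \<in> sets borel" "g = (\<lambda>u r. \<Sum>i<q'. c' i * indicator (A' i) u * indicator (B' i) r)"
    by blast
  have "(\<Sum>i<q + q'. (if i < q then c i else c' (i - q)) * indicator (if i < q then A i else A' (i - q)) u
      * indicator (if i < q then B i else B' (i - q)) r) = f u r + g u r" (is "sum ?h _ = _") for u r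
  proof -
    have "sum ?h {..<q + q'} = sum ?h {..<q} + sum ?h {q..<q + q'}"
      using sum.atLeastLessThan_concat[of 0 q "q + q'" ?h] by (simp add: lessThan_atLeast0)
    moreover have "sum ?h {q..<q + q'} = (\<Sum>i<q'. ?h (i + q))"
      using sum.shift_bounds_nat_ivl[of ?h 0 q q'] by (simp add: lessThan_atLeast0 add.commute)
    ultimately show ?thesis using *(2,4) by simp
  qed
  then show ?case using *(1,3)
    by (intro exI[of _ "q + q'"] exI[of _ "\<lambda>i. if i < q then c i else c' (i - q)"]
      exI[of _ "\<lambda>i. if i < q then A i else A' (i - q)"] exI[of _ "\<lambda>i. if i < q then B i else B' (i - q)"]) auto
qed

lemma measurable_rect_simple [measurable (raw)]:
  assumes "rect_simple f" and [measurable]: "X \<in> borel_measurable M" "Y \<in> borel_measurable M"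
  shows "(\<lambda>w. f (X w) (Y w)) \<in> borel_measurable M"
  using assms(1)
proof induction
  case (rect A B c)
  note [measurable] = rect
  show ?case by measurable
next
  case (add f g)
  note [measurable] = add.IH
  show ?case by measurable
qed

text \<open>A single bounded pointwise limit of rectangle functions already reaches the exponentials
  needed for the queue; the common bound \<open>B\<close> is there for dominated
  convergence.\<close>

definition rect_limit :: "(real \<Rightarrow> real \<Rightarrow> complex) \<Rightarrow> bool" where
  "rect_limit f \<longleftrightarrow> (\<exists>F B. (\<forall>i. rect_simple (F i)) \<and> (\<forall>i u r. norm (F i u r) \<le> B) \<and>
     (\<forall>u r. (\<lambda>i. F i u r) \<longlonglongrightarrow> f u r))"

lemma rect_limit_simple:
  assumes "rect_simple f" "\<And>u r. norm (f u r) \<le> B"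
  shows "rect_limit f"
  unfolding rect_limit_def using assms by (intro exI[of _ "\<lambda>_. f"] exI[of _ B]) auto

text \<open>Exponentials of sums are products, so this closure property is what makes mark functions
  additive later.\<close>

lemma rect_limit_mult:
  assumes "rect_limit f" "rect_limit g"
  shows "rect_limit (\<lambda>u r. f u r * g u r)"
proof -
  obtain F A G B where F: "\<And>i. rect_simple (F i)" "\<And>i u r. norm (F i u r) \<le> A" "\<And>u r. (\<lambda>i. F i u r) \<longlonglongrightarrow> f u r"
    and G: "\<And>i. rect_simple (G i)" "\<And>i u r. norm (G i u r) \<le> B" "\<And>u r. (\<lambda>i. G i u r) \<longlonglongrightarrow> g u r"
    using assms unfolding rect_limit_def by blast
  have "norm (F i u r * G i u r) \<le> A * B" for i u r
    unfolding norm_mult using F(2)[of i u r] G(2)[of i u r]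
    by (intro mult_mono) (auto intro: order_trans[OF norm_ge_zero])
  then show ?thesis unfolding rect_limit_def using F G
    by (intro exI[of _ "\<lambda>i u r. F i u r * G i u r"] exI[of _ "A * B"])
      (auto intro: rect_simple_mult tendsto_mult)
qed

lemma rect_limit_bounded: "rect_limit f \<Longrightarrow> \<exists>B\<ge>1. \<forall>u r. norm (f u r) \<le> B"
proof -
  assume "rect_limit f"
  then obtain F B where F: "\<And>i u r. norm (F i u r) \<le> B" "\<And>u r. (\<lambda>i. F i u r) \<longlonglongrightarrow> f u r"
    unfolding rect_limit_def by blast
  have "norm (f u r) \<le> B" for u r
    by (rule tendsto_upperbound[OF tendsto_norm[OF F(2)]]) (auto simp: F(1))
  then show ?thesis by (intro exI[of _ "max 1 B"]) (auto simp: le_max_iff_disj)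
qed

lemma measurable_rect_limit:
  assumes "rect_limit f" and [measurable]: "X \<in> borel_measurable M" "Y \<in> borel_measurable M"
  shows "(\<lambda>w. f (X w) (Y w)) \<in> borel_measurable M"
proof -
  obtain F where F: "\<And>i. rect_simple (F i)" "\<And>u r. (\<lambda>i. F i u r) \<longlonglongrightarrow> f u r"
    using assms(1) unfolding rect_limit_def by blast
  show ?thesis
    by (rule borel_measurable_LIMSEQ_metric[of "\<lambda>i w. F i (X w) (Y w)"]) (use F in \<open>auto intro: measurable_rect_simple\<close>)
qed

lemma integrable_Icc_const: "integrable lborel (\<lambda>u. indicator {0..T::real} u * (x :: real))"
  by (intro integrable_mult_left integrable_real_indicator) (auto simp: emeasure_lborel_Icc_eq)

section \<open>Arrival times with conditionally independent marks\<close>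

locale marked_poisson = prob_space P for P :: "'w measure" +
  fixes \<Gamma> :: "nat \<Rightarrow> 'w \<Rightarrow> ereal" and L :: "nat \<Rightarrow> 'w \<Rightarrow> real" and m :: "real \<Rightarrow> real"
    and \<nu> :: "real \<Rightarrow> real measure" and mb :: real
  assumes arr: "arrival_times P \<Gamma>"
    and L_meas [measurable]: "\<And>k. L k \<in> borel_measurable P"
    and pois: "poisson_process P \<Gamma> (density lborel (\<lambda>s. ennreal (m s)))"
    and m_meas [measurable]: "m \<in> borel_measurable borel"
    and m_nonneg: "\<And>s. 0 \<le> m s" and m_le: "\<And>s. m s \<le> mb"
    and cs: "conditional_services P \<Gamma> L \<nu>"
    and \<nu>_prob: "\<And>s. s \<ge> 0 \<Longrightarrow> prob_space (\<nu> s)" and \<nu>_sets: "\<And>s. s \<ge> 0 \<Longrightarrow> sets (\<nu> s) = sets borel"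
    and \<nu>_meas: "\<And>B. B \<in> sets borel \<Longrightarrow> (\<lambda>s. indicator {0..} s * measure (\<nu> s) B) \<in> borel_measurable borel"
begin

abbreviation "tm k w \<equiv> real_of_ereal (\<Gamma> k w)"

definition count :: "real \<Rightarrow> 'w \<Rightarrow> nat" where
  "count T w = card {k. \<Gamma> k w \<le> ereal T}"

lemma \<Gamma>_meas [measurable]: "\<Gamma> k \<in> borel_measurable P"
  using arr by (simp add: arrival_times_def)

lemma \<Gamma>_mono: "w \<in> space P \<Longrightarrow> j \<le> k \<Longrightarrow> \<Gamma> j w \<le> \<Gamma> k w"
proof -
  assume w: "w \<in> space P" and "j \<le> k"
  have "\<Gamma> n w \<le> \<Gamma> (Suc n) w" for n using arr w unfolding arrival_times_def by blast
  then show ?thesis by (rule lift_Suc_mono_le[OF _ \<open>j \<le> k\<close>])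
qed

text \<open>Arrival times are nondecreasing and finitely many lie below \<open>T\<close>, so they
  occupy an initial segment of indices, and sums and products over arrivals run over
  \<open>k < count T w\<close>.\<close>

lemma arrivals_before:
  assumes w: "w \<in> space P"
  shows "{k. \<Gamma> k w \<le> ereal T} = {..<count T w}"
proof -
  have fin: "finite {k. \<Gamma> k w \<le> ereal T}" using arr w by (simp add: arrival_times_def)
  have "\<exists>n. \<not> \<Gamma> n w \<le> ereal T"
  proof (rule ccontr)
    assume "\<not> ?thesis"
    then have "{k. \<Gamma> k w \<le> ereal T} = UNIV" by blast
    then show False using fin infinite_UNIV_nat by (simp only:)
  qed
  then obtain n where n: "\<not> \<Gamma> n w \<le> ereal T" by blast
  define q where "q = (LEAST n. \<not> \<Gamma> n w \<le> ereal T)"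
  have q1: "\<not> \<Gamma> q w \<le> ereal T" unfolding q_def by (rule LeastI[of "\<lambda>n. \<not> \<Gamma> n w \<le> ereal T", OF n])
  have "{k. \<Gamma> k w \<le> ereal T} = {..<q}"
  proof safe
    fix k assume "\<Gamma> k w \<le> ereal T"
    then show "k < q" using q1 \<Gamma>_mono[OF w, of q k] order_trans[of "\<Gamma> q w" "\<Gamma> k w" "ereal T"] not_less[of k q] by blast
  next
    fix k assume "k < q"
    then show "\<Gamma> k w \<le> ereal T" using not_less_Least[of k "\<lambda>n. \<not> \<Gamma> n w \<le> ereal T"] unfolding q_def by blast
  qed
  then show ?thesis by (simp add: count_def)
qed

lemma less_count_iff: "w \<in> space P \<Longrightarrow> k < count T w \<longleftrightarrow> \<Gamma> k w \<le> ereal T"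
  using arrivals_before[of w T] by auto

lemma tm_bounds:
  assumes "w \<in> space P" "k < count T w"
  shows "0 \<le> tm k w" "tm k w \<le> T" "\<Gamma> k w = ereal (tm k w)"
proof -
  have 1: "0 \<le> \<Gamma> k w" "\<Gamma> k w \<le> ereal T" using arr assms less_count_iff by (auto simp: arrival_times_def)
  then show e: "\<Gamma> k w = ereal (tm k w)" by (cases "\<Gamma> k w") auto
  show "0 \<le> tm k w" "tm k w \<le> T" using 1 by (cases "\<Gamma> k w"; simp)+
qed

lemma tm_nonneg: "w \<in> space P \<Longrightarrow> 0 \<le> tm k w"
  using arr by (auto simp: arrival_times_def real_of_ereal_pos)

lemma num_points_indep:
  assumes "\<And>i. B i \<in> sets borel" "\<And>i. B i \<subseteq> {0..T}" "disjoint_family B"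
  shows "indep_vars (\<lambda>_. count_space UNIV) (\<lambda>i. num_points \<Gamma> (B i)) (UNIV :: nat set)"
proof -
  have "bounded (B i)" for i by (rule bounded_subset[OF bounded_closed_interval assms(2)])
  moreover have "B i \<subseteq> {0..}" for i by (rule order_trans[OF assms(2)]) auto
  ultimately have "(\<forall>i. B i \<in> sets borel \<and> bounded (B i) \<and> B i \<subseteq> {0..}) \<and> disjoint_family B"
    using assms(1,3) by simp
  with pois[unfolded poisson_process_def, THEN conjunct2, THEN spec, of B] show ?thesis by (rule mp)
qed

lemma num_points_measurable:
  assumes "B \<in> sets borel" "B \<subseteq> {0..T}"
  shows "num_points \<Gamma> B \<in> measurable P (count_space UNIV)"
proof -
  have "indep_vars (\<lambda>_. count_space UNIV) (\<lambda>i. num_points \<Gamma> (if i = 0 then B else {})) (UNIV :: nat set)"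
    by (rule num_points_indep[where T=T]) (use assms in \<open>auto simp: disjoint_family_on_def\<close>)
  then have "num_points \<Gamma> (if (0::nat) = 0 then B else {}) \<in> measurable P (count_space UNIV)"
    unfolding indep_vars_def by blast
  then show ?thesis by simp
qed

definition mass :: "real set \<Rightarrow> real" where
  "mass B = measure (density lborel (\<lambda>s. ennreal (m s))) B"

lemma integrable_m:
  assumes [measurable]: "B \<in> sets borel" and "B \<subseteq> {0..T}"
  shows "integrable lborel (\<lambda>u. indicator B u * m u)"
proof (rule Bochner_Integration.integrable_bound)
  show "integrable lborel (\<lambda>u. indicator {0..T} u * mb)" by (rule integrable_Icc_const)
  have "mb \<ge> 0" using m_nonneg[of 0] m_le[of 0] by simp
  then show "AE u in lborel. norm (indicator B u * m u) \<le> norm (indicator {0..T} u * mb)"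
    using assms(2) m_nonneg m_le by (intro AE_I2) (auto simp: indicator_def)
qed measurable

lemma mass_eq:
  assumes [measurable]: "B \<in> sets borel" and "B \<subseteq> {0..T}"
  shows "mass B = (\<integral>u. indicator B u * m u \<partial>lborel)"
proof -
  have "emeasure (density lborel (\<lambda>s. ennreal (m s))) B = (\<integral>\<^sup>+u. ennreal (indicator B u * m u) \<partial>lborel)"
    by (subst emeasure_density) (auto intro!: nn_integral_cong split: split_indicator)
  also have "\<dots> = ennreal (\<integral>u. indicator B u * m u \<partial>lborel)"
    by (rule nn_integral_eq_integral) (use integrable_m[OF assms] m_nonneg in auto)
  finally show ?thesis unfolding mass_def measure_def
    by (simp add: enn2real_ennreal integral_nonneg_AE m_nonneg)
qed

lemma num_points_power:
  fixes c :: complex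
  assumes "B \<in> sets borel" "B \<subseteq> {0..T}"
  shows "integrable P (\<lambda>w. c ^ num_points \<Gamma> B w)"
    "(\<integral>w. c ^ num_points \<Gamma> B w \<partial>P) = exp (mass B * (c - 1))"
proof -
  have "bounded B" by (rule bounded_subset[OF bounded_closed_interval assms(2)])
  moreover have "B \<subseteq> {0..}" by (rule order_trans[OF assms(2)]) auto
  ultimately have "prob {w \<in> space P. num_points \<Gamma> B w = n} = exp (- mass B) * mass B ^ n / fact n" for n
    using pois[unfolded poisson_process_def, THEN conjunct1, rule_format, of B n] assms unfolding mass_def by simp
  then show "integrable P (\<lambda>w. c ^ num_points \<Gamma> B w)" "(\<integral>w. c ^ num_points \<Gamma> B w \<partial>P) = exp (mass B * (c - 1))"
    using poisson_power_expectation[OF num_points_measurable[OF assms], of "mass B" c] by (auto simp: mass_def)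
qed

lemma count_eq_num_points: "w \<in> space P \<Longrightarrow> count T w = num_points \<Gamma> {0..T} w"
proof -
  assume w: "w \<in> space P"
  have "{k. \<Gamma> k w \<le> ereal T} = {k. \<Gamma> k w \<in> ereal ` {0..T}}"
  proof (intro Collect_cong iffI)
    fix k assume "\<Gamma> k w \<le> ereal T"
    then have "k < count T w" using less_count_iff w by simp
    then show "\<Gamma> k w \<in> ereal ` {0..T}" using tm_bounds[OF w] by (metis atLeastAtMost_iff image_eqI)
  qed auto
  then show ?thesis by (simp add: count_def num_points_def)
qed

lemma measurable_count [measurable]: "count T \<in> measurable P (count_space UNIV)"
  using num_points_measurable[of "{0..T}" T] count_eq_num_points
  by (subst measurable_cong[where g="num_points \<Gamma> {0..T}"]) auto

text \<open>Read off from the generating function; it supplies the dominating functions for products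
  over arrivals.\<close>

lemma integrable_power_count: "integrable P (\<lambda>w. (b::real) ^ count T w)"
proof -
  have "integrable P (\<lambda>w. norm ((of_real b :: complex) ^ num_points \<Gamma> {0..T} w))"
    by (intro integrable_norm num_points_power(1)[where T=T]) auto
  moreover have "integrable P (\<lambda>w. \<bar>b\<bar> ^ count T w)
      \<longleftrightarrow> integrable P (\<lambda>w. norm ((of_real b :: complex) ^ num_points \<Gamma> {0..T} w))"
    by (rule Bochner_Integration.integrable_cong) (auto simp: count_eq_num_points norm_power)
  ultimately have 1: "integrable P (\<lambda>w. \<bar>b\<bar> ^ count T w)" by blast
  show ?thesis
    by (rule Bochner_Integration.integrable_bound[OF 1]) (auto simp: power_abs)
qed

lemma norm_prod_count_le:
  fixes f :: "nat \<Rightarrow> complex"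
  assumes "\<And>k. k < n \<Longrightarrow> norm (f k) \<le> b" 
  shows "norm (\<Prod>k<n. f k) \<le> b ^ n"
proof -
  have "norm (\<Prod>k<n. f k) = (\<Prod>k<n. norm (f k))" by (rule prod_norm[symmetric])
  also have "\<dots> \<le> (\<Prod>k<n. b)" using assms by (intro prod_mono) auto
  finally show ?thesis by simp
qed

lemma measurable_prod_count:
  fixes f :: "nat \<Rightarrow> 'w \<Rightarrow> complex"
  assumes [measurable]: "\<And>k. f k \<in> borel_measurable P"
  shows "(\<lambda>w. \<Prod>k<count T w. f k w) \<in> borel_measurable P"
proof -
  have "(\<lambda>w. (\<lambda>n w. \<Prod>k<n. f k w) (count T w) w) \<in> borel_measurable P"
    by (rule measurable_compose_countable) measurable
  then show ?thesis by simp
qed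

text \<open>Arrivals are grouped by the value of \<open>h\<close>. The level sets are disjoint, so
  the counts are independent Poisson variables and their generating functions multiply.\<close>

lemma poisson_product_simple:
  fixes h :: "real \<Rightarrow> complex"
  assumes h: "simple_function borel h"
  shows "(\<integral>w. (\<Prod>k<count T w. h (tm k w)) \<partial>P)
    = exp (\<integral>u. indicator {0..T} u * (h u - 1) * m u \<partial>lborel)"
proof -
  define R where "R = range h"
  have finR: "finite R" using h by (simp add: simple_function_def R_def)
  obtain b where b: "bij_betw b {..<card R} R"
    using ex_bij_betw_nat_finite[OF finR] by (auto simp: lessThan_atLeast0)
  have hm[measurable]: "h \<in> borel_measurable borel" by (rule borel_measurable_simple_function[OF h])
  define A where "A c = {u \<in> {0..T}. h u = c}" for c
  have Am[measurable]: "A c \<in> sets borel" for c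
  proof -
    have "A c = {0..T} \<inter> (h -` {c} \<inter> space borel)" by (auto simp: A_def)
    then show ?thesis using h by (auto simp: simple_function_def measurable_sets[OF hm])
  qed
  have AT: "A c \<subseteq> {0..T}" for c by (auto simp: A_def)
  \<comment> \<open>Padded with empty sets, since independence is stated for sequences of
    sets.\<close>
  define B where "B i = (if i < card R then A (b i) else {})" for i
  have Bd: "disjoint_family B"
    unfolding disjoint_family_on_def
  proof (intro ballI impI)
    fix i j :: nat assume ij: "i \<noteq> j"
    show "B i \<inter> B j = {}"
    proof (cases "i < card R \<and> j < card R")
      case True
      then have "b i \<noteq> b j" using b ij by (auto simp: bij_betw_def inj_on_def)
      then show ?thesis using True by (auto simp: B_def A_def)
    qed (auto simp: B_def)
  qed
  have B: "B i \<in> sets borel" "B i \<subseteq> {0..T}" for i using AT by (auto simp: B_def)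
  have prod_eq: "(\<Prod>k<count T w. h (tm k w)) = (\<Prod>i<card R. b i ^ num_points \<Gamma> (B i) w)" if w: "w \<in> space P" for w
  proof -
    have "(\<Prod>k<count T w. h (tm k w)) = (\<Prod>c\<in>R. \<Prod>k\<in>{k\<in>{..<count T w}. h (tm k w) = c}. h (tm k w))"
      by (rule prod.group[symmetric]) (use finR in \<open>auto simp: R_def\<close>)
    also have "\<dots> = (\<Prod>c\<in>R. c ^ num_points \<Gamma> (A c) w)"
    proof (rule prod.cong[OF refl])
      fix c assume "c \<in> R"
      have "{k\<in>{..<count T w}. h (tm k w) = c} = {k. \<Gamma> k w \<in> ereal ` A c}"
      proof (intro set_eqI iffI)
        fix k assume "k \<in> {k\<in>{..<count T w}. h (tm k w) = c}"
        then show "k \<in> {k. \<Gamma> k w \<in> ereal ` A c}"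
          using tm_bounds[OF w, of k T] by (auto simp: A_def intro!: image_eqI[of _ _ "tm k w"])
      next
        fix k assume "k \<in> {k. \<Gamma> k w \<in> ereal ` A c}"
        then obtain u where "u \<in> A c" "\<Gamma> k w = ereal u" by auto
        then show "k \<in> {k\<in>{..<count T w}. h (tm k w) = c}" using less_count_iff[OF w] by (auto simp: A_def)
      qed
      moreover have "(\<Prod>k\<in>{k\<in>{..<count T w}. h (tm k w) = c}. h (tm k w)) = c ^ card {k\<in>{..<count T w}. h (tm k w) = c}"
        by simp
      ultimately show "(\<Prod>k\<in>{k\<in>{..<count T w}. h (tm k w) = c}. h (tm k w)) = c ^ num_points \<Gamma> (A c) w"
        by (simp add: num_points_def)
    qed
    also have "\<dots> = (\<Prod>i<card R. b i ^ num_points \<Gamma> (A (b i)) w)"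
      using prod.reindex_bij_betw[OF b, of "\<lambda>c. c ^ num_points \<Gamma> (A c) w"] by simp
    also have "\<dots> = (\<Prod>i<card R. b i ^ num_points \<Gamma> (B i) w)" by (simp add: B_def)
    finally show ?thesis .
  qed
  have "(\<integral>w. (\<Prod>k<count T w. h (tm k w)) \<partial>P) = (\<integral>w. (\<Prod>i<card R. b i ^ num_points \<Gamma> (B i) w) \<partial>P)"
    by (rule Bochner_Integration.integral_cong[OF refl prod_eq])
  also have "\<dots> = (\<Prod>i<card R. \<integral>w. b i ^ num_points \<Gamma> (B i) w \<partial>P)"
  proof (rule indep_vars_lebesgue_integral)
    have "indep_vars (\<lambda>_. count_space UNIV) (\<lambda>i. num_points \<Gamma> (B i)) {..<card R}"
      by (rule indep_vars_subset[OF num_points_indep[OF B Bd]]) auto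
    from indep_vars_compose2[OF this, of "\<lambda>i n. b i ^ n" "\<lambda>_. borel"]
    show "indep_vars (\<lambda>_. borel) (\<lambda>i w. b i ^ num_points \<Gamma> (B i) w) {..<card R}" by simp
  qed (use num_points_power(1)[OF B] in auto)
  also have "\<dots> = exp (\<Sum>i<card R. mass (B i) * (b i - 1))"
    unfolding num_points_power(2)[OF B] by (simp add: exp_sum)
  also have "(\<Sum>i<card R. mass (B i) * (b i - 1)) = (\<Sum>c\<in>R. mass (A c) * (c - 1))"
    using sum.reindex_bij_betw[OF b, of "\<lambda>c. mass (A c) * (c - 1)"] by (simp add: B_def)
  also have "\<dots> = (\<Sum>c\<in>R. \<integral>u. of_real (indicator (A c) u * m u) * (c - 1) \<partial>lborel)"
    by (simp only: mass_eq[OF Am AT] integral_mult_left_zero integral_complex_of_real)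
  also have "\<dots> = (\<integral>u. (\<Sum>c\<in>R. of_real (indicator (A c) u * m u) * (c - 1)) \<partial>lborel)"
    by (rule Bochner_Integration.integral_sum[symmetric])
      (intro integrable_mult_left integrable_of_real integrable_m[OF Am AT])
  also have "\<dots> = (\<integral>u. indicator {0..T} u * (h u - 1) * m u \<partial>lborel)"
  proof (rule Bochner_Integration.integral_cong[OF refl])
    fix u
    show "(\<Sum>c\<in>R. of_real (indicator (A c) u * m u) * (c - 1)) = indicator {0..T} u * (h u - 1) * of_real (m u)"
    proof (cases "u \<in> {0..T}")
      case True
      have "(\<Sum>c\<in>R. of_real (indicator (A c) u * m u) * (c - 1)) = (\<Sum>c\<in>R. if c = h u then of_real (m u) * (h u - 1) else 0)"
        using True by (intro sum.cong) (auto simp: A_def indicator_def)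
      also have "\<dots> = of_real (m u) * (h u - 1)" using finR by (simp add: R_def)
      finally show ?thesis using True by simp
    qed (auto simp: A_def)
  qed
  finally show ?thesis .
qed

text \<open>Simple functions bounded by \<open>2 * b\<close> approximate \<open>h\<close> pointwise,
  and \<open>(2 * b) ^ count T w\<close> dominates the products.\<close>

lemma poisson_product:
  fixes h :: "real \<Rightarrow> complex"
  assumes h[measurable]: "h \<in> borel_measurable borel" and hb: "\<And>u. norm (h u) \<le> b"
  shows "(\<integral>w. (\<Prod>k<count T w. h (tm k w)) \<partial>P)
    = exp (\<integral>u. indicator {0..T} u * (h u - 1) * m u \<partial>lborel)"
proof -
  have b: "b \<ge> 0" using hb[of 0] norm_ge_zero order_trans by blast
  obtain F where F: "\<And>i. simple_function borel (F i)" "\<And>u. (\<lambda>i. F i u) \<longlonglongrightarrow> h u"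
    and F2: "\<And>i u. dist (F i u) 0 \<le> 2 * dist (h u) 0"
    using borel_measurable_implies_sequence_metric[OF h, of 0] by auto
  have Fb: "norm (F i u) \<le> 2 * b" for i u using F2[of i u] hb[of u] by simp
  have [measurable]: "F i \<in> borel_measurable borel" for i by (rule borel_measurable_simple_function[OF F(1)])
  have "(\<lambda>i. \<integral>w. (\<Prod>k<count T w. F i (tm k w)) \<partial>P) \<longlonglongrightarrow> (\<integral>w. (\<Prod>k<count T w. h (tm k w)) \<partial>P)"
  proof (rule integral_dominated_convergence[where w="\<lambda>w. (2 * b) ^ count T w"])
    show "integrable P (\<lambda>w. (2 * b) ^ count T w)" by (rule integrable_power_count)
    show "AE w in P. norm (\<Prod>k<count T w. F i (tm k w)) \<le> (2 * b) ^ count T w" for i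
      by (intro AE_I2 norm_prod_count_le Fb)
    show "AE w in P. (\<lambda>i. \<Prod>k<count T w. F i (tm k w)) \<longlonglongrightarrow> (\<Prod>k<count T w. h (tm k w))"
      by (intro AE_I2 tendsto_prod F)
  qed (intro measurable_prod_count; measurable)+
  moreover have "(\<lambda>i. exp (\<integral>u. indicator {0..T} u * (F i u - 1) * m u \<partial>lborel))
    \<longlonglongrightarrow> exp (\<integral>u. indicator {0..T} u * (h u - 1) * m u \<partial>lborel)"
  proof (intro tendsto_exp integral_dominated_convergence[where w="\<lambda>u. indicator {0..T} u * ((2 * b + 1) * mb)"])
    show "AE u in lborel. norm (indicator {0..T} u * (F i u - 1) * complex_of_real (m u)) \<le> indicator {0..T} u * ((2 * b + 1) * mb)" for i
    proof (intro AE_I2)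
      fix u
      have 1: "norm (F i u - 1) \<le> 2 * b + 1" using Fb[of i u] norm_triangle_ineq4[of "F i u" 1] by simp
      have "norm (F i u - 1) * m u \<le> (2 * b + 1) * mb" by (rule mult_mono[OF 1 m_le]) (use b m_nonneg in auto)
      then show "norm (indicator {0..T} u * (F i u - 1) * complex_of_real (m u)) \<le> indicator {0..T} u * ((2 * b + 1) * mb)"
        using m_nonneg[of u] by (simp add: norm_mult indicator_def)
    qed
    show "AE u in lborel. (\<lambda>i. indicator {0..T} u * (F i u - 1) * complex_of_real (m u)) \<longlonglongrightarrow> indicator {0..T} u * (h u - 1) * complex_of_real (m u)"
      by (intro AE_I2 tendsto_intros F)
  qed (measurable, rule integrable_Icc_const)
  ultimately show ?thesis unfolding poisson_product_simple[OF F(1)] by (rule LIMSEQ_unique)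
qed

section \<open>Conditioning on the arrival times\<close>

abbreviation arrival_sigma where "arrival_sigma \<equiv> generated_sigma P UNIV \<Gamma>"

lemma space_arrival_sigma: "space arrival_sigma = space P"
  by (simp add: generated_sigma_def space_measure_of_conv)

lemma subalgebra_arrival_sigma: "subalgebra P arrival_sigma"
  unfolding subalgebra_def
proof (intro conjI space_arrival_sigma)
  have "sets arrival_sigma = sigma_sets (space P) {\<Gamma> i -` B \<inter> space P | i B. i \<in> UNIV \<and> B \<in> sets borel}"
    unfolding generated_sigma_def by (rule sets_measure_of) auto
  also have "\<dots> \<subseteq> sets P" by (rule sets.sigma_sets_subset) (auto intro: measurable_sets[OF \<Gamma>_meas])
  finally show "sets arrival_sigma \<subseteq> sets P" .
qed

lemma \<Gamma>_meas_arrival [measurable]: "\<Gamma> k \<in> borel_measurable arrival_sigma"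
proof (rule measurableI)
  fix B :: "ereal set" assume "B \<in> sets borel"
  then have "\<Gamma> k -` B \<inter> space P \<in> {\<Gamma> i -` B \<inter> space P | i B. i \<in> UNIV \<and> B \<in> sets borel}" by blast
  then show "\<Gamma> k -` B \<inter> space arrival_sigma \<in> sets arrival_sigma"
    unfolding space_arrival_sigma unfolding generated_sigma_def by (subst sets_measure_of) auto
qed simp

lemma kernel_measurable [measurable]:
  assumes "B \<in> sets borel"
  shows "(\<lambda>w. measure (\<nu> (tm k w)) B) \<in> borel_measurable P"
proof -
  have "(\<lambda>w. indicator {0..} (tm k w) * measure (\<nu> (tm k w)) B) \<in> borel_measurable P"
    by (rule measurable_compose[OF _ \<nu>_meas[OF assms]]) simp
  then show ?thesis
    by (rule measurable_cong[THEN iffD1, rotated]) (simp add: tm_nonneg)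
qed

lemma kernel_le_1: "measure (\<nu> u) B \<le> 1" if "u \<ge> 0"
  using prob_space.prob_le_1[OF \<nu>_prob[OF that]] .

text \<open>The restrictions on the count and on the arrival times define an event \<open>G\<close>
  of the arrival sigma-algebra, so the service event may be replaced by its conditional probability.
  On \<open>G\<close> the first \<open>n\<close> arrivals are finite, as the product formula in
  \<open>conditional_services\<close> requires.\<close>

lemma conditional_rect:
  assumes A[measurable]: "\<And>k. A k \<in> sets borel" and B[measurable]: "\<And>k. B k \<in> sets borel"
  shows "(\<integral>w. indicator {w. count T w = n} w * (\<Prod>k<n. indicator (A k) (tm k w) * indicator (B k) (L k w)) \<partial>P)
    = (\<integral>w. indicator {w. count T w = n} w * (\<Prod>k<n. indicator (A k) (tm k w) * measure (\<nu> (tm k w)) (B k)) \<partial>P)"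
proof -
  interpret fs: finite_measure_subalgebra P arrival_sigma
    by unfold_locales (rule subalgebra_arrival_sigma)
  define G where "G = {w\<in>space P. count T w = n \<and> (\<forall>k<n. tm k w \<in> A k)}"
  \<comment> \<open>Written in terms of \<open>\<Gamma>\<close> alone, the condition on the count is
    measurable for the arrival sigma-algebra.\<close>
  have eq: "count T w = n \<longleftrightarrow> (\<forall>k<n. \<Gamma> k w \<le> ereal T) \<and> \<not> \<Gamma> n w \<le> ereal T" if w: "w \<in> space P" for w
  proof
    assume "count T w = n"
    then show "(\<forall>k<n. \<Gamma> k w \<le> ereal T) \<and> \<not> \<Gamma> n w \<le> ereal T" using less_count_iff[OF w, of _ T] by auto
  next
    assume "(\<forall>k<n. \<Gamma> k w \<le> ereal T) \<and> \<not> \<Gamma> n w \<le> ereal T"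
    then have "\<not> n < count T w" "\<forall>k<n. k < count T w" using less_count_iff[OF w, of _ T] by auto
    then show "count T w = n" by (meson linorder_neqE_nat less_irrefl)
  qed
  have "G = {w\<in>space arrival_sigma. ((\<forall>k<n. \<Gamma> k w \<le> ereal T) \<and> \<not> \<Gamma> n w \<le> ereal T) \<and> (\<forall>k<n. tm k w \<in> A k)}"
    unfolding G_def space_arrival_sigma by (intro Collect_cong conj_cong refl eq)
  also have "\<dots> \<in> sets arrival_sigma" by measurable
  finally have G: "G \<in> sets arrival_sigma" .
  then have [measurable]: "G \<in> sets P" using subalgebra_arrival_sigma by (auto simp: subalgebra_def)
  define E where "E = {w \<in> space P. \<forall>k<n. L k w \<in> B k}"
  have [measurable]: "E \<in> sets P" unfolding E_def by measurable
  have "integrable P (indicat_real E)"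
    by (rule integrable_const_bound[of _ 1]) (auto simp: indicator_def)
  from fs.real_cond_exp_intA[OF this G]
  have 1: "(\<integral>w. indicat_real G w * indicator E w \<partial>P) = (\<integral>w. indicat_real G w * real_cond_exp P arrival_sigma (indicator E) w \<partial>P)"
    by (simp add: set_lebesgue_integral_def)
  have "(\<integral>w. indicator {w. count T w = n} w * (\<Prod>k<n. indicator (A k) (tm k w) * indicator (B k) (L k w)) \<partial>P)
    = (\<integral>w. indicat_real G w * indicator E w \<partial>P)"
  proof (rule Bochner_Integration.integral_cong[OF refl])
    fix w assume w: "w \<in> space P"
    have "(\<Prod>k<n. indicator (A k) (tm k w) * indicat_real (B k) (L k w)) =
        (if (\<forall>k<n. tm k w \<in> A k) \<and> (\<forall>k<n. L k w \<in> B k) then 1 else 0)"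
      by (auto simp: indicator_def intro!: prod.neutral)
    then show "indicator {w. count T w = n} w * (\<Prod>k<n. indicator (A k) (tm k w) * indicator (B k) (L k w))
      = indicat_real G w * indicator E w"
      using w by (auto simp: G_def E_def indicator_def)
  qed
  also note 1
  also have "(\<integral>w. indicat_real G w * real_cond_exp P arrival_sigma (indicator E) w \<partial>P)
    = (\<integral>w. indicator {w. count T w = n} w * (\<Prod>k<n. indicator (A k) (tm k w) * measure (\<nu> (tm k w)) (B k)) \<partial>P)"
  proof (rule integral_cong_AE)
    have "real_cond_exp P arrival_sigma (indicator E) \<in> borel_measurable P"
      by (rule measurable_from_subalg[OF subalgebra_arrival_sigma borel_measurable_cond_exp])
    then show "(\<lambda>w. indicat_real G w * real_cond_exp P arrival_sigma (indicator E) w) \<in> borel_measurable P" by measurable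
    show "(\<lambda>w. indicat_real {w. count T w = n} w * (\<Prod>k<n. indicator (A k) (tm k w) * measure (\<nu> (tm k w)) (B k))) \<in> borel_measurable P"
      by measurable
    have "AE w in P. (\<forall>k<n. \<Gamma> k w < \<infinity>) \<longrightarrow> real_cond_exp P arrival_sigma (indicator E) w
           = (\<Prod>k<n. measure (\<nu> (tm k w)) (B k))"
      using cs B unfolding conditional_services_def E_def by blast
    then show "AE w in P. indicat_real G w * real_cond_exp P arrival_sigma (indicator E) w
      = indicator {w. count T w = n} w * (\<Prod>k<n. indicator (A k) (tm k w) * measure (\<nu> (tm k w)) (B k))"
      using AE_space
    proof eventually_elim
      case (elim w)
      show ?case
      proof (cases "count T w = n")
        case True
        then have "\<Gamma> k w < \<infinity>" if "k < n" for k
          using less_count_iff[OF elim(2), of k T] that by (auto intro: le_less_trans)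
        then have e: "real_cond_exp P arrival_sigma (indicator E) w = (\<Prod>k<n. measure (\<nu> (tm k w)) (B k))"
          using elim(1) by simp
        show ?thesis
        proof (cases "\<forall>k<n. tm k w \<in> A k")
          case T: True
          then show ?thesis using True elim(2) unfolding e G_def by simp
        next
          case F: False
          then have "(\<Prod>k<n. indicator (A k) (tm k w) * measure (\<nu> (tm k w)) (B k)) = 0"
            by (auto simp: indicator_def)
          moreover have "w \<notin> G" using F by (simp add: G_def)
          ultimately show ?thesis by simp
        qed
      qed (simp add: G_def)
    qed
  qed
  finally show ?thesis .
qed

text \<open>Multiplying out over choice functions \<open>\<iota>\<close> reduces products of linear
  combinations to products with a single rectangle per factor.\<close>

lemma integral_prod_sum_expand:
  fixes y :: "nat \<Rightarrow> nat \<Rightarrow> 'w \<Rightarrow> real" and c :: "nat \<Rightarrow> complex"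
  assumes [measurable]: "\<And>k i. y k i \<in> borel_measurable P" "I \<in> borel_measurable P"
    and y: "\<And>k i w. w \<in> space P \<Longrightarrow> 0 \<le> y k i w \<and> y k i w \<le> 1"
    and I: "\<And>w. w \<in> space P \<Longrightarrow> 0 \<le> I w \<and> I w \<le> (1::real)"
  shows "(\<integral>w. I w *\<^sub>R (\<Prod>k<n. \<Sum>i<q. c i * of_real (y k i w)) \<partial>P)
    = (\<Sum>\<iota>\<in>PiE {..<n} (\<lambda>_. {..<q}). (\<Prod>k<n. c (\<iota> k)) * of_real (\<integral>w. I w * (\<Prod>k<n. y k (\<iota> k) w) \<partial>P))"
proof -
  have int: "integrable P (\<lambda>w. I w * (\<Prod>k<n. y k (\<iota> k) w))" for \<iota>
  proof (rule integrable_const_bound[of _ 1])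
    show "AE w in P. norm (I w * (\<Prod>k<n. y k (\<iota> k) w)) \<le> 1"
    proof (rule AE_I2)
      fix w assume w: "w \<in> space P"
      have "0 \<le> (\<Prod>k<n. y k (\<iota> k) w)" "(\<Prod>k<n. y k (\<iota> k) w) \<le> 1"
        using y[OF w] by (auto intro!: prod_nonneg prod_le_1)
      then show "norm (I w * (\<Prod>k<n. y k (\<iota> k) w)) \<le> 1"
        using I[OF w] by (simp add: abs_mult mult_le_one)
    qed
  qed measurable
  have "I w *\<^sub>R (\<Prod>k<n. \<Sum>i<q. c i * of_real (y k i w))
      = (\<Sum>\<iota>\<in>PiE {..<n} (\<lambda>_. {..<q}). (\<Prod>k<n. c (\<iota> k)) * of_real (I w * (\<Prod>k<n. y k (\<iota> k) w)))" for w
    by (subst prod_sum_PiE) (auto simp: prod.distrib sum_distrib_left scaleR_conv_of_real mult_ac intro!: sum.cong)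
  then have "(\<integral>w. I w *\<^sub>R (\<Prod>k<n. \<Sum>i<q. c i * of_real (y k i w)) \<partial>P)
    = (\<integral>w. (\<Sum>\<iota>\<in>PiE {..<n} (\<lambda>_. {..<q}). (\<Prod>k<n. c (\<iota> k)) * of_real (I w * (\<Prod>k<n. y k (\<iota> k) w))) \<partial>P)" by simp
  also have "\<dots> = (\<Sum>\<iota>\<in>PiE {..<n} (\<lambda>_. {..<q}). \<integral>w. (\<Prod>k<n. c (\<iota> k)) * of_real (I w * (\<Prod>k<n. y k (\<iota> k) w)) \<partial>P)"
    by (intro Bochner_Integration.integral_sum integrable_mult_right integrable_of_real int)
  finally show ?thesis by (simp only: integral_mult_right_zero integral_complex_of_real)
qed

definition mark_mean :: "(real \<Rightarrow> real \<Rightarrow> complex) \<Rightarrow> real \<Rightarrow> complex" where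
  "mark_mean f u = (\<integral>r. f u r \<partial>\<nu> u)"

lemma mark_mean_rect:
  assumes u: "u \<ge> 0" and "\<And>i. B i \<in> sets borel"
  shows "mark_mean (\<lambda>u r. \<Sum>i<(q::nat). c i * indicator (A i) u * indicator (B i) r) u
    = (\<Sum>i<q. c i * of_real (indicator (A i) u * measure (\<nu> u) (B i)))"
proof -
  interpret N: prob_space "\<nu> u" by (rule \<nu>_prob[OF u])
  have S: "B i \<in> sets (\<nu> u)" for i using assms \<nu>_sets[OF u] by simp
  have i: "integrable (\<nu> u) (\<lambda>r. indicat_real (B i) r)" for i
    by (rule N.integrable_const_bound[of _ 1]) (use S in \<open>auto simp: indicator_def\<close>)
  have "mark_mean (\<lambda>u r. \<Sum>i<q. c i * indicator (A i) u * indicator (B i) r) u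
    = (\<integral>r. (\<Sum>i<q. (c i * of_real (indicator (A i) u)) * of_real (indicat_real (B i) r)) \<partial>\<nu> u)"
    unfolding mark_mean_def by (simp add: of_real_indicator)
  also have "\<dots> = (\<Sum>i<q. \<integral>r. (c i * of_real (indicator (A i) u)) * of_real (indicat_real (B i) r) \<partial>\<nu> u)"
    by (intro Bochner_Integration.integral_sum integrable_mult_right integrable_of_real i)
  also have "\<dots> = (\<Sum>i<q. (c i * of_real (indicator (A i) u)) * of_real (\<integral>r. indicat_real (B i) r \<partial>\<nu> u))"
    by (simp only: integral_mult_right_zero integral_complex_of_real)
  also have "\<dots> = (\<Sum>i<q. c i * of_real (indicator (A i) u * measure (\<nu> u) (B i)))"
    using S sets.sets_into_space[OF S] by (simp add: Int_absorb2 mult.assoc)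
  finally show ?thesis .
qed

lemma conditional_simple:
  assumes "rect_simple f"
  shows "(\<integral>w. indicat_real {w. count T w = n} w *\<^sub>R (\<Prod>k<n. f (tm k w) (L k w)) \<partial>P)
    = (\<integral>w. indicat_real {w. count T w = n} w *\<^sub>R (\<Prod>k<n. mark_mean f (tm k w)) \<partial>P)"
    and "(\<lambda>w. mark_mean f (tm k w)) \<in> borel_measurable P"
    and "(\<lambda>u. if u \<ge> 0 then mark_mean f u else 0) \<in> borel_measurable borel"
proof -
  obtain q :: nat and c A B where AB: "\<And>i. A i \<in> sets borel" "\<And>i. B i \<in> sets borel"
    and f: "f = (\<lambda>u r. \<Sum>i<q. c i * indicator (A i) u * indicator (B i) r)"
    using rect_simple_representation[OF assms] by blast
  note [measurable] = AB
  have f2: "f u r = (\<Sum>i<q. c i * of_real (indicator (A i) u * indicator (B i) r))" for u r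
    unfolding f by (simp add: of_real_indicator mult.assoc)
  have mm: "mark_mean f u = (\<Sum>i<q. c i * of_real (indicator (A i) u * measure (\<nu> u) (B i)))" if "u \<ge> 0" for u
    unfolding f by (rule mark_mean_rect[OF that AB(2)])
  have e1: "(\<integral>w. indicat_real {w. count T w = n} w *\<^sub>R (\<Prod>k<n. f (tm k w) (L k w)) \<partial>P)
    = (\<Sum>\<iota>\<in>PiE {..<n} (\<lambda>_. {..<q}). (\<Prod>k<n. c (\<iota> k)) *
        of_real (\<integral>w. indicator {w. count T w = n} w * (\<Prod>k<n. indicator (A (\<iota> k)) (tm k w) * indicator (B (\<iota> k)) (L k w)) \<partial>P))"
    unfolding f2 by (rule integral_prod_sum_expand) (auto simp: indicator_def)
  have "(\<integral>w. indicat_real {w. count T w = n} w *\<^sub>R (\<Prod>k<n. mark_mean f (tm k w)) \<partial>P)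
    = (\<integral>w. indicat_real {w. count T w = n} w *\<^sub>R (\<Prod>k<n. \<Sum>i<q. c i * of_real (indicator (A i) (tm k w) * measure (\<nu> (tm k w)) (B i))) \<partial>P)"
    by (rule Bochner_Integration.integral_cong[OF refl]) (simp add: mm tm_nonneg del: of_real_mult)
  also have "\<dots> = (\<Sum>\<iota>\<in>PiE {..<n} (\<lambda>_. {..<q}). (\<Prod>k<n. c (\<iota> k)) *
        of_real (\<integral>w. indicator {w. count T w = n} w * (\<Prod>k<n. indicator (A (\<iota> k)) (tm k w) * measure (\<nu> (tm k w)) (B (\<iota> k))) \<partial>P))"
    by (rule integral_prod_sum_expand) (auto simp: indicator_def kernel_le_1 tm_nonneg)
  also have "\<dots> = (\<integral>w. indicat_real {w. count T w = n} w *\<^sub>R (\<Prod>k<n. f (tm k w) (L k w)) \<partial>P)"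
    unfolding e1 conditional_rect[of "\<lambda>k. A (\<iota> k)" "\<lambda>k. B (\<iota> k)" for \<iota>, OF AB] ..
  finally show "(\<integral>w. indicat_real {w. count T w = n} w *\<^sub>R (\<Prod>k<n. f (tm k w) (L k w)) \<partial>P)
    = (\<integral>w. indicat_real {w. count T w = n} w *\<^sub>R (\<Prod>k<n. mark_mean f (tm k w)) \<partial>P)" ..
  have "(\<lambda>w. \<Sum>i<q. c i * of_real (indicator (A i) (tm k w) * measure (\<nu> (tm k w)) (B i))) \<in> borel_measurable P"
    by measurable
  then show "(\<lambda>w. mark_mean f (tm k w)) \<in> borel_measurable P"
    by (rule measurable_cong[THEN iffD1, rotated]) (simp add: mm tm_nonneg del: of_real_mult)
  have "(\<lambda>u. \<Sum>i<q. c i * of_real (indicator (A i) u * (indicator {0..} u * measure (\<nu> u) (B i)))) \<in> borel_measurable borel"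
    using \<nu>_meas[OF AB(2)] by measurable
  also have "(\<lambda>u. \<Sum>i<q. c i * of_real (indicator (A i) u * (indicator {0..} u * measure (\<nu> u) (B i))))
    = (\<lambda>u. if u \<ge> 0 then mark_mean f u else 0)"
    by (auto simp: mm fun_eq_iff)
  finally show "(\<lambda>u. if u \<ge> 0 then mark_mean f u else 0) \<in> borel_measurable borel" .
qed

lemma norm_mark_mean_le:
  assumes u: "u \<ge> 0" and "\<And>r. norm (f u r) \<le> b"
  shows "norm (mark_mean f u) \<le> b"
proof -
  interpret N: prob_space "\<nu> u" by (rule \<nu>_prob[OF u])
  have b: "b \<ge> 0" using assms(2) norm_ge_zero order_trans by blast
  have "norm (mark_mean f u) \<le> (\<integral>r. norm (f u r) \<partial>\<nu> u)" unfolding mark_mean_def by (rule integral_norm_bound)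
  also have "\<dots> \<le> (\<integral>r. b \<partial>\<nu> u)" by (rule integral_mono') (use assms b in auto)
  finally show ?thesis by (simp add: N.prob_space)
qed

lemma mark_mean_tendsto:
  assumes u: "u \<ge> 0" and F: "\<And>i. rect_simple (F i)" "\<And>i r. norm (F i u r) \<le> b" "\<And>r. (\<lambda>i. F i u r) \<longlonglongrightarrow> f u r"
  shows "(\<lambda>i. mark_mean (F i) u) \<longlonglongrightarrow> mark_mean f u"
  unfolding mark_mean_def
proof (rule integral_dominated_convergence[where w="\<lambda>_. b"])
  interpret N: prob_space "\<nu> u" by (rule \<nu>_prob[OF u])
  have [measurable]: "(\<lambda>r. r) \<in> borel_measurable (\<nu> u)" using \<nu>_sets[OF u] by simp
  show Fm: "F i u \<in> borel_measurable (\<nu> u)" for i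
    using measurable_rect_simple[OF F(1), of "\<lambda>_. u" "\<nu> u" "\<lambda>r. r"] by simp
  show "f u \<in> borel_measurable (\<nu> u)"
    by (rule borel_measurable_LIMSEQ_metric[OF Fm F(3)])
  show "integrable (\<nu> u) (\<lambda>_. b)" by simp
qed (use F in auto)

lemma conditional_limit:
  assumes "rect_limit f"
  shows "(\<integral>w. indicat_real {w. count T w = n} w *\<^sub>R (\<Prod>k<n. f (tm k w) (L k w)) \<partial>P)
    = (\<integral>w. indicat_real {w. count T w = n} w *\<^sub>R (\<Prod>k<n. mark_mean f (tm k w)) \<partial>P)"
    and "(\<lambda>w. mark_mean f (tm k w)) \<in> borel_measurable P"
    and "(\<lambda>u. if u \<ge> 0 then mark_mean f u else 0) \<in> borel_measurable borel"
proof -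
  obtain F b where F: "\<And>i. rect_simple (F i)" "\<And>i u r. norm (F i u r) \<le> b" "\<And>u r. (\<lambda>i. F i u r) \<longlonglongrightarrow> f u r"
    using assms unfolding rect_limit_def by blast
  have b: "b \<ge> 0" using F(2) norm_ge_zero order_trans by blast
  have mm: "(\<lambda>i. mark_mean (F i) u) \<longlonglongrightarrow> mark_mean f u" if "u \<ge> 0" for u
    by (rule mark_mean_tendsto[where b=b]) (use that F in auto)
  note Fm[measurable] = conditional_simple(2)[OF F(1)]
  show m1[measurable]: "(\<lambda>w. mark_mean f (tm k w)) \<in> borel_measurable P" for k
    by (rule borel_measurable_LIMSEQ_metric[of "\<lambda>i w. mark_mean (F i) (tm k w)"]) (use mm tm_nonneg in auto)
  show "(\<lambda>u. if u \<ge> 0 then mark_mean f u else 0) \<in> borel_measurable borel"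
    by (rule borel_measurable_LIMSEQ_metric[of "\<lambda>i u. if u \<ge> 0 then mark_mean (F i) u else 0"])
      (use mm conditional_simple(3)[OF F(1)] in auto)
  note [measurable] = measurable_rect_simple[OF F(1)] measurable_rect_limit[OF assms]
  have bound: "norm (indicat_real {w. count T w = n} w *\<^sub>R (\<Prod>k<n. z k)) \<le> b ^ n" if "\<And>k. k < n \<Longrightarrow> norm (z k) \<le> b" for z :: "nat \<Rightarrow> complex" and w
    using norm_prod_count_le[of n z b, OF that] b by (auto simp: indicator_def)
  have "(\<lambda>i. \<integral>w. indicat_real {w. count T w = n} w *\<^sub>R (\<Prod>k<n. F i (tm k w) (L k w)) \<partial>P)
    \<longlonglongrightarrow> (\<integral>w. indicat_real {w. count T w = n} w *\<^sub>R (\<Prod>k<n. f (tm k w) (L k w)) \<partial>P)"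
    by (rule integral_dominated_convergence[where w="\<lambda>_. b ^ n"])
      (auto intro!: AE_I2 tendsto_intros F bound simp del: norm_scaleR)
  moreover have "(\<lambda>i. \<integral>w. indicat_real {w. count T w = n} w *\<^sub>R (\<Prod>k<n. mark_mean (F i) (tm k w)) \<partial>P)
    \<longlonglongrightarrow> (\<integral>w. indicat_real {w. count T w = n} w *\<^sub>R (\<Prod>k<n. mark_mean f (tm k w)) \<partial>P)"
    by (rule integral_dominated_convergence[where w="\<lambda>_. b ^ n"])
      (auto intro!: AE_I2 tendsto_intros mm tm_nonneg F bound norm_mark_mean_le simp del: norm_scaleR)
  ultimately show "(\<integral>w. indicat_real {w. count T w = n} w *\<^sub>R (\<Prod>k<n. f (tm k w) (L k w)) \<partial>P)
    = (\<integral>w. indicat_real {w. count T w = n} w *\<^sub>R (\<Prod>k<n. mark_mean f (tm k w)) \<partial>P)"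
    unfolding conditional_simple(1)[OF F(1)] by (rule LIMSEQ_unique)
qed

text \<open>The conditioning results hold on the events where the count is a given \<open>n\<close>;
  summing over \<open>n\<close> under the dominating function \<open>b ^ count T w\<close> removes
  that restriction.\<close>

lemma integral_by_count:
  fixes f :: "nat \<Rightarrow> 'w \<Rightarrow> complex"
  assumes [measurable]: "\<And>k. f k \<in> borel_measurable P" and b: "\<And>k w. w \<in> space P \<Longrightarrow> norm (f k w) \<le> b"
  shows "(\<lambda>q. \<Sum>n<q. \<integral>w. indicat_real {w. count T w = n} w *\<^sub>R (\<Prod>k<n. f k w) \<partial>P)
    \<longlonglongrightarrow> (\<integral>w. (\<Prod>k<count T w. f k w) \<partial>P)"
proof -
  obtain w0 where "w0 \<in> space P" using not_empty by blast
  then have b0: "b \<ge> 0" using b norm_ge_zero order_trans by blast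
  have int: "integrable P (\<lambda>w. indicat_real {w. count T w = n} w *\<^sub>R (\<Prod>k<n. f k w))" for n
    by (rule integrable_const_bound[of _ "b ^ n"])
      (use norm_prod_count_le[of n _ b] b b0 in \<open>auto intro!: AE_I2 simp: indicator_def\<close>)
  have eq: "(\<Sum>n<q. \<integral>w. indicat_real {w. count T w = n} w *\<^sub>R (\<Prod>k<n. f k w) \<partial>P)
    = (\<integral>w. indicat_real {w. count T w < q} w *\<^sub>R (\<Prod>k<count T w. f k w) \<partial>P)" for q
  proof -
    have "(\<Sum>n<q. indicat_real {w. count T w = n} w *\<^sub>R (\<Prod>k<n. f k w)) = indicat_real {w. count T w < q} w *\<^sub>R (\<Prod>k<count T w. f k w)" for w
    proof -
      have "(\<Sum>n<q. indicat_real {w. count T w = n} w *\<^sub>R (\<Prod>k<n. f k w))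
        = (\<Sum>n<q. if n = count T w then (\<Prod>k<n. f k w) else 0)"
        by (rule sum.cong) (auto simp: indicator_def)
      then show ?thesis by (simp add: indicator_def)
    qed
    then show ?thesis using int by (subst Bochner_Integration.integral_sum[symmetric]) auto
  qed
  show ?thesis unfolding eq
  proof (rule integral_dominated_convergence[where w="\<lambda>w. b ^ count T w"])
    show "integrable P (\<lambda>w. b ^ count T w)" by (rule integrable_power_count)
    show "(\<lambda>w. \<Prod>k<count T w. f k w) \<in> borel_measurable P" by (rule measurable_prod_count) simp
    then show "(\<lambda>w. indicat_real {w. count T w < q} w *\<^sub>R (\<Prod>k<count T w. f k w)) \<in> borel_measurable P" for q by measurable
    show "AE w in P. norm (indicat_real {w. count T w < q} w *\<^sub>R (\<Prod>k<count T w. f k w)) \<le> b ^ count T w" for q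
      using norm_prod_count_le[of _ _ b] b b0 by (auto intro!: AE_I2 simp: indicator_def)
    show "AE w in P. (\<lambda>q. indicat_real {w. count T w < q} w *\<^sub>R (\<Prod>k<count T w. f k w)) \<longlonglongrightarrow> (\<Prod>k<count T w. f k w)"
    proof (rule AE_I2, rule tendsto_eventually)
      fix w
      show "\<forall>\<^sub>F q in sequentially. indicat_real {w. count T w < q} w *\<^sub>R (\<Prod>k<count T w. f k w) = (\<Prod>k<count T w. f k w)"
        using eventually_gt_at_top[of "count T w"] by eventually_elim simp
    qed
  qed
qed

text \<open>Averaging out the services replaces \<open>f\<close> by its mean under the service law,
  after which the Poisson product formula applies: Campbell's formula for the marked
  process.\<close>

lemma marked_product_expectation:
  assumes f: "rect_limit f"
  shows "(\<integral>w. (\<Prod>k<count T w. f (tm k w) (L k w)) \<partial>P)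
    = exp (\<integral>u. indicator {0..T} u * (mark_mean f u - 1) * m u \<partial>lborel)"
    and "integrable P (\<lambda>w. \<Prod>k<count T w. f (tm k w) (L k w))"
proof -
  obtain b where b: "b \<ge> 1" "\<And>u r. norm (f u r) \<le> b" using rect_limit_bounded[OF f] by blast
  have [measurable]: "(\<lambda>w. f (tm k w) (L k w)) \<in> borel_measurable P" for k by (rule measurable_rect_limit[OF f]) auto
  note [measurable] = conditional_limit(2)[OF f]
  \<comment> \<open>The same partial sums over the count converge to either side.\<close>
  have "(\<integral>w. (\<Prod>k<count T w. f (tm k w) (L k w)) \<partial>P) = (\<integral>w. (\<Prod>k<count T w. mark_mean f (tm k w)) \<partial>P)"
  proof (rule LIMSEQ_unique)
    show "(\<lambda>q. \<Sum>n<q. \<integral>w. indicat_real {w. count T w = n} w *\<^sub>R (\<Prod>k<n. f (tm k w) (L k w)) \<partial>P)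
      \<longlonglongrightarrow> (\<integral>w. (\<Prod>k<count T w. f (tm k w) (L k w)) \<partial>P)"
      by (rule integral_by_count[where b=b]) (use b in auto)
    show "(\<lambda>q. \<Sum>n<q. \<integral>w. indicat_real {w. count T w = n} w *\<^sub>R (\<Prod>k<n. f (tm k w) (L k w)) \<partial>P)
      \<longlonglongrightarrow> (\<integral>w. (\<Prod>k<count T w. mark_mean f (tm k w)) \<partial>P)"
      unfolding conditional_limit(1)[OF f]
      by (rule integral_by_count[where b=b]) (use b norm_mark_mean_le tm_nonneg in auto)
  qed
  \<comment> \<open>The mean is controlled at nonnegative times only; arrival times are nonnegative,
    so its value elsewhere may be set to 0 to obtain a Borel function.\<close>
  also have "\<dots> = (\<integral>w. (\<Prod>k<count T w. (if tm k w \<ge> 0 then mark_mean f (tm k w) else 0)) \<partial>P)"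
    by (rule Bochner_Integration.integral_cong) (auto simp: tm_nonneg)
  also have "\<dots> = exp (\<integral>u. indicator {0..T} u * ((if u \<ge> 0 then mark_mean f u else 0) - 1) * m u \<partial>lborel)"
    by (rule poisson_product[OF conditional_limit(3)[OF f], where b=b]) (use b norm_mark_mean_le in auto)
  also have "(\<integral>u. indicator {0..T} u * ((if u \<ge> 0 then mark_mean f u else 0) - 1) * m u \<partial>lborel)
    = (\<integral>u. indicator {0..T} u * (mark_mean f u - 1) * m u \<partial>lborel)"
    by (rule Bochner_Integration.integral_cong) (auto simp: indicator_def)
  finally show "(\<integral>w. (\<Prod>k<count T w. f (tm k w) (L k w)) \<partial>P)
    = exp (\<integral>u. indicator {0..T} u * (mark_mean f u - 1) * m u \<partial>lborel)" .
  show "integrable P (\<lambda>w. \<Prod>k<count T w. f (tm k w) (L k w))"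
  proof (rule Bochner_Integration.integrable_bound[OF integrable_power_count[of b T]])
    show "(\<lambda>w. \<Prod>k<count T w. f (tm k w) (L k w)) \<in> borel_measurable P" by (rule measurable_prod_count) simp
    show "AE w in P. norm (\<Prod>k<count T w. f (tm k w) (L k w)) \<le> norm (b ^ count T w)"
      using norm_prod_count_le[of _ _ b] b by (intro AE_I2) simp
  qed
qed

end

section \<open>Exponential moments of the queue\<close>

definition alive :: "real \<Rightarrow> real \<Rightarrow> real \<Rightarrow> real" where
  "alive t u r = indicator {0..t} u * indicator {t - u<..} r"

definition mark_fun :: "(real \<Rightarrow> real \<Rightarrow> real) \<Rightarrow> bool" where
  "mark_fun \<phi> \<longleftrightarrow> (\<exists>b. \<forall>u r. \<bar>\<phi> u r\<bar> \<le> b) \<and> (\<forall>u. \<phi> u \<in> borel_measurable borel) \<and>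
     (\<forall>z::complex. rect_limit (\<lambda>u r. exp (z * of_real (\<phi> u r))))"

lemma mark_fun_add:
  assumes "mark_fun \<phi>" "mark_fun \<xi>"
  shows "mark_fun (\<lambda>u r. \<phi> u r + \<xi> u r)"
proof -
  obtain b b' where b: "\<And>u r. \<bar>\<phi> u r\<bar> \<le> b" "\<And>u r. \<bar>\<xi> u r\<bar> \<le> b'"
    using assms unfolding mark_fun_def by blast
  have "\<bar>\<phi> u r + \<xi> u r\<bar> \<le> b + b'" for u r using b(1)[of u r] b(2)[of u r] by linarith
  moreover have "rect_limit (\<lambda>u r. exp (z * of_real (\<phi> u r + \<xi> u r)))" for z :: complex
    using rect_limit_mult[of "\<lambda>u r. exp (z * of_real (\<phi> u r))" "\<lambda>u r. exp (z * of_real (\<xi> u r))"] assms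
    by (simp add: mark_fun_def distrib_left exp_add)
  ultimately show ?thesis using assms unfolding mark_fun_def by (auto intro: borel_measurable_add)
qed

lemma mark_fun_scale:
  assumes "mark_fun \<phi>"
  shows "mark_fun (\<lambda>u r. \<theta> * \<phi> u r)"
proof -
  obtain b where b: "\<And>u r. \<bar>\<phi> u r\<bar> \<le> b" using assms unfolding mark_fun_def by blast
  have "\<bar>\<theta> * \<phi> u r\<bar> \<le> \<bar>\<theta>\<bar> * b" for u r unfolding abs_mult by (rule mult_left_mono[OF b]) simp
  moreover have "rect_limit (\<lambda>u r. exp (z * of_real (\<theta> * \<phi> u r)))" for z :: complex
    using assms unfolding mark_fun_def by (simp add: mult.assoc[symmetric])
  moreover have "(\<lambda>r. \<theta> * \<phi> u r) \<in> borel_measurable borel" for u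
  proof -
    have "\<phi> u \<in> borel_measurable borel" using assms unfolding mark_fun_def by blast
    then show ?thesis by (rule borel_measurable_times[OF borel_measurable_const])
  qed
  ultimately show ?thesis unfolding mark_fun_def by blast
qed

lemma mark_fun_zero: "mark_fun (\<lambda>u r. 0)"
  unfolding mark_fun_def by (auto intro!: rect_limit_simple[where B=1] rect_simple_const exI[of _ 0])

lemma mark_fun_sum: "finite J \<Longrightarrow> (\<And>j. j \<in> J \<Longrightarrow> mark_fun (\<phi> j)) \<Longrightarrow> mark_fun (\<lambda>u r. \<Sum>j\<in>J. \<phi> j u r)"
  by (induction J rule: finite_induct) (auto intro: mark_fun_zero mark_fun_add)

lemma exp_times_indicator: "x = 0 \<or> x = 1 \<Longrightarrow> exp (z * of_real x) = 1 + (exp z - 1) * (of_real x :: complex)"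
  by auto

lemma mark_fun_interval: "mark_fun (\<lambda>u r. indicator {s<..s'} u)"
proof -
  have "rect_limit (\<lambda>u r. exp (z * of_real (indicator {s<..s'} u)))" for z :: complex
  proof -
    have e: "(\<lambda>u r. exp (z * of_real (indicator {s<..s'} u)))
        = (\<lambda>u (r::real). 1 + (exp z - 1) * indicator {s<..s'} u * indicator UNIV r)"
      by (simp add: indicator_def fun_eq_iff)
    show ?thesis unfolding e
    proof (rule rect_limit_simple)
      show "rect_simple (\<lambda>u r. 1 + (exp z - 1) * indicator {s<..s'} u * indicator UNIV r)"
        by (intro rect_simple.add rect_simple_const rect_simple.rect) auto
      show "norm (1 + (exp z - 1) * indicator {s<..s'} u * indicator UNIV r) \<le> 1 + norm (exp z - 1)" for u r :: real
        using norm_triangle_ineq[of 1 "exp z - 1"] by (auto simp: indicator_def)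
    qed
  qed
  then show ?thesis unfolding mark_fun_def by (auto intro!: exI[of _ 1] simp: indicator_def)
qed

lemma dyadic_floor_tendsto: "(\<lambda>i. dyadic_floor i u) \<longlonglongrightarrow> u"
proof (rule tendsto_sandwich)
  show "(\<lambda>i. u - 1 / 2 ^ i) \<longlonglongrightarrow> u"
    using tendsto_diff[OF tendsto_const[of u] LIMSEQ_divide_realpow_zero[of 2 1]] by simp
qed (auto intro!: always_eventually less_imp_le[OF dyadic_floor_gt] dyadic_floor_le)

text \<open>The region \<open>r > t - u\<close> is not a finite union of rectangles. With
  \<open>u\<close> replaced by \<open>dyadic_floor i u\<close> in the threshold it becomes one, and
  since the floors approach \<open>u\<close> from below, the indicators of the open half-lines
  converge pointwise.\<close>

lemma mark_fun_alive: "mark_fun (alive t)"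
proof -
  have "rect_limit (\<lambda>u r. exp (z * of_real (alive t u r)))" for z :: complex
  proof -
    define J where "J i = {..nat \<lfloor>2 ^ i * t\<rfloor>}" for i :: nat
    define A where "A i j = {u \<in> {0..t}. \<lfloor>2 ^ i * u\<rfloor> = int j}" for i j :: nat
    define F where "F i u r = 1 + (\<Sum>j\<in>J i. (exp z - 1) * indicator (A i j) u * indicator {t - real j / 2 ^ i<..} r)" for i u r
    have A[measurable]: "A i j \<in> sets borel" for i j unfolding A_def by measurable
    have Fs: "rect_simple (F i)" for i
      unfolding F_def by (intro rect_simple.add rect_simple_const rect_simple_sum rect_simple.rect) (auto simp: J_def A)
    have Fv: "F i u r = 1 + (exp z - 1) * of_real (indicator {0..t} u * indicator {t - dyadic_floor i u<..} r)" for i u r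
    proof (cases "u \<in> {0..t}")
      case True
      define j0 where "j0 = nat \<lfloor>2 ^ i * u\<rfloor>"
      have "0 \<le> 2 ^ i * u" "2 ^ i * u \<le> 2 ^ i * t" using True by auto
      then have j0: "\<lfloor>2 ^ i * u\<rfloor> = int j0" "j0 \<in> J i" unfolding j0_def J_def by (auto intro!: nat_mono floor_mono)
      have fl: "dyadic_floor i u = real j0 / 2 ^ i" unfolding dyadic_floor_def j0(1) by simp
      have "(\<Sum>j\<in>J i. (exp z - 1) * indicator (A i j) u * indicator {t - real j / 2 ^ i<..} r)
        = (\<Sum>j\<in>J i. if j = j0 then (exp z - 1) * indicator {t - real j0 / 2 ^ i<..} r else 0)"
        using True j0(1) by (intro sum.cong) (auto simp: A_def indicator_def)
      also have "\<dots> = (exp z - 1) * indicator {t - real j0 / 2 ^ i<..} r" using j0(2) by (simp add: J_def)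
      finally show ?thesis using True unfolding F_def fl by (simp add: of_real_indicator)
    qed (auto simp: F_def A_def)
    have Fb: "norm (F i u r) \<le> 1 + norm (exp z - 1)" for i u r
      unfolding Fv using norm_triangle_ineq[of 1 "exp z - 1"] by (auto simp: indicator_def)
    have Fl: "(\<lambda>i. F i u r) \<longlonglongrightarrow> exp (z * of_real (alive t u r))" for u r
    proof -
      have "\<forall>\<^sub>F i in sequentially. indicat_real {t - dyadic_floor i u<..} r = indicator {t - u<..} r"
      proof (cases "t - u < r")
        case True
        then have "\<forall>\<^sub>F i in sequentially. t - r < dyadic_floor i u"
          by (intro order_tendstoD(1)[OF dyadic_floor_tendsto]) simp
        then show ?thesis by eventually_elim (use True in \<open>auto simp: indicator_def\<close>)
      next
        case False
        then have "\<not> t - dyadic_floor i u < r" for i using dyadic_floor_le[of i u] by linarith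
        then show ?thesis using False by (auto simp: indicator_def)
      qed
      then have "\<forall>\<^sub>F i in sequentially. F i u r = exp (z * of_real (alive t u r))"
      proof eventually_elim
        case (elim i)
        have "F i u r = 1 + (exp z - 1) * of_real (alive t u r)" unfolding Fv alive_def elim ..
        then show ?case by (subst exp_times_indicator) (auto simp: alive_def indicator_def)
      qed
      then show ?thesis by (rule tendsto_eventually)
    qed
    show ?thesis unfolding rect_limit_def using Fs Fb Fl by blast
  qed
  moreover have "alive t u \<in> borel_measurable borel" for u
    unfolding alive_def[abs_def] by measurable
  moreover have "\<bar>alive t u r\<bar> \<le> 1" for u r by (simp add: alive_def indicator_def)
  ultimately show ?thesis unfolding mark_fun_def by blast
qed

text \<open>For \<open>x = - y\<close> the claim is
  \<open>(1 - y + y\<^sup>2) * exp y \<ge> 1\<close>, which follows from the quadratic Taylor lower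
  bound for \<open>exp y\<close>.\<close>

lemma exp_quadratic_upper: "\<bar>x\<bar> \<le> 1 \<Longrightarrow> exp x \<le> 1 + x + (x::real)\<^sup>2"
proof (cases "x \<ge> 0")
  case False
  assume x: "\<bar>x\<bar> \<le> 1"
  define y where "y = - x"
  have y: "0 \<le> y" "y \<le> 1" using False x by (auto simp: y_def)
  have e: "exp y \<ge> 1 + y + y\<^sup>2 / 2" by (rule exp_lower_Taylor_quadratic[OF y(1)])
  have nn: "0 \<le> 1 - y + y\<^sup>2" using y by (simp add: power2_eq_square)
  have "1 \<le> (1 - y + y\<^sup>2) * (1 + y + y\<^sup>2 / 2)"
  proof -
    have "(1 - y + y\<^sup>2) * (1 + y + y\<^sup>2 / 2) = 1 + y\<^sup>2 / 2 + y ^ 3 / 2 + y ^ 4 / 2"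
      by (simp add: field_simps power2_eq_square power3_eq_cube power4_eq_xxxx)
    then show ?thesis using y by simp
  qed
  also have "\<dots> \<le> (1 - y + y\<^sup>2) * exp y" by (rule mult_left_mono[OF e nn])
  finally have "exp (- y) \<le> (1 - y + y\<^sup>2)"
    by (simp add: exp_minus field_simps)
  then show ?thesis by (simp add: y_def)
qed (auto intro: exp_bound)

locale queue = service_density \<rho> \<alpha> c C + marked_poisson P \<Gamma> L m "service_law \<rho>" mb
  for \<rho> :: "real \<Rightarrow> real \<Rightarrow> real" and \<alpha> c C :: real and P :: "'w measure" and \<Gamma> L m mb
begin

definition tail_at :: "real \<Rightarrow> real \<Rightarrow> real" where
  "tail_at t u = indicator {0..t} u * service_tail \<rho> u (t - u)"

definition mean :: "real \<Rightarrow> real" where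
  "mean t = (\<integral>u. tail_at t u * m u \<partial>lborel)"

lemma sets_service_law: "sets (service_law \<rho> u) = sets borel"
  by (simp add: service_law_def)

lemma mb_nonneg: "0 \<le> mb"
  using m_nonneg[of 0] m_le[of 0] by simp

lemma mark_fun_integrable:
  assumes "mark_fun \<phi>" and u: "u \<ge> 0" and f: "continuous_on UNIV (f :: real \<Rightarrow> 'b :: {banach, second_countable_topology})"
  shows "integrable (service_law \<rho> u) (\<lambda>r. f (\<phi> u r))"
proof -
  interpret N: prob_space "service_law \<rho> u" by (rule \<rho>_prob[OF u])
  obtain b where b: "\<And>u r. \<bar>\<phi> u r\<bar> \<le> b" using assms unfolding mark_fun_def by blast
  have "bounded (f ` {-b..b})"
    by (intro compact_imp_bounded compact_continuous_image continuous_on_subset[OF f]) auto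
  then obtain B where B: "\<And>x. x \<in> {-b..b} \<Longrightarrow> norm (f x) \<le> B" unfolding bounded_iff by blast
  have [measurable]: "\<phi> u \<in> borel_measurable (service_law \<rho> u)" "f \<in> borel_measurable borel"
    using assms(1) borel_measurable_continuous_onI[OF f]
    by (auto simp: mark_fun_def cong: measurable_cong_sets[OF sets_service_law refl])
  show ?thesis
    by (rule N.integrable_const_bound[of _ B]) (use b in \<open>auto intro!: AE_I2 B simp: abs_le_iff minus_le_iff\<close>)
qed

lemma integral_alive: "u \<ge> 0 \<Longrightarrow> (\<integral>r. alive t u r \<partial>service_law \<rho> u) = tail_at t u"
proof -
  assume u: "u \<ge> 0"
  interpret N: prob_space "service_law \<rho> u" by (rule \<rho>_prob[OF u])
  have "space (service_law \<rho> u) = UNIV" by (simp add: service_law_def)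
  then have "(\<integral>r. alive t u r \<partial>service_law \<rho> u) = indicator {0..t} u * measure (service_law \<rho> u) {t - u<..}"
    unfolding alive_def by simp
  then show ?thesis using service_tail_eq[OF u, of "t - u"] by (auto simp: tail_at_def indicator_def)
qed

text \<open>The source of the covariance kernel: presence at two times means arrival by the earlier
  one and survival to the later one.\<close>

lemma alive_mult: "alive s u r * alive t u r = indicator {0..min s t} u * alive (max s t) u r"
  by (auto simp: alive_def indicator_def max_def min_def)

lemma tail_at_bounds: "0 \<le> tail_at t u" "tail_at t u \<le> 1"
  using service_tail_bounds[of u "t - u"] by (auto simp: tail_at_def indicator_def)

lemma tail_at_measurable [measurable]: "tail_at t \<in> borel_measurable borel"
proof -
  have "continuous_on {0<..t} (\<lambda>u. service_tail \<rho> u (t - u))"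
    unfolding continuous_on_iff
  proof (intro ballI allI impI)
    fix u e :: real assume u: "u \<in> {0<..t}" and "e > 0"
    define K where "K = C / c + C"
    have K: "K > 0" using C_pos c_pos by (simp add: K_def add_pos_pos)
    have "dist (service_tail \<rho> x (t - x)) (service_tail \<rho> u (t - u)) < e" if x: "x \<in> {0<..t}" "dist x u < e / K" for x
    proof -
      have "\<bar>service_tail \<rho> x (t - x) - service_tail \<rho> u (t - u)\<bar> \<le> C / c * \<bar>x - u\<bar> + C * \<bar>(t - x) - (t - u)\<bar>"
        by (rule service_tail_lipschitz) (use u x in auto)
      also have "\<dots> = K * \<bar>x - u\<bar>" by (simp add: K_def distrib_right abs_minus_commute)
      also have "\<dots> < K * (e / K)" using x(2) K by (intro mult_strict_left_mono) (auto simp: dist_real_def)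
      also have "\<dots> = e" using K by simp
      finally show ?thesis by (simp add: dist_real_def)
    qed
    then show "\<exists>d>0. \<forall>x\<in>{0<..t}. dist x u < d \<longrightarrow> dist (service_tail \<rho> x (t - x)) (service_tail \<rho> u (t - u)) < e"
      using divide_pos_pos[OF \<open>e > 0\<close> K] by blast
  qed
  from borel_measurable_continuous_on_indicator[OF _ this]
  have [measurable]: "(\<lambda>u. indicator {0<..t} u *\<^sub>R service_tail \<rho> u (t - u)) \<in> borel_measurable borel" by simp
  have "(\<lambda>u. indicator {0<..t} u *\<^sub>R service_tail \<rho> u (t - u) + indicator {0} u * tail_at t 0) \<in> borel_measurable borel"
    by measurable
  also have "(\<lambda>u. indicator {0<..t} u *\<^sub>R service_tail \<rho> u (t - u) + indicator {0} u * tail_at t 0) = tail_at t"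
    by (auto simp: tail_at_def indicator_def fun_eq_iff)
  finally show ?thesis .
qed

lemma integrable_times_m:
  fixes f :: "real \<Rightarrow> 'b :: {real_normed_field, banach, second_countable_topology}"
  assumes [measurable]: "f \<in> borel_measurable borel" and "\<And>u. norm (f u) \<le> b" "\<And>u. u \<notin> {0..T} \<Longrightarrow> f u = 0"
  shows "integrable lborel (\<lambda>u. f u * of_real (m u))"
proof (rule Bochner_Integration.integrable_bound[OF integrable_Icc_const[of T "b * mb"]])
  show "AE u in lborel. norm (f u * of_real (m u)) \<le> norm (indicator {0..T} u * (b * mb))"
  proof (rule AE_I2)
    fix u
    show "norm (f u * of_real (m u)) \<le> norm (indicator {0..T} u * (b * mb))"
    proof (cases "u \<in> {0..T}")
      case True
      have b: "0 \<le> b" using assms(2)[of u] norm_ge_zero order_trans by blast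
      have "norm (f u) * m u \<le> b * mb" by (rule mult_mono) (use assms m_le m_nonneg b in auto)
      then show ?thesis using True b m_nonneg mb_nonneg by (simp add: norm_mult)
    qed (simp add: assms(3))
  qed
qed measurable

text \<open>\<open>T\<close> is any horizon beyond \<open>t\<close>, so that several times can share
  one finite sum over arrivals.\<close>

lemma active_jobs_eq:
  assumes w: "w \<in> space P" and t: "0 \<le> t" "t \<le> T"
  shows "active_jobs \<Gamma> L t w = (\<Sum>k<count T w. alive t (tm k w) (L k w))"
proof -
  have "active_jobs \<Gamma> L t w = (\<Sum>k<count T w. of_bool (\<Gamma> k w \<le> ereal t \<and> ereal t < \<Gamma> k w + ereal (L k w)))"
    unfolding active_jobs_def
  proof (rule suminf_finite)
    fix k assume "k \<notin> {..<count T w}"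
    then have "\<not> \<Gamma> k w \<le> ereal T" using less_count_iff[OF w] by auto
    then have "\<not> \<Gamma> k w \<le> ereal t" using t order_trans[of "\<Gamma> k w" "ereal t" "ereal T"] by auto
    then show "of_bool (\<Gamma> k w \<le> ereal t \<and> ereal t < \<Gamma> k w + ereal (L k w)) = (0::real)" by simp
  qed simp
  also have "\<dots> = (\<Sum>k<count T w. alive t (tm k w) (L k w))"
  proof (rule sum.cong[OF refl])
    fix k assume "k \<in> {..<count T w}"
    then have k: "0 \<le> tm k w" "\<Gamma> k w = ereal (tm k w)" using tm_bounds[OF w, of k T] by auto
    define u where "u = tm k w"
    have "(of_bool (ereal u \<le> ereal t \<and> ereal t < ereal u + ereal (L k w)) :: real) = alive t u (L k w)"
      using k(1) by (auto simp: alive_def indicator_def u_def)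
    then show "of_bool (\<Gamma> k w \<le> ereal t \<and> ereal t < \<Gamma> k w + ereal (L k w)) = alive t (tm k w) (L k w)"
      unfolding u_def k(2)[symmetric] by simp
  qed
  finally show ?thesis .
qed

lemma exp_functional:
  fixes z :: complex
  assumes \<phi>: "mark_fun \<phi>"
  shows "(\<integral>w. exp (z * of_real (\<Sum>k<count T w. \<phi> (tm k w) (L k w))) \<partial>P)
    = exp (\<integral>u. indicator {0..T} u * ((\<integral>r. exp (z * of_real (\<phi> u r)) \<partial>service_law \<rho> u) - 1) * m u \<partial>lborel)"
    and "integrable P (\<lambda>w. exp (z * of_real (\<Sum>k<count T w. \<phi> (tm k w) (L k w))))"
proof -
  have "rect_limit (\<lambda>u r. exp (z * of_real (\<phi> u r)))" using \<phi> by (simp add: mark_fun_def)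
  note * = marked_product_expectation[OF this, of T]
  have e: "exp (z * of_real (\<Sum>k<count T w. \<phi> (tm k w) (L k w))) = (\<Prod>k<count T w. exp (z * of_real (\<phi> (tm k w) (L k w))))" for w
    by (simp add: sum_distrib_left exp_sum)
  show "(\<integral>w. exp (z * of_real (\<Sum>k<count T w. \<phi> (tm k w) (L k w))) \<partial>P)
    = exp (\<integral>u. indicator {0..T} u * ((\<integral>r. exp (z * of_real (\<phi> u r)) \<partial>service_law \<rho> u) - 1) * m u \<partial>lborel)"
    unfolding e using *(1) by (simp add: mark_mean_def)
  show "integrable P (\<lambda>w. exp (z * of_real (\<Sum>k<count T w. \<phi> (tm k w) (L k w))))"
    unfolding e by (rule *(2))
qed

lemma exp_mean_measurable:
  fixes z :: complex
  assumes \<phi>: "mark_fun \<phi>"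
  shows "(\<lambda>u. indicator {0..T} u * (\<integral>r. exp (z * of_real (\<phi> u r)) \<partial>service_law \<rho> u)) \<in> borel_measurable borel"
proof -
  have "rect_limit (\<lambda>u r. exp (z * of_real (\<phi> u r)))" using \<phi> by (simp add: mark_fun_def)
  from conditional_limit(3)[OF this]
  have [measurable]: "(\<lambda>u. if u \<ge> 0 then \<integral>r. exp (z * of_real (\<phi> u r)) \<partial>service_law \<rho> u else 0) \<in> borel_measurable borel"
    unfolding mark_mean_def .
  have "(\<lambda>u. indicator {0..T} u * (if u \<ge> 0 then \<integral>r. exp (z * of_real (\<phi> u r)) \<partial>service_law \<rho> u else 0)) \<in> borel_measurable borel"
    by measurable
  also have "(\<lambda>u. indicator {0..T} u * (if u \<ge> 0 then \<integral>r. exp (z * of_real (\<phi> u r)) \<partial>service_law \<rho> u else 0))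
    = (\<lambda>u. indicator {0..T} u * (\<integral>r. exp (z * of_real (\<phi> u r)) \<partial>service_law \<rho> u))"
    by (auto simp: indicator_def fun_eq_iff)
  finally show ?thesis .
qed

lemma real_exp_functional:
  assumes \<phi>: "mark_fun \<phi>"
  shows "(\<integral>w. exp (\<Sum>k<count T w. \<phi> (tm k w) (L k w)) \<partial>P)
    = exp (\<integral>u. indicator {0..T} u * ((\<integral>r. exp (\<phi> u r) \<partial>service_law \<rho> u) - 1) * m u \<partial>lborel)"
    and "integrable P (\<lambda>w. exp (\<Sum>k<count T w. \<phi> (tm k w) (L k w)))"
    and "(\<lambda>u. indicator {0..T} u * (\<integral>r. exp (\<phi> u r) \<partial>service_law \<rho> u)) \<in> borel_measurable borel"
proof -
  note * = exp_functional[OF \<phi>, of 1 T]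
  have e: "exp (1 * complex_of_real x) = of_real (exp x)" for x by (simp add: exp_of_real)
  have i: "integrable P (\<lambda>w. complex_of_real (exp (\<Sum>k<count T w. \<phi> (tm k w) (L k w))))"
    using *(2) unfolding e .
  then show "integrable P (\<lambda>w. exp (\<Sum>k<count T w. \<phi> (tm k w) (L k w)))" by (simp only: complex_of_real_integrable_eq)
  have "complex_of_real (\<integral>w. exp (\<Sum>k<count T w. \<phi> (tm k w) (L k w)) \<partial>P)
    = exp (\<integral>u. indicator {0..T} u * (of_real (\<integral>r. exp (\<phi> u r) \<partial>service_law \<rho> u) - 1) * of_real (m u) \<partial>lborel)"
    using *(1) unfolding e integral_complex_of_real .
  also have "(\<integral>u. indicator {0..T} u * (of_real (\<integral>r. exp (\<phi> u r) \<partial>service_law \<rho> u) - 1) * of_real (m u) \<partial>lborel)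
    = (\<integral>u. complex_of_real (indicator {0..T} u * ((\<integral>r. exp (\<phi> u r) \<partial>service_law \<rho> u) - 1) * m u) \<partial>lborel)"
    by (simp add: of_real_indicator)
  finally show "(\<integral>w. exp (\<Sum>k<count T w. \<phi> (tm k w) (L k w)) \<partial>P)
    = exp (\<integral>u. indicator {0..T} u * ((\<integral>r. exp (\<phi> u r) \<partial>service_law \<rho> u) - 1) * m u \<partial>lborel)"
    unfolding integral_complex_of_real by (simp only: exp_of_real of_real_eq_iff)
  \<comment> \<open>Measurability is inherited from the complex case through the real part.\<close>
  have pt: "Re (indicator {0..T} u * (\<integral>r. exp (1 * complex_of_real (\<phi> u r)) \<partial>service_law \<rho> u))
      = indicator {0..T} u * (\<integral>r. exp (\<phi> u r) \<partial>service_law \<rho> u)" for u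
    unfolding e integral_complex_of_real by (simp add: indicator_def)
  have "(\<lambda>u. Re (indicator {0..T} u * (\<integral>r. exp (1 * complex_of_real (\<phi> u r)) \<partial>service_law \<rho> u))) \<in> borel_measurable borel"
    using exp_mean_measurable[OF \<phi>] by measurable
  then show "(\<lambda>u. indicator {0..T} u * (\<integral>r. exp (\<phi> u r) \<partial>service_law \<rho> u)) \<in> borel_measurable borel"
    unfolding pt .
qed

end

section \<open>Second-order expansion of the joint characteristic function\<close>

lemma fourth_power_le_exp: "(x::real) ^ 4 \<le> 256 * (exp x + exp (- x))"
proof -
  have *: "y ^ 4 \<le> 256 * exp y" if "y \<ge> 0" for y :: real
  proof -
    \<comment> \<open>The route is \<open>exp y \<ge> (1 + y / 4) ^ 4\<close>; the factor 256 is
      \<open>4 ^ 4\<close>.\<close>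
    have "(y / 4) ^ 4 \<le> (1 + y / 4) ^ 4" using that by (intro power_mono) auto
    also have "\<dots> \<le> exp y" using exp_ge_one_plus_x_over_n_power_n[of 4 y] that by simp
    finally show ?thesis by (simp add: power_divide)
  qed
  show ?thesis
  proof (cases "x \<ge> 0")
    case True
    then show ?thesis using *[of x] exp_ge_zero[of "- x"] by (simp add: add_increasing2)
  next
    case False
    then show ?thesis using *[of "- x"] exp_ge_zero[of x] by (simp add: add_increasing)
  qed
qed

lemma iexp_second_order: "norm (iexp x - 1 - \<i> * of_real x + of_real (x\<^sup>2 / 2)) \<le> \<bar>x\<bar> ^ 3 / 6"
proof -
  have "(\<Sum>k\<le>2. (\<i> * complex_of_real x) ^ k / fact k) = 1 + \<i> * x - x\<^sup>2 / 2"
    by (simp add: numeral_2_eq_2 power2_eq_square field_simps)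
  then have e: "iexp x - 1 - \<i> * of_real x + of_real (x\<^sup>2 / 2) = iexp x - (\<Sum>k\<le>2. (\<i> * complex_of_real x) ^ k / fact k)"
    by (simp only:) simp
  have f: "\<bar>x\<bar> ^ Suc 2 / fact (Suc 2) = \<bar>x\<bar> ^ 3 / 6" by (simp add: numeral_eq_Suc)
  show ?thesis unfolding e using iexp_approx1[of x 2] unfolding f .
qed

lemma alive_if: "alive t u r = (if 0 \<le> u \<and> u \<le> t \<and> t - u < r then 1 else 0)"
  by (simp add: alive_def indicator_def)

context queue
begin

abbreviation jobs where "jobs \<equiv> active_jobs \<Gamma> L"

lemma jobs_measurable:
  assumes "0 \<le> t"
  shows "jobs t \<in> borel_measurable P"
proof -
  have "(\<lambda>w. (\<lambda>n w. \<Sum>k<n. alive t (tm k w) (L k w)) (count t w) w) \<in> borel_measurable P"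
    by (rule measurable_compose_countable[OF _ measurable_count]) (unfold alive_if, measurable)
  then show ?thesis
    by (rule measurable_cong[THEN iffD1, rotated]) (simp add: active_jobs_eq[OF _ assms order_refl])
qed

lemma mean_integrable: "integrable lborel (\<lambda>u. tail_at t u * m u)"
  using integrable_times_m[of "tail_at t" 1 t] tail_at_bounds[of t] by (simp add: tail_at_def)

lemma mark_fun_combination: "mark_fun (\<lambda>u r. \<Sum>j<(n::nat). \<theta> j * alive (t j) u r)"
  by (intro mark_fun_sum mark_fun_scale mark_fun_alive) simp

text \<open>The exponent is the integral of \<open>E u - 1\<close> against the intensity. Centring
  removes the linear term, the quadratic term is the covariance by \<open>alive_mult\<close>, and
  the cubic Taylor remainder is integrated over a total mass of at most \<open>mb * T\<close>.
  Producing an exponent \<open>Z\<close> avoids complex logarithms.\<close>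

lemma characteristic_function:
  fixes n :: nat and t \<theta> :: "nat \<Rightarrow> real" and a T :: real
  assumes t: "\<And>j. j < n \<Longrightarrow> 0 \<le> t j \<and> t j \<le> T" and a: "a > 0" and T: "T \<ge> 0"
  shows "\<exists>Z. (\<integral>w. iexp (\<Sum>j<n. \<theta> j * (a * (jobs (t j) w - mean (t j)))) \<partial>P) = exp Z \<and>
    norm (Z + of_real (a\<^sup>2 / 2 * (\<Sum>i<n. \<Sum>j<n. \<theta> i * \<theta> j *
      (\<integral>u. indicator {0..min (t i) (t j)} u * tail_at (max (t i) (t j)) u * m u \<partial>lborel))))
    \<le> (a * (\<Sum>j<n. \<bar>\<theta> j\<bar>)) ^ 3 / 6 * (mb * T)"
proof -
  define \<phi> where "\<phi> u r = (\<Sum>j<n. \<theta> j * alive (t j) u r)" for u r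
  define S where "S = (\<Sum>j<n. \<bar>\<theta> j\<bar>)"
  have \<phi>: "mark_fun \<phi>" unfolding \<phi>_def by (rule mark_fun_combination)
  have alive01: "\<bar>alive s u r\<bar> \<le> 1" for s u r by (simp add: alive_def indicator_def)
  have \<phi>S: "\<bar>\<phi> u r\<bar> \<le> S" for u r
    unfolding \<phi>_def S_def
    by (rule order_trans[OF sum_abs], rule sum_mono) (use mult_left_mono[OF alive01 abs_ge_zero] in \<open>simp add: abs_mult\<close>)
  have S0: "S \<ge> 0" unfolding S_def by (intro sum_nonneg) simp
  define \<phi>1 where "\<phi>1 u = (\<Sum>j<n. \<theta> j * tail_at (t j) u)" for u
  define \<phi>2 where "\<phi>2 u = (\<Sum>i<n. \<Sum>j<n. \<theta> i * \<theta> j * (indicator {0..min (t i) (t j)} u * tail_at (max (t i) (t j)) u))" for u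
  have [measurable]: "\<phi>1 \<in> borel_measurable borel" "\<phi>2 \<in> borel_measurable borel"
    unfolding \<phi>1_def[abs_def] \<phi>2_def[abs_def] by measurable
  have ialive: "integrable (service_law \<rho> u) (alive s u)" if "u \<ge> 0" for s u
    using mark_fun_integrable[OF mark_fun_alive that, of "\<lambda>x. x" s] by (simp add: continuous_on_id)
  have E1: "(\<integral>r. \<phi> u r \<partial>service_law \<rho> u) = \<phi>1 u" if "u \<ge> 0" for u
    unfolding \<phi>_def \<phi>1_def using ialive[OF that] by (simp add: integral_alive[OF that])
  have E2: "(\<integral>r. (\<phi> u r)\<^sup>2 \<partial>service_law \<rho> u) = \<phi>2 u" if "u \<ge> 0" for u
  proof -
    have "(\<phi> u r)\<^sup>2 = (\<Sum>i<n. \<Sum>j<n. (\<theta> i * \<theta> j * indicator {0..min (t i) (t j)} u) * alive (max (t i) (t j)) u r)" for r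
      unfolding \<phi>_def power2_eq_square sum_product
    proof (intro sum.cong refl)
      fix i j
      show "\<theta> i * alive (t i) u r * (\<theta> j * alive (t j) u r) = (\<theta> i * \<theta> j * indicator {0..min (t i) (t j)} u) * alive (max (t i) (t j)) u r"
        using alive_mult[of "t i" u r "t j"] by (simp add: mult_ac)
    qed
    then show ?thesis unfolding \<phi>2_def using ialive[OF that] by (simp add: integral_alive[OF that] mult.assoc)
  qed
  have supp: "tail_at s u = 0" if "u \<notin> {0..s}" for s u using that by (simp add: tail_at_def)
  have supp1: "\<phi>1 u = 0" "\<phi>2 u = 0" if "u \<notin> {0..T}" for u
  proof -
    show "\<phi>1 u = 0" unfolding \<phi>1_def by (rule sum.neutral) (use that t in \<open>force simp: tail_at_def indicator_def\<close>)
    show "\<phi>2 u = 0" unfolding \<phi>2_def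
    proof (intro sum.neutral ballI)
      fix i j assume ij: "i \<in> {..<n}" "j \<in> {..<n}"
      then have "u \<notin> {0..min (t i) (t j)}" using that t[of i] by auto
      then show "\<theta> i * \<theta> j * (indicator {0..min (t i) (t j)} u * tail_at (max (t i) (t j)) u) = 0" by simp
    qed
  qed
  have b1: "\<bar>\<phi>1 u\<bar> \<le> S" "\<bar>\<phi>2 u\<bar> \<le> S * S" for u
  proof -
    show "\<bar>\<phi>1 u\<bar> \<le> S" unfolding \<phi>1_def S_def
      by (rule order_trans[OF sum_abs], rule sum_mono)
        (use mult_left_mono[OF tail_at_bounds(2) abs_ge_zero] tail_at_bounds(1) in \<open>simp add: abs_mult\<close>)
    have "\<bar>\<phi>2 u\<bar> \<le> (\<Sum>i<n. \<Sum>j<n. \<bar>\<theta> i\<bar> * \<bar>\<theta> j\<bar>)"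
      unfolding \<phi>2_def
    proof (intro order_trans[OF sum_abs] sum_mono)
      fix i j
      have "\<bar>indicator {0..min (t i) (t j)} u * tail_at (max (t i) (t j)) u\<bar> \<le> 1"
        using tail_at_bounds[of "max (t i) (t j)" u] by (simp add: indicator_def)
      from mult_left_mono[OF this, of "\<bar>\<theta> i * \<theta> j\<bar>"]
      show "\<bar>\<theta> i * \<theta> j * (indicator {0..min (t i) (t j)} u * tail_at (max (t i) (t j)) u)\<bar> \<le> \<bar>\<theta> i\<bar> * \<bar>\<theta> j\<bar>"
        by (simp add: abs_mult)
    qed
    then show "\<bar>\<phi>2 u\<bar> \<le> S * S" by (simp add: S_def sum_product)
  qed
  define E where "E u = (\<integral>r. exp ((\<i> * a) * of_real (\<phi> u r)) \<partial>service_law \<rho> u)" for u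
  have En: "norm (E u) \<le> 1" if "u \<ge> 0" for u
  proof -
    interpret N: prob_space "service_law \<rho> u" by (rule \<rho>_prob[OF that])
    have "norm (E u) \<le> (\<integral>r. norm (exp ((\<i> * a) * of_real (\<phi> u r))) \<partial>service_law \<rho> u)"
      unfolding E_def by (rule integral_norm_bound)
    also have "\<dots> = (\<integral>r. 1 \<partial>service_law \<rho> u)" by simp
    finally show ?thesis by (simp add: N.prob_space)
  qed
  \<comment> \<open>The bound \<open>\<bar>\<phi> u r\<bar> \<le> S\<close> turns the third-order
    remainder of a single arrival into a constant.\<close>
  have approx: "norm (E u - 1 - (\<i> * a) * of_real (\<phi>1 u) + of_real (a\<^sup>2 / 2) * of_real (\<phi>2 u)) \<le> (a * S) ^ 3 / 6" if u: "u \<ge> 0" for u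
  proof -
    interpret N: prob_space "service_law \<rho> u" by (rule \<rho>_prob[OF u])
    have i1: "integrable (service_law \<rho> u) (\<lambda>r. exp ((\<i> * a) * of_real (\<phi> u r)))"
      by (rule mark_fun_integrable[OF \<phi> u]) (intro continuous_intros)
    have i2: "integrable (service_law \<rho> u) (\<lambda>r. \<phi> u r)"
      by (rule mark_fun_integrable[OF \<phi> u, of "\<lambda>x. x"]) (intro continuous_intros)
    have i3: "integrable (service_law \<rho> u) (\<lambda>r. (\<phi> u r)\<^sup>2)"
      by (rule mark_fun_integrable[OF \<phi> u]) (intro continuous_intros)
    have ci2: "integrable (service_law \<rho> u) (\<lambda>r. complex_of_real (\<phi> u r))" using i2 by (rule integrable_of_real)
    have ci3: "integrable (service_law \<rho> u) (\<lambda>r. complex_of_real ((\<phi> u r)\<^sup>2))" using i3 by (rule integrable_of_real)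
    let ?g = "\<lambda>r. exp ((\<i> * a) * of_real (\<phi> u r)) - 1 - (\<i> * a) * of_real (\<phi> u r) + of_real (a\<^sup>2 / 2) * of_real ((\<phi> u r)\<^sup>2)"
    have ci0: "integrable (service_law \<rho> u) (\<lambda>r. 1 :: complex)" by simp
    have "(\<integral>r. ?g r \<partial>service_law \<rho> u) = E u - (\<integral>r. 1 \<partial>service_law \<rho> u)
        - (\<i> * a) * (\<integral>r. complex_of_real (\<phi> u r) \<partial>service_law \<rho> u)
        + of_real (a\<^sup>2 / 2) * (\<integral>r. complex_of_real ((\<phi> u r)\<^sup>2) \<partial>service_law \<rho> u)"
      unfolding E_def
      by (simp only: Bochner_Integration.integral_add Bochner_Integration.integral_diff Bochner_Integration.integrable_diff
        Bochner_Integration.integrable_add integrable_mult_right integral_mult_right_zero i1 ci0 ci2 ci3)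
    also have "(\<integral>r. (1::complex) \<partial>service_law \<rho> u) = 1" by (simp add: N.prob_space)
    finally have "(\<integral>r. ?g r \<partial>service_law \<rho> u) = E u - 1 - (\<i> * a) * of_real (\<integral>r. \<phi> u r \<partial>service_law \<rho> u)
        + of_real (a\<^sup>2 / 2) * of_real (\<integral>r. (\<phi> u r)\<^sup>2 \<partial>service_law \<rho> u)"
      unfolding integral_complex_of_real .
    then have "E u - 1 - (\<i> * a) * of_real (\<phi>1 u) + of_real (a\<^sup>2 / 2) * of_real (\<phi>2 u) = (\<integral>r. ?g r \<partial>service_law \<rho> u)"
      unfolding E1[OF u] E2[OF u] by (rule sym)
    then have "norm (E u - 1 - (\<i> * a) * of_real (\<phi>1 u) + of_real (a\<^sup>2 / 2) * of_real (\<phi>2 u)) \<le> (\<integral>r. norm (?g r) \<partial>service_law \<rho> u)"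
      by (simp only: integral_norm_bound)
    also have "\<dots> \<le> (\<integral>r. (a * S) ^ 3 / 6 \<partial>service_law \<rho> u)"
    proof (rule integral_mono')
      fix r
      have e1: "of_real (a\<^sup>2 / 2) * of_real ((\<phi> u r)\<^sup>2) = complex_of_real ((a * \<phi> u r)\<^sup>2 / 2)"
        unfolding of_real_mult[symmetric] by (rule arg_cong[where f=of_real]) (simp add: power_mult_distrib)
      have e2: "(\<i> * a) * of_real (\<phi> u r) = \<i> * of_real (a * \<phi> u r)"
        by (simp only: of_real_mult mult.assoc)
      have "norm (?g r) = norm (iexp (a * \<phi> u r) - 1 - \<i> * of_real (a * \<phi> u r) + of_real ((a * \<phi> u r)\<^sup>2 / 2))"
        unfolding e1 e2 by (rule refl)
      also have "\<dots> \<le> \<bar>a * \<phi> u r\<bar> ^ 3 / 6" by (rule iexp_second_order)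
      also have "\<bar>a * \<phi> u r\<bar> ^ 3 \<le> (a * S) ^ 3"
        using \<phi>S a by (intro power_mono) (auto simp: abs_mult)
      finally show "norm (?g r) \<le> (a * S) ^ 3 / 6" by simp
      show "0 \<le> (a * S) ^ 3 / 6" using a S0 by simp
    qed simp
    finally show ?thesis by (simp add: N.prob_space)
  qed
  define fE where "fE u = indicator {0..T} u * (E u - 1)" for u
  have fE_meas[measurable]: "fE \<in> borel_measurable borel"
  proof -
    have [measurable]: "(\<lambda>u. indicator {0..T} u * E u) \<in> borel_measurable borel"
      unfolding E_def by (rule exp_mean_measurable[OF \<phi>])
    have "fE = (\<lambda>u. indicator {0..T} u * E u - indicator {0..T} u)" by (auto simp: fE_def right_diff_distrib fun_eq_iff)
    also have "\<dots> \<in> borel_measurable borel" by measurable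
    finally show ?thesis .
  qed
  have fEb: "norm (fE u) \<le> 2" for u
    using En[of u] norm_triangle_ineq4[of "E u" 1] by (auto simp: fE_def indicator_def)
  have iE: "integrable lborel (\<lambda>u. fE u * of_real (m u))"
    by (rule integrable_times_m[where T=T, OF fE_meas fEb]) (simp add: fE_def)
  have i1: "integrable lborel (\<lambda>u. \<phi>1 u * m u)"
    using integrable_times_m[of \<phi>1 S T] b1 supp1 by simp
  have i2: "integrable lborel (\<lambda>u. \<phi>2 u * m u)"
    using integrable_times_m[of \<phi>2 "S * S" T] b1 supp1 by simp
  have ci1: "integrable lborel (\<lambda>u. complex_of_real (\<phi>1 u * m u))" using i1 by (rule integrable_of_real)
  have ci2: "integrable lborel (\<lambda>u. complex_of_real (\<phi>2 u * m u))" using i2 by (rule integrable_of_real)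
  have I1: "(\<integral>u. \<phi>1 u * m u \<partial>lborel) = (\<Sum>j<n. \<theta> j * mean (t j))"
    unfolding \<phi>1_def mean_def sum_distrib_right mult.assoc using mean_integrable
    by (subst Bochner_Integration.integral_sum) auto
  have I2: "(\<integral>u. \<phi>2 u * m u \<partial>lborel) = (\<Sum>i<n. \<Sum>j<n. \<theta> i * \<theta> j *
      (\<integral>u. indicator {0..min (t i) (t j)} u * tail_at (max (t i) (t j)) u * m u \<partial>lborel))"
  proof -
    have ii: "integrable lborel (\<lambda>u. indicator {0..min x y} u * tail_at y' u * m u)" for x y y'
      using integrable_times_m[of "\<lambda>u. indicator {0..min x y} u * tail_at y' u" 1 "min x y"] tail_at_bounds[of y']
      by (simp add: indicator_def)
    have "(\<integral>u. \<phi>2 u * m u \<partial>lborel) = (\<integral>u. (\<Sum>i<n. \<Sum>j<n. (\<theta> i * \<theta> j) * (indicator {0..min (t i) (t j)} u * tail_at (max (t i) (t j)) u * m u)) \<partial>lborel)"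
      unfolding \<phi>2_def by (simp only: sum_distrib_right mult.assoc)
    also have "\<dots> = (\<Sum>i<n. \<Sum>j<n. \<integral>u. (\<theta> i * \<theta> j) * (indicator {0..min (t i) (t j)} u * tail_at (max (t i) (t j)) u * m u) \<partial>lborel)"
      by (simp only: Bochner_Integration.integral_sum Bochner_Integration.integrable_sum integrable_mult_right ii)
    finally show ?thesis by simp
  qed
  \<comment> \<open>The second term is the phase contributed by the deterministic centring.\<close>
  define Z where "Z = (\<integral>u. fE u * of_real (m u) \<partial>lborel) - \<i> * a * of_real (\<integral>u. \<phi>1 u * m u \<partial>lborel)"
  have "(\<integral>w. iexp (\<Sum>j<n. \<theta> j * (a * (jobs (t j) w - mean (t j)))) \<partial>P)
    = (\<integral>w. exp ((\<i> * a) * of_real (\<Sum>k<count T w. \<phi> (tm k w) (L k w))) * exp (- (\<i> * a * of_real (\<integral>u. \<phi>1 u * m u \<partial>lborel))) \<partial>P)"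
  proof (rule Bochner_Integration.integral_cong[OF refl])
    fix w assume w: "w \<in> space P"
    have "(\<Sum>j<n. \<theta> j * jobs (t j) w) = (\<Sum>j<n. \<Sum>k<count T w. \<theta> j * alive (t j) (tm k w) (L k w))"
      using t by (intro sum.cong) (auto simp: active_jobs_eq[OF w, of _ T] sum_distrib_left)
    also have "\<dots> = (\<Sum>k<count T w. \<phi> (tm k w) (L k w))" unfolding \<phi>_def by (rule sum.swap)
    finally have j: "(\<Sum>j<n. \<theta> j * jobs (t j) w) = (\<Sum>k<count T w. \<phi> (tm k w) (L k w))" .
    have "(\<Sum>j<n. \<theta> j * (a * (jobs (t j) w - mean (t j)))) = a * ((\<Sum>j<n. \<theta> j * jobs (t j) w) - (\<Sum>j<n. \<theta> j * mean (t j)))"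
      by (simp add: sum_distrib_left sum_subtractf right_diff_distrib mult_ac)
    also have "\<dots> = a * (\<Sum>k<count T w. \<phi> (tm k w) (L k w)) - a * (\<integral>u. \<phi>1 u * m u \<partial>lborel)"
      unfolding j I1 by (simp only: right_diff_distrib)
    finally have e: "(\<Sum>j<n. \<theta> j * (a * (jobs (t j) w - mean (t j)))) = a * (\<Sum>k<count T w. \<phi> (tm k w) (L k w)) - a * (\<integral>u. \<phi>1 u * m u \<partial>lborel)" .
    show "iexp (\<Sum>j<n. \<theta> j * (a * (jobs (t j) w - mean (t j)))) =
      exp ((\<i> * a) * of_real (\<Sum>k<count T w. \<phi> (tm k w) (L k w))) * exp (- (\<i> * a * of_real (\<integral>u. \<phi>1 u * m u \<partial>lborel)))"
      unfolding e by (simp only: of_real_diff of_real_mult right_diff_distrib exp_diff exp_minus divide_inverse mult.assoc)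
  qed
  also have "\<dots> = exp Z"
    unfolding Z_def using exp_functional(1)[OF \<phi>, of "\<i> * a" T]
    by (simp add: exp_diff exp_minus divide_inverse fE_def E_def mult.assoc)
  finally have "(\<integral>w. iexp (\<Sum>j<n. \<theta> j * (a * (jobs (t j) w - mean (t j)))) \<partial>P) = exp Z" .
  moreover have "norm (Z + of_real (a\<^sup>2 / 2 * (\<integral>u. \<phi>2 u * m u \<partial>lborel))) \<le> (a * S) ^ 3 / 6 * (mb * T)"
  proof -
    have "Z + of_real (a\<^sup>2 / 2 * (\<integral>u. \<phi>2 u * m u \<partial>lborel))
      = (\<integral>u. fE u * of_real (m u) \<partial>lborel) - (\<i> * a) * (\<integral>u. of_real (\<phi>1 u * m u) \<partial>lborel) + of_real (a\<^sup>2 / 2) * (\<integral>u. of_real (\<phi>2 u * m u) \<partial>lborel)"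
      unfolding Z_def integral_complex_of_real by simp
    also have "\<dots> = (\<integral>u. fE u * of_real (m u) - (\<i> * a) * of_real (\<phi>1 u * m u) + of_real (a\<^sup>2 / 2) * of_real (\<phi>2 u * m u) \<partial>lborel)" (is "_ = ?I")
      using iE ci1 ci2
      by (simp only: Bochner_Integration.integral_add Bochner_Integration.integral_diff Bochner_Integration.integrable_diff
        Bochner_Integration.integrable_add integrable_mult_right integral_mult_right_zero)
    finally have "norm (Z + of_real (a\<^sup>2 / 2 * (\<integral>u. \<phi>2 u * m u \<partial>lborel))) = norm ?I" by (rule arg_cong)
    also have "norm ?I \<le> (\<integral>u. norm (fE u * of_real (m u) - (\<i> * a) * of_real (\<phi>1 u * m u) + of_real (a\<^sup>2 / 2) * of_real (\<phi>2 u * m u)) \<partial>lborel)"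
      by (rule integral_norm_bound)
    also have "\<dots> \<le> (\<integral>u. indicator {0..T} u * ((a * S) ^ 3 / 6 * mb) \<partial>lborel)"
    proof (rule integral_mono')
      fix u
      show nn: "0 \<le> indicator {0..T} u * ((a * S) ^ 3 / 6 * mb)" using a S0 mb_nonneg by simp
      show "norm (fE u * of_real (m u) - (\<i> * a) * of_real (\<phi>1 u * m u) + of_real (a\<^sup>2 / 2) * of_real (\<phi>2 u * m u))
        \<le> indicator {0..T} u * ((a * S) ^ 3 / 6 * mb)"
      proof (cases "u \<in> {0..T}")
        case True
        have "fE u * of_real (m u) - (\<i> * a) * of_real (\<phi>1 u * m u) + of_real (a\<^sup>2 / 2) * of_real (\<phi>2 u * m u)
          = (E u - 1 - (\<i> * a) * of_real (\<phi>1 u) + of_real (a\<^sup>2 / 2) * of_real (\<phi>2 u)) * of_real (m u)"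
          using True by (simp only: fE_def indicator_simps mult_1 of_real_mult mult.assoc distrib_right left_diff_distrib)
        also have "norm \<dots> \<le> (a * S) ^ 3 / 6 * mb"
          unfolding norm_mult using approx[of u] m_le m_nonneg True a S0 by (intro mult_mono) auto
        finally show ?thesis using True by simp
      qed (simp add: fE_def supp1)
    qed (rule integrable_Icc_const)
    also have "\<dots> = (a * S) ^ 3 / 6 * (mb * T)" using T by simp
    finally show ?thesis .
  qed
  ultimately show ?thesis unfolding I2 S_def by blast
qed

end

section \<open>Increments of the queue\<close>

context queue
begin

definition centred :: "real \<Rightarrow> 'w \<Rightarrow> real" where
  "centred t w = jobs t w - mean t"

text \<open>Beyond the density bound, the tail can only gain, and only from arrivals in
  \<open>{s<..t}\<close>; the one-sided version is what the departures in \<open>churn\<close> need.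
  The point \<open>u = 0\<close> is left out because the density bounds hold for positive arrival
  times.\<close>

lemma tail_increment:
  assumes st: "0 \<le> s" "s \<le> t" "t \<le> T" and u: "u \<noteq> 0"
  shows "\<bar>tail_at t u - tail_at s u\<bar> \<le> indicator {s<..t} u + indicator {0..T} u * (C * (t - s))"
    and "tail_at s u - tail_at t u \<le> indicator {0..T} u * (C * (t - s))"
proof -
  have C0: "0 \<le> C * (t - s)" using C_pos st by simp
  consider "u < 0 \<or> t < u" | "0 < u" "u \<le> s" | "s < u" "u \<le> t" using u by linarith
  then have "\<bar>tail_at t u - tail_at s u\<bar> \<le> indicator {s<..t} u + indicator {0..T} u * (C * (t - s)) \<and>
    tail_at s u - tail_at t u \<le> indicator {0..T} u * (C * (t - s))"
  proof cases
    case 1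
    then have "tail_at t u = 0" "tail_at s u = 0" using st by (auto simp: tail_at_def)
    then show ?thesis using C0 by simp
  next
    case 2
    then have e: "tail_at t u = service_tail \<rho> u (t - u)" "tail_at s u = service_tail \<rho> u (s - u)"
      using st by (auto simp: tail_at_def)
    have "\<bar>service_tail \<rho> u (t - u) - service_tail \<rho> u (s - u)\<bar> \<le> C / c * \<bar>u - u\<bar> + C * \<bar>(t - u) - (s - u)\<bar>"
      by (rule service_tail_lipschitz) (use 2 st in auto)
    then have "\<bar>tail_at t u - tail_at s u\<bar> \<le> C * (t - s)" unfolding e using st by simp
    moreover have "indicator {s<..t} u = (0::real)" "indicator {0..T} u = (1::real)" using 2 st by auto
    ultimately show ?thesis by (simp add: abs_le_iff)
  next
    case 3
    then have "tail_at s u = 0" using st by (auto simp: tail_at_def)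
    moreover have "indicator {s<..t} u = (1::real)" "indicator {0..T} u = (1::real)" using 3 st by auto
    ultimately show ?thesis using tail_at_bounds[of t u] C0 by simp
  qed
  then show "\<bar>tail_at t u - tail_at s u\<bar> \<le> indicator {s<..t} u + indicator {0..T} u * (C * (t - s))"
    and "tail_at s u - tail_at t u \<le> indicator {0..T} u * (C * (t - s))" by auto
qed

text \<open>The difference is nonzero only for a job that arrives in \<open>{s<..t}\<close> or whose
  service ends in that interval.\<close>

lemma alive_increment_square:
  assumes "0 \<le> s" "s \<le> t" "t \<le> T"
  shows "(alive t u r - alive s u r)\<^sup>2 \<le> indicator {s<..t} u + indicator {0..T} u * indicator {s - u<..t - u} r"
  using assms by (auto simp: alive_if indicator_def)

lemma increment_weight_integral:
  assumes "0 \<le> s" "s \<le> t" "t \<le> T"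
  shows "integrable lborel (\<lambda>u. x * indicator {s<..t} u + indicator {0..T} u * y)"
    "(\<integral>u. x * indicator {s<..t} u + indicator {0..T} u * y \<partial>lborel) = x * (t - s) + y * (T :: real)"
proof -
  have i1: "integrable lborel (\<lambda>u. x * indicat_real {s<..t} u)"
    using assms by (intro integrable_mult_right integrable_real_indicator) (auto simp: emeasure_lborel_Ioc)
  note i2 = integrable_Icc_const[of T y]
  show "integrable lborel (\<lambda>u. x * indicator {s<..t} u + indicator {0..T} u * y)"
    by (rule Bochner_Integration.integrable_add[OF i1 i2])
  show "(\<integral>u. x * indicator {s<..t} u + indicator {0..T} u * y \<partial>lborel) = x * (t - s) + y * T"
    using assms by (subst Bochner_Integration.integral_add[OF i1 i2]) simp
qed

text \<open>The computation gives \<open>1 + C * T\<close>; the constant is relaxed to 2 so that one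
  bound is shared with the exponential moments of \<open>churn\<close>.\<close>

lemma mean_increment:
  assumes st: "0 \<le> s" "s \<le> t" "t \<le> T"
  shows "\<bar>mean t - mean s\<bar> \<le> mb * ((2 + C * T) * (t - s))"
proof -
  have "\<bar>mean t - mean s\<bar> = \<bar>\<integral>u. tail_at t u * m u - tail_at s u * m u \<partial>lborel\<bar>"
    unfolding mean_def using mean_integrable by simp
  also have "\<dots> \<le> (\<integral>u. \<bar>tail_at t u * m u - tail_at s u * m u\<bar> \<partial>lborel)" by (rule integral_abs_bound)
  also have "\<dots> \<le> (\<integral>u. mb * indicator {s<..t} u + indicator {0..T} u * (mb * (C * (t - s))) \<partial>lborel)"
  proof (rule integral_mono_AE)
    show "AE u in lborel. \<bar>tail_at t u * m u - tail_at s u * m u\<bar> \<le> mb * indicator {s<..t} u + indicator {0..T} u * (mb * (C * (t - s)))"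
      using AE_lborel_singleton[of "0::real"]
    proof eventually_elim
      case (elim u)
      have "\<bar>tail_at t u * m u - tail_at s u * m u\<bar> = \<bar>tail_at t u - tail_at s u\<bar> * m u"
        using m_nonneg[of u] by (simp add: left_diff_distrib[symmetric] abs_mult)
      also have "\<dots> \<le> (indicator {s<..t} u + indicator {0..T} u * (C * (t - s))) * mb"
        by (rule mult_mono[OF tail_increment(1)[OF st elim] m_le]) (use C_pos st m_nonneg in \<open>auto intro!: add_nonneg_nonneg\<close>)
      finally show ?case by (simp add: algebra_simps)
    qed
    show "integrable lborel (\<lambda>u. mb * indicator {s<..t} u + indicator {0..T} u * (mb * (C * (t - s))))"
      by (rule increment_weight_integral(1)[OF st])
  qed (use mean_integrable in auto)
  also have "\<dots> = mb * (t - s) + mb * (C * (t - s)) * T" by (rule increment_weight_integral(2)[OF st])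
  also have "\<dots> = mb * ((1 + C * T) * (t - s))" by (simp add: algebra_simps)
  also have "\<dots> \<le> mb * ((2 + C * T) * (t - s))" using mb_nonneg st by (intro mult_left_mono mult_right_mono) auto
  finally show ?thesis .
qed

text \<open>By \<open>exp x \<le> 1 + x + x\<^sup>2\<close> for
  \<open>\<bar>x\<bar> \<le> 1\<close>. Centring cancels the linear term, and the square is bounded
  through the expected numbers of arrivals and departures in the interval, whence the factor
  \<open>b\<^sup>2\<close>.\<close>

lemma increment_exp_moment:
  assumes st: "0 \<le> s" "s \<le> t" "t \<le> T" and b: "\<bar>b\<bar> \<le> 1"
  shows "integrable P (\<lambda>w. exp (b * (centred t w - centred s w)))"
    and "(\<integral>w. exp (b * (centred t w - centred s w)) \<partial>P) \<le> exp (b\<^sup>2 * (mb * ((2 + C * T) * (t - s))))"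
proof -
  define \<phi> where "\<phi> u r = b * (alive t u r + (-1) * alive s u r)" for u r
  have \<phi>: "mark_fun \<phi>" unfolding \<phi>_def by (intro mark_fun_scale mark_fun_add mark_fun_alive)
  have \<phi>1: "\<bar>\<phi> u r\<bar> \<le> 1" for u r
  proof -
    have "\<bar>alive t u r + (-1) * alive s u r\<bar> \<le> 1" by (simp add: alive_if)
    from mult_mono[OF b this] show ?thesis unfolding \<phi>_def abs_mult by simp
  qed
  have X: "exp (b * (centred t w - centred s w)) = exp (\<Sum>k<count T w. \<phi> (tm k w) (L k w)) * exp (- (b * (mean t - mean s)))"
    if w: "w \<in> space P" for w
  proof -
    have "(\<Sum>k<count T w. \<phi> (tm k w) (L k w)) = b * (jobs t w - jobs s w)"
      unfolding \<phi>_def using st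
      by (simp add: active_jobs_eq[OF w, of _ T] sum_distrib_left sum_subtractf right_diff_distrib sum.distrib)
    then have "b * (centred t w - centred s w) = (\<Sum>k<count T w. \<phi> (tm k w) (L k w)) + - (b * (mean t - mean s))"
      unfolding centred_def by (simp add: algebra_simps)
    then show ?thesis by (simp only: exp_add)
  qed
  have i: "integrable P (\<lambda>w. exp (\<Sum>k<count T w. \<phi> (tm k w) (L k w)) * exp (- (b * (mean t - mean s))))"
    by (intro integrable_mult_left real_exp_functional(2) \<phi>)
  show "integrable P (\<lambda>w. exp (b * (centred t w - centred s w)))"
    by (rule Bochner_Integration.integrable_cong[THEN iffD2, OF refl X i])
  define E where "E u = (\<integral>r. exp (\<phi> u r) \<partial>service_law \<rho> u)" for u
  define Q where "Q = (\<integral>u. indicator {0..T} u * (E u - 1) * m u \<partial>lborel)"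
  have "(\<integral>w. exp (b * (centred t w - centred s w)) \<partial>P) = exp Q * exp (- (b * (mean t - mean s)))"
    unfolding Q_def E_def real_exp_functional(1)[OF \<phi>, symmetric] integral_mult_left_zero[symmetric]
    by (rule Bochner_Integration.integral_cong[OF refl X])
  also have "\<dots> = exp (Q - b * (mean t - mean s))" by (simp only: exp_add[symmetric] diff_conv_add_uminus)
  finally have eq: "(\<integral>w. exp (b * (centred t w - centred s w)) \<partial>P) = exp (Q - b * (mean t - mean s))" .
  have Eb: "E u \<le> 1 + b * (tail_at t u - tail_at s u) + b\<^sup>2 * (indicator {s<..t} u + C * (t - s))" "0 \<le> E u" "E u \<le> 3"
    if u: "u > 0" "u \<le> T" for u
  proof -
    have u0: "u \<ge> 0" using u by simp
    interpret N: prob_space "service_law \<rho> u" by (rule \<rho>_prob[OF u0])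
    have iexp: "integrable (service_law \<rho> u) (\<lambda>r. exp (\<phi> u r))"
      by (rule mark_fun_integrable[OF \<phi> u0]) (intro continuous_intros)
    have ia: "integrable (service_law \<rho> u) (alive x u)" for x
      using mark_fun_integrable[OF mark_fun_alive u0, of "\<lambda>x. x" x] by (simp add: continuous_on_id)
    have iB: "integrable (service_law \<rho> u) (\<lambda>r. indicat_real {s - u<..t - u} r)"
      by (rule N.integrable_const_bound[of _ 1]) (auto simp: indicator_def service_law_def)
    let ?h = "\<lambda>r. 1 + b * (alive t u r - alive s u r) + b\<^sup>2 * (indicator {s<..t} u + indicat_real {s - u<..t - u} r)"
    have ih: "integrable (service_law \<rho> u) ?h" using ia iB by simp
    have "E u \<le> (\<integral>r. ?h r \<partial>service_law \<rho> u)"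
      unfolding E_def
    proof (rule integral_mono[OF iexp ih])
      fix r
      have "exp (\<phi> u r) \<le> 1 + \<phi> u r + (\<phi> u r)\<^sup>2" by (rule exp_quadratic_upper[OF \<phi>1])
      also have "(\<phi> u r)\<^sup>2 = b\<^sup>2 * (alive t u r - alive s u r)\<^sup>2" unfolding \<phi>_def by (simp add: power_mult_distrib)
      also have "\<dots> \<le> b\<^sup>2 * (indicator {s<..t} u + indicator {0..T} u * indicator {s - u<..t - u} r)"
        by (rule mult_left_mono[OF alive_increment_square[OF st]]) simp
      also have "indicat_real {0..T} u = 1" using u by simp
      finally show "exp (\<phi> u r) \<le> ?h r" unfolding \<phi>_def by simp
    qed
    also have "(\<integral>r. ?h r \<partial>service_law \<rho> u) = 1 + b * (tail_at t u - tail_at s u) + b\<^sup>2 * (indicator {s<..t} u + measure (service_law \<rho> u) {s - u<..t - u})"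
    proof -
      have sp: "space (service_law \<rho> u) = UNIV" by (simp add: service_law_def)
      have pu: "measure (service_law \<rho> u) UNIV = 1" using N.prob_space unfolding sp .
      show ?thesis using ia iB by (simp add: integral_alive[OF u0] pu sp)
    qed
    also have "\<dots> \<le> 1 + b * (tail_at t u - tail_at s u) + b\<^sup>2 * (indicator {s<..t} u + C * (t - s))"
      using service_law_interval[OF u(1), of "s - u" "t - u"] st by (intro add_left_mono mult_left_mono) auto
    finally show "E u \<le> 1 + b * (tail_at t u - tail_at s u) + b\<^sup>2 * (indicator {s<..t} u + C * (t - s))" .
    show "0 \<le> E u" unfolding E_def by (rule integral_nonneg_AE) simp
    have "E u \<le> (\<integral>r. 3 \<partial>service_law \<rho> u)" unfolding E_def
    proof (rule integral_mono[OF iexp])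
      fix r
      have "exp (\<phi> u r) \<le> exp 1" using \<phi>1[of u r] by simp
      then show "exp (\<phi> u r) \<le> 3" using exp_le by linarith
    qed simp
    then show "E u \<le> 3" by (simp add: N.prob_space)
  qed
  have fm: "(\<lambda>u. indicator {0..T} u * (E u - 1)) \<in> borel_measurable borel"
  proof -
    have [measurable]: "(\<lambda>u. indicator {0..T} u * E u) \<in> borel_measurable borel"
      unfolding E_def by (rule real_exp_functional(3)[OF \<phi>])
    have "(\<lambda>u. indicator {0..T} u * (E u - 1)) = (\<lambda>u. indicator {0..T} u * E u - indicator {0..T} u)"
      by (simp add: right_diff_distrib fun_eq_iff)
    also have "\<dots> \<in> borel_measurable borel" by measurable
    finally show ?thesis .
  qed
  have iQ: "integrable lborel (\<lambda>u. indicator {0..T} u * (E u - 1) * m u)"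
  proof (rule Bochner_Integration.integrable_bound[OF integrable_Icc_const[of T "4 * mb"]])
    show "(\<lambda>u. indicator {0..T} u * (E u - 1) * m u) \<in> borel_measurable lborel"
      using borel_measurable_times[OF fm m_meas] by simp
    show "AE u in lborel. norm (indicator {0..T} u * (E u - 1) * m u) \<le> norm (indicator {0..T} u * (4 * mb))"
      using AE_lborel_singleton[of "0::real"]
    proof eventually_elim
      case (elim u)
      show ?case
      proof (cases "u \<in> {0..T}")
        case True
        then have "u > 0" "u \<le> T" using elim by auto
        then have "\<bar>E u - 1\<bar> \<le> 4" using Eb(2,3)[of u] by (simp add: abs_le_iff)
        then have "\<bar>E u - 1\<bar> * m u \<le> 4 * mb" using m_le[of u] m_nonneg[of u] by (intro mult_mono) auto
        then show ?thesis using True m_nonneg[of u] mb_nonneg by (simp add: abs_mult)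
      qed simp
    qed
  qed
  have "Q - b * (mean t - mean s) = (\<integral>u. indicator {0..T} u * (E u - 1) * m u - b * (tail_at t u * m u - tail_at s u * m u) \<partial>lborel)"
    unfolding Q_def mean_def using iQ mean_integrable by simp
  also have "\<dots> \<le> (\<integral>u. (b\<^sup>2 * mb) * indicator {s<..t} u + indicator {0..T} u * (b\<^sup>2 * mb * (C * (t - s))) \<partial>lborel)"
  proof (rule integral_mono_AE)
    show "AE u in lborel. indicator {0..T} u * (E u - 1) * m u - b * (tail_at t u * m u - tail_at s u * m u)
      \<le> (b\<^sup>2 * mb) * indicator {s<..t} u + indicator {0..T} u * (b\<^sup>2 * mb * (C * (t - s)))"
      using AE_lborel_singleton[of "0::real"]
    proof eventually_elim
      case (elim u)
      show ?case
      proof (cases "u \<in> {0..T}")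
        case True
        then have u: "u > 0" "u \<le> T" using elim by auto
        have "indicator {0..T} u * (E u - 1) * m u - b * (tail_at t u * m u - tail_at s u * m u)
          = (E u - 1 - b * (tail_at t u - tail_at s u)) * m u" using True by (simp add: algebra_simps)
        also have "\<dots> \<le> (b\<^sup>2 * (indicator {s<..t} u + C * (t - s))) * m u"
          using Eb(1)[OF u] m_nonneg[of u] by (intro mult_right_mono) auto
        also have "\<dots> \<le> (b\<^sup>2 * (indicator {s<..t} u + C * (t - s))) * mb"
          using m_le[of u] C_pos st by (intro mult_left_mono mult_nonneg_nonneg add_nonneg_nonneg) auto
        finally show ?thesis using True by (simp add: algebra_simps)
      next
        case False
        then have "tail_at t u = 0" "tail_at s u = 0" "u \<notin> {s<..t}" using st by (auto simp: tail_at_def)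
        then show ?thesis using False by simp
      qed
    qed
    show "integrable lborel (\<lambda>u. (b\<^sup>2 * mb) * indicator {s<..t} u + indicator {0..T} u * (b\<^sup>2 * mb * (C * (t - s))))"
      by (rule increment_weight_integral(1)[OF st])
  qed (use iQ mean_integrable in auto)
  also have "\<dots> = (b\<^sup>2 * mb) * (t - s) + b\<^sup>2 * mb * (C * (t - s)) * T" by (rule increment_weight_integral(2)[OF st])
  also have "\<dots> = b\<^sup>2 * (mb * ((1 + C * T) * (t - s)))" by (simp add: algebra_simps)
  also have "\<dots> \<le> b\<^sup>2 * (mb * ((2 + C * T) * (t - s)))" using mb_nonneg st by (intro mult_left_mono mult_right_mono) auto
  finally show "(\<integral>w. exp (b * (centred t w - centred s w)) \<partial>P) \<le> exp (b\<^sup>2 * (mb * ((2 + C * T) * (t - s))))"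
    unfolding eq by simp
qed

lemma centred_measurable: "0 \<le> t \<Longrightarrow> centred t \<in> borel_measurable P"
  using jobs_measurable[of t] unfolding centred_def[abs_def] by measurable

text \<open>The parameter \<open>b\<close> is left free; for dyadic increments it is chosen so that
  the exponent stays bounded. 512 is twice the constant of
  \<open>fourth_power_le_exp\<close>.\<close>

lemma increment_fourth_moment:
  assumes st: "0 \<le> s" "s \<le> t" "t \<le> T" and b: "0 < b" "b \<le> 1"
  shows "integrable P (\<lambda>w. (centred t w - centred s w) ^ 4)"
    and "(\<integral>w. (centred t w - centred s w) ^ 4 \<partial>P) \<le> 512 / b ^ 4 * exp (b\<^sup>2 * (mb * ((2 + C * T) * (t - s))))"
proof -
  define X where "X w = centred t w - centred s w" for w
  have [measurable]: "centred t \<in> borel_measurable P" "centred s \<in> borel_measurable P"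
    using st by (intro centred_measurable; simp)+
  have [measurable]: "X \<in> borel_measurable P" unfolding X_def[abs_def] by measurable
  have e1: "integrable P (\<lambda>w. exp (b * X w))" "integrable P (\<lambda>w. exp ((- b) * X w))"
    unfolding X_def using b by (intro increment_exp_moment[OF st]; simp)+
  define g where "g w = 256 / b ^ 4 * (exp (b * X w) + exp ((- b) * X w))" for w
  have ig: "integrable P g" unfolding g_def[abs_def] using e1 by (intro integrable_mult_right Bochner_Integration.integrable_add)
  have le: "X w ^ 4 \<le> g w" for w
  proof -
    have "b ^ 4 * X w ^ 4 \<le> 256 * (exp (b * X w) + exp ((- b) * X w))"
      using fourth_power_le_exp[of "b * X w"] by (simp add: power_mult_distrib)
    then show ?thesis using b by (simp add: g_def pos_le_divide_eq mult.commute)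
  qed
  show i: "integrable P (\<lambda>w. (centred t w - centred s w) ^ 4)" unfolding X_def[symmetric]
  proof (rule Bochner_Integration.integrable_bound[OF ig])
    show "AE w in P. norm (X w ^ 4) \<le> norm (g w)"
    proof (rule AE_I2)
      fix w
      have "norm (X w ^ 4) = X w ^ 4" by simp
      then show "norm (X w ^ 4) \<le> norm (g w)" using le[of w] by simp
    qed
  qed measurable
  have "(\<integral>w. X w ^ 4 \<partial>P) \<le> (\<integral>w. g w \<partial>P)"
    by (rule integral_mono[OF i[folded X_def] ig le])
  also have "\<dots> = 256 / b ^ 4 * ((\<integral>w. exp (b * X w) \<partial>P) + (\<integral>w. exp ((- b) * X w) \<partial>P))"
    unfolding g_def using e1 by (subst integral_mult_right_zero) simp
  also have "\<dots> \<le> 256 / b ^ 4 * (exp (b\<^sup>2 * (mb * ((2 + C * T) * (t - s)))) + exp ((- b)\<^sup>2 * (mb * ((2 + C * T) * (t - s)))))"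
    unfolding X_def using b by (intro mult_left_mono add_mono increment_exp_moment[OF st]) auto
  finally show "(\<integral>w. (centred t w - centred s w) ^ 4 \<partial>P) \<le> 512 / b ^ 4 * exp (b\<^sup>2 * (mb * ((2 + C * T) * (t - s))))"
    unfolding X_def by simp
qed

text \<open>Bounds the total change of the number of jobs over \<open>{s..s'}\<close>: twice the arrivals in the
  interval, plus the departures.\<close>

definition churn :: "real \<Rightarrow> real \<Rightarrow> real \<Rightarrow> 'w \<Rightarrow> real" where
  "churn T s s' w = (\<Sum>k<count T w. 2 * indicator {s<..s'} (tm k w) + (alive s (tm k w) (L k w) + (-1) * alive s' (tm k w) (L k w)))"

lemma churn_measurable: "churn T s s' \<in> borel_measurable P"
proof -
  have "(\<lambda>w. (\<lambda>n w. \<Sum>k<n. 2 * indicator {s<..s'} (tm k w) + (alive s (tm k w) (L k w) + (-1) * alive s' (tm k w) (L k w))) (count T w) w) \<in> borel_measurable P"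
    by (rule measurable_compose_countable[OF _ measurable_count]) (unfold alive_if, measurable)
  then show ?thesis unfolding churn_def[abs_def] .
qed

text \<open>Checked job by job: the weight 2 on arrivals compensates the -1 of a job that arrives in
  the interval and is still present at \<open>s'\<close>.\<close>

lemma churn_dominates:
  assumes w: "w \<in> space P" and st: "0 \<le> s" "s \<le> t" "t \<le> s'" "s' \<le> T"
  shows "\<bar>jobs t w - jobs s w\<bar> \<le> churn T s s' w"
proof -
  have "jobs t w - jobs s w = (\<Sum>k<count T w. alive t (tm k w) (L k w) - alive s (tm k w) (L k w))"
    using st by (simp add: active_jobs_eq[OF w, of _ T] sum_subtractf)
  also have "\<bar>\<dots>\<bar> \<le> (\<Sum>k<count T w. \<bar>alive t (tm k w) (L k w) - alive s (tm k w) (L k w)\<bar>)" by (rule sum_abs)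
  also have "\<dots> \<le> churn T s s' w"
    unfolding churn_def
  proof (rule sum_mono)
    fix k
    define u r where "u = tm k w" and "r = L k w"
    show "\<bar>alive t (tm k w) (L k w) - alive s (tm k w) (L k w)\<bar>
      \<le> 2 * indicator {s<..s'} (tm k w) + (alive s (tm k w) (L k w) + (-1) * alive s' (tm k w) (L k w))"
      unfolding u_def[symmetric] r_def[symmetric] using st by (auto simp: alive_if indicator_def)
  qed
  finally show ?thesis .
qed

text \<open>The churn of a job lies between 0 and 2, where \<open>exp x - 1 \<le> 9 * x\<close>
  because \<open>exp 2 \<le> 9\<close>. There is no centring, hence no gain from a second-order
  expansion; the bound is applied on the shortest intervals, where the expected churn is of order
  1.\<close>

lemma churn_exp_moment:
  assumes st: "0 \<le> s" "s \<le> t" "t \<le> T"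
  shows "integrable P (\<lambda>w. exp (churn T s t w))"
    and "(\<integral>w. exp (churn T s t w) \<partial>P) \<le> exp (9 * (mb * ((2 + C * T) * (t - s))))"
proof -
  define \<phi> where "\<phi> u r = 2 * indicator {s<..t} u + (alive s u r + (-1) * alive t u r)" for u r
  have \<phi>: "mark_fun \<phi>" unfolding \<phi>_def
    by (intro mark_fun_scale mark_fun_add mark_fun_alive mark_fun_interval)
  have \<phi>b: "0 \<le> \<phi> u r" "\<phi> u r \<le> 2" for u r
    unfolding \<phi>_def using st by (auto simp: alive_if indicator_def)
  have ch: "churn T s t w = (\<Sum>k<count T w. \<phi> (tm k w) (L k w))" for w
    by (simp only: churn_def \<phi>_def)
  show "integrable P (\<lambda>w. exp (churn T s t w))"
    unfolding ch by (rule real_exp_functional(2)[OF \<phi>])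
  define E where "E u = (\<integral>r. exp (\<phi> u r) \<partial>service_law \<rho> u)" for u
  have eq: "(\<integral>w. exp (churn T s t w) \<partial>P) = exp (\<integral>u. indicator {0..T} u * (E u - 1) * m u \<partial>lborel)"
    unfolding ch E_def by (rule real_exp_functional(1)[OF \<phi>])
  have e9: "exp (2::real) \<le> 9"
  proof -
    have "exp (2::real) = exp 1 * exp 1" by (simp add: exp_add[symmetric])
    also have "\<dots> \<le> 3 * 3" by (rule mult_mono) (use exp_le in auto)
    finally show ?thesis by simp
  qed
  have Eb: "E u - 1 \<le> 9 * (2 * indicator {s<..t} u + C * (t - s))" if u: "u > 0" "u \<le> T" for u
  proof -
    have u0: "u \<ge> 0" using u by simp
    interpret N: prob_space "service_law \<rho> u" by (rule \<rho>_prob[OF u0])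
    have iexp: "integrable (service_law \<rho> u) (\<lambda>r. exp (\<phi> u r))"
      by (rule mark_fun_integrable[OF \<phi> u0]) (intro continuous_intros)
    have ia: "integrable (service_law \<rho> u) (alive x u)" for x
      using mark_fun_integrable[OF mark_fun_alive u0, of "\<lambda>x. x" x] by (simp add: continuous_on_id)
    let ?h = "\<lambda>r. 1 + 9 * (2 * indicator {s<..t} u + (alive s u r - alive t u r))"
    have "E u \<le> (\<integral>r. ?h r \<partial>service_law \<rho> u)"
      unfolding E_def
    proof (rule integral_mono[OF iexp])
      show "integrable (service_law \<rho> u) ?h" using ia by simp
      fix r
      have "1 - \<phi> u r \<le> exp (- \<phi> u r)" using exp_ge_add_one_self[of "- \<phi> u r"] by simp
      then have "(1 - \<phi> u r) * exp (\<phi> u r) \<le> exp (- \<phi> u r) * exp (\<phi> u r)" by (rule mult_right_mono) simp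
      also have "\<dots> = 1" by (simp add: exp_minus)
      finally have "exp (\<phi> u r) \<le> 1 + exp (\<phi> u r) * \<phi> u r" by (simp add: algebra_simps)
      also have "exp (\<phi> u r) * \<phi> u r \<le> 9 * \<phi> u r"
      proof (rule mult_right_mono[OF _ \<phi>b(1)])
        have "exp (\<phi> u r) \<le> exp 2" using \<phi>b(2) by simp
        then show "exp (\<phi> u r) \<le> 9" using e9 by linarith
      qed
      finally show "exp (\<phi> u r) \<le> ?h r" unfolding \<phi>_def by simp
    qed
    also have "\<dots> = 1 + 9 * (2 * indicator {s<..t} u + (tail_at s u - tail_at t u))"
      using ia by (simp add: integral_alive[OF u0] N.prob_space)
    also have "\<dots> \<le> 1 + 9 * (2 * indicator {s<..t} u + C * (t - s))"
      using tail_increment(2)[OF st, of u] u by simp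
    finally show ?thesis by simp
  qed
  have "(\<integral>u. indicator {0..T} u * (E u - 1) * m u \<partial>lborel) \<le> (\<integral>u. (18 * mb) * indicator {s<..t} u + indicator {0..T} u * (9 * mb * (C * (t - s))) \<partial>lborel)"
  proof (rule integral_mono_AE')
    show "integrable lborel (\<lambda>u. (18 * mb) * indicator {s<..t} u + indicator {0..T} u * (9 * mb * (C * (t - s))))"
      by (rule increment_weight_integral(1)[OF st])
    show "AE u in lborel. 0 \<le> (18 * mb) * indicator {s<..t} u + indicator {0..T} u * (9 * mb * (C * (t - s)))"
      using mb_nonneg C_pos st by (intro AE_I2 add_nonneg_nonneg mult_nonneg_nonneg) auto
    show "AE u in lborel. indicator {0..T} u * (E u - 1) * m u \<le> (18 * mb) * indicator {s<..t} u + indicator {0..T} u * (9 * mb * (C * (t - s)))"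
      using AE_lborel_singleton[of "0::real"]
    proof eventually_elim
      case (elim u)
      show ?case
      proof (cases "u \<in> {0..T}")
        case True
        then have u: "u > 0" "u \<le> T" using elim by auto
        have "indicator {0..T} u * (E u - 1) * m u = (E u - 1) * m u" using True by simp
        also have "\<dots> \<le> 9 * (2 * indicator {s<..t} u + C * (t - s)) * m u"
          using Eb[OF u] m_nonneg[of u] by (rule mult_right_mono)
        also have "\<dots> \<le> 9 * (2 * indicator {s<..t} u + C * (t - s)) * mb"
          using m_le[of u] C_pos st by (intro mult_left_mono mult_nonneg_nonneg add_nonneg_nonneg) auto
        finally show ?thesis using True by (simp add: algebra_simps)
      next
        case False
        then have "u \<notin> {s<..t}" using st by auto
        then show ?thesis using False by simp
      qed
    qed
  qed
  also have "\<dots> = (18 * mb) * (t - s) + 9 * mb * (C * (t - s)) * T" by (rule increment_weight_integral(2)[OF st])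
  also have "\<dots> = 9 * (mb * ((2 + C * T) * (t - s)))" by (simp add: algebra_simps)
  finally show "(\<integral>w. exp (churn T s t w) \<partial>P) \<le> exp (9 * (mb * ((2 + C * T) * (t - s))))"
    unfolding eq by simp
qed

lemma churn_tail:
  assumes st: "0 \<le> s" "s \<le> t" "t \<le> T" and a: "a > 0" and d: "\<delta> > 0"
  shows "measure P {w\<in>space P. \<delta> < \<bar>a * churn T s t w\<bar>} \<le> a ^ 4 * (512 * exp (9 * (mb * ((2 + C * T) * (t - s))))) / \<delta> ^ 4"
proof -
  have m: "(\<lambda>w. a * churn T s t w) \<in> borel_measurable P" using churn_measurable[of T s t] by measurable
  have le: "(a * churn T s t w) ^ 4 \<le> a ^ 4 * (512 * exp (churn T s t w))" if w: "w \<in> space P" for w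
  proof -
    \<comment> \<open>Comparing \<open>s\<close> with itself shows the churn to be nonnegative, so
      the second exponential in \<open>fourth_power_le_exp\<close> is bounded by the first.\<close>
    have "\<bar>jobs s w - jobs s w\<bar> \<le> churn T s t w" by (rule churn_dominates[OF w]) (use st in auto)
    then have "0 \<le> churn T s t w" by simp
    then have "256 * (exp (churn T s t w) + exp (- churn T s t w)) \<le> 256 * (exp (churn T s t w) + exp (churn T s t w))"
      by (intro mult_left_mono add_left_mono) auto
    with fourth_power_le_exp[of "churn T s t w"] have "churn T s t w ^ 4 \<le> 256 * (exp (churn T s t w) + exp (churn T s t w))"
      by (rule order_trans)
    then have "churn T s t w ^ 4 \<le> 512 * exp (churn T s t w)" by simp
    then show ?thesis unfolding power_mult_distrib by (rule mult_left_mono) simp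
  qed
  have ie: "integrable P (\<lambda>w. a ^ 4 * (512 * exp (churn T s t w)))"
    by (intro integrable_mult_right churn_exp_moment(1)[OF st])
  have i: "integrable P (\<lambda>w. (a * churn T s t w) ^ 4)"
  proof (rule Bochner_Integration.integrable_bound[OF ie])
    show "(\<lambda>w. (a * churn T s t w) ^ 4) \<in> borel_measurable P" using m by (rule borel_measurable_power)
    show "AE w in P. norm ((a * churn T s t w) ^ 4) \<le> norm (a ^ 4 * (512 * exp (churn T s t w)))"
    proof (rule AE_I2)
      fix w assume "w \<in> space P"
      from le[OF this] show "norm ((a * churn T s t w) ^ 4) \<le> norm (a ^ 4 * (512 * exp (churn T s t w)))" by simp
    qed
  qed
  have "(\<integral>w. (a * churn T s t w) ^ 4 \<partial>P) \<le> (\<integral>w. a ^ 4 * (512 * exp (churn T s t w)) \<partial>P)"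
    by (rule integral_mono[OF i ie le])
  also have "\<dots> = a ^ 4 * (512 * (\<integral>w. exp (churn T s t w) \<partial>P))" by simp
  also have "\<dots> \<le> a ^ 4 * (512 * exp (9 * (mb * ((2 + C * T) * (t - s)))))"
    using churn_exp_moment(2)[OF st] by (intro mult_left_mono) auto
  finally show ?thesis by (rule fourth_moment_tail[OF prob_space_axioms m i _ d])
qed

text \<open>The choice \<open>b\<^sup>2 = 2 ^ l / 2 ^ n\<close> balances an intensity of at most
  \<open>K0 * 2 ^ n\<close> against a cell of length \<open>1 / 2 ^ l\<close>: the exponent stays
  bounded, and \<open>a ^ 4 / b ^ 4\<close> is at most \<open>(1 / 2 ^ l)\<^sup>2\<close>. The
  requirement \<open>b \<le> 1\<close> is why chaining stops at level \<open>n\<close>.\<close>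

lemma dyadic_increment_tail:
  fixes T :: nat
  assumes l: "l \<le> n" "j < T * 2 ^ l" and a: "a > 0" "a\<^sup>2 \<le> 1 / 2 ^ n" and mb: "mb \<le> K0 * 2 ^ n"
  shows "measure P {w\<in>space P. chain_rate ^ l < \<bar>a * (centred (real (Suc j) / 2 ^ l) w - centred (real j / 2 ^ l) w)\<bar>}
    \<le> 512 * exp (K0 * (2 + C * T)) * ((1 / 2 ^ l)\<^sup>2 / (chain_rate ^ l) ^ 4)"
proof -
  define s t where "s = real j / 2 ^ l" and "t = real (Suc j) / 2 ^ l"
  have ts: "t - s = 1 / 2 ^ l" unfolding s_def t_def by (simp add: diff_divide_distrib[symmetric])
  have "real (Suc j) \<le> real (T * 2 ^ l)" using l(2) by (intro of_nat_mono) simp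
  then have tT: "t \<le> T" unfolding t_def by (simp add: divide_le_eq)
  have s0: "0 \<le> s" unfolding s_def by simp
  have st: "s \<le> t" using ts by (simp add: algebra_simps)
  define b :: real where "b = sqrt (2 ^ l / 2 ^ n)"
  have b2: "b\<^sup>2 = 2 ^ l / 2 ^ n" unfolding b_def by simp
  have b0: "0 < b" unfolding b_def by simp
  have "(2::real) ^ l \<le> 2 ^ n" using l(1) by (intro power_increasing) auto
  then have b1: "b \<le> 1" unfolding b_def by simp
  have b4: "b ^ 4 = (2 ^ l / 2 ^ n)\<^sup>2" unfolding b2[symmetric] by (simp add: power_mult[symmetric])
  have a4: "a ^ 4 \<le> (1 / 2 ^ n)\<^sup>2"
    using power_mono[OF a(2), of 2] by (simp add: power_mult[symmetric])
  have CT: "0 \<le> 2 + C * real T" using C_pos by simp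
  have ex: "b\<^sup>2 * (mb * ((2 + C * T) * (t - s))) \<le> K0 * (2 + C * T)"
  proof -
    have "b\<^sup>2 * (mb * ((2 + C * T) * (t - s))) = mb / 2 ^ n * (2 + C * T)" unfolding b2 ts by simp
    also have "\<dots> \<le> K0 * (2 + C * T)" using mb CT by (intro mult_right_mono) (simp_all add: divide_le_eq)
    finally show ?thesis .
  qed
  have i: "integrable P (\<lambda>w. (a * (centred t w - centred s w)) ^ 4)"
    unfolding power_mult_distrib by (intro integrable_mult_right increment_fourth_moment(1)[OF s0 st tT b0 b1])
  have m: "(\<lambda>w. a * (centred t w - centred s w)) \<in> borel_measurable P"
  proof -
    have [measurable]: "centred t \<in> borel_measurable P" "centred s \<in> borel_measurable P"
      using s0 st by (intro centred_measurable; simp)+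
    show ?thesis by measurable
  qed
  have "(\<integral>w. (a * (centred t w - centred s w)) ^ 4 \<partial>P) = a ^ 4 * (\<integral>w. (centred t w - centred s w) ^ 4 \<partial>P)"
    by (simp add: power_mult_distrib)
  also have "\<dots> \<le> (1 / 2 ^ n)\<^sup>2 * (512 / b ^ 4 * exp (b\<^sup>2 * (mb * ((2 + C * T) * (t - s)))))"
    using a4 increment_fourth_moment(2)[OF s0 st tT b0 b1] by (intro mult_mono) auto
  also have "\<dots> \<le> (1 / 2 ^ n)\<^sup>2 * (512 / b ^ 4 * exp (K0 * (2 + C * T)))"
    using ex b0 by (intro mult_left_mono) auto
  also have "\<dots> = 512 * exp (K0 * (2 + C * T)) * (1 / 2 ^ l)\<^sup>2" unfolding b4 by (simp add: power_divide)
  finally have "(\<integral>w. (a * (centred t w - centred s w)) ^ 4 \<partial>P) \<le> 512 * exp (K0 * (2 + C * T)) * (1 / 2 ^ l)\<^sup>2" .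
  from fourth_moment_tail[OF prob_space_axioms m i this, of "chain_rate ^ l"]
  show ?thesis unfolding s_def t_def by (simp add: chain_rate_def)
qed

text \<open>Chaining from level \<open>l0\<close> to level \<open>n\<close>, then churn inside one
  cell of level \<open>n\<close>. \<open>B1\<close> collects the increments above their threshold,
  \<open>B2\<close> the cells of large churn: there are \<open>T * 2 ^ n\<close> of these cells,
  each bad with probability of order \<open>a ^ 4\<close>, and
  \<open>2 ^ n * a ^ 4 \<le> a\<^sup>2\<close>.\<close>

lemma oscillation_bound:
  fixes T :: nat
  assumes l0: "l0 \<le> n" and a: "a > 0" "a\<^sup>2 \<le> 1 / 2 ^ n" and mb: "mb \<le> K0 * 2 ^ n" and d: "\<delta> > 0"
  defines "V \<equiv> 2 + C * T"
  shows "\<exists>B\<in>sets P. measure P B \<le> T * (2048 * exp (K0 * V)) * (5000 / 6561) ^ l0 + T * (512 * exp (9 * (K0 * V))) / \<delta> ^ 4 * a\<^sup>2 \<and>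
    (\<forall>w\<in>space P - B. \<forall>t. 0 \<le> t \<longrightarrow> t < real T \<longrightarrow>
      \<bar>a * centred t w - a * centred (dyadic_floor l0 t) w\<bar> \<le> 9 * chain_rate ^ l0 + \<delta> + a * (K0 * V))"
proof -
  define I where "I l j = {w\<in>space P. chain_rate ^ l < \<bar>a * (centred (real (Suc j) / 2 ^ l) w - centred (real j / 2 ^ l) w)\<bar>}" for l j
  define J where "J j = {w\<in>space P. \<delta> < \<bar>a * churn T (real j / 2 ^ n) (real (Suc j) / 2 ^ n) w\<bar>}" for j
  define B1 where "B1 = (\<Union>l\<in>{l0<..n}. \<Union>j<T * 2 ^ l. I l j)"
  define B2 where "B2 = (\<Union>j<T * 2 ^ n. J j)"
  have mI: "I l j \<in> sets P" for l j
  proof -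
    have [measurable]: "centred (real (Suc j) / 2 ^ l) \<in> borel_measurable P" "centred (real j / 2 ^ l) \<in> borel_measurable P"
      by (intro centred_measurable; simp)+
    show ?thesis unfolding I_def by measurable
  qed
  have mJ: "J j \<in> sets P" for j
    unfolding J_def using churn_measurable[of T "real j / 2 ^ n" "real (Suc j) / 2 ^ n"] by measurable
  have mB1: "B1 \<in> sets P" unfolding B1_def using mI by auto
  have mB2: "B2 \<in> sets P" unfolding B2_def using mJ by auto
  have V0: "0 \<le> V" using C_pos by (simp add: V_def)
  have Suc_le: "real (Suc j) / 2 ^ l \<le> T" if "j < T * 2 ^ l" for j l :: nat
  proof -
    have "real (Suc j) \<le> real (T * 2 ^ l)" using that by (intro of_nat_mono) simp
    then show ?thesis by (simp add: divide_le_eq)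
  qed
  have gap: "real (Suc j) / 2 ^ l - real j / 2 ^ l = 1 / 2 ^ l" for j l :: nat
    by (simp add: diff_divide_distrib[symmetric])
  have mbV: "mb * (V * (1 / 2 ^ n)) \<le> K0 * V"
  proof -
    have "mb * (V * (1 / 2 ^ n)) = mb / 2 ^ n * V" by simp
    also have "\<dots> \<le> K0 * V" using mb V0 by (intro mult_right_mono) (simp_all add: divide_le_eq)
    finally show ?thesis .
  qed
  have "measure P B1 \<le> (\<Sum>l\<in>{l0<..n}. measure P (\<Union>j<T * 2 ^ l. I l j))"
    unfolding B1_def using mI by (intro finite_measure_subadditive_finite) auto
  also have "\<dots> \<le> (\<Sum>l\<in>{l0<..n}. T * (512 * exp (K0 * V)) * (5000 / 6561) ^ l)"
  proof (rule sum_mono)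
    fix l assume l: "l \<in> {l0<..n}"
    have "measure P (\<Union>j<T * 2 ^ l. I l j) \<le> (\<Sum>j<T * 2 ^ l. measure P (I l j))"
      using mI by (intro finite_measure_subadditive_finite) auto
    also have "\<dots> \<le> (\<Sum>j<T * 2 ^ l. 512 * exp (K0 * V) * ((1 / 2 ^ l)\<^sup>2 / (chain_rate ^ l) ^ 4))"
      unfolding I_def V_def using l by (intro sum_mono dyadic_increment_tail) (auto intro: a mb)
    also have "\<dots> = T * (512 * exp (K0 * V)) * (2 ^ l * ((1 / 2 ^ l)\<^sup>2 / (chain_rate ^ l) ^ 4))" by simp
    finally show "measure P (\<Union>j<T * 2 ^ l. I l j) \<le> T * (512 * exp (K0 * V)) * (5000 / 6561) ^ l"
      unfolding chain_rate_tail .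
  qed
  also have "\<dots> = T * (512 * exp (K0 * V)) * (\<Sum>l\<in>{l0<..n}. (5000 / 6561) ^ l)" by (simp only: sum_distrib_left)
  also have "\<dots> \<le> T * (512 * exp (K0 * V)) * (4 * (5000 / 6561) ^ l0)"
    by (intro mult_left_mono sum_tail_rate l0) auto
  finally have P1: "measure P B1 \<le> T * (2048 * exp (K0 * V)) * (5000 / 6561) ^ l0" by simp
  have "measure P B2 \<le> (\<Sum>j<T * 2 ^ n. measure P (J j))"
    unfolding B2_def using mJ by (intro finite_measure_subadditive_finite) auto
  also have "\<dots> \<le> (\<Sum>j<T * 2 ^ n. a ^ 4 * (512 * exp (9 * (K0 * V))) / \<delta> ^ 4)"
  proof (rule sum_mono)
    fix j assume j: "j \<in> {..<T * 2 ^ n}"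
    have "measure P (J j) \<le> a ^ 4 * (512 * exp (9 * (mb * ((2 + C * T) * (real (Suc j) / 2 ^ n - real j / 2 ^ n))))) / \<delta> ^ 4"
      unfolding J_def using j Suc_le[of j n] by (intro churn_tail a d) (auto simp: divide_right_mono)
    also have "\<dots> \<le> a ^ 4 * (512 * exp (9 * (K0 * V))) / \<delta> ^ 4"
      unfolding gap V_def[symmetric] using mbV d by (intro divide_right_mono mult_left_mono) auto
    finally show "measure P (J j) \<le> a ^ 4 * (512 * exp (9 * (K0 * V))) / \<delta> ^ 4" .
  qed
  also have "\<dots> = T * (512 * exp (9 * (K0 * V))) / \<delta> ^ 4 * (2 ^ n * a ^ 4)" by simp
  also have "\<dots> \<le> T * (512 * exp (9 * (K0 * V))) / \<delta> ^ 4 * a\<^sup>2"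
  proof (rule mult_left_mono)
    have "2 ^ n * a ^ 4 = (2 ^ n * a\<^sup>2) * a\<^sup>2" by (simp add: power_add[symmetric])
    also have "\<dots> \<le> 1 * a\<^sup>2" using a by (intro mult_right_mono) (simp_all add: pos_le_divide_eq mult.commute)
    finally show "2 ^ n * a ^ 4 \<le> a\<^sup>2" by simp
  qed (use d in auto)
  finally have P2: "measure P B2 \<le> T * (512 * exp (9 * (K0 * V))) / \<delta> ^ 4 * a\<^sup>2" .
  have osc: "\<bar>a * centred t w - a * centred (dyadic_floor l0 t) w\<bar> \<le> 9 * chain_rate ^ l0 + \<delta> + a * (K0 * V)"
    if w: "w \<in> space P - (B1 \<union> B2)" and t: "0 \<le> t" "t < real T" for w t
  proof -
    have ws: "w \<in> space P" using w by simp
    have 1: "\<bar>a * centred (dyadic_floor n t) w - a * centred (dyadic_floor l0 t) w\<bar> \<le> (\<Sum>l\<in>{l0<..n}. chain_rate ^ l)"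
    proof (rule dyadic_chain[OF t l0, where x="\<lambda>t. a * centred t w"])
      fix l j assume l: "l0 < l" "l \<le> n" "j < T * 2 ^ l"
      have "w \<notin> I l j" using w l by (auto simp: B1_def)
      then show "\<bar>a * centred (real (Suc j) / 2 ^ l) w - a * centred (real j / 2 ^ l) w\<bar> \<le> chain_rate ^ l"
        using ws by (simp add: I_def right_diff_distrib)
    qed (simp add: chain_rate_def)
    define j where "j = nat \<lfloor>2 ^ n * t\<rfloor>"
    have fl: "dyadic_floor n t = real j / 2 ^ n" unfolding j_def by (rule dyadic_floor_eq_nat[OF t(1)])
    have "real j \<le> 2 ^ n * t" using dyadic_floor_le[of n t] unfolding fl by (simp add: divide_le_eq mult.commute)
    also have "\<dots> < real (T * 2 ^ n)" using t(2) by simp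
    finally have j: "j < T * 2 ^ n" by linarith
    have r: "real j / 2 ^ n \<le> t" "t \<le> real (Suc j) / 2 ^ n"
      using dyadic_floor_le[of n t] dyadic_floor_gt[of t n] gap[of j n] unfolding fl by auto
    have "w \<notin> J j" using w j by (auto simp: B2_def)
    then have "\<bar>a * churn T (real j / 2 ^ n) (real (Suc j) / 2 ^ n) w\<bar> \<le> \<delta>" using ws by (simp add: J_def)
    moreover have "a * \<bar>jobs t w - jobs (real j / 2 ^ n) w\<bar> \<le> a * churn T (real j / 2 ^ n) (real (Suc j) / 2 ^ n) w"
      using a by (intro mult_left_mono churn_dominates[OF ws] r Suc_le j) auto
    ultimately have 2: "a * \<bar>jobs t w - jobs (real j / 2 ^ n) w\<bar> \<le> \<delta>" by linarith
    \<comment> \<open>Within a cell the mean moves by at most \<open>K0 * V\<close>, a bounded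
      amount that the factor \<open>a\<close> makes small.\<close>
    have "\<bar>mean t - mean (real j / 2 ^ n)\<bar> \<le> mb * ((2 + C * T) * (t - real j / 2 ^ n))"
      by (rule mean_increment) (use r t in auto)
    also have "\<dots> \<le> mb * (V * (1 / 2 ^ n))"
      unfolding V_def[symmetric] using r gap[of j n] V0 mb_nonneg by (intro mult_left_mono) auto
    also have "\<dots> \<le> K0 * V" by (rule mbV)
    finally have 3: "a * \<bar>mean t - mean (real j / 2 ^ n)\<bar> \<le> a * (K0 * V)" using a by (intro mult_left_mono) auto
    have "\<bar>a * centred t w - a * centred (real j / 2 ^ n) w\<bar> = \<bar>a * (jobs t w - jobs (real j / 2 ^ n) w) - a * (mean t - mean (real j / 2 ^ n))\<bar>"
      by (simp add: centred_def algebra_simps)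
    also have "\<dots> \<le> \<bar>a * (jobs t w - jobs (real j / 2 ^ n) w)\<bar> + \<bar>a * (mean t - mean (real j / 2 ^ n))\<bar>" by (rule abs_triangle_ineq4)
    also have "\<dots> = a * \<bar>jobs t w - jobs (real j / 2 ^ n) w\<bar> + a * \<bar>mean t - mean (real j / 2 ^ n)\<bar>"
      using a by (simp add: abs_mult)
    also have "\<dots> \<le> \<delta> + a * (K0 * V)" using 2 3 by linarith
    finally have 4: "\<bar>a * centred t w - a * centred (dyadic_floor n t) w\<bar> \<le> \<delta> + a * (K0 * V)" unfolding fl .
    show "\<bar>a * centred t w - a * centred (dyadic_floor l0 t) w\<bar> \<le> 9 * chain_rate ^ l0 + \<delta> + a * (K0 * V)"
      using 1 4 sum_chain_rate[OF l0] by linarith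
  qed
  have "measure P (B1 \<union> B2) \<le> measure P B1 + measure P B2" by (rule measure_Un_le[OF mB1 mB2])
  then have "measure P (B1 \<union> B2) \<le> T * (2048 * exp (K0 * V)) * (5000 / 6561) ^ l0 + T * (512 * exp (9 * (K0 * V))) / \<delta> ^ 4 * a\<^sup>2"
    using P1 P2 by linarith
  then show ?thesis using osc mB1 mB2 by (intro bexI[of _ "B1 \<union> B2"] conjI ballI allI impI) auto
qed

end

section \<open>The limiting covariance\<close>

locale arrival_rate = service_density \<rho> \<alpha> c C
  for \<rho> :: "real \<Rightarrow> real \<Rightarrow> real" and \<alpha> c C :: real +
  fixes \<Lambda> :: "real \<Rightarrow> real" and \<Lambda>b \<Lambda>l \<psi>bar :: real
  assumes \<Lambda>_nonneg: "\<And>s. s \<ge> 0 \<Longrightarrow> 0 \<le> \<Lambda> s" and \<Lambda>_le: "\<And>s. s \<ge> 0 \<Longrightarrow> \<Lambda> s \<le> \<Lambda>b"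
    and \<Lambda>_lip: "\<Lambda>l-lipschitz_on {0..} \<Lambda>"
    and \<psi>bar_nonneg: "0 \<le> \<psi>bar"
begin

text \<open>Time 0, a null set for the integrals, is left out because the Lipschitz bounds hold at
  positive arrival times.\<close>

definition load :: "real \<Rightarrow> real \<Rightarrow> real" where
  "load t u = indicator {0<..t} u * (\<Lambda> u * service_tail \<rho> u (t - u))"

definition cov :: "real \<Rightarrow> real \<Rightarrow> real" where
  "cov s t = \<psi>bar * (\<integral>u. indicator {0<..min s t} u * load (max s t) u \<partial>lborel)"

lemma cov_sym: "cov s t = cov t s"
  by (simp add: cov_def min.commute max.commute)

lemma \<Lambda>b_nonneg: "0 \<le> \<Lambda>b"
  using \<Lambda>_nonneg[of 0] \<Lambda>_le[of 0] by simp

lemma \<Lambda>l_nonneg: "0 \<le> \<Lambda>l"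
  using \<Lambda>_lip by (rule lipschitz_on_nonneg)

lemma \<Lambda>_diff: "0 \<le> s \<Longrightarrow> 0 \<le> t \<Longrightarrow> \<bar>\<Lambda> s - \<Lambda> t\<bar> \<le> \<Lambda>l * \<bar>s - t\<bar>"
  using lipschitz_onD[OF \<Lambda>_lip, of s t] by (simp add: dist_real_def)

lemma load_bounds: "0 \<le> load t u" "load t u \<le> \<Lambda>b"
proof -
  have "0 \<le> load t u \<and> load t u \<le> \<Lambda>b"
  proof (cases "u \<in> {0<..t}")
    case True
    then have "0 \<le> service_tail \<rho> u (t - u) \<and> service_tail \<rho> u (t - u) \<le> 1" by (intro service_tail_bounds) auto
    moreover have "0 \<le> \<Lambda> u" "\<Lambda> u \<le> \<Lambda>b" using True \<Lambda>_nonneg \<Lambda>_le by auto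
    ultimately show ?thesis using True mult_mono[of "\<Lambda> u" \<Lambda>b "service_tail \<rho> u (t - u)" 1] \<Lambda>b_nonneg
      by (auto simp: load_def)
  next
    case False
    then show ?thesis using \<Lambda>b_nonneg by (simp add: load_def)
  qed
  then show "0 \<le> load t u" "load t u \<le> \<Lambda>b" by auto
qed

definition "load_lip = \<Lambda>l + \<Lambda>b * (C / c + C)"

lemma load_lip_nonneg: "0 \<le> load_lip"
  unfolding load_lip_def using \<Lambda>l_nonneg \<Lambda>b_nonneg C_pos c_pos by (intro add_nonneg_nonneg mult_nonneg_nonneg) auto

lemma load_lipschitz:
  assumes u: "0 < u" "u \<le> t" and v: "0 < v" "v \<le> t"
  shows "\<bar>load t u - load t v\<bar> \<le> load_lip * \<bar>u - v\<bar>"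
proof -
  let ?a = "service_tail \<rho> u (t - u)" and ?b = "service_tail \<rho> v (t - v)"
  have "load t u - load t v = (\<Lambda> u - \<Lambda> v) * ?a + \<Lambda> v * (?a - ?b)"
    using u v by (simp add: load_def algebra_simps)
  also have "\<bar>\<dots>\<bar> \<le> \<bar>(\<Lambda> u - \<Lambda> v) * ?a\<bar> + \<bar>\<Lambda> v * (?a - ?b)\<bar>" by (rule abs_triangle_ineq)
  also have "\<dots> \<le> (\<Lambda>l * \<bar>u - v\<bar>) * 1 + \<Lambda>b * ((C / c + C) * \<bar>u - v\<bar>)"
  proof (rule add_mono)
    show "\<bar>(\<Lambda> u - \<Lambda> v) * ?a\<bar> \<le> (\<Lambda>l * \<bar>u - v\<bar>) * 1"
      unfolding abs_mult using \<Lambda>_diff[of u v] service_tail_bounds[of u "t - u"] u v \<Lambda>l_nonneg by (intro mult_mono) auto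
    have "\<bar>?a - ?b\<bar> \<le> C / c * \<bar>u - v\<bar> + C * \<bar>(t - u) - (t - v)\<bar>" by (rule service_tail_lipschitz) (use u v in auto)
    also have "\<bar>(t - u) - (t - v)\<bar> = \<bar>u - v\<bar>" by simp
    finally have "\<bar>?a - ?b\<bar> \<le> (C / c + C) * \<bar>u - v\<bar>" by (simp only: distrib_right)
    then show "\<bar>\<Lambda> v * (?a - ?b)\<bar> \<le> \<Lambda>b * ((C / c + C) * \<bar>u - v\<bar>)"
      unfolding abs_mult using \<Lambda>_nonneg[of v] \<Lambda>_le[of v] v \<Lambda>b_nonneg by (intro mult_mono) auto
  qed
  also have "\<dots> = load_lip * \<bar>u - v\<bar>" unfolding load_lip_def by (simp only: distrib_right mult_1_right mult.assoc)
  finally show ?thesis .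
qed

lemma load_measurable [measurable]: "load t \<in> borel_measurable borel"
proof -
  have "load_lip-lipschitz_on {0<..t} (load t)"
    by (rule lipschitz_onI) (use load_lipschitz load_lip_nonneg in \<open>auto simp: dist_real_def\<close>)
  then have "continuous_on {0<..t} (load t)" by (rule lipschitz_on_continuous_on)
  then have "(\<lambda>u. indicator {0<..t} u *\<^sub>R load t u) \<in> borel_measurable borel"
    by (intro borel_measurable_continuous_on_indicator) auto
  also have "(\<lambda>u. indicator {0<..t} u *\<^sub>R load t u) = load t" by (auto simp: load_def fun_eq_iff indicator_def)
  finally show ?thesis .
qed

lemma load_integrable:
  assumes "f \<in> borel_measurable borel" "\<And>u. \<bar>f u\<bar> \<le> b"
  shows "integrable lborel (\<lambda>u. load t u * f u)" "integrable lborel (\<lambda>u. indicator {0<..s} u * (load t u * f u))"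
proof -
  have i: "integrable lborel (\<lambda>u. indicator {0..t} u * (\<Lambda>b * b))" by (rule integrable_Icc_const)
  have le: "norm (load t u * f u) \<le> norm (indicator {0..t} u * (\<Lambda>b * b))" for u
  proof (cases "u \<in> {0<..t}")
    case True
    have "\<bar>load t u * f u\<bar> \<le> \<Lambda>b * b" unfolding abs_mult using load_bounds[of t u] assms(2)[of u] \<Lambda>b_nonneg
      by (intro mult_mono) auto
    then show ?thesis using True by simp
  qed (simp add: load_def)
  have m: "(\<lambda>u. load t u * f u) \<in> borel_measurable lborel"
    using borel_measurable_times[OF load_measurable assms(1)] by simp
  show 1: "integrable lborel (\<lambda>u. load t u * f u)"
    by (rule Bochner_Integration.integrable_bound[OF i m AE_I2[OF le]])
  show "integrable lborel (\<lambda>u. indicator {0<..s} u * (load t u * f u))"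
  proof (rule Bochner_Integration.integrable_bound[OF 1])
    show "(\<lambda>u. indicator {0<..s} u * (load t u * f u)) \<in> borel_measurable lborel"
      by (rule borel_measurable_times[OF _ m]) simp
  qed (auto simp: indicator_def)
qed

lemma kernel_integrable: "integrable lborel (\<lambda>u. indicator {0<..s} u * load t u)"
  using load_integrable(2)[of "\<lambda>_. 1" 1 s t] by simp

text \<open>The same dichotomy as in \<open>tail_increment\<close>: arrival times between
  \<open>s\<close> and \<open>s'\<close> can gain a whole load, earlier ones change only by the
  density bound.\<close>

lemma kernel_increment:
  assumes st: "0 \<le> s" "s \<le> s'" "s' \<le> T" and t: "0 \<le> t" "t \<le> T"
  shows "\<bar>indicator {0<..min s' t} u * load (max s' t) u - indicator {0<..min s t} u * load (max s t) u\<bar>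
    \<le> \<Lambda>b * indicator {s<..s'} u + indicator {0..T} u * (\<Lambda>b * (C * (s' - s)))"
proof -
  have nn: "0 \<le> \<Lambda>b * (C * (s' - s))" using \<Lambda>b_nonneg C_pos st by simp
  consider "u \<le> 0 \<or> s' < u \<or> t < u" | "0 < u" "u \<le> s" "u \<le> t" | "0 < u" "s < u" "u \<le> s'" "u \<le> t" using st t by linarith
  then show ?thesis
  proof cases
    case 1
    then have "u \<notin> {0<..min s' t}" "u \<notin> {0<..min s t}" using st by auto
    then show ?thesis using nn \<Lambda>b_nonneg by simp
  next
    case 2
    then have ind: "indicator {0<..min s' t} u = (1::real)" "indicator {0<..min s t} u = (1::real)"
      "indicator {s<..s'} u = (0::real)" "indicator {0..T} u = (1::real)" using st t by auto
    have "load (max s' t) u - load (max s t) u = \<Lambda> u * (service_tail \<rho> u (max s' t - u) - service_tail \<rho> u (max s t - u))"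
      using 2 st by (simp add: load_def right_diff_distrib le_max_iff_disj)
    also have "\<bar>\<dots>\<bar> \<le> \<Lambda>b * (C * (s' - s))"
      unfolding abs_mult
    proof (rule mult_mono)
      have "\<bar>service_tail \<rho> u (max s' t - u) - service_tail \<rho> u (max s t - u)\<bar>
        \<le> C / c * \<bar>u - u\<bar> + C * \<bar>(max s' t - u) - (max s t - u)\<bar>"
        by (rule service_tail_lipschitz) (use 2 st in auto)
      also have "\<dots> = C * \<bar>max s' t - max s t\<bar>" by simp
      also have "\<dots> \<le> C * (s' - s)" using C_pos st by (intro mult_left_mono) auto
      finally show "\<bar>service_tail \<rho> u (max s' t - u) - service_tail \<rho> u (max s t - u)\<bar> \<le> C * (s' - s)" .
    qed (use \<Lambda>_nonneg[of u] \<Lambda>_le[of u] \<Lambda>b_nonneg 2 in auto)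
    finally show ?thesis unfolding ind by simp
  next
    case 3
    then have "indicator {0<..min s' t} u = (1::real)" "indicator {0<..min s t} u = (0::real)"
      "indicator {s<..s'} u = (1::real)" "indicator {0..T} u = (1::real)" using st t by auto
    then show ?thesis using load_bounds[of "max s' t" u] nn by simp
  qed
qed

lemma cov_lipschitz_1:
  assumes st: "0 \<le> s" "s \<le> s'" "s' \<le> T" and t: "0 \<le> t" "t \<le> T"
  shows "\<bar>cov s' t - cov s t\<bar> \<le> \<psi>bar * (\<Lambda>b * (1 + C * T)) * (s' - s)"
proof -
  have i1: "integrable lborel (\<lambda>u. \<Lambda>b * indicat_real {s<..s'} u)"
    using st by (intro integrable_mult_right integrable_real_indicator) (auto simp: emeasure_lborel_Ioc)
  note i2 = integrable_Icc_const[of T "\<Lambda>b * (C * (s' - s))"]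
  have "\<bar>(\<integral>u. indicator {0<..min s' t} u * load (max s' t) u \<partial>lborel) - (\<integral>u. indicator {0<..min s t} u * load (max s t) u \<partial>lborel)\<bar>
    = \<bar>\<integral>u. indicator {0<..min s' t} u * load (max s' t) u - indicator {0<..min s t} u * load (max s t) u \<partial>lborel\<bar>"
    using kernel_integrable by simp
  also have "\<dots> \<le> (\<integral>u. \<bar>indicator {0<..min s' t} u * load (max s' t) u - indicator {0<..min s t} u * load (max s t) u\<bar> \<partial>lborel)"
    by (rule integral_abs_bound)
  also have "\<dots> \<le> (\<integral>u. \<Lambda>b * indicator {s<..s'} u + indicator {0..T} u * (\<Lambda>b * (C * (s' - s))) \<partial>lborel)"
    by (rule integral_mono[OF _ Bochner_Integration.integrable_add[OF i1 i2] kernel_increment[OF st t]])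
      (use kernel_integrable in simp)
  also have "\<dots> = \<Lambda>b * (s' - s) + (\<Lambda>b * (C * (s' - s))) * T"
    using st by (subst Bochner_Integration.integral_add[OF i1 i2]) simp
  also have "\<dots> = (\<Lambda>b * (1 + C * T)) * (s' - s)" by (simp add: algebra_simps)
  finally have "\<psi>bar * \<bar>(\<integral>u. indicator {0<..min s' t} u * load (max s' t) u \<partial>lborel) - (\<integral>u. indicator {0<..min s t} u * load (max s t) u \<partial>lborel)\<bar>
    \<le> \<psi>bar * ((\<Lambda>b * (1 + C * T)) * (s' - s))" by (rule mult_left_mono[OF _ \<psi>bar_nonneg])
  then show ?thesis unfolding cov_def
    by (simp only: right_diff_distrib[symmetric] abs_mult abs_of_nonneg[OF \<psi>bar_nonneg] mult.assoc)
qed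

lemma cov_lipschitz:
  assumes "s \<in> {0..T}" "s' \<in> {0..T}" "t \<in> {0..T}" "t' \<in> {0..T}"
  shows "\<bar>cov s t - cov s' t'\<bar> \<le> \<psi>bar * (\<Lambda>b * (1 + C * T)) * (\<bar>s - s'\<bar> + \<bar>t - t'\<bar>)"
proof -
  have 1: "\<bar>cov x y - cov x' y\<bar> \<le> \<psi>bar * (\<Lambda>b * (1 + C * T)) * \<bar>x - x'\<bar>"
    if "x \<in> {0..T}" "x' \<in> {0..T}" "y \<in> {0..T}" for x x' y
    using cov_lipschitz_1[of x x' T y] cov_lipschitz_1[of x' x T y] that
    by (cases "x \<le> x'") (auto simp: abs_minus_commute)
  have "\<bar>cov s t - cov s' t\<bar> \<le> \<psi>bar * (\<Lambda>b * (1 + C * T)) * \<bar>s - s'\<bar>" by (rule 1) (use assms in auto)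
  moreover have "\<bar>cov s' t - cov s' t'\<bar> \<le> \<psi>bar * (\<Lambda>b * (1 + C * T)) * \<bar>t - t'\<bar>"
    using 1[of t t' s'] assms by (simp add: cov_sym)
  ultimately show ?thesis unfolding distrib_left by linarith
qed

text \<open>For fixed \<open>u > 0\<close> the kernel is \<open>\<Lambda> u\<close> times the
  second-moment matrix of the variables \<open>alive (t i) u\<close> under the service law, so the
  form is an integral of squares.\<close>

lemma cov_psd: "0 \<le> (\<Sum>i<(N::nat). \<Sum>j<N. a i * a j * cov (t i) (t j))"
proof -
  let ?k = "\<lambda>s t u. indicator {0<..min s t} u * load (max s t) u"
  have "(\<Sum>i<N. \<Sum>j<N. a i * a j * cov (t i) (t j)) = \<psi>bar * (\<integral>u. (\<Sum>i<N. \<Sum>j<N. a i * a j * ?k (t i) (t j) u) \<partial>lborel)"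
    using kernel_integrable by (simp add: cov_def sum_distrib_left mult_ac)
  also have "0 \<le> \<dots>"
  proof (rule mult_nonneg_nonneg[OF \<psi>bar_nonneg integral_nonneg_AE[OF AE_I2]])
    fix u :: real
    show "0 \<le> (\<Sum>i<N. \<Sum>j<N. a i * a j * ?k (t i) (t j) u)"
    proof (cases "u > 0")
      case True
      then have u0: "u \<ge> 0" by simp
      interpret N: prob_space "service_law \<rho> u" by (rule \<rho>_prob[OF u0])
      have k: "?k s t u = \<Lambda> u * (\<integral>r. alive s u r * alive t u r \<partial>service_law \<rho> u)" for s t
      proof (cases "u \<le> min s t")
        case u: True
        have "(\<integral>r. alive s u r * alive t u r \<partial>service_law \<rho> u) = (\<integral>r. indicator {max s t - u<..} r \<partial>service_law \<rho> u)"
          by (rule Bochner_Integration.integral_cong) (use u u0 in \<open>auto simp: alive_def indicator_def\<close>)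
        also have "\<dots> = measure (service_law \<rho> u) {max s t - u<..}"
          by (simp add: service_law_def)
        also have "\<dots> = service_tail \<rho> u (max s t - u)" using u u0 by (intro service_tail_eq[symmetric]) auto
        finally show ?thesis using u True by (simp add: load_def le_max_iff_disj)
      next
        case False
        then have z: "alive s u r * alive t u r = 0" for r by (auto simp: alive_def indicator_def)
        show ?thesis unfolding z using False by simp
      qed
      have ia: "integrable (service_law \<rho> u) (\<lambda>r. alive s u r * alive t u r)" for s t
        by (rule N.integrable_const_bound[of _ 1]) (auto simp: alive_def indicator_def service_law_def)
      have "(\<Sum>i<N. \<Sum>j<N. a i * a j * ?k (t i) (t j) u) = \<Lambda> u * (\<integral>r. (\<Sum>i<N. \<Sum>j<N. a i * a j * (alive (t i) u r * alive (t j) u r)) \<partial>service_law \<rho> u)"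
        unfolding k using ia by (simp add: sum_distrib_left mult_ac)
      also have "\<dots> = \<Lambda> u * (\<integral>r. (\<Sum>i<N. a i * alive (t i) u r)\<^sup>2 \<partial>service_law \<rho> u)"
        by (simp add: power2_eq_square sum_product mult_ac)
      also have "0 \<le> \<dots>" using \<Lambda>_nonneg[OF u0] by (intro mult_nonneg_nonneg integral_nonneg_AE) auto
      finally show ?thesis .
    next
      case False
      then have "u \<notin> {0<..x}" for x by simp
      then show ?thesis by simp
    qed
  qed
  finally show ?thesis .
qed

text \<open>Mean and variance coincide as for a Poisson variable: the centring of the queue is the
  diagonal of the limiting covariance. This also makes the centring continuous in
  \<open>t\<close>.\<close>

lemma limit_mean_eq: "t \<ge> 0 \<Longrightarrow> limit_mean \<psi>bar \<Lambda> \<rho> t = cov t t"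
proof -
  assume t: "t \<ge> 0"
  have "(LBINT s:{0..t}. \<Lambda> s * service_tail \<rho> s (t - s)) = (\<integral>u. indicator {0} u * (\<Lambda> 0 * service_tail \<rho> 0 t) + load t u \<partial>lborel)"
    unfolding set_lebesgue_integral_def
    by (rule Bochner_Integration.integral_cong) (use t in \<open>auto simp: load_def indicator_def\<close>)
  also have "\<dots> = (\<integral>u. indicator {0<..t} u * load t u \<partial>lborel)"
  proof (rule integral_cong_AE)
    show "AE u in lborel. indicator {0} u * (\<Lambda> 0 * service_tail \<rho> 0 t) + load t u = indicator {0<..t} u * load t u"
      using AE_lborel_singleton[of "0::real"] by eventually_elim (auto simp: load_def indicator_def)
  qed auto
  finally show ?thesis by (simp add: limit_mean_def cov_def)
qed

lemma cov_tendsto: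
  assumes s: "s \<ge> 0" "(x \<longlongrightarrow> s) F" and t: "t \<ge> 0" "(y \<longlongrightarrow> t) F"
    and xy: "\<forall>\<^sub>F i in F. x i \<ge> 0 \<and> y i \<ge> 0"
  shows "((\<lambda>i. cov (x i) (y i)) \<longlongrightarrow> cov s t) F"
proof (rule Lim_null_comparison[THEN LIM_zero_cancel])
  define T where "T = max s t + 1"
  have "\<forall>\<^sub>F i in F. x i < T" "\<forall>\<^sub>F i in F. y i < T"
    using s t by (auto intro!: order_tendstoD(2) simp: T_def)
  then show "\<forall>\<^sub>F i in F. norm (cov (x i) (y i) - cov s t) \<le> \<psi>bar * (\<Lambda>b * (1 + C * T)) * (\<bar>x i - s\<bar> + \<bar>y i - t\<bar>)"
    using xy
  proof eventually_elim
    case (elim i)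
    then show ?case unfolding real_norm_def by (intro cov_lipschitz) (use s t in \<open>auto simp: T_def\<close>)
  qed
  have "((\<lambda>i. \<psi>bar * (\<Lambda>b * (1 + C * T)) * (\<bar>x i - s\<bar> + \<bar>y i - t\<bar>)) \<longlongrightarrow> \<psi>bar * (\<Lambda>b * (1 + C * T)) * (\<bar>s - s\<bar> + \<bar>t - t\<bar>)) F"
    by (intro tendsto_intros s t)
  then show "((\<lambda>i. \<psi>bar * (\<Lambda>b * (1 + C * T)) * (\<bar>x i - s\<bar> + \<bar>y i - t\<bar>)) \<longlongrightarrow> 0) F" by simp
qed

lemma cov_continuous: "continuous_on {0..} (\<lambda>t. cov t t)"
  unfolding continuous_on_def
proof
  fix t :: real assume t: "t \<in> {0..}"
  have "\<forall>\<^sub>F x in at t within {0..}. x \<ge> 0 \<and> x \<ge> 0" by (simp add: eventually_at_filter)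
  then show "((\<lambda>t. cov t t) \<longlongrightarrow> cov t t) (at t within {0..})"
    using t by (intro cov_tendsto tendsto_ident_at) auto
qed

lemma gaussian_limit_exists:
  "\<exists>G. centered_gaussian_process white_noise G \<and> (\<forall>w. continuous_on {0..} (\<lambda>t. G t w)) \<and>
    (\<forall>t\<ge>0. G t \<in> borel_measurable white_noise) \<and>
    (\<forall>(k::nat) t \<theta>. (\<forall>j<k. t j \<ge> 0) \<longrightarrow> (\<integral>w. iexp (\<Sum>j<k. \<theta> j * G (t j) w) \<partial>white_noise)
      = exp (- ((\<Sum>i<k. \<Sum>j<k. \<theta> i * \<theta> j * cov (t i) (t j)) / 2)))"
proof (rule gaussian_process_exists)
  show "cov s t = cov t s" for s t by (rule cov_sym)
  show "0 \<le> (\<Sum>i<N. \<Sum>j<N. a i * a j * cov (t i) (t j))" for N :: nat and t a by (rule cov_psd)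
  show "\<exists>K. \<forall>s\<in>{0..T}. \<forall>t\<in>{0..T}. cov t t - 2 * cov s t + cov s s \<le> K * \<bar>t - s\<bar>" for T
  proof (intro exI ballI)
    fix s t assume st: "s \<in> {0..T}" "t \<in> {0..T}"
    define k where "k = \<psi>bar * (\<Lambda>b * (1 + C * T))"
    have "\<bar>cov t t - cov s t\<bar> \<le> k * (\<bar>t - s\<bar> + \<bar>t - t\<bar>)" "\<bar>cov s s - cov s t\<bar> \<le> k * (\<bar>s - s\<bar> + \<bar>s - t\<bar>)"
      unfolding k_def by (rule cov_lipschitz; use st in auto)+
    then have "\<bar>cov t t - cov s t\<bar> \<le> k * \<bar>t - s\<bar>" "\<bar>cov s s - cov s t\<bar> \<le> k * \<bar>t - s\<bar>" by (simp_all add: abs_minus_commute)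
    then show "cov t t - 2 * cov s t + cov s s \<le> (2 * (\<psi>bar * (\<Lambda>b * (1 + C * T)))) * \<bar>t - s\<bar>"
      unfolding k_def[symmetric] mult.assoc by linarith
  qed
  show "(\<lambda>l. cov (dyadic_floor l s) (dyadic_floor l t)) \<longlonglongrightarrow> cov s t" if "s \<ge> 0" "t \<ge> 0" for s t
    using that by (intro cov_tendsto dyadic_floor_tendsto always_eventually) (auto simp: dyadic_floor_nonneg)
qed

end

section \<open>Quenched convergence\<close>

lemma cadlag_of_bool: "cadlag (\<lambda>s. of_bool (x \<le> s \<and> s < y) :: real)"
  unfolding cadlag_def
proof (intro conjI allI impI)
  fix t :: real
  have "\<exists>b>t. \<forall>s>t. s < b \<longrightarrow> (of_bool (x \<le> s \<and> s < y) :: real) = of_bool (x \<le> t \<and> t < y)"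
  proof (cases "t < x")
    case True then show ?thesis by (intro exI[of _ x]) auto
  next
    case x: False
    show ?thesis
    proof (cases "t < y")
      case True then show ?thesis using x by (intro exI[of _ y]) auto
    next
      case False then show ?thesis by (intro exI[of _ "t + 1"]) auto
    qed
  qed
  then show "((\<lambda>s. of_bool (x \<le> s \<and> s < y) :: real) \<longlongrightarrow> of_bool (x \<le> t \<and> t < y)) (at_right t)"
    by (intro tendsto_eventually) (simp add: eventually_at_right_field)
next
  fix t :: real
  have "\<exists>b<t. \<forall>s>b. s < t \<longrightarrow> (of_bool (x \<le> s \<and> s < y) :: real) = of_bool (x < t \<and> t \<le> y)"
  proof (cases "y < t")
    case True then show ?thesis by (intro exI[of _ y]) auto
  next
    case y: False
    show ?thesis
    proof (cases "x < t")
      case True then show ?thesis using y by (intro exI[of _ x]) auto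
    next
      case False then show ?thesis by (intro exI[of _ "t - 1"]) auto
    qed
  qed
  then show "\<exists>l. ((\<lambda>s. of_bool (x \<le> s \<and> s < y) :: real) \<longlongrightarrow> l) (at_left t)"
    by (intro exI tendsto_eventually) (simp add: eventually_at_left_field)
qed

text \<open>The queue is a finite sum over arrivals on each bounded interval, but the sum changes
  with the horizon; hence a local criterion.\<close>

lemma cadlag_local:
  assumes "\<And>T. \<exists>y. cadlag y \<and> (\<forall>s. 0 \<le> s \<longrightarrow> s \<le> T \<longrightarrow> x s = y s)"
  shows "cadlag x"
  unfolding cadlag_def
proof (intro conjI allI impI)
  fix t :: real assume t: "t \<ge> 0"
  obtain y where y: "cadlag y" "\<And>s. 0 \<le> s \<Longrightarrow> s \<le> t + 1 \<Longrightarrow> x s = y s" using assms[of "t + 1"] by auto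
  have "\<forall>\<^sub>F s in at_right t. x s = y s"
    unfolding eventually_at_right_field using t y(2) by (intro exI[of _ "t + 1"]) auto
  moreover have "(y \<longlongrightarrow> y t) (at_right t)" using y(1) t by (simp add: cadlag_def)
  ultimately show "(x \<longlongrightarrow> x t) (at_right t)" using y(2)[of t] t by (simp add: tendsto_cong)
next
  fix t :: real assume t: "t > 0"
  obtain y where y: "cadlag y" "\<And>s. 0 \<le> s \<Longrightarrow> s \<le> t \<Longrightarrow> x s = y s" using assms[of t] by auto
  have "\<forall>\<^sub>F s in at_left t. x s = y s"
    unfolding eventually_at_left_field using t y(2) by (intro exI[of _ 0]) auto
  moreover obtain l where "(y \<longlongrightarrow> l) (at_left t)" using y(1) t by (auto simp: cadlag_def)
  ultimately show "\<exists>l. (x \<longlongrightarrow> l) (at_left t)" by (auto simp: tendsto_cong)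
qed

lemma cadlag_sum:
  fixes x :: "'i \<Rightarrow> real \<Rightarrow> real"
  assumes "\<And>i. i \<in> I \<Longrightarrow> cadlag (x i)"
  shows "cadlag (\<lambda>t. \<Sum>i\<in>I. x i t)"
  unfolding cadlag_def
proof (intro conjI allI impI)
  fix t :: real assume "t \<ge> 0"
  then show "((\<lambda>t. \<Sum>i\<in>I. x i t) \<longlongrightarrow> (\<Sum>i\<in>I. x i t)) (at_right t)"
    using assms by (intro tendsto_sum) (auto simp: cadlag_def)
next
  fix t :: real assume "t > 0"
  then have "\<forall>i\<in>I. \<exists>l. (x i \<longlongrightarrow> l) (at_left t)" using assms by (auto simp: cadlag_def)
  then obtain l where "\<forall>i\<in>I. (x i \<longlongrightarrow> l i) (at_left t)" by metis
  then show "\<exists>l. ((\<lambda>t. \<Sum>i\<in>I. x i t) \<longlongrightarrow> l) (at_left t)"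
    by (intro exI[of _ "\<Sum>i\<in>I. l i"] tendsto_sum) auto
qed

lemma cadlag_affine:
  fixes x y :: "real \<Rightarrow> real"
  assumes "cadlag x" "cadlag y"
  shows "cadlag (\<lambda>t. a * (x t - y t))"
  unfolding cadlag_def
proof (intro conjI allI impI)
  fix t :: real assume "t \<ge> 0"
  then show "((\<lambda>t. a * (x t - y t)) \<longlongrightarrow> a * (x t - y t)) (at_right t)"
    using assms by (intro tendsto_intros) (auto simp: cadlag_def)
next
  fix t :: real assume "t > 0"
  then obtain l l' where "(x \<longlongrightarrow> l) (at_left t)" "(y \<longlongrightarrow> l') (at_left t)" using assms unfolding cadlag_def by meson
  then show "\<exists>l. ((\<lambda>t. a * (x t - y t)) \<longlongrightarrow> l) (at_left t)"
    by (intro exI[of _ "a * (l - l')"] tendsto_intros)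
qed

context queue
begin

lemma jobs_cadlag:
  assumes w: "w \<in> space P"
  shows "cadlag (\<lambda>t. jobs t w)"
proof (rule cadlag_local)
  fix T
  define y where "y s = (\<Sum>k<count T w. of_bool (tm k w \<le> s \<and> s < tm k w + L k w) :: real)" for s
  have "cadlag y" unfolding y_def[abs_def] by (intro cadlag_sum cadlag_of_bool)
  moreover have "jobs s w = y s" if s: "0 \<le> s" "s \<le> T" for s
    unfolding y_def active_jobs_eq[OF w s]
    by (rule sum.cong) (use s tm_nonneg[OF w] in \<open>auto simp: alive_def indicator_def\<close>)
  ultimately show "\<exists>y. cadlag y \<and> (\<forall>s. 0 \<le> s \<longrightarrow> s \<le> T \<longrightarrow> jobs s w = y s)" by auto
qed

end

text \<open>One realisation of the environment is frozen: \<open>q\<close> stands for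
  \<open>\<psi>\<close> along the path of \<open>Z\<close>, and the ergodic random variable has
  become the number \<open>D\<close>.\<close>

locale random_environment = arrival_rate \<rho> \<alpha> c C \<Lambda> \<Lambda>b \<Lambda>l \<psi>bar
  for \<rho> :: "real \<Rightarrow> real \<Rightarrow> real" and \<alpha> c C :: real and \<Lambda> \<Lambda>b \<Lambda>l \<psi>bar +
  fixes q :: "real \<Rightarrow> real" and qb D \<kappa> \<beta> :: real
  assumes q_meas [measurable]: "q \<in> borel_measurable borel"
    and q_nonneg: "\<And>u. 0 \<le> q u" and q_le: "\<And>u. q u \<le> qb"
    and D_pos: "D > 0" and kappa: "0 < \<kappa>" "\<kappa> < 1"
    and beta: "0 < \<beta>" "\<beta> < 2 * \<kappa>"
    and ergodic: "\<And>t. t > 0 \<Longrightarrow> \<bar>1 / t * (\<integral>u. indicator {0..t} u * q u \<partial>lborel) - \<psi>bar\<bar> \<le> D / (1 + t) powr \<kappa>"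
begin

text \<open>\<open>\<Lambda>\<close> is cut off at negative times, where its sign and size are
  unknown.\<close>

definition rate :: "real \<Rightarrow> real \<Rightarrow> real" where
  "rate \<epsilon> u = \<epsilon> powr (- \<beta>) * (indicator {0..} u * \<Lambda> u) * q (u / \<epsilon>)"

definition env_cov :: "real \<Rightarrow> real \<Rightarrow> real \<Rightarrow> real" where
  "env_cov \<epsilon> s t = (\<integral>u. indicator {0<..min s t} u * (load (max s t) u * q (u / \<epsilon>)) \<partial>lborel)"

text \<open>The first factor comes from \<open>oscillating_integral_bound\<close> applied to the
  load, the second from \<open>ergodic_average_bound\<close>.\<close>

definition averaging_const :: "real \<Rightarrow> real" where
  "averaging_const T = (\<Lambda>b + load_lip * T) * (D * T)"

lemma averaging_const_nonneg: "T \<ge> 0 \<Longrightarrow> 0 \<le> averaging_const T"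
  unfolding averaging_const_def using D_pos load_lip_nonneg \<Lambda>b_nonneg by simp

lemma q_abs: "\<bar>q u\<bar> \<le> qb"
  using q_nonneg[of u] q_le[of u] by simp

lemma q_scaled_meas [measurable]: "(\<lambda>u. q (u / \<epsilon>)) \<in> borel_measurable borel"
  by (rule measurable_compose[OF _ q_meas]) simp

text \<open>The oscillating part \<open>q (u / \<epsilon>) - \<psi>bar\<close> has primitives of
  order \<open>\<epsilon> powr \<kappa>\<close>, and the load is bounded and Lipschitz on
  \<open>{0<..t}\<close>.\<close>

lemma env_cov_error:
  assumes st: "0 \<le> s" "s \<le> T" "0 \<le> t" "t \<le> T" and T: "T \<ge> 1" and \<epsilon>: "\<epsilon> > 0"
  shows "\<bar>env_cov \<epsilon> s t - cov s t\<bar> \<le> averaging_const T * \<epsilon> powr \<kappa>"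
proof (cases "min s t > 0")
  case True
  let ?s = "min s t" and ?t = "max s t"
  have i: "integrable lborel (\<lambda>u. indicator {0<..?s} u * (load ?t u * q (u / \<epsilon>)))"
    by (rule load_integrable(2)[where b=qb]) (use q_abs in auto)
  have "env_cov \<epsilon> s t - cov s t = (\<integral>u. indicator {0<..?s} u * (load ?t u * q (u / \<epsilon>)) - \<psi>bar * (indicator {0<..?s} u * load ?t u) \<partial>lborel)"
    unfolding env_cov_def cov_def using i kernel_integrable by simp
  also have "\<dots> = (\<integral>u. indicator {0<..?s} u * (load ?t u * (q (u / \<epsilon>) - \<psi>bar)) \<partial>lborel)"
    by (rule Bochner_Integration.integral_cong) (simp_all add: algebra_simps)
  also have "\<bar>\<dots>\<bar> \<le> (\<Lambda>b + load_lip * ?s) * (D * T * \<epsilon> powr \<kappa>)"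
  proof (rule oscillating_integral_bound[OF True])
    show "\<bar>load ?t u\<bar> \<le> \<Lambda>b" for u using load_bounds[of ?t u] by simp
    show "\<bar>load ?t u - load ?t v\<bar> \<le> load_lip * \<bar>u - v\<bar>" if "0 < u" "u \<le> ?s" "0 < v" "v \<le> ?s" for u v
      by (rule load_lipschitz) (use that in auto)
    show "\<bar>q (u / \<epsilon>) - \<psi>bar\<bar> \<le> qb + \<psi>bar" for u
      using q_nonneg[of "u / \<epsilon>"] q_le[of "u / \<epsilon>"] \<psi>bar_nonneg by (simp add: abs_le_iff)
    show "\<bar>\<integral>u. indicator {0<..v} u * (q (u / \<epsilon>) - \<psi>bar) \<partial>lborel\<bar> \<le> D * T * \<epsilon> powr \<kappa>" if "0 < v" "v \<le> ?s" for v
      by (rule ergodic_average_bound[OF q_meas q_abs ergodic D_pos kappa \<epsilon> T]) (use that st in auto)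
  qed (use load_lip_nonneg in auto)
  also have "\<dots> \<le> (\<Lambda>b + load_lip * T) * (D * T * \<epsilon> powr \<kappa>)"
    using st load_lip_nonneg D_pos T by (intro mult_right_mono add_left_mono mult_left_mono) auto
  finally show ?thesis by (simp add: averaging_const_def mult.assoc)
next
  case False
  then have e: "{0<..min s t} = {}" by auto
  show ?thesis unfolding env_cov_def cov_def e using averaging_const_nonneg[of T] T by simp
qed

end

text \<open>The scale \<open>\<epsilon>\<close> is fixed here; the locale is instantiated anew at
  each scale, with the arrivals and services of that scale and the same environment.\<close>

locale quenched_queue = random_environment \<rho> \<alpha> c C \<Lambda> \<Lambda>b \<Lambda>l \<psi>bar q qb D \<kappa> \<beta>
  + queue \<rho> \<alpha> c C P \<Gamma> L "random_environment.rate \<Lambda> q \<beta> \<epsilon>" "\<epsilon> powr (- \<beta>) * (\<Lambda>b * qb)"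
  for \<rho> :: "real \<Rightarrow> real \<Rightarrow> real" and \<alpha> c C :: real and \<Lambda> \<Lambda>b \<Lambda>l \<psi>bar q qb D \<kappa> \<beta>
    and P :: "'w measure" and \<Gamma> L \<epsilon> +
  assumes eps: "\<epsilon> > 0"
begin

definition amp :: real where "amp = \<epsilon> powr (\<beta> / 2)"

text \<open>The fluctuation is centred by the averaged mean. This is the deterministic remainder
  after the quenched mean has been subtracted instead.\<close>

definition drift :: "real \<Rightarrow> real" where "drift t = amp * (mean t - cov t t / \<epsilon> powr \<beta>)"

abbreviation "fluct t w \<equiv> fluctuation \<beta> (limit_mean \<psi>bar \<Lambda> \<rho>) \<epsilon> \<Gamma> L t w"

lemma amp_pos: "amp > 0"
  using eps by (simp add: amp_def)

lemma amp_square: "amp\<^sup>2 = \<epsilon> powr \<beta>"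
  using eps by (simp add: amp_def power2_eq_square powr_add[symmetric])

lemma amp_square_minus: "amp\<^sup>2 * \<epsilon> powr (- \<beta>) = 1"
  using eps by (simp add: amp_square powr_minus)

lemma fluct_eq: "t \<ge> 0 \<Longrightarrow> fluct t w = amp * centred t w + drift t"
  by (simp add: fluctuation_def limit_mean_eq drift_def centred_def amp_def algebra_simps)

lemma tail_covariance:
  "(\<integral>u. indicator {0..min s t} u * tail_at (max s t) u * rate \<epsilon> u \<partial>lborel) = \<epsilon> powr (- \<beta>) * env_cov \<epsilon> s t"
proof -
  have "(\<integral>u. indicator {0..min s t} u * tail_at (max s t) u * rate \<epsilon> u \<partial>lborel)
    = (\<integral>u. \<epsilon> powr (- \<beta>) * (indicator {0<..min s t} u * (load (max s t) u * q (u / \<epsilon>))) \<partial>lborel)"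
  proof (rule integral_cong_AE)
    show "AE u in lborel. indicator {0..min s t} u * tail_at (max s t) u * rate \<epsilon> u
      = \<epsilon> powr (- \<beta>) * (indicator {0<..min s t} u * (load (max s t) u * q (u / \<epsilon>)))"
      using AE_lborel_singleton[of "0::real"]
      by eventually_elim (auto simp: load_def tail_at_def rate_def indicator_def)
    show "(\<lambda>u. indicator {0..min s t} u * tail_at (max s t) u * rate \<epsilon> u) \<in> borel_measurable lborel"
      using borel_measurable_times[OF borel_measurable_times[OF _ tail_at_measurable] m_meas] by simp
    have "(\<lambda>u. \<epsilon> powr (- \<beta>) * (indicator {0<..min s t} u * (load (max s t) u * q (u / \<epsilon>)))) \<in> borel_measurable borel"
      by measurable
    then show "(\<lambda>u. \<epsilon> powr (- \<beta>) * (indicator {0<..min s t} u * (load (max s t) u * q (u / \<epsilon>)))) \<in> borel_measurable lborel" by simp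
  qed
  then show ?thesis by (simp add: env_cov_def)
qed

lemma mean_eq: "mean t = \<epsilon> powr (- \<beta>) * env_cov \<epsilon> t t"
proof -
  have e: "indicator {0..t} u * tail_at t u = tail_at t u" for u by (simp add: tail_at_def indicator_def)
  show ?thesis using tail_covariance[of t t] unfolding mean_def min.idem max.idem e .
qed

text \<open>The mean is \<open>\<epsilon> powr (- \<beta>)\<close> times \<open>env_cov\<close>, so
  an averaging error of order \<open>\<epsilon> powr \<kappa>\<close> is amplified by \<open>amp *
  \<epsilon> powr (- \<beta>) = \<epsilon> powr (- \<beta> / 2)\<close>.\<close>

lemma drift_bound:
  assumes t: "0 \<le> t" "t \<le> T" and T: "T \<ge> 1"
  shows "\<bar>drift t\<bar> \<le> averaging_const T * \<epsilon> powr (\<kappa> - \<beta> / 2)"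
proof -
  have "drift t = amp * \<epsilon> powr (- \<beta>) * (env_cov \<epsilon> t t - cov t t)"
    unfolding drift_def mean_eq by (simp add: powr_minus divide_inverse algebra_simps)
  also have "amp * \<epsilon> powr (- \<beta>) = \<epsilon> powr (- \<beta> / 2)" by (simp add: amp_def powr_add[symmetric])
  finally have "\<bar>drift t\<bar> = \<epsilon> powr (- \<beta> / 2) * \<bar>env_cov \<epsilon> t t - cov t t\<bar>" by (simp add: abs_mult)
  also have "\<dots> \<le> \<epsilon> powr (- \<beta> / 2) * (averaging_const T * \<epsilon> powr \<kappa>)"
    using env_cov_error[OF t t T eps] by (intro mult_left_mono) auto
  also have "\<dots> = averaging_const T * \<epsilon> powr (\<kappa> - \<beta> / 2)"
  proof -
    have "\<epsilon> powr (- \<beta> / 2) * \<epsilon> powr \<kappa> = \<epsilon> powr (\<kappa> - \<beta> / 2)" by (simp add: powr_add[symmetric])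
    then show ?thesis by (simp add: mult.left_commute)
  qed
  finally show ?thesis .
qed

lemma fluct_measurable: "t \<ge> 0 \<Longrightarrow> fluct t \<in> borel_measurable P"
  using jobs_measurable[of t] unfolding fluctuation_def[abs_def] by measurable

lemma fluct_cadlag: "w \<in> space P \<Longrightarrow> cadlag (\<lambda>t. fluct t w)"
proof -
  assume w: "w \<in> space P"
  have "cadlag (\<lambda>t. cov t t / \<epsilon> powr \<beta>)"
    by (rule continuous_imp_cadlag) (intro continuous_intros cov_continuous; use eps in simp)
  then have c: "cadlag (\<lambda>t. \<epsilon> powr (\<beta> / 2) * (jobs t w - cov t t / \<epsilon> powr \<beta>))"
    by (rule cadlag_affine[OF jobs_cadlag[OF w]])
  show ?thesis
  proof (rule cadlag_local)
    fix T
    show "\<exists>y. cadlag y \<and> (\<forall>s. 0 \<le> s \<longrightarrow> s \<le> T \<longrightarrow> fluct s w = y s)"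
      using c by (intro exI[of _ "\<lambda>t. \<epsilon> powr (\<beta> / 2) * (jobs t w - cov t t / \<epsilon> powr \<beta>)"]) (simp add: fluctuation_def limit_mean_eq)
  qed
qed

text \<open>The three terms are the drift, the averaging of the covariance, and the cubic remainder,
  for which \<open>amp ^ 3 * \<epsilon> powr (- \<beta>) = amp\<close>.\<close>

lemma fluct_char:
  fixes n :: nat and t \<theta> :: "nat \<Rightarrow> real"
  assumes t: "\<And>j. j < n \<Longrightarrow> 0 \<le> t j \<and> t j \<le> T" and T: "T \<ge> 1"
  shows "\<exists>z. (\<integral>w. iexp (\<Sum>j<n. \<theta> j * fluct (t j) w) \<partial>P) = exp z \<and>
    norm (z + of_real ((\<Sum>i<n. \<Sum>j<n. \<theta> i * \<theta> j * cov (t i) (t j)) / 2))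
      \<le> (\<Sum>j<n. \<bar>\<theta> j\<bar>) * averaging_const T * \<epsilon> powr (\<kappa> - \<beta> / 2)
        + (\<Sum>j<n. \<bar>\<theta> j\<bar>)\<^sup>2 * averaging_const T * \<epsilon> powr \<kappa>
        + (\<Sum>j<n. \<bar>\<theta> j\<bar>) ^ 3 * (\<Lambda>b * qb * T) * amp"
proof -
  define S where "S = (\<Sum>j<n. \<bar>\<theta> j\<bar>)"
  have S0: "0 \<le> S" unfolding S_def by (simp add: sum_nonneg)
  have T0: "T \<ge> 0" using T by simp
  obtain z where z: "(\<integral>w. iexp (\<Sum>j<n. \<theta> j * (amp * (jobs (t j) w - mean (t j)))) \<partial>P) = exp z"
    and zn: "norm (z + of_real (amp\<^sup>2 / 2 * (\<Sum>i<n. \<Sum>j<n. \<theta> i * \<theta> j * (\<epsilon> powr (- \<beta>) * env_cov \<epsilon> (t i) (t j)))))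
      \<le> (amp * S) ^ 3 / 6 * (\<epsilon> powr (- \<beta>) * (\<Lambda>b * qb) * T)"
    using characteristic_function[where n=n and \<theta>=\<theta> and t=t and T=T and a=amp, OF t amp_pos T0] unfolding S_def tail_covariance by blast
  define d where "d = (\<Sum>j<n. \<theta> j * drift (t j))"
  have "(\<Sum>j<n. \<theta> j * fluct (t j) w) = (\<Sum>j<n. \<theta> j * (amp * (jobs (t j) w - mean (t j)))) + d" for w
    unfolding d_def sum.distrib[symmetric]
    by (rule sum.cong) (use t in \<open>auto simp: fluct_eq centred_def algebra_simps\<close>)
  then have "iexp (\<Sum>j<n. \<theta> j * fluct (t j) w) = iexp (\<Sum>j<n. \<theta> j * (amp * (jobs (t j) w - mean (t j)))) * iexp d" for w
    by (simp only: of_real_add distrib_left exp_add)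
  then have "(\<integral>w. iexp (\<Sum>j<n. \<theta> j * fluct (t j) w) \<partial>P) = exp z * iexp d"
    unfolding z[symmetric] by (simp only: integral_mult_left_zero)
  then have eq: "(\<integral>w. iexp (\<Sum>j<n. \<theta> j * fluct (t j) w) \<partial>P) = exp (z + \<i> * of_real d)" by (simp only: exp_add)
  define A where "A = (\<Sum>i<n. \<Sum>j<n. \<theta> i * \<theta> j * env_cov \<epsilon> (t i) (t j))"
  define B where "B = (\<Sum>i<n. \<Sum>j<n. \<theta> i * \<theta> j * cov (t i) (t j))"
  have "amp\<^sup>2 / 2 * (\<Sum>i<n. \<Sum>j<n. \<theta> i * \<theta> j * (\<epsilon> powr (- \<beta>) * env_cov \<epsilon> (t i) (t j)))
    = (amp\<^sup>2 * \<epsilon> powr (- \<beta>)) * A / 2"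
    unfolding A_def by (simp add: sum_distrib_left mult_ac)
  then have zA: "norm (z + of_real (A / 2)) \<le> (amp * S) ^ 3 / 6 * (\<epsilon> powr (- \<beta>) * (\<Lambda>b * qb) * T)"
    using zn unfolding amp_square_minus by simp
  have "(amp * S) ^ 3 / 6 * (\<epsilon> powr (- \<beta>) * (\<Lambda>b * qb) * T) = (amp\<^sup>2 * \<epsilon> powr (- \<beta>)) * (S ^ 3 / 6 * (\<Lambda>b * qb * T) * amp)"
    by (simp add: power_mult_distrib power2_eq_square power3_eq_cube)
  also have "\<dots> = S ^ 3 / 6 * (\<Lambda>b * qb * T) * amp" unfolding amp_square_minus by simp
  also have "\<dots> \<le> S ^ 3 * (\<Lambda>b * qb * T) * amp"
    using S0 amp_pos \<Lambda>b_nonneg q_abs[of 0] T0 by (intro mult_right_mono mult_nonneg_nonneg) auto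
  finally have 1: "norm (z + of_real (A / 2)) \<le> S ^ 3 * (\<Lambda>b * qb * T) * amp" using zA by linarith
  have "\<bar>d\<bar> \<le> (\<Sum>j<n. \<bar>\<theta> j\<bar> * (averaging_const T * \<epsilon> powr (\<kappa> - \<beta> / 2)))"
    unfolding d_def using t T
    by (intro order_trans[OF sum_abs] sum_mono) (auto simp: abs_mult intro!: mult_left_mono drift_bound)
  then have 2: "\<bar>d\<bar> \<le> S * averaging_const T * \<epsilon> powr (\<kappa> - \<beta> / 2)" by (simp only: S_def sum_distrib_right mult.assoc)
  have "\<bar>A - B\<bar> = \<bar>\<Sum>i<n. \<Sum>j<n. \<theta> i * \<theta> j * (env_cov \<epsilon> (t i) (t j) - cov (t i) (t j))\<bar>"
    unfolding A_def B_def by (simp add: sum_subtractf right_diff_distrib)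
  also have "\<dots> \<le> (\<Sum>i<n. \<Sum>j<n. \<bar>\<theta> i\<bar> * \<bar>\<theta> j\<bar> * (averaging_const T * \<epsilon> powr \<kappa>))"
    using t T eps
    by (intro order_trans[OF sum_abs] sum_mono) (auto simp: abs_mult intro!: mult_left_mono env_cov_error)
  also have "\<dots> = S\<^sup>2 * averaging_const T * \<epsilon> powr \<kappa>"
  proof -
    have "S\<^sup>2 * x = (\<Sum>i<n. \<Sum>j<n. \<bar>\<theta> i\<bar> * \<bar>\<theta> j\<bar> * x)" for x
      unfolding S_def power2_eq_square sum_product by (simp only: sum_distrib_right)
    then show ?thesis unfolding mult.assoc[of "S\<^sup>2"] by (rule sym)
  qed
  finally have 3: "\<bar>A - B\<bar> \<le> S\<^sup>2 * averaging_const T * \<epsilon> powr \<kappa>" .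
  \<comment> \<open>The comparison of exponents splits into the expansion with quadratic form
    \<open>A\<close>, the phase of the drift, and the replacement of \<open>A\<close> by
    \<open>B\<close>.\<close>
  have "z + \<i> * of_real d + of_real (B / 2) = (z + of_real (A / 2)) + \<i> * of_real d + of_real ((B - A) / 2)"
    by (simp add: algebra_simps diff_divide_distrib)
  then have "norm (z + \<i> * of_real d + of_real (B / 2)) \<le> norm (z + of_real (A / 2)) + norm (\<i> * complex_of_real d) + norm (complex_of_real ((B - A) / 2))"
    by (metis norm_triangle_ineq norm_triangle_mono order_refl)
  also have "norm (\<i> * complex_of_real d) = \<bar>d\<bar>" by (simp add: norm_mult)
  also have "norm (complex_of_real ((B - A) / 2)) = \<bar>A - B\<bar> / 2" unfolding norm_of_real by (simp add: abs_minus_commute)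
  also have "\<bar>A - B\<bar> / 2 \<le> \<bar>A - B\<bar>" by simp
  finally have "norm (z + \<i> * of_real d + of_real (B / 2)) \<le> norm (z + of_real (A / 2)) + \<bar>d\<bar> + \<bar>A - B\<bar>" by simp
  also have "\<dots> \<le> S ^ 3 * (\<Lambda>b * qb * T) * amp + S * averaging_const T * \<epsilon> powr (\<kappa> - \<beta> / 2) + S\<^sup>2 * averaging_const T * \<epsilon> powr \<kappa>"
    by (intro add_mono 1 2 3)
  finally have "norm (z + \<i> * of_real d + of_real (B / 2))
    \<le> S * averaging_const T * \<epsilon> powr (\<kappa> - \<beta> / 2) + S\<^sup>2 * averaging_const T * \<epsilon> powr \<kappa> + S ^ 3 * (\<Lambda>b * qb * T) * amp"
    by (simp only: ac_simps)
  then show ?thesis unfolding eq S_def[symmetric] B_def[symmetric] by (intro exI[of _ "z + \<i> * of_real d"]) auto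
qed

text \<open>The scale \<open>\<epsilon>\<close> is tied to a dyadic level:
  \<open>1 / 2 ^ Suc n < \<epsilon> powr \<beta> \<le> 1 / 2 ^ n\<close>. The first inequality
  bounds the intensity by \<open>2 * \<Lambda>b * qb * 2 ^ n\<close>, which is where the factor 2 in
  \<open>K\<close> comes from; the second is the bound on the amplitude.\<close>

lemma fluct_oscillation:
  fixes T l :: nat
  assumes T: "T \<ge> 1" and small: "\<epsilon> powr \<beta> \<le> 1 / 2 ^ l" and d: "\<delta> > 0"
  defines "K \<equiv> 2 * \<Lambda>b * qb * (2 + C * T)"
  shows "\<exists>B\<in>sets P. measure P B \<le> T * (2048 * exp K) * (5000 / 6561) ^ l + T * (512 * exp (9 * K)) / \<delta> ^ 4 * \<epsilon> powr \<beta> \<and>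
    (\<forall>w\<in>space P - B. \<forall>t. 0 \<le> t \<longrightarrow> t < real T \<longrightarrow>
      \<bar>fluct t w - fluct (dyadic_floor l t) w\<bar> \<le> 9 * chain_rate ^ l + \<delta> + amp * K + 2 * averaging_const T * \<epsilon> powr (\<kappa> - \<beta> / 2))"
proof -
  have a2: "0 < amp\<^sup>2" using amp_pos by simp
  have lim: "(\<lambda>n. (1 / 2 :: real) ^ n) \<longlonglongrightarrow> 0" by (rule LIMSEQ_realpow_zero) auto
  have "\<exists>n. (1 / 2 :: real) ^ n < amp\<^sup>2" using order_tendstoD(2)[OF lim a2] by (auto simp: eventually_sequentially)
  \<comment> \<open>The first level whose mesh is finer than \<open>\<epsilon> powr \<beta>\<close>.
    Since \<open>small\<close> forces \<open>N > l\<close>, the level \<open>n = N - 1\<close> is at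
    least \<open>l\<close>.\<close>
  define N where "N = (LEAST n. (1 / 2 :: real) ^ n < amp\<^sup>2)"
  have N: "(1 / 2) ^ N < amp\<^sup>2" unfolding N_def by (rule LeastI_ex) fact
  have Nmin: "amp\<^sup>2 \<le> (1 / 2) ^ n" if "n < N" for n using not_less_Least[of n "\<lambda>n. (1 / 2 :: real) ^ n < amp\<^sup>2"] that unfolding N_def by simp
  have lN: "l < N"
  proof (rule ccontr)
    assume "\<not> l < N"
    then have "(1 / 2 :: real) ^ l \<le> (1 / 2) ^ N" by (intro power_decreasing) auto
    then show False using N small unfolding amp_square by (simp add: power_one_over)
  qed
  define n where "n = N - 1"
  have nN: "N = Suc n" using lN by (simp add: n_def)
  have n1: "amp\<^sup>2 \<le> 1 / 2 ^ n" using Nmin[of n] nN by (simp add: power_one_over)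
  have "1 < 2 * 2 ^ n * amp\<^sup>2" using N unfolding nN power_one_over by (simp add: divide_less_eq mult.commute)
  have "\<epsilon> powr (- \<beta>) \<le> 2 * 2 ^ n"
  proof -
    have "\<epsilon> powr (- \<beta>) * 1 \<le> \<epsilon> powr (- \<beta>) * (2 * 2 ^ n * amp\<^sup>2)" using \<open>1 < 2 * 2 ^ n * amp\<^sup>2\<close> by (intro mult_left_mono) auto
    also have "\<dots> = (amp\<^sup>2 * \<epsilon> powr (- \<beta>)) * (2 * 2 ^ n)" by (simp only: mult_ac)
    finally show ?thesis unfolding amp_square_minus by simp
  qed
  then have mb: "\<epsilon> powr (- \<beta>) * (\<Lambda>b * qb) \<le> 2 * \<Lambda>b * qb * 2 ^ n"
    using mult_right_mono[of "\<epsilon> powr (- \<beta>)" "2 * 2 ^ n" "\<Lambda>b * qb"] \<Lambda>b_nonneg q_abs[of 0] by (simp add: mult_ac)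
  have "l \<le> n" using lN nN by simp
  from oscillation_bound[OF this amp_pos n1 mb d, of T]
  obtain B where B: "B \<in> sets P" "measure P B \<le> T * (2048 * exp K) * (5000 / 6561) ^ l + T * (512 * exp (9 * K)) / \<delta> ^ 4 * amp\<^sup>2"
    and osc: "\<And>w t. w \<in> space P - B \<Longrightarrow> 0 \<le> t \<Longrightarrow> t < real T \<Longrightarrow>
      \<bar>amp * centred t w - amp * centred (dyadic_floor l t) w\<bar> \<le> 9 * chain_rate ^ l + \<delta> + amp * K"
    unfolding K_def by (auto simp: mult.assoc)
  show ?thesis
  proof (rule bexI[OF _ B(1)], intro conjI ballI allI impI)
    show "measure P B \<le> T * (2048 * exp K) * (5000 / 6561) ^ l + T * (512 * exp (9 * K)) / \<delta> ^ 4 * \<epsilon> powr \<beta>"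
      using B(2) unfolding amp_square .
    fix w and t :: real assume w: "w \<in> space P - B" and t: "0 \<le> t" "t < T"
    define s where "s = dyadic_floor l t"
    have s: "0 \<le> s" "s \<le> t" unfolding s_def using dyadic_floor_nonneg[OF t(1)] dyadic_floor_le by auto
    have "\<bar>drift t\<bar> \<le> averaging_const T * \<epsilon> powr (\<kappa> - \<beta> / 2)" "\<bar>drift s\<bar> \<le> averaging_const T * \<epsilon> powr (\<kappa> - \<beta> / 2)"
      using s t T by (intro drift_bound; simp)+
    then show "\<bar>fluct t w - fluct (dyadic_floor l t) w\<bar> \<le> 9 * chain_rate ^ l + \<delta> + amp * K + 2 * averaging_const T * \<epsilon> powr (\<kappa> - \<beta> / 2)"
      using osc[OF w t] fluct_eq[OF t(1), of w] fluct_eq[OF s(1), of w] unfolding s_def by linarith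
  qed
qed

end

text \<open>Stated along positive null sequences of scales, on one probability space; characteristic
  functions and tightness come from \<open>fluct_char\<close> and \<open>fluct_oscillation\<close>
  at each scale.\<close>

lemma (in random_environment) fluctuations_converge:
  fixes P :: "'w measure" and e :: "nat \<Rightarrow> real" and Y :: "real \<Rightarrow> 'v \<Rightarrow> real"
  assumes e: "\<And>n. e n > 0" "e \<longlonglongrightarrow> 0"
    and queue: "\<And>n. quenched_queue \<rho> \<alpha> c C \<Lambda> \<Lambda>b \<Lambda>l \<psi>bar q qb D \<kappa> \<beta> P (\<Gamma> (e n)) (L (e n)) (e n)"
    and M': "prob_space M'" and Y: "\<And>t. t \<ge> 0 \<Longrightarrow> Y t \<in> borel_measurable M'"
    and Ypath: "\<And>w. w \<in> space M' \<Longrightarrow> continuous_on {0..} (\<lambda>t. Y t w)"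
    and Ychar: "\<And>(k::nat) t \<theta>. (\<And>j. j < k \<Longrightarrow> t j \<ge> 0) \<Longrightarrow> (\<integral>w. iexp (\<Sum>j<k. \<theta> j * Y (t j) w) \<partial>M')
      = exp (- ((\<Sum>i<k. \<Sum>j<k. \<theta> i * \<theta> j * cov (t i) (t j)) / 2))"
    and f: "continuous_map skorokhod_topology euclideanreal f"
    and bd: "\<And>x. x \<in> skorokhod_space \<Longrightarrow> \<bar>f x\<bar> \<le> B"
  shows "(\<lambda>n. \<integral>w. f (restrict (\<lambda>t. fluctuation \<beta> (limit_mean \<psi>bar \<Lambda> \<rho>) (e n) (\<Gamma> (e n)) (L (e n)) t w) {0..}) \<partial>P)
    \<longlonglongrightarrow> (\<integral>w. f (restrict (\<lambda>t. Y t w) {0..}) \<partial>M')"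
proof -
  define X where "X n t w = fluctuation \<beta> (limit_mean \<psi>bar \<Lambda> \<rho>) (e n) (\<Gamma> (e n)) (L (e n)) t w" for n t w
  have ev: "\<forall>\<^sub>F n in sequentially. 0 \<le> e n" using e(1) by (intro always_eventually) (simp add: less_imp_le)
  have lim_powr: "(\<lambda>n. x * e n powr p) \<longlonglongrightarrow> 0" if "p > 0" for x p
  proof -
    have "(\<lambda>n. e n powr p) \<longlonglongrightarrow> 0" using tendsto_powr2[OF e(2) tendsto_const ev that] that by simp
    from tendsto_mult_right_zero[OF this, of x] show ?thesis .
  qed
  have pos: "\<kappa> - \<beta> / 2 > 0" "\<beta> / 2 > 0" using beta by auto
  have P: "prob_space P"
  proof -
    interpret quenched_queue \<rho> \<alpha> c C \<Lambda> \<Lambda>b \<Lambda>l \<psi>bar q qb D \<kappa> \<beta> P "\<Gamma> (e 0)" "L (e 0)" "e 0" by (rule queue)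
    show ?thesis by (rule prob_space_axioms)
  qed
  have "(\<lambda>n. \<integral>w. f (restrict (\<lambda>t. X n t w) {0..}) \<partial>P) \<longlonglongrightarrow> (\<integral>w. f (restrict (\<lambda>t. Y t w) {0..}) \<partial>M')"
  proof (rule weak_convergence_skorokhod[where X=X, OF P M' _ _ Y Ypath _ _ f bd])
    fix n
    interpret quenched_queue \<rho> \<alpha> c C \<Lambda> \<Lambda>b \<Lambda>l \<psi>bar q qb D \<kappa> \<beta> P "\<Gamma> (e n)" "L (e n)" "e n" by (rule queue)
    show "X n t \<in> borel_measurable P" if "t \<ge> 0" for t
      unfolding X_def[abs_def] by (rule fluct_measurable[OF that])
    show "cadlag (\<lambda>t. X n t w)" if "w \<in> space P" for w
      unfolding X_def by (rule fluct_cadlag[OF that])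
  next
    fix k :: nat and t \<theta> :: "nat \<Rightarrow> real"
    assume t: "\<And>j. j < k \<Longrightarrow> t j \<ge> 0"
    define T where "T = 1 + (\<Sum>j<k. \<bar>t j\<bar>)"
    have T: "T \<ge> 1" by (simp add: T_def sum_nonneg)
    have tT: "0 \<le> t j \<and> t j \<le> T" if "j < k" for j
    proof -
      have "\<bar>t j\<bar> \<le> (\<Sum>j<k. \<bar>t j\<bar>)" using that by (intro member_le_sum) auto
      then show ?thesis using t[OF that] by (simp add: T_def)
    qed
    define S where "S = (\<Sum>j<k. \<bar>\<theta> j\<bar>)"
    define V where "V = (\<Sum>i<k. \<Sum>j<k. \<theta> i * \<theta> j * cov (t i) (t j)) / 2"
    define err where "err n = S * averaging_const T * e n powr (\<kappa> - \<beta> / 2) + S\<^sup>2 * averaging_const T * e n powr \<kappa>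
      + S ^ 3 * (\<Lambda>b * qb * T) * e n powr (\<beta> / 2)" for n
    have "\<exists>z. (\<integral>w. iexp (\<Sum>j<k. \<theta> j * X n (t j) w) \<partial>P) = exp z \<and> norm (z + of_real V) \<le> err n" for n
    proof -
      interpret quenched_queue \<rho> \<alpha> c C \<Lambda> \<Lambda>b \<Lambda>l \<psi>bar q qb D \<kappa> \<beta> P "\<Gamma> (e n)" "L (e n)" "e n" by (rule queue)
      from fluct_char[where t=t and n=k and T=T and \<theta>=\<theta>, OF tT T] show ?thesis
        unfolding X_def V_def err_def S_def amp_def .
    qed
    then obtain z where z: "\<And>n. (\<integral>w. iexp (\<Sum>j<k. \<theta> j * X n (t j) w) \<partial>P) = exp (z n)"
      and zn: "\<And>n. norm (z n + of_real V) \<le> err n" by metis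
    have "err \<longlonglongrightarrow> 0 + 0 + 0" unfolding err_def by (intro tendsto_add lim_powr pos kappa)
    then have "err \<longlonglongrightarrow> 0" by simp
    then have "(\<lambda>n. z n + of_real V) \<longlonglongrightarrow> 0" by (rule Lim_null_comparison[rotated]) (use zn in auto)
    then have "(\<lambda>n. (z n + of_real V) - of_real V) \<longlonglongrightarrow> 0 - of_real V" by (intro tendsto_diff tendsto_const)
    then have "(\<lambda>n. exp (z n)) \<longlonglongrightarrow> exp (- of_real V)" by (intro tendsto_exp) simp
    moreover have "(\<integral>w. iexp (\<Sum>j<k. \<theta> j * Y (t j) w) \<partial>M') = exp (- of_real V)"
      using Ychar[where k=k and t=t and \<theta>=\<theta>, OF t]
      by (simp only: V_def exp_of_real of_real_minus[symmetric])
    ultimately show "(\<lambda>n. \<integral>w. iexp (\<Sum>j<k. \<theta> j * X n (t j) w) \<partial>P) \<longlonglongrightarrow> (\<integral>w. iexp (\<Sum>j<k. \<theta> j * Y (t j) w) \<partial>M')"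
      by (simp only: z)
  next
    fix T \<delta> \<eta> :: real assume T: "T > 0" and d: "\<delta> > 0" and eta: "\<eta> > 0"
    \<comment> \<open>The oscillation bound needs an integer horizon and strict inequality, while
      tightness is required up to \<open>T\<close> inclusive.\<close>
    define N where "N = nat \<lceil>T\<rceil> + 1"
    have NT: "T < real N" "N \<ge> 1" unfolding N_def by linarith+
    define K where "K = 2 * \<Lambda>b * qb * (2 + C * N)"
    have r1: "(\<lambda>l. 9 * chain_rate ^ l) \<longlonglongrightarrow> 0" by (rule chain_rate_tendsto)
    have r2: "(\<lambda>l. N * (2048 * exp K) * (5000 / 6561) ^ l) \<longlonglongrightarrow> 0"
      by (intro tendsto_mult_right_zero LIMSEQ_realpow_zero) auto
    \<comment> \<open>The budget is four quarters of \<open>\<delta>\<close> and two halves of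
      \<open>\<eta>\<close>. Terms that decay in the level are settled here by \<open>l0\<close>,
      terms that decay in the scale are settled below for each \<open>l\<close>.\<close>
    have "\<forall>\<^sub>F l in sequentially. 9 * chain_rate ^ l < \<delta> / 4 \<and> N * (2048 * exp K) * (5000 / 6561) ^ l < \<eta> / 2"
      using order_tendstoD(2)[OF r1, of "\<delta> / 4"] order_tendstoD(2)[OF r2, of "\<eta> / 2"] d eta by (auto intro: eventually_conj)
    then obtain l0 where l0: "\<And>l. l \<ge> l0 \<Longrightarrow> 9 * chain_rate ^ l < \<delta> / 4"
      "\<And>l. l \<ge> l0 \<Longrightarrow> N * (2048 * exp K) * (5000 / 6561) ^ l < \<eta> / 2" by (auto simp: eventually_sequentially)
    show "\<exists>l0. \<forall>l\<ge>l0. \<forall>\<^sub>F n in sequentially. \<exists>B\<in>sets P. measure P B \<le> \<eta> \<and>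
        (\<forall>w\<in>space P - B. \<forall>t\<in>{0..T}. \<bar>X n t w - X n (dyadic_floor l t) w\<bar> \<le> \<delta>)"
    proof (intro exI[of _ l0] allI impI)
      fix l assume l: "l \<ge> l0"
      have e1: "\<forall>\<^sub>F n in sequentially. 1 * e n powr \<beta> < 1 / 2 ^ l"
        using beta by (intro order_tendstoD(2)[OF lim_powr]) auto
      have e2: "\<forall>\<^sub>F n in sequentially. N * (512 * exp (9 * K)) / (\<delta> / 4) ^ 4 * e n powr \<beta> < \<eta> / 2"
        using beta eta by (intro order_tendstoD(2)[OF lim_powr]) auto
      have e3: "\<forall>\<^sub>F n in sequentially. K * e n powr (\<beta> / 2) < \<delta> / 4"
        using beta d by (intro order_tendstoD(2)[OF lim_powr]) auto
      have e4: "\<forall>\<^sub>F n in sequentially. 2 * averaging_const N * e n powr (\<kappa> - \<beta> / 2) < \<delta> / 4"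
        using pos d by (intro order_tendstoD(2)[OF lim_powr]) auto
      show "\<forall>\<^sub>F n in sequentially. \<exists>B\<in>sets P. measure P B \<le> \<eta> \<and>
        (\<forall>w\<in>space P - B. \<forall>t\<in>{0..T}. \<bar>X n t w - X n (dyadic_floor l t) w\<bar> \<le> \<delta>)"
        using e1 e2 e3 e4
      proof eventually_elim
        case (elim n)
        interpret quenched_queue \<rho> \<alpha> c C \<Lambda> \<Lambda>b \<Lambda>l \<psi>bar q qb D \<kappa> \<beta> P "\<Gamma> (e n)" "L (e n)" "e n" by (rule queue)
        have sm: "e n powr \<beta> \<le> 1 / 2 ^ l" using elim(1) by simp
        have d4: "\<delta> / 4 > 0" using d by simp
        obtain B where B: "B \<in> sets P"
          "measure P B \<le> N * (2048 * exp K) * (5000 / 6561) ^ l + N * (512 * exp (9 * K)) / (\<delta> / 4) ^ 4 * e n powr \<beta>"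
          and osc: "\<And>w t. w \<in> space P - B \<Longrightarrow> 0 \<le> t \<Longrightarrow> t < real N \<Longrightarrow> \<bar>X n t w - X n (dyadic_floor l t) w\<bar>
            \<le> 9 * chain_rate ^ l + \<delta> / 4 + amp * K + 2 * averaging_const N * e n powr (\<kappa> - \<beta> / 2)"
          using fluct_oscillation[OF NT(2) sm d4] unfolding X_def K_def by blast
        show ?case
        proof (intro bexI[OF _ B(1)] conjI ballI)
          show "measure P B \<le> \<eta>" using B(2) l0(2)[OF l] elim(2) by linarith
          fix w t assume w: "w \<in> space P - B" and t: "t \<in> {0..T}"
          have "amp * K < \<delta> / 4" using elim(3) by (simp add: amp_def mult.commute)
          moreover have "\<bar>X n t w - X n (dyadic_floor l t) w\<bar>
            \<le> 9 * chain_rate ^ l + \<delta> / 4 + amp * K + 2 * averaging_const N * e n powr (\<kappa> - \<beta> / 2)"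
            by (rule osc[OF w]) (use t NT in auto)
          ultimately show "\<bar>X n t w - X n (dyadic_floor l t) w\<bar> \<le> \<delta>" using elim(4) l0(1)[OF l] by linarith
        qed
      qed
    qed
  qed
  then show ?thesis unfolding X_def .
qed

text \<open>Values at the dyadic point following the cell of \<open>t\<close> are used; that point
  is strictly above \<open>t\<close>, so right-continuity applies.\<close>

lemma right_continuous_borel_measurable:
  fixes y :: "real \<Rightarrow> real"
  assumes y: "\<And>t. t \<ge> 0 \<Longrightarrow> (y \<longlongrightarrow> y t) (at_right t)"
  shows "(\<lambda>t. indicator {0..} t * y t) \<in> borel_measurable borel"
proof (rule borel_measurable_LIMSEQ_real)
  define u where "u n t = indicator {0..} t * y (dyadic_floor n t + 1 / 2 ^ n)" for n and t :: real
  show "(\<lambda>n. u n t) \<longlonglongrightarrow> indicator {0..} t * y t" for t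
  proof (cases "t \<ge> 0")
    case True
    have "(\<lambda>n. dyadic_floor n t + (1 / 2) ^ n) \<longlonglongrightarrow> t + 0"
      by (intro tendsto_add dyadic_floor_tendsto LIMSEQ_realpow_zero) auto
    then have "(\<lambda>n. dyadic_floor n t + 1 / 2 ^ n) \<longlonglongrightarrow> t" by (simp add: power_one_over)
    moreover have "\<forall>\<^sub>F n in sequentially. t < dyadic_floor n t + 1 / 2 ^ n"
    proof (intro always_eventually allI)
      show "t < dyadic_floor n t + 1 / 2 ^ n" for n using dyadic_floor_gt[of t n] by simp
    qed
    ultimately have "filterlim (\<lambda>n. dyadic_floor n t + 1 / 2 ^ n) (at_right t) sequentially"
      by (rule tendsto_imp_filterlim_at_right)
    from filterlim_compose[OF y[OF True] this] show ?thesis unfolding u_def by (intro tendsto_mult tendsto_const)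
  qed (simp add: u_def)
  show "u n \<in> borel_measurable borel" for n
  proof -
    have "(\<lambda>t :: real. \<lfloor>2 ^ n * t\<rfloor>) \<in> borel \<rightarrow>\<^sub>M count_space UNIV" by measurable
    moreover have "(\<lambda>z :: int. y (real_of_int z / 2 ^ n + 1 / 2 ^ n)) \<in> borel_measurable (count_space UNIV)" by simp
    ultimately have [measurable]: "(\<lambda>t :: real. y (real_of_int \<lfloor>2 ^ n * t\<rfloor> / 2 ^ n + 1 / 2 ^ n)) \<in> borel_measurable borel"
      by (rule measurable_compose)
    then show ?thesis unfolding u_def[abs_def] dyadic_floor_def by measurable
  qed
qed

lemma bounded_abs_bound: "bounded (f ` S) \<Longrightarrow> \<exists>B. \<forall>x\<in>S. \<bar>f x :: real\<bar> \<le> B"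
  by (auto simp: bounded_iff)

text \<open>The Gaussian process is built before a realisation is fixed, so one limit serves almost
  every environment. The exceptional null set comes from the ergodic bound and from the hypothesis
  on the queue, which are already uniform in the time and in the scale respectively.\<close>

theorem theorem3p6:
  fixes M :: "'w measure"
    and Z :: "real \<Rightarrow> 'w \<Rightarrow> real ^ 'd"
    and K :: "real \<Rightarrow> real ^ 'd \<Rightarrow> (real ^ 'd) measure"
    and \<pi> :: "(real ^ 'd) measure"
    and Q :: "'w \<Rightarrow> 'w measure"
    and \<Lambda> :: "real \<Rightarrow> real"
    and \<psi> :: "real ^ 'd \<Rightarrow> real"
    and \<rho> :: "real \<Rightarrow> real \<Rightarrow> real"
    and \<Gamma> :: "real \<Rightarrow> nat \<Rightarrow> 'w \<Rightarrow> ereal"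
    and L :: "real \<Rightarrow> nat \<Rightarrow> 'w \<Rightarrow> real"
    and \<alpha> \<beta> \<kappa> c C \<psi>bar :: real
  assumes "prob_space M"
    (* environment *)
    and Z_measurable: "\<And>t. t \<ge> 0 \<Longrightarrow> Z t \<in> borel_measurable M"
    and Z_cadlag: "\<And>\<omega>. \<omega> \<in> space M \<Longrightarrow> cadlag (\<lambda>t. Z t \<omega>)"
    and transitions: "transition_laws M Z K"
    and invariant: "invariant_law K \<pi>"
    and invariant_unique: "\<And>\<pi>'. invariant_law K \<pi>' \<Longrightarrow> \<pi>' = \<pi>"
    and \<Lambda>_pos: "\<And>s. s \<ge> 0 \<Longrightarrow> \<Lambda> s > 0"
    and \<Lambda>_bounded: "bounded (\<Lambda> ` {0..})"
    and \<Lambda>_Lipschitz: "\<exists>B. B-lipschitz_on {0..} \<Lambda>"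
    and \<psi>_pos: "\<And>z. \<psi> z > 0"
    and \<psi>_bounded: "bounded (range \<psi>)"
    and \<psi>_Lipschitz: "\<exists>B. B-lipschitz_on UNIV \<psi>"
    and \<psi>bar: "\<psi>bar = (\<integral>z. \<psi> z \<partial>\<pi>)"
    and ergodic: "\<And>\<kappa>'. 0 < \<kappa>' \<Longrightarrow> \<kappa>' < 1/2 \<Longrightarrow>
      \<exists>D \<in> borel_measurable (generated_sigma M {0..} Z). (\<forall>\<omega>\<in>space M. D \<omega> > 0) \<and>
        (AE \<omega> in M. \<forall>t>0. \<bar>1 / t * (LBINT u:{0..t}. \<psi> (Z u \<omega>)) - \<psi>bar\<bar>
                            \<le> D \<omega> / (1 + t) powr \<kappa>')"
    (* service times *)
    and "\<alpha> > 0" "c > 0" "C > 0"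
    and \<rho>_measurable: "\<And>s. s \<ge> 0 \<Longrightarrow> set_borel_measurable borel {0..} (\<rho> s)"
    and \<rho>_nonneg: "\<And>s r. s \<ge> 0 \<Longrightarrow> r \<ge> 0 \<Longrightarrow> \<rho> s r \<ge> 0"
    and \<rho>_prob: "\<And>s. s \<ge> 0 \<Longrightarrow> prob_space (service_law \<rho> s)"
    and \<rho>_bounds: "\<And>r s. r > 0 \<Longrightarrow> s > 0 \<Longrightarrow>
      c * min (r powr (- 1 - \<alpha>)) 1 \<le> \<rho> s r \<and> \<rho> s r \<le> C * min (r powr (- 1 - \<alpha>)) 1"
    and \<rho>_deriv: "\<And>r s. r > 0 \<Longrightarrow> s > 0 \<Longrightarrow>
      \<exists>D. ((\<lambda>u. \<rho> u r) has_real_derivative D) (at s) \<and> D \<le> C * min (r powr (- 1 - \<alpha>)) 1"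
    (* quenched probability and queue *)
    and quenched: "regular_cond_prob M (generated_sigma M {0..} Z) Q"
    and arrivals: "\<And>\<epsilon>. \<epsilon> > 0 \<Longrightarrow> arrival_times M (\<Gamma> \<epsilon>)"
    and L_measurable: "\<And>\<epsilon> k. \<epsilon> > 0 \<Longrightarrow> L \<epsilon> k \<in> borel_measurable M"
    and queue: "AE \<omega> in M. \<forall>\<epsilon>>0.
      poisson_process (Q \<omega>) (\<Gamma> \<epsilon>) (arrival_intensity \<beta> \<Lambda> \<psi> \<epsilon> (\<lambda>t. Z t \<omega>)) \<and>
      conditional_services (Q \<omega>) (\<Gamma> \<epsilon>) (L \<epsilon>) (service_law \<rho>)"
    (* exponents *)
    and "0 < \<kappa>" "\<kappa> < 1/2" "0 < \<beta>" "\<beta> < 2 * \<kappa>"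
  shows "\<exists>(M' :: (real \<Rightarrow> real) measure) Gbar.
    prob_space M' \<and> centered_gaussian_process M' Gbar \<and>
    (\<forall>w\<in>space M'. continuous_on {0..} (\<lambda>t. Gbar t w)) \<and>
    (AE \<omega> in M. converges_in_distribution (at_right 0) skorokhod_topology
       (\<lambda>_. Q \<omega>)
       (\<lambda>\<epsilon> w. restrict (\<lambda>t. fluctuation \<beta> (limit_mean \<psi>bar \<Lambda> \<rho>) \<epsilon> (\<Gamma> \<epsilon>) (L \<epsilon>) t w) {0..})
       M' (\<lambda>w. restrict (\<lambda>t. Gbar t w) {0..}))"
proof -
  interpret service_density \<rho> \<alpha> c C
    by (rule service_density.intro; fact)
  obtain \<Lambda>b where \<Lambda>b: "\<And>s. s \<ge> 0 \<Longrightarrow> \<bar>\<Lambda> s\<bar> \<le> \<Lambda>b" using bounded_abs_bound[OF \<Lambda>_bounded] by auto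
  obtain \<Lambda>l where \<Lambda>l: "\<Lambda>l-lipschitz_on {0..} \<Lambda>" using \<Lambda>_Lipschitz by auto
  obtain qb where qb: "\<And>z. \<bar>\<psi> z\<bar> \<le> qb" using bounded_abs_bound[OF \<psi>_bounded] by auto
  have \<psi>_cont: "isCont \<psi> z" for z
    using \<psi>_Lipschitz lipschitz_on_continuous_on[of _ UNIV \<psi>] by (auto simp: continuous_on_eq_continuous_at)
  have \<psi>bar0: "0 \<le> \<psi>bar" unfolding \<psi>bar using \<psi>_pos by (intro integral_nonneg_AE) (simp add: less_imp_le)
  interpret arrival_rate \<rho> \<alpha> c C \<Lambda> \<Lambda>b \<Lambda>l \<psi>bar
  proof (intro arrival_rate.intro service_density_axioms arrival_rate_axioms.intro \<Lambda>l \<psi>bar0)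
    show "0 \<le> \<Lambda> s" if "s \<ge> 0" for s using \<Lambda>_pos[OF that] by simp
    show "\<Lambda> s \<le> \<Lambda>b" if "s \<ge> 0" for s using \<Lambda>b[OF that] by simp
  qed
  obtain G where G: "centered_gaussian_process white_noise G" "\<And>w. continuous_on {0..} (\<lambda>t. G t w)"
    "\<And>t. t \<ge> 0 \<Longrightarrow> G t \<in> borel_measurable white_noise"
    and Gchar: "\<And>(k::nat) t \<theta>. (\<And>j. j < k \<Longrightarrow> t j \<ge> 0) \<Longrightarrow> (\<integral>w. iexp (\<Sum>j<k. \<theta> j * G (t j) w) \<partial>white_noise)
      = exp (- ((\<Sum>i<k. \<Sum>j<k. \<theta> i * \<theta> j * cov (t i) (t j)) / 2))"
    using gaussian_limit_exists by blast
  have G_skorokhod: "restrict (\<lambda>t. G t w) {0..} \<in> skorokhod_space" for w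
    using cadlag_restrict[OF continuous_imp_cadlag[OF G(2)]] by (simp add: skorokhod_space_def)
  obtain D where D: "\<And>\<omega>. \<omega> \<in> space M \<Longrightarrow> D \<omega> > 0"
    and erg: "AE \<omega> in M. \<forall>t>0. \<bar>1 / t * (LBINT u:{0..t}. \<psi> (Z u \<omega>)) - \<psi>bar\<bar> \<le> D \<omega> / (1 + t) powr \<kappa>"
    using ergodic[OF \<open>0 < \<kappa>\<close> \<open>\<kappa> < 1/2\<close>] by blast
  have m_\<Lambda>: "(\<lambda>u. indicator {0..} u * \<Lambda> u) \<in> borel_measurable borel"
    using borel_measurable_continuous_on_indicator[OF _ lipschitz_on_continuous_on[OF \<Lambda>l]] by simp
  \<comment> \<open>Measurability of the kernel \<open>Q\<close> into \<open>prob_algebra M\<close>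
    already makes every \<open>Q \<omega>\<close> a probability measure on the sets of
    \<open>M\<close>, without a further null set.\<close>
  have Q: "prob_space (Q \<omega>)" "sets (Q \<omega>) = sets M" if "\<omega> \<in> space M" for \<omega>
  proof -
    have "\<omega> \<in> space (generated_sigma M {0..} Z)" using that by (simp add: generated_sigma_def space_measure_of_conv)
    moreover have "Q \<in> generated_sigma M {0..} Z \<rightarrow>\<^sub>M prob_algebra M"
      using quenched unfolding regular_cond_prob_def by (rule conjunct1)
    ultimately have "Q \<omega> \<in> space (prob_algebra M)" by (rule measurable_space[rotated])
    then show "prob_space (Q \<omega>)" "sets (Q \<omega>) = sets M" by (auto simp: space_prob_algebra)
  qed
  show ?thesis
  proof (intro exI conjI ballI)
    show "prob_space white_noise" by (rule prob_space_white_noise)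
    show "centered_gaussian_process white_noise G" by (rule G(1))
    show "continuous_on {0..} (\<lambda>t. G t w)" for w by (rule G(2))
    show "AE \<omega> in M. converges_in_distribution (at_right 0) skorokhod_topology (\<lambda>_. Q \<omega>)
       (\<lambda>\<epsilon> w. restrict (\<lambda>t. fluctuation \<beta> (limit_mean \<psi>bar \<Lambda> \<rho>) \<epsilon> (\<Gamma> \<epsilon>) (L \<epsilon>) t w) {0..})
       white_noise (\<lambda>w. restrict (\<lambda>t. G t w) {0..})"
      using AE_space erg queue
    proof eventually_elim
      case (elim \<omega>)
      \<comment> \<open>Cut off at negative times to be total and bounded. Paths of \<open>Z\<close>
        are right-continuous and \<open>\<psi>\<close> is continuous, which gives measurability of
        \<open>q\<close>.\<close>
      define q where "q u = indicator {0..} u * \<psi> (Z u \<omega>)" for u :: real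
      define P where "P = Q \<omega>"
      have P: "prob_space P" and setsP: "sets P = sets M" unfolding P_def using Q[OF elim(1)] by auto
      have spaceP: "space P = space M" by (rule sets_eq_imp_space_eq[OF setsP])
      have "random_environment_axioms \<psi>bar q qb (D \<omega>) \<kappa> \<beta>"
      proof
        have "((\<lambda>u. \<psi> (Z u \<omega>)) \<longlongrightarrow> \<psi> (Z t \<omega>)) (at_right t)" if "t \<ge> 0" for t
          using Z_cadlag[OF elim(1)] that by (intro isCont_tendsto_compose[OF \<psi>_cont]) (simp add: cadlag_def)
        then show "q \<in> borel_measurable borel" unfolding q_def[abs_def] by (rule right_continuous_borel_measurable)
        have "0 \<le> qb" using qb[of 0] by linarith
        then show "0 \<le> q u" "q u \<le> qb" for u
          using \<psi>_pos[of "Z u \<omega>"] qb[of "Z u \<omega>"] by (auto simp: q_def indicator_def)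
        show "0 < D \<omega>" by (rule D[OF elim(1)])
        show "0 < \<kappa>" "\<kappa> < 1" "0 < \<beta>" "\<beta> < 2 * \<kappa>" using \<open>0 < \<kappa>\<close> \<open>\<kappa> < 1/2\<close> \<open>0 < \<beta>\<close> \<open>\<beta> < 2 * \<kappa>\<close> by auto
        show "\<bar>1 / t * (\<integral>u. indicator {0..t} u * q u \<partial>lborel) - \<psi>bar\<bar> \<le> D \<omega> / (1 + t) powr \<kappa>" if "t > 0" for t
        proof -
          have "(\<integral>u. indicator {0..t} u * q u \<partial>lborel) = (LBINT u:{0..t}. \<psi> (Z u \<omega>))"
            unfolding set_lebesgue_integral_def
            by (rule Bochner_Integration.integral_cong) (auto simp: q_def indicator_def)
          then show ?thesis using elim(2) that by simp
        qed
      qed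
      then interpret random_environment \<rho> \<alpha> c C \<Lambda> \<Lambda>b \<Lambda>l \<psi>bar q qb "D \<omega>" \<kappa> \<beta>
        by (intro random_environment.intro arrival_rate_axioms)
      have qq: "quenched_queue \<rho> \<alpha> c C \<Lambda> \<Lambda>b \<Lambda>l \<psi>bar q qb (D \<omega>) \<kappa> \<beta> P (\<Gamma> \<epsilon>) (L \<epsilon>) \<epsilon>" if \<epsilon>: "\<epsilon> > 0" for \<epsilon>
      proof -
        have rate_meas: "rate \<epsilon> \<in> borel_measurable borel"
          unfolding rate_def[abs_def]
          by (rule borel_measurable_times[OF borel_measurable_times[OF borel_measurable_const m_\<Lambda>] q_scaled_meas])
        have \<Lambda>0: "0 \<le> indicator {0..} s * \<Lambda> s \<and> indicator {0..} s * \<Lambda> s \<le> \<Lambda>b" for s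
          using \<Lambda>_nonneg[of s] \<Lambda>_le[of s] \<Lambda>b_nonneg by (simp add: indicator_def)
        have "(indicator {0..} s * \<Lambda> s) * q (s / \<epsilon>) \<le> \<Lambda>b * qb" for s
          using \<Lambda>0[of s] q_nonneg q_le \<Lambda>b_nonneg by (intro mult_mono) auto
        then have rate_bounds: "0 \<le> rate \<epsilon> s" "rate \<epsilon> s \<le> \<epsilon> powr (- \<beta>) * (\<Lambda>b * qb)" for s
          using \<Lambda>0[of s] q_nonneg mult_left_mono[of _ "\<Lambda>b * qb" "\<epsilon> powr (- \<beta>)"]
          unfolding rate_def mult.assoc[of "\<epsilon> powr (- \<beta>)"] by (auto intro!: mult_nonneg_nonneg simp del: mult_le_cancel_left_pos)
        \<comment> \<open>For \<open>\<epsilon> > 0\<close> the cut-offs at \<open>s\<close> and at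
          \<open>s / \<epsilon>\<close> agree.\<close>
        have "arrival_intensity \<beta> \<Lambda> \<psi> \<epsilon> (\<lambda>t. Z t \<omega>) = density lborel (\<lambda>s. ennreal (rate \<epsilon> s))"
          unfolding arrival_intensity_def rate_def q_def using \<epsilon>
          by (intro arg_cong[of _ _ "density lborel"] ext) (auto simp: indicator_def)
        then have "poisson_process P (\<Gamma> \<epsilon>) (density lborel (\<lambda>s. ennreal (rate \<epsilon> s)))"
          "conditional_services P (\<Gamma> \<epsilon>) (L \<epsilon>) (service_law \<rho>)"
          using elim(3) \<epsilon> unfolding P_def by auto
        moreover have "arrival_times P (\<Gamma> \<epsilon>)"
          using arrivals[OF \<epsilon>] unfolding arrival_times_def spaceP measurable_cong_sets[OF setsP refl] .
        moreover have "L \<epsilon> k \<in> borel_measurable P" for k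
          using L_measurable[OF \<epsilon>] unfolding measurable_cong_sets[OF setsP refl] .
        moreover have "sets (service_law \<rho> s) = sets borel" for s by (simp add: service_law_def)
        ultimately have "marked_poisson_axioms P (\<Gamma> \<epsilon>) (L \<epsilon>) (rate \<epsilon>) (service_law \<rho>) (\<epsilon> powr (- \<beta>) * (\<Lambda>b * qb))"
          by (intro marked_poisson_axioms.intro rate_meas rate_bounds \<rho>_prob service_law_measurable)
        then show ?thesis
          by (intro quenched_queue.intro random_environment_axioms queue.intro service_density_axioms
              marked_poisson.intro P quenched_queue_axioms.intro \<epsilon>)
      qed
      show ?case
        unfolding converges_in_distribution_def topspace_skorokhod_topology P_def[symmetric]
      proof (intro conjI allI impI)
        define X where "X \<epsilon> t w = fluctuation \<beta> (limit_mean \<psi>bar \<Lambda> \<rho>) \<epsilon> (\<Gamma> \<epsilon>) (L \<epsilon>) t w" for \<epsilon> t w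
        have X: "cadlag (\<lambda>t. X \<epsilon> t w)" if "\<epsilon> > 0" "w \<in> space P" for \<epsilon> w
          unfolding X_def using quenched_queue.fluct_cadlag[OF qq[OF that(1)] that(2)] .
        have Xm: "X \<epsilon> t \<in> borel_measurable P" if "\<epsilon> > 0" "t \<ge> 0" for \<epsilon> t
          unfolding X_def[abs_def] using quenched_queue.fluct_measurable[OF qq[OF that(1)] that(2)] .
        have Xs: "restrict (\<lambda>t. X \<epsilon> t w) {0..} \<in> skorokhod_space" if "\<epsilon> > 0" "w \<in> space P" for \<epsilon> w
          using cadlag_restrict[OF X[OF that]] by (simp add: skorokhod_space_def)
        have pos: "\<forall>\<^sub>F \<epsilon> in at_right 0. (0::real) < \<epsilon>" by (rule eventually_at_right_less)
        show "\<forall>\<^sub>F \<epsilon> in at_right 0. (\<lambda>w. restrict (\<lambda>t. X \<epsilon> t w) {0..}) \<in> space P \<rightarrow> skorokhod_space"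
          using pos by eventually_elim (auto intro: Xs)
        show "(\<lambda>w. restrict (\<lambda>t. G t w) {0..}) \<in> space white_noise \<rightarrow> skorokhod_space" using G_skorokhod by auto
        fix f assume f: "continuous_map skorokhod_topology euclideanreal f \<and> bounded (f ` skorokhod_space)"
        obtain B where B: "\<And>x. x \<in> skorokhod_space \<Longrightarrow> \<bar>f x\<bar> \<le> B" using bounded_abs_bound[OF f[THEN conjunct2]] by auto
        show "\<forall>\<^sub>F \<epsilon> in at_right 0. integrable P (\<lambda>w. f (restrict (\<lambda>t. X \<epsilon> t w) {0..}))"
          using pos
        proof eventually_elim
          case (elim \<epsilon>)
          show ?case
          proof (rule finite_measure.integrable_const_bound[of _ _ B])
            show "finite_measure P" using P by (rule prob_space.finite_measure)
            show "(\<lambda>w. f (restrict (\<lambda>t. X \<epsilon> t w) {0..})) \<in> borel_measurable P"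
              by (rule borel_measurable_continuous_skorokhod[OF f[THEN conjunct1] Xm[OF elim] X[OF elim]])
          qed (use B Xs[OF elim] in auto)
        qed
        interpret W: prob_space white_noise by (rule prob_space_white_noise)
        have "(\<lambda>w. f (restrict (\<lambda>t. G t w) {0..})) \<in> borel_measurable white_noise"
          by (rule borel_measurable_continuous_skorokhod[OF f[THEN conjunct1] G(3) continuous_imp_cadlag[OF G(2)]])
        then show "integrable white_noise (\<lambda>w. f (restrict (\<lambda>t. G t w) {0..}))"
          by (intro W.integrable_const_bound[of _ B]) (use B G_skorokhod in auto)
        \<comment> \<open>The limit from the right at 0 is tested along sequences, which reduces it
          to \<open>fluctuations_converge\<close>.\<close>
        show "((\<lambda>\<epsilon>. \<integral>w. f (restrict (\<lambda>t. X \<epsilon> t w) {0..}) \<partial>P) \<longlongrightarrow> (\<integral>w. f (restrict (\<lambda>t. G t w) {0..}) \<partial>white_noise)) (at_right 0)"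
          unfolding tendsto_at_iff_sequentially comp_def
        proof (intro allI impI)
          fix e :: "nat \<Rightarrow> real" assume "\<forall>n. e n \<in> {0<..} - {0}" and e: "e \<longlonglongrightarrow> 0"
          then have e0: "\<And>n. e n > 0" by auto
          show "(\<lambda>n. \<integral>w. f (restrict (\<lambda>t. X (e n) t w) {0..}) \<partial>P) \<longlonglongrightarrow> (\<integral>w. f (restrict (\<lambda>t. G t w) {0..}) \<partial>white_noise)"
            unfolding X_def
            by (rule fluctuations_converge[OF e0 e qq[OF e0] prob_space_white_noise G(3) G(2) Gchar f[THEN conjunct1] B])
        qed
      qed
    qed
  qed
qed

end
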